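(* Let $M$ be a smooth manifold with a finite open cover $\{U_i\}$. For each $i$ let $E_i=TU_i\oplus T^*U_i$ be the generalized tangent bundle of $U_i$. On the overlaps $U_{ij}=U_i\cap U_j$ let smooth maps $\varphi_{ij}:E_j|_{U_{ij}}\to E_i|_{U_{ij}}$ be given such that: (i) each $\varphi_{ij}$ is a $b$-field transform; (ii) $\varphi_{ii}=\mathrm{Id}$ and $\varphi_{ij}=\varphi_{ji}^{-1}$; (iii) $\varphi_{ij}\circ\varphi_{jk}=\varphi_{ik}$ on $U_i\cap U_j\cap U_k$ for all $i,j,k$. Then: 1. The $E_i$ glue via the $\varphi_{ij}$ to a vector bundle $E$ over $M$, and on $E$ one can define (from the local data) a pairing $\langle\cdot,\cdot\rangle$, an anchor $\rho$, and a bracket on sections which make $E$ into a Courant algebroid. 2. The $\varphi_{ij}$ preserve the cotangent subbundle $T^*M$, and $E$ is an exact Courant algebroid. There exist local $2$-forms $b_i\in\Omega^2(U_i)$ such that $\varphi_{ij}=\exp(b_j-b_i)$ on overlaps, and the $3$-forms $db_i$ patch together to a global closed $3$-form $H$ on $M$; $E$ is isomorphic, as a Courant algebroid, to the exact Courant algebroid $(TM\oplus T^*M,[\cdot,\cdot]_C^H,\langle\cdot,\cdot\rangle,\rho=\pi)$. 3. If on each $E_i$ there is given a Courant-integrable strong generalized almost complex structure $\mathfrak{J}_i$, and $\mathfrak{J}_i=\varphi_{ij}\circ\mathfrak{J}_j\circ\varphi_{ji}$ on $U_{ij}$ for all $i,j$, then the $\mathfrak{J}_i$ glue together to a strong generalized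 almost complex structure on $E$ which is integrable with respect to the Courant bracket on $E$.
   Context: On $TM\oplus T^*M$: pairing $\langle X+\xi,Y+\eta\rangle=\iota_X\eta+\iota_Y\xi$; $\pi$ is the projection to $TM$; Dorfman bracket $[X+\xi,Y+\eta]_D=[X,Y]+\mathcal{L}_X\eta-\iota_Yd\xi$; Courant bracket $[u,v]_C=\frac12([u,v]_D-[v,u]_D)$. For a closed $3$-form $H$, $[X+\xi,Y+\eta]_D^H=[X+\xi,Y+\eta]_D+\iota_X\iota_YH$ and $[\cdot,\cdot]_C^H$ is its skew-symmetrization (with factor $\frac12$). For a $2$-form $b$, $e^b=\exp(b)$ is the map $X+\xi\mapsto X+\xi+\iota_Xb$; it is called a $b$-field transform when $db=0$. A Courant algebroid is a vector bundle $E\to M$ with a nondegenerate symmetric pairing, a bundle map $\rho:E\to TM$ and a skew-symmetric bracket $[\cdot,\cdot]_C$ on sections such that, with $\mathcal{D}f$ defined by $\langle\mathcal{D}f,e\rangle=\rho(e)f$ and $u\circ v=[u,v]_C+\frac12\mathcal{D}\langle u,v\rangle$, one has $u\circ(v\circ w)=(u\circ v)\circ w+v\circ(u\circ w)$ and $\rho(u)\langle v,w\rangle=\langle u\circ v,w\rangle+\langle v,u\circ w\rangle$ (from which $\rho(u\circ v)=[\rho(u),\rho(v)]$ and $u\circ(fv)=f(u\circ v)+(\rho(u)f)v$). It is exact if $0\to T^*M\xrightarrow{\rho^*}E\xrightarrow{\rho}TM\to0$ is exact (using $E\cong E^*$ via the pairing). Isomorphisms are bundle isomorphisms over $\mathrm{id}_M$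 preserving pairing, anchor and bracket. The glued bundle is $E=\bigsqcup_iE_i/\!\sim$ with $u_i\sim u_j$ iff they lie over the same $x\in U_{ij}$ and $u_i=\varphi_{ij}(u_j)$; its pairing, anchor and bracket are those which correspond over each $U_i$, under the identification $E|_{U_i}\cong E_i$, to the standard pairing, projection and Courant bracket of $TU_i\oplus T^*U_i$. A strong generalized almost complex structure on a Courant algebroid $E$ is an endomorphism $\mathfrak{J}$ with $\mathfrak{J}^2=-\mathrm{Id}$ and $\langle\mathfrak{J}v,\mathfrak{J}w\rangle=\langle v,w\rangle$; it is (Courant-)integrable if sections of its $+i$-eigenbundle in $E\otimes\mathbb{C}$ are closed under the (complexified) bracket. *)

theory Defs
  imports "HOL-Analysis.Analysis"
begin

section \<open>Smooth maps and smooth manifolds\<close>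

primrec ck_on :: "nat \<Rightarrow> 'a::real_normed_vector set \<Rightarrow> ('a \<Rightarrow> 'b::real_normed_vector) \<Rightarrow> bool" where
  "ck_on 0 S f \<longleftrightarrow> continuous_on S f"
| "ck_on (Suc k) S f \<longleftrightarrow> (\<forall>x\<in>S. f differentiable (at x)) \<and>
     (\<forall>v. ck_on k S (\<lambda>x. frechet_derivative f (at x) v))"

text \<open>Only used for open \<open>S\<close> in a finite-dimensional space.\<close>
definition smooth_map_on :: "'a::real_normed_vector set \<Rightarrow> ('a \<Rightarrow> 'b::real_normed_vector) \<Rightarrow> bool" where
  "smooth_map_on S f \<longleftrightarrow> (\<forall>k. ck_on k S f)"

type_synonym ('m, 'e) atlas = "('m set \<times> ('m \<Rightarrow> 'e)) set"

text \<open>The manifold is the whole type \<open>'m\<close> (Hausdorff and second countable by its type classes), the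
  model space is the finite-dimensional Euclidean space \<open>'e\<close>. The class \<^class>\<open>euclidean_space\<close> would
  exclude dimension 0, hence \<^class>\<open>real_inner\<close> together with an explicit finite spanning set.\<close>
definition smooth_manifold ::
  "('m::{t2_space,second_countable_topology}, 'e::real_inner) atlas \<Rightarrow> bool" where
  "smooth_manifold A \<longleftrightarrow>
     (\<exists>B. finite B \<and> span B = (UNIV :: 'e set)) \<and>
     (\<Union>(V, c)\<in>A. V) = UNIV \<and>
     (\<forall>(V, c)\<in>A. open V \<and> open (c ` V) \<and> homeomorphism V (c ` V) c (inv_into V c)) \<and>
     (\<forall>(V, c)\<in>A. \<forall>(V', c')\<in>A. smooth_map_on (c ` (V \<inter> V')) (c' \<circ> inv_into V c))"

definition smooth_fun ::
  "('m::topological_space, 'e::real_inner) atlas \<Rightarrow> 'm set \<Rightarrow> ('m \<Rightarrow> real) \<Rightarrow> bool" where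
  "smooth_fun A W f \<longleftrightarrow> (\<forall>(V, c)\<in>A. smooth_map_on (c ` (V \<inter> W)) (f \<circ> inv_into V c))"

definition smooth_near ::
  "('m::topological_space, 'e::real_inner) atlas \<Rightarrow> 'm \<Rightarrow> ('m \<Rightarrow> real) \<Rightarrow> bool" where
  "smooth_near A x f \<longleftrightarrow> (\<exists>V. open V \<and> x \<in> V \<and> smooth_fun A V f)"


section \<open>Vector spaces and vector bundles with explicit operations\<close>

text \<open>The fibres of a glued bundle are sets of equivalence classes, so the operations of a fibre cannot
  be those of a type class.\<close>
record 'v vsp =
  vcarrier :: "'v set"
  vadd :: "'v \<Rightarrow> 'v \<Rightarrow> 'v"
  vzero :: 'v
  vscale :: "real \<Rightarrow> 'v \<Rightarrow> 'v"

definition real_vsp :: "'v vsp \<Rightarrow> bool" where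
  "real_vsp V \<longleftrightarrow>
     vzero V \<in> vcarrier V \<and>
     (\<forall>u\<in>vcarrier V. \<forall>v\<in>vcarrier V. vadd V u v \<in> vcarrier V) \<and>
     (\<forall>a. \<forall>u\<in>vcarrier V. vscale V a u \<in> vcarrier V) \<and>
     (\<forall>u\<in>vcarrier V. \<forall>v\<in>vcarrier V. \<forall>w\<in>vcarrier V. vadd V (vadd V u v) w = vadd V u (vadd V v w)) \<and>
     (\<forall>u\<in>vcarrier V. \<forall>v\<in>vcarrier V. vadd V u v = vadd V v u) \<and>
     (\<forall>u\<in>vcarrier V. vadd V (vzero V) u = u) \<and>
     (\<forall>u\<in>vcarrier V. vadd V u (vscale V (-1) u) = vzero V) \<and>
     (\<forall>u\<in>vcarrier V. vscale V 1 u = u) \<and>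
     (\<forall>a b. \<forall>u\<in>vcarrier V. vscale V a (vscale V b u) = vscale V (a * b) u) \<and>
     (\<forall>a b. \<forall>u\<in>vcarrier V. vscale V (a + b) u = vadd V (vscale V a u) (vscale V b u)) \<and>
     (\<forall>a. \<forall>u\<in>vcarrier V. \<forall>v\<in>vcarrier V. vscale V a (vadd V u v) = vadd V (vscale V a u) (vscale V a v))"

definition linear_vsp :: "'v vsp \<Rightarrow> 'w vsp \<Rightarrow> ('v \<Rightarrow> 'w) \<Rightarrow> bool" where
  "linear_vsp V W f \<longleftrightarrow>
     (\<forall>u\<in>vcarrier V. f u \<in> vcarrier W) \<and>
     (\<forall>u\<in>vcarrier V. \<forall>v\<in>vcarrier V. f (vadd V u v) = vadd W (f u) (f v)) \<and>
     (\<forall>a. \<forall>u\<in>vcarrier V. f (vscale V a u) = vscale W a (f u))"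

primrec lincomb :: "'v vsp \<Rightarrow> (nat \<Rightarrow> real) \<Rightarrow> (nat \<Rightarrow> 'v) \<Rightarrow> nat \<Rightarrow> 'v" where
  "lincomb V c e 0 = vzero V"
| "lincomb V c e (Suc n) = vadd V (lincomb V c e n) (vscale V (c n) (e n))"

definition basis_vsp :: "'v vsp \<Rightarrow> nat \<Rightarrow> (nat \<Rightarrow> 'v) \<Rightarrow> bool" where
  "basis_vsp V n e \<longleftrightarrow> (\<forall>k<n. e k \<in> vcarrier V) \<and>
     (\<forall>v\<in>vcarrier V. \<exists>!c. (\<forall>k\<ge>n. c k = 0) \<and> v = lincomb V c e n)"

definition coords :: "'v vsp \<Rightarrow> nat \<Rightarrow> (nat \<Rightarrow> 'v) \<Rightarrow> 'v \<Rightarrow> nat \<Rightarrow> real" where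
  "coords V n e v = (THE c. (\<forall>k\<ge>n. c k = 0) \<and> v = lincomb V c e n)"

text \<open>A vector bundle is given by its fibres and a bundle atlas; a local trivialisation over \<open>V\<close> is
  recorded as the local frame \<open>e 0, \<dots>, e (vrank - 1)\<close> over \<open>V\<close> which it sends to the standard basis.\<close>
record ('m, 'v) vbundle =
  fibre :: "'m \<Rightarrow> 'v vsp"
  vrank :: nat
  frames :: "('m set \<times> (nat \<Rightarrow> 'm \<Rightarrow> 'v)) set"

definition vector_bundle ::
  "('m::topological_space, 'e::real_inner) atlas \<Rightarrow> 'm set \<Rightarrow> ('m, 'v) vbundle \<Rightarrow> bool" where
  "vector_bundle A W E \<longleftrightarrow>
     (\<forall>x\<in>W. real_vsp (fibre E x)) \<and>
     (\<Union>(V, e)\<in>frames E. V) = W \<and>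
     (\<forall>(V, e)\<in>frames E. open V \<and> (\<forall>x\<in>V. basis_vsp (fibre E x) (vrank E) (\<lambda>k. e k x))) \<and>
     (\<forall>(V, e)\<in>frames E. \<forall>(V', e')\<in>frames E. \<forall>j<vrank E. \<forall>k<vrank E.
        smooth_fun A (V \<inter> V') (\<lambda>x. coords (fibre E x) (vrank E) (\<lambda>k. e k x) (e' j x) k))"

text \<open>Smooth sections over an open set \<open>V\<close>, extended by \<open>undefined\<close> outside \<open>V\<close> so that equality of
  functions is equality of sections.\<close>
definition sections ::
  "('m::topological_space, 'e::real_inner) atlas \<Rightarrow> 'm set \<Rightarrow> ('m, 'v) vbundle \<Rightarrow> ('m \<Rightarrow> 'v) set" where
  "sections A V E = {s \<in> (\<Pi>\<^sub>E x\<in>V. vcarrier (fibre E x)).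
     \<forall>(V', e)\<in>frames E. \<forall>k<vrank E.
       smooth_fun A (V \<inter> V') (\<lambda>x. coords (fibre E x) (vrank E) (\<lambda>k. e k x) (s x) k)}"

definition bundle_map ::
  "('m::topological_space, 'e::real_inner) atlas \<Rightarrow> 'm set \<Rightarrow> ('m, 'v) vbundle \<Rightarrow> ('m, 'w) vbundle \<Rightarrow>
   ('m \<Rightarrow> 'v \<Rightarrow> 'w) \<Rightarrow> bool" where
  "bundle_map A W E F \<Phi> \<longleftrightarrow>
     (\<forall>x\<in>W. linear_vsp (fibre E x) (fibre F x) (\<Phi> x)) \<and>
     (\<forall>V s. open V \<and> V \<subseteq> W \<and> s \<in> sections A V E \<longrightarrow> (\<lambda>x\<in>V. \<Phi> x (s x)) \<in> sections A V F)"

definition bundle_iso ::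
  "('m::topological_space, 'e::real_inner) atlas \<Rightarrow> 'm set \<Rightarrow> ('m, 'v) vbundle \<Rightarrow> ('m, 'w) vbundle \<Rightarrow>
   ('m \<Rightarrow> 'v \<Rightarrow> 'w) \<Rightarrow> bool" where
  "bundle_iso A W E F \<Phi> \<longleftrightarrow>
     bundle_map A W E F \<Phi> \<and>
     (\<forall>x\<in>W. bij_betw (\<Phi> x) (vcarrier (fibre E x)) (vcarrier (fibre F x))) \<and>
     bundle_map A W F E (\<lambda>x. inv_into (vcarrier (fibre E x)) (\<Phi> x))"


section \<open>Tangent vectors, vector fields and differential forms\<close>

text \<open>Tangent vectors at \<open>x\<close> are the derivations of the algebra of germs at \<open>x\<close> of smooth functions,
  extended by 0 to functions that are not smooth near \<open>x\<close>. In particular the tangent space of an open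
  submanifold is literally that of the ambient manifold.\<close>
type_synonym 'm tvec = "('m \<Rightarrow> real) \<Rightarrow> real"

definition tangent_space ::
  "('m::topological_space, 'e::real_inner) atlas \<Rightarrow> 'm \<Rightarrow> 'm tvec set" where
  "tangent_space A x = {v.
     (\<forall>f. \<not> smooth_near A x f \<longrightarrow> v f = 0) \<and>
     (\<forall>f g. smooth_near A x f \<and> smooth_near A x g \<longrightarrow>
        (eventually (\<lambda>y. f y = g y) (nhds x) \<longrightarrow> v f = v g) \<and>
        v (\<lambda>y. f y + g y) = v f + v g \<and>
        v (\<lambda>y. f y * g y) = f x * v g + g x * v f) \<and>
     (\<forall>a f. smooth_near A x f \<longrightarrow> v (\<lambda>y. a * f y) = a * v f)}"

definition tangent_vsp ::
  "('m::topological_space, 'e::real_inner) atlas \<Rightarrow> 'm \<Rightarrow> 'm tvec vsp" where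
  "tangent_vsp A x = \<lparr>vcarrier = tangent_space A x, vadd = (\<lambda>u v f. u f + v f),
     vzero = (\<lambda>f. 0), vscale = (\<lambda>a u f. a * u f)\<rparr>"

definition vector_field ::
  "('m::topological_space, 'e::real_inner) atlas \<Rightarrow> 'm set \<Rightarrow> ('m \<Rightarrow> 'm tvec) \<Rightarrow> bool" where
  "vector_field A W X \<longleftrightarrow> (\<forall>x\<in>W. X x \<in> tangent_space A x) \<and>
     (\<forall>V f. open V \<and> V \<subseteq> W \<and> smooth_fun A V f \<longrightarrow> smooth_fun A V (\<lambda>x. X x f))"

definition lie_bracket ::
  "('m::topological_space, 'e::real_inner) atlas \<Rightarrow> ('m \<Rightarrow> 'm tvec) \<Rightarrow> ('m \<Rightarrow> 'm tvec) \<Rightarrow> 'm \<Rightarrow> 'm tvec" where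
  "lie_bracket A X Y x = (\<lambda>f. if smooth_near A x f
     then X x (\<lambda>y. Y y f) - Y x (\<lambda>y. X y f) else 0)"

text \<open>A \<open>k\<close>-form at \<open>x\<close> is an alternating multilinear function of \<open>k\<close> tangent vectors at \<open>x\<close>, given
  as a list, and is 0 on all other lists; the case \<open>k = 1\<close> is the cotangent space.\<close>
type_synonym 'm mform = "'m tvec list \<Rightarrow> real"

definition alt_forms ::
  "('m::topological_space, 'e::real_inner) atlas \<Rightarrow> nat \<Rightarrow> 'm \<Rightarrow> 'm mform set" where
  "alt_forms A k x = {\<omega>.
     (\<forall>vs. \<not> (set vs \<subseteq> tangent_space A x \<and> length vs = k) \<longrightarrow> \<omega> vs = 0) \<and>
     (\<forall>vs. set vs \<subseteq> tangent_space A x \<and> length vs = k \<longrightarrow>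
        (\<forall>i<k. \<forall>u\<in>tangent_space A x. \<forall>v\<in>tangent_space A x. \<forall>a.
           \<omega> (vs[i := (\<lambda>f. u f + v f)]) = \<omega> (vs[i := u]) + \<omega> (vs[i := v]) \<and>
           \<omega> (vs[i := (\<lambda>f. a * u f)]) = a * \<omega> (vs[i := u])) \<and>
        (\<forall>i j. i < j \<and> j < k \<and> vs ! i = vs ! j \<longrightarrow> \<omega> vs = 0))}"

definition diff_form ::
  "('m::topological_space, 'e::real_inner) atlas \<Rightarrow> 'm set \<Rightarrow> nat \<Rightarrow> ('m \<Rightarrow> 'm mform) \<Rightarrow> bool" where
  "diff_form A W k \<omega> \<longleftrightarrow> (\<forall>x\<in>W. \<omega> x \<in> alt_forms A k x) \<and>
     (\<forall>V Xs. open V \<and> V \<subseteq> W \<and> length Xs = k \<and> (\<forall>X\<in>set Xs. vector_field A V X) \<longrightarrow>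
        smooth_fun A V (\<lambda>x. \<omega> x (map (\<lambda>X. X x) Xs)))"

text \<open>The invariant formula for \<open>d\<omega>(X\<^sub>0, \<dots>, X\<^sub>k)\<close>; \<^term>\<open>nths Xs (- S)\<close> drops the entries with index in \<open>S\<close>.\<close>
definition ext_deriv_fields ::
  "('m::topological_space, 'e::real_inner) atlas \<Rightarrow> ('m \<Rightarrow> 'm mform) \<Rightarrow> ('m \<Rightarrow> 'm tvec) list \<Rightarrow> 'm \<Rightarrow> real" where
  "ext_deriv_fields A \<omega> Xs x =
     (\<Sum>i<length Xs. (-1) ^ i * (Xs ! i) x (\<lambda>y. \<omega> y (map (\<lambda>X. X y) (nths Xs (- {i}))))) +
     (\<Sum>j<length Xs. \<Sum>i<j. (-1) ^ (i + j) *
        \<omega> x (lie_bracket A (Xs ! i) (Xs ! j) x # map (\<lambda>X. X x) (nths Xs (- {i, j}))))"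

text \<open>The value at tangent vectors is computed with arbitrary local vector fields extending them.\<close>
definition ext_deriv ::
  "('m::topological_space, 'e::real_inner) atlas \<Rightarrow> ('m \<Rightarrow> 'm mform) \<Rightarrow> 'm \<Rightarrow> 'm mform" where
  "ext_deriv A \<omega> x vs = (if set vs \<subseteq> tangent_space A x
     then THE r. \<forall>V Xs. open V \<and> x \<in> V \<and> (\<forall>X\<in>set Xs. vector_field A V X) \<and> map (\<lambda>X. X x) Xs = vs
            \<longrightarrow> r = ext_deriv_fields A \<omega> Xs x
     else 0)"

definition closed_form ::
  "('m::topological_space, 'e::real_inner) atlas \<Rightarrow> 'm set \<Rightarrow> ('m \<Rightarrow> 'm mform) \<Rightarrow> bool" where
  "closed_form A W \<omega> \<longleftrightarrow> (\<forall>x\<in>W. \<forall>vs. ext_deriv A \<omega> x vs = 0)"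

definition lie_deriv ::
  "('m::topological_space, 'e::real_inner) atlas \<Rightarrow> ('m \<Rightarrow> 'm tvec) \<Rightarrow> ('m \<Rightarrow> 'm mform) \<Rightarrow> 'm \<Rightarrow> 'm mform" where
  "lie_deriv A X \<omega> x vs = (if set vs \<subseteq> tangent_space A x
     then THE r. \<forall>V Zs. open V \<and> x \<in> V \<and> (\<forall>Z\<in>set Zs. vector_field A V Z) \<and> map (\<lambda>Z. Z x) Zs = vs
            \<longrightarrow> r = X x (\<lambda>y. \<omega> y (map (\<lambda>Z. Z y) Zs))
                    - (\<Sum>i<length Zs. \<omega> x (vs[i := lie_bracket A X (Zs ! i) x]))
     else 0)"

text \<open>The tangent bundle of an open submanifold \<open>W\<close>; its bundle atlas consists of all smooth local
  frames.\<close>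
definition tangent_bundle ::
  "('m::topological_space, 'e::real_inner) atlas \<Rightarrow> 'm set \<Rightarrow> ('m, 'm tvec) vbundle" where
  "tangent_bundle A W = \<lparr>fibre = tangent_vsp A, vrank = dim (UNIV :: 'e set),
     frames = {(V, e). open V \<and> V \<subseteq> W \<and> (\<forall>k<dim (UNIV :: 'e set). vector_field A V (e k)) \<and>
       (\<forall>x\<in>V. basis_vsp (tangent_vsp A x) (dim (UNIV :: 'e set)) (\<lambda>k. e k x))}\<rparr>"


section \<open>The generalized tangent bundle\<close>

type_synonym 'm gvec = "'m tvec \<times> 'm mform"

definition gtan_vsp ::
  "('m::topological_space, 'e::real_inner) atlas \<Rightarrow> 'm \<Rightarrow> 'm gvec vsp" where
  "gtan_vsp A x = \<lparr>vcarrier = tangent_space A x \<times> alt_forms A 1 x,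
     vadd = (\<lambda>u v. (\<lambda>f. fst u f + fst v f, \<lambda>vs. snd u vs + snd v vs)),
     vzero = (\<lambda>f. 0, \<lambda>vs. 0),
     vscale = (\<lambda>a u. (\<lambda>f. a * fst u f, \<lambda>vs. a * snd u vs))\<rparr>"

abbreviation gtan ::
  "('m::topological_space, 'e::real_inner) atlas \<Rightarrow> 'm \<Rightarrow> 'm gvec set" where
  "gtan A x \<equiv> vcarrier (gtan_vsp A x)"

definition gen_tangent_bundle ::
  "('m::topological_space, 'e::real_inner) atlas \<Rightarrow> 'm set \<Rightarrow> ('m, 'm gvec) vbundle" where
  "gen_tangent_bundle A W = \<lparr>fibre = gtan_vsp A, vrank = 2 * dim (UNIV :: 'e set),
     frames = {(V, e). open V \<and> V \<subseteq> W \<and>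
       (\<forall>k<2 * dim (UNIV :: 'e set).
          vector_field A V (\<lambda>x. fst (e k x)) \<and> diff_form A V 1 (\<lambda>x. snd (e k x))) \<and>
       (\<forall>x\<in>V. basis_vsp (gtan_vsp A x) (2 * dim (UNIV :: 'e set)) (\<lambda>k. e k x))}\<rparr>"

definition gpairing :: "'m gvec \<Rightarrow> 'm gvec \<Rightarrow> real" where
  "gpairing u v = snd v [fst u] + snd u [fst v]"

text \<open>The \<open>H\<close>-twisted Dorfman bracket at \<open>x\<close>. Contraction inserts a vector in the first slot, so the
  value of \<open>\<iota>\<^sub>X \<iota>\<^sub>Y H\<close> at \<open>Z\<close> is \<open>H(Y, X, Z)\<close>.\<close>
definition dorfman ::
  "('m::topological_space, 'e::real_inner) atlas \<Rightarrow> ('m \<Rightarrow> 'm mform) \<Rightarrow>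
   ('m \<Rightarrow> 'm gvec) \<Rightarrow> ('m \<Rightarrow> 'm gvec) \<Rightarrow> 'm \<Rightarrow> 'm gvec" where
  "dorfman A H u v x =
     (lie_bracket A (\<lambda>y. fst (u y)) (\<lambda>y. fst (v y)) x,
      \<lambda>vs. lie_deriv A (\<lambda>y. fst (u y)) (\<lambda>y. snd (v y)) x vs
           - ext_deriv A (\<lambda>y. snd (u y)) x (fst (v x) # vs)
           + H x (fst (v x) # fst (u x) # vs))"

definition courant_bracket ::
  "('m::topological_space, 'e::real_inner) atlas \<Rightarrow> ('m \<Rightarrow> 'm mform) \<Rightarrow>
   ('m \<Rightarrow> 'm gvec) \<Rightarrow> ('m \<Rightarrow> 'm gvec) \<Rightarrow> 'm \<Rightarrow> 'm gvec" where
  "courant_bracket A H u v x = vscale (gtan_vsp A x) (1/2)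
     (vadd (gtan_vsp A x) (dorfman A H u v x) (vscale (gtan_vsp A x) (-1) (dorfman A H v u x)))"

text \<open>\<open>exp b (X + \<xi>) = X + \<xi> + \<iota>\<^sub>X b\<close>\<close>
definition b_exp :: "'m mform \<Rightarrow> 'm gvec \<Rightarrow> 'm gvec" where
  "b_exp b u = (fst u, \<lambda>vs. snd u vs + b (fst u # vs))"

definition b_field_transform ::
  "('m::topological_space, 'e::real_inner) atlas \<Rightarrow> 'm set \<Rightarrow> ('m \<Rightarrow> 'm gvec \<Rightarrow> 'm gvec) \<Rightarrow> bool" where
  "b_field_transform A W \<phi> \<longleftrightarrow> (\<exists>b. diff_form A W 2 b \<and> closed_form A W b \<and>
     (\<forall>x\<in>W. \<forall>u\<in>gtan A x. \<phi> x u = b_exp (b x) u))"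


section \<open>Courant algebroids\<close>

record ('m, 'v) courant =
  vb :: "('m, 'v) vbundle"
  pairing :: "'m \<Rightarrow> 'v \<Rightarrow> 'v \<Rightarrow> real"
  anchor :: "'m \<Rightarrow> 'v \<Rightarrow> 'm tvec"
  brkt :: "('m \<Rightarrow> 'v) \<Rightarrow> ('m \<Rightarrow> 'v) \<Rightarrow> 'm \<Rightarrow> 'v"

text \<open>The section \<open>\<D> f\<close> over \<open>W\<close>.\<close>
definition courant_D :: "'m set \<Rightarrow> ('m, 'v) courant \<Rightarrow> ('m \<Rightarrow> real) \<Rightarrow> 'm \<Rightarrow> 'v" where
  "courant_D W C f = (\<lambda>x\<in>W. THE w. w \<in> vcarrier (fibre (vb C) x) \<and>
     (\<forall>e\<in>vcarrier (fibre (vb C) x). pairing C x w e = anchor C x e f))"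

text \<open>\<open>u \<circ> v = [u, v] + \<D>\<langle>u, v\<rangle> / 2\<close>\<close>
definition courant_circ ::
  "'m set \<Rightarrow> ('m, 'v) courant \<Rightarrow> ('m \<Rightarrow> 'v) \<Rightarrow> ('m \<Rightarrow> 'v) \<Rightarrow> 'm \<Rightarrow> 'v" where
  "courant_circ W C u v = (\<lambda>x\<in>W. vadd (fibre (vb C) x) (brkt C u v x)
     (vscale (fibre (vb C) x) (1/2) (courant_D W C (\<lambda>y. pairing C y (u y) (v y)) x)))"

definition sec_add :: "'m set \<Rightarrow> ('m, 'v) vbundle \<Rightarrow> ('m \<Rightarrow> 'v) \<Rightarrow> ('m \<Rightarrow> 'v) \<Rightarrow> 'm \<Rightarrow> 'v" where
  "sec_add W E s t = (\<lambda>x\<in>W. vadd (fibre E x) (s x) (t x))"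

definition sec_scale :: "'m set \<Rightarrow> ('m, 'v) vbundle \<Rightarrow> real \<Rightarrow> ('m \<Rightarrow> 'v) \<Rightarrow> 'm \<Rightarrow> 'v" where
  "sec_scale W E a s = (\<lambda>x\<in>W. vscale (fibre E x) a (s x))"

definition courant_algebroid ::
  "('m::topological_space, 'e::real_inner) atlas \<Rightarrow> 'm set \<Rightarrow> ('m, 'v) courant \<Rightarrow> bool" where
  "courant_algebroid A W C \<longleftrightarrow> (let E = vb C; \<Gamma> = sections A W E; circ = courant_circ W C in
     vector_bundle A W E \<and>
     \<comment> \<open>nondegenerate symmetric smooth pairing\<close>
     (\<forall>x\<in>W. \<forall>u\<in>vcarrier (fibre E x). \<forall>v\<in>vcarrier (fibre E x). \<forall>w\<in>vcarrier (fibre E x). \<forall>a.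
        pairing C x u v = pairing C x v u \<and>
        pairing C x (vadd (fibre E x) u v) w = pairing C x u w + pairing C x v w \<and>
        pairing C x (vscale (fibre E x) a u) w = a * pairing C x u w) \<and>
     (\<forall>x\<in>W. \<forall>u\<in>vcarrier (fibre E x).
        (\<forall>v\<in>vcarrier (fibre E x). pairing C x u v = 0) \<longrightarrow> u = vzero (fibre E x)) \<and>
     (\<forall>V s t. open V \<and> V \<subseteq> W \<and> s \<in> sections A V E \<and> t \<in> sections A V E \<longrightarrow>
        smooth_fun A V (\<lambda>x. pairing C x (s x) (t x))) \<and>
     \<comment> \<open>anchor\<close>
     bundle_map A W E (tangent_bundle A W) (anchor C) \<and>
     \<comment> \<open>skew-symmetric real-bilinear bracket on sections\<close>
     (\<forall>u\<in>\<Gamma>. \<forall>v\<in>\<Gamma>. brkt C u v \<in> \<Gamma> \<and> brkt C u v = sec_scale W E (-1) (brkt C v u)) \<and>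
     (\<forall>u\<in>\<Gamma>. \<forall>v\<in>\<Gamma>. \<forall>w\<in>\<Gamma>. brkt C (sec_add W E u v) w = sec_add W E (brkt C u w) (brkt C v w)) \<and>
     (\<forall>u\<in>\<Gamma>. \<forall>v\<in>\<Gamma>. \<forall>a. brkt C (sec_scale W E a u) v = sec_scale W E a (brkt C u v)) \<and>
     \<comment> \<open>Leibniz identity and invariance of the pairing\<close>
     (\<forall>u\<in>\<Gamma>. \<forall>v\<in>\<Gamma>. \<forall>w\<in>\<Gamma>.
        circ u (circ v w) = sec_add W E (circ (circ u v) w) (circ v (circ u w))) \<and>
     (\<forall>u\<in>\<Gamma>. \<forall>v\<in>\<Gamma>. \<forall>w\<in>\<Gamma>. \<forall>x\<in>W.
        anchor C x (u x) (\<lambda>y. pairing C y (v y) (w y)) =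
        pairing C x (circ u v x) (w x) + pairing C x (v x) (circ u w x)))"

text \<open>The dual of the anchor followed by the identification of the dual of the fibre with the fibre by
  means of the pairing.\<close>
definition coanchor :: "('m, 'v) courant \<Rightarrow> 'm \<Rightarrow> 'm mform \<Rightarrow> 'v" where
  "coanchor C x \<alpha> = (THE w. w \<in> vcarrier (fibre (vb C) x) \<and>
     (\<forall>e\<in>vcarrier (fibre (vb C) x). pairing C x w e = \<alpha> [anchor C x e]))"

definition exact_courant_algebroid ::
  "('m::topological_space, 'e::real_inner) atlas \<Rightarrow> 'm set \<Rightarrow> ('m, 'v) courant \<Rightarrow> bool" where
  "exact_courant_algebroid A W C \<longleftrightarrow> courant_algebroid A W C \<and>
     (\<forall>x\<in>W. inj_on (coanchor C x) (alt_forms A 1 x) \<and>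
        coanchor C x ` alt_forms A 1 x = {u \<in> vcarrier (fibre (vb C) x). anchor C x u = (\<lambda>f. 0)} \<and>
        anchor C x ` vcarrier (fibre (vb C) x) = tangent_space A x)"

definition courant_iso ::
  "('m::topological_space, 'e::real_inner) atlas \<Rightarrow> 'm set \<Rightarrow> ('m, 'v) courant \<Rightarrow> ('m, 'w) courant \<Rightarrow>
   ('m \<Rightarrow> 'v \<Rightarrow> 'w) \<Rightarrow> bool" where
  "courant_iso A W C C' \<Psi> \<longleftrightarrow>
     bundle_iso A W (vb C) (vb C') \<Psi> \<and>
     (\<forall>x\<in>W. \<forall>u\<in>vcarrier (fibre (vb C) x). \<forall>v\<in>vcarrier (fibre (vb C) x).
        pairing C' x (\<Psi> x u) (\<Psi> x v) = pairing C x u v) \<and>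
     (\<forall>x\<in>W. \<forall>u\<in>vcarrier (fibre (vb C) x). anchor C' x (\<Psi> x u) = anchor C x u) \<and>
     (\<forall>u\<in>sections A W (vb C). \<forall>v\<in>sections A W (vb C). \<forall>x\<in>W.
        brkt C' (\<lambda>y\<in>W. \<Psi> y (u y)) (\<lambda>y\<in>W. \<Psi> y (v y)) x = \<Psi> x (brkt C u v x))"

text \<open>\<open>(TW \<oplus> T\<^sup>*W, [\<cdot>,\<cdot>]\<^sub>C\<^sup>H, \<langle>\<cdot>,\<cdot>\<rangle>, \<pi>)\<close>\<close>
definition twisted_courant ::
  "('m::topological_space, 'e::real_inner) atlas \<Rightarrow> 'm set \<Rightarrow> ('m \<Rightarrow> 'm mform) \<Rightarrow> ('m, 'm gvec) courant" where
  "twisted_courant A W H = \<lparr>vb = gen_tangent_bundle A W, pairing = (\<lambda>x. gpairing),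
     anchor = (\<lambda>x. fst), brkt = (\<lambda>u v. \<lambda>x\<in>W. courant_bracket A H u v x)\<rparr>"

abbreviation standard_courant ::
  "('m::topological_space, 'e::real_inner) atlas \<Rightarrow> 'm set \<Rightarrow> ('m, 'm gvec) courant" where
  "standard_courant A W \<equiv> twisted_courant A W (\<lambda>x vs. 0)"

definition strong_gacs ::
  "('m::topological_space, 'e::real_inner) atlas \<Rightarrow> 'm set \<Rightarrow> ('m, 'v) courant \<Rightarrow> ('m \<Rightarrow> 'v \<Rightarrow> 'v) \<Rightarrow> bool" where
  "strong_gacs A W C J \<longleftrightarrow>
     bundle_map A W (vb C) (vb C) J \<and>
     (\<forall>x\<in>W. \<forall>u\<in>vcarrier (fibre (vb C) x). J x (J x u) = vscale (fibre (vb C) x) (-1) u) \<and>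
     (\<forall>x\<in>W. \<forall>u\<in>vcarrier (fibre (vb C) x). \<forall>v\<in>vcarrier (fibre (vb C) x).
        pairing C x (J x u) (J x v) = pairing C x u v)"

text \<open>A section of \<open>E \<otimes> \<complex>\<close> is a pair \<open>(a, b)\<close> of sections of \<open>E\<close>, standing for \<open>a + \<i> b\<close>. It
  lies in the \<open>+\<i>\<close>-eigenbundle iff \<open>(J a, J b) = \<i> (a, b) = (- b, a)\<close>.\<close>
definition plus_i_sections ::
  "('m::topological_space, 'e::real_inner) atlas \<Rightarrow> 'm set \<Rightarrow> ('m, 'v) courant \<Rightarrow> ('m \<Rightarrow> 'v \<Rightarrow> 'v) \<Rightarrow>
   (('m \<Rightarrow> 'v) \<times> ('m \<Rightarrow> 'v)) set" where
  "plus_i_sections A W C J = {(a, b). a \<in> sections A W (vb C) \<and> b \<in> sections A W (vb C) \<and>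
     (\<forall>x\<in>W. (J x (a x), J x (b x)) = (vscale (fibre (vb C) x) (-1) (b x), a x))}"

text \<open>\<open>[a + \<i> b, c + \<i> d] = ([a, c] - [b, d]) + \<i> ([a, d] + [b, c])\<close>\<close>
definition complex_brkt ::
  "'m set \<Rightarrow> ('m, 'v) courant \<Rightarrow> ('m \<Rightarrow> 'v) \<times> ('m \<Rightarrow> 'v) \<Rightarrow> ('m \<Rightarrow> 'v) \<times> ('m \<Rightarrow> 'v) \<Rightarrow>
   ('m \<Rightarrow> 'v) \<times> ('m \<Rightarrow> 'v)" where
  "complex_brkt W C p q =
     (sec_add W (vb C) (brkt C (fst p) (fst q)) (sec_scale W (vb C) (-1) (brkt C (snd p) (snd q))),
      sec_add W (vb C) (brkt C (fst p) (snd q)) (brkt C (snd p) (fst q)))"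

definition courant_integrable ::
  "('m::topological_space, 'e::real_inner) atlas \<Rightarrow> 'm set \<Rightarrow> ('m, 'v) courant \<Rightarrow> ('m \<Rightarrow> 'v \<Rightarrow> 'v) \<Rightarrow> bool" where
  "courant_integrable A W C J \<longleftrightarrow>
     (\<forall>p\<in>plus_i_sections A W C J. \<forall>q\<in>plus_i_sections A W C J.
        complex_brkt W C p q \<in> plus_i_sections A W C J)"


section \<open>Gluing\<close>

text \<open>Points of the disjoint union of the \<open>E\<^sub>i\<close> are triples \<open>(i, x, u)\<close> with \<open>u\<close> in the fibre over \<open>x\<close>.\<close>
definition glue_union ::
  "('m::topological_space, 'e::real_inner) atlas \<Rightarrow> 'i set \<Rightarrow> ('i \<Rightarrow> 'm set) \<Rightarrow> ('i \<times> 'm \<times> 'm gvec) set" where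
  "glue_union A I U = {(i, x, u). i \<in> I \<and> x \<in> U i \<and> u \<in> gtan A x}"

definition glue_rel ::
  "('m::topological_space, 'e::real_inner) atlas \<Rightarrow> 'i set \<Rightarrow> ('i \<Rightarrow> 'm set) \<Rightarrow>
   ('i \<Rightarrow> 'i \<Rightarrow> 'm \<Rightarrow> 'm gvec \<Rightarrow> 'm gvec) \<Rightarrow> (('i \<times> 'm \<times> 'm gvec) \<times> ('i \<times> 'm \<times> 'm gvec)) set" where
  "glue_rel A I U \<phi> = {((i, x, u), (j, y, v)).
     (i, x, u) \<in> glue_union A I U \<and> (j, y, v) \<in> glue_union A I U \<and> x = y \<and> u = \<phi> i j x v}"

definition glue_class ::
  "('m::topological_space, 'e::real_inner) atlas \<Rightarrow> 'i set \<Rightarrow> ('i \<Rightarrow> 'm set) \<Rightarrow>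
   ('i \<Rightarrow> 'i \<Rightarrow> 'm \<Rightarrow> 'm gvec \<Rightarrow> 'm gvec) \<Rightarrow> 'i \<Rightarrow> 'm \<Rightarrow> 'm gvec \<Rightarrow> ('i \<times> 'm \<times> 'm gvec) set" where
  "glue_class A I U \<phi> i x u = glue_rel A I U \<phi> `` {(i, x, u)}"

text \<open>Under the gluing conditions a class over \<open>x\<close> has exactly one representative \<open>(i, x, u)\<close> for each \<open>i\<close>
  with \<open>x \<in> U i\<close>; operations on classes act on these representatives simultaneously.\<close>
definition glued_bundle ::
  "('m::topological_space, 'e::real_inner) atlas \<Rightarrow> 'i set \<Rightarrow> ('i \<Rightarrow> 'm set) \<Rightarrow>
   ('i \<Rightarrow> 'i \<Rightarrow> 'm \<Rightarrow> 'm gvec \<Rightarrow> 'm gvec) \<Rightarrow> ('m, ('i \<times> 'm \<times> 'm gvec) set) vbundle" where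
  "glued_bundle A I U \<phi> = \<lparr>
     fibre = (\<lambda>x. \<lparr>
       vcarrier = {(i, y, u) \<in> glue_union A I U. y = x} // glue_rel A I U \<phi>,
       vadd = (\<lambda>p q. {(i, y, vadd (gtan_vsp A y) u v) | i y u v. (i, y, u) \<in> p \<and> (i, y, v) \<in> q}),
       vzero = {(i, x, vzero (gtan_vsp A x)) | i. i \<in> I \<and> x \<in> U i},
       vscale = (\<lambda>a p. {(i, y, vscale (gtan_vsp A y) a u) | i y u. (i, y, u) \<in> p})\<rparr>),
     vrank = 2 * dim (UNIV :: 'e set),
     frames = {(V, \<lambda>k x. glue_class A I U \<phi> i x (e k x)) | i V e.
       i \<in> I \<and> (V, e) \<in> frames (gen_tangent_bundle A (U i))}\<rparr>"

text \<open>The local representative over \<open>U i\<close> of a section of the glued bundle.\<close>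
definition local_rep ::
  "('i \<Rightarrow> 'm set) \<Rightarrow> 'i \<Rightarrow> ('m \<Rightarrow> ('i \<times> 'm \<times> 'm gvec) set) \<Rightarrow> 'm \<Rightarrow> 'm gvec" where
  "local_rep U i s = (\<lambda>x\<in>U i. THE u. (i, x, u) \<in> s x)"

definition glued_courant ::
  "('m::topological_space, 'e::real_inner) atlas \<Rightarrow> 'i set \<Rightarrow> ('i \<Rightarrow> 'm set) \<Rightarrow>
   ('i \<Rightarrow> 'i \<Rightarrow> 'm \<Rightarrow> 'm gvec \<Rightarrow> 'm gvec) \<Rightarrow> ('m, ('i \<times> 'm \<times> 'm gvec) set) courant" where
  "glued_courant A I U \<phi> = \<lparr>
     vb = glued_bundle A I U \<phi>,
     pairing = (\<lambda>x p q. THE r. \<exists>i u v. (i, x, u) \<in> p \<and> (i, x, v) \<in> q \<and> r = gpairing u v),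
     anchor = (\<lambda>x p. THE X. \<exists>i u. (i, x, u) \<in> p \<and> X = fst u),
     brkt = (\<lambda>s t x. {(i, x, brkt (standard_courant A (U i)) (local_rep U i s) (local_rep U i t) x)
       | i. i \<in> I \<and> x \<in> U i})\<rparr>"

definition glued_endo ::
  "('i \<Rightarrow> 'm \<Rightarrow> 'm gvec \<Rightarrow> 'm gvec) \<Rightarrow> 'm \<Rightarrow> ('i \<times> 'm \<times> 'm gvec) set \<Rightarrow> ('i \<times> 'm \<times> 'm gvec) set" where
  "glued_endo J x p = {(i, x, J i x u) | i u. (i, x, u) \<in> p}"

end

theory Submission
  imports Defs
begin

text \<open>Write \<open>\<phi> i j = exp (B i j)\<close>. The closed 2-forms \<open>B i j\<close> form an additive Cech cocycle, and a
  partition of unity \<open>\<rho>\<close> subordinate to the cover gives \<open>b i = \<Sum>k. \<rho> k * B k i\<close> with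
  \<open>B i j = b j - b i\<close>. As \<open>B i j\<close> is closed, the forms \<open>d (b i)\<close> agree on overlaps and define a closed
  3-form \<open>H\<close>. The maps \<open>exp (b i)\<close> are compatible with the gluing, so they identify \<open>E\<close> with
  \<open>TM \<oplus> T\<^sup>*M\<close>; since \<open>exp b\<close> preserves pairing and anchor and carries the \<open>d b\<close>-twisted bracket from
  the standard one, the glued structure corresponds to the \<open>H\<close>-twisted one, for which the Courant
  axioms are checked on vector fields and forms by means of \<open>d H = 0\<close>. Integrability of a glued
  complex structure is local.\<close>

section \<open>Maps of class \<open>C\<^sup>k\<close>\<close>

text \<open>The definitions create obstacles that shape the development. Tangent vectors are
  derivations of germs, so that coordinate derivations span the tangent space has to be derived, by
  Hadamard's lemma; and since the model space is only an inner product space with a finite spanning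
  set, compactness of balls and coordinates come from an orthonormal basis. Exterior and Lie
  derivatives are definite descriptions over all extensions of tangent vectors to fields, so they
  have a determinate value only once tensoriality is known; identities are proved for fields and
  transferred to points afterwards. Smoothness of a section refers to arbitrary frames of the bundle
  atlas, so its coordinates are recovered as solutions of smooth linear systems before sections can
  be treated as pairs of a vector field and a 1-form. Even the first part of the theorem goes
  through the potential \<open>b\<close>: well-definedness and all axioms on the glued bundle are
  carried over along the resulting bijections of fibres instead of being checked on
  overlaps.\<close>

lemma ck_on_cong:
  assumes "open S" "\<And>x. x \<in> S \<Longrightarrow> f x = g x"
  shows "ck_on k S f \<longleftrightarrow> ck_on k S g"
  using assms(2)
proof (induction k arbitrary: f g)
  case 0
  then show ?case by (auto intro!: continuous_on_cong)
next
  case (Suc k)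
  have fd: "(f has_derivative D) (at x) \<longleftrightarrow> (g has_derivative D) (at x)" if "x \<in> S" for x D
    using has_derivative_transform_within_open[OF _ assms(1) that, of f D UNIV g]
      has_derivative_transform_within_open[OF _ assms(1) that, of g D UNIV f] Suc.prems by auto
  then have "frechet_derivative f (at x) = frechet_derivative g (at x)" if "x \<in> S" for x
    using that by (simp add: frechet_derivative_def)
  moreover have "f differentiable (at x) \<longleftrightarrow> g differentiable (at x)" if "x \<in> S" for x
    using fd that by (simp add: differentiable_def)
  moreover have "ck_on k S (\<lambda>x. frechet_derivative f (at x) v) \<longleftrightarrow>
      ck_on k S (\<lambda>x. frechet_derivative g (at x) v)" for v
    by (rule Suc.IH) (simp add: calculation)
  ultimately show ?case by simp
qed

lemma ck_on_mono: "ck_on k S f \<Longrightarrow> T \<subseteq> S \<Longrightarrow> ck_on k T f"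
  by (induction k arbitrary: f) (auto intro: continuous_on_subset)

text \<open>The Frechet derivative is unique, so any explicit formula \<open>f'\<close> for it may
  replace \<open>frechet_derivative\<close>. The closure properties below are inductions on
  \<open>k\<close> through this rule: the differentiation formula is exhibited and the induction
  hypothesis is applied to it.\<close>

lemma ck_on_SucI:
  assumes "open S" "\<And>x. x \<in> S \<Longrightarrow> (f has_derivative (\<lambda>v. f' v x)) (at x)" "\<And>v. ck_on k S (f' v)"
  shows "ck_on (Suc k) S f"
proof -
  have "frechet_derivative f (at x) v = f' v x" if "x \<in> S" for x v
    using frechet_derivative_at[OF assms(2)[OF that]] by metis
  then have "ck_on k S (\<lambda>x. frechet_derivative f (at x) v)" for v
    using ck_on_cong[OF assms(1), of "\<lambda>x. frechet_derivative f (at x) v" "f' v" k] assms(3) by simp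
  with assms(2) show ?thesis by (auto simp: differentiable_def)
qed

lemma ck_on_SucD:
  "ck_on (Suc k) S f \<Longrightarrow> ck_on k S f"
proof (induction k arbitrary: f)
  case 0
  then show ?case
    by (auto intro!: continuous_at_imp_continuous_on differentiable_imp_continuous_within)
next
  case (Suc k)
  then show ?case
    unfolding ck_on.simps(2)[of _ S f] by blast
qed

lemma ck_on_has_derivative:
  "ck_on (Suc k) S f \<Longrightarrow> x \<in> S \<Longrightarrow> (f has_derivative (\<lambda>v. frechet_derivative f (at x) v)) (at x)"
  using frechet_derivative_works[of f "at x"] by auto

lemma ck_on_local:
  assumes "\<And>x. x \<in> S \<Longrightarrow> \<exists>T. open T \<and> x \<in> T \<and> ck_on k (S \<inter> T) f"
  shows "ck_on k S f"
  using assms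
proof (induction k arbitrary: f)
  case 0
  show ?case
  proof (simp add: continuous_on_eq_continuous_within, intro ballI)
    fix x assume x: "x \<in> S"
    then obtain T where T: "open T" "x \<in> T" "continuous_on (S \<inter> T) f" using 0 by auto
    then have "continuous (at x within (S \<inter> T)) f"
      using x by (simp add: continuous_on_eq_continuous_within)
    moreover have "at x within (S \<inter> T) = at x within S"
      by (rule at_within_nhd[OF T(2,1)]) auto
    ultimately show "continuous (at x within S) f" by (simp add: continuous_within)
  qed
next
  case (Suc k)
  show ?case
  proof (simp, intro conjI ballI allI)
    fix x assume "x \<in> S" then show "f differentiable at x" using Suc.prems[of x] by auto
  next
    fix v show "ck_on k S (\<lambda>x. frechet_derivative f (at x) v)"
      by (rule Suc.IH) (use Suc.prems in fastforce)
  qed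
qed

lemma ck_on_const: "open S \<Longrightarrow> ck_on k S (\<lambda>x. c)"
proof (induction k arbitrary: c)
  case (Suc k)
  then show ?case by (intro ck_on_SucI[where f'="\<lambda>v x. 0"]) auto
qed auto

lemma ck_on_bounded_linear:
  assumes "open S" "bounded_linear L" "ck_on k S f"
  shows "ck_on k S (\<lambda>x. L (f x))"
  using assms(3)
proof (induction k arbitrary: f)
  case 0
  then show ?case using bounded_linear.continuous_on[OF assms(2), of S f] by simp
next
  case (Suc k)
  show ?case
  proof (rule ck_on_SucI[OF assms(1)])
    fix x assume "x \<in> S"
    from bounded_linear.has_derivative[OF assms(2) ck_on_has_derivative[OF Suc.prems this]]
    show "((\<lambda>x. L (f x)) has_derivative (\<lambda>v. L (frechet_derivative f (at x) v))) (at x)" .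
  qed (use Suc in auto)
qed

lemma ck_on_ident: "open S \<Longrightarrow> ck_on k S (\<lambda>x. x)"
proof (cases k)
  case (Suc j)
  assume "open S"
  then show ?thesis unfolding Suc
    by (intro ck_on_SucI[where f'="\<lambda>v x. v"]) (auto intro: ck_on_const)
qed auto

lemma ck_on_add:
  assumes "open S" "ck_on k S f" "ck_on k S g"
  shows "ck_on k S (\<lambda>x. f x + g x)"
  using assms(2,3)
proof (induction k arbitrary: f g)
  case (Suc k)
  show ?case
  proof (rule ck_on_SucI[OF assms(1)])
    fix x assume "x \<in> S"
    from has_derivative_add[OF ck_on_has_derivative[OF Suc.prems(1) this] ck_on_has_derivative[OF Suc.prems(2) this]]
    show "((\<lambda>x. f x + g x) has_derivative
      (\<lambda>v. frechet_derivative f (at x) v + frechet_derivative g (at x) v)) (at x)" .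
  qed (use Suc in auto)
qed (auto intro: continuous_on_add)

lemma ck_on_sum:
  assumes "open S" "\<And>i. i \<in> I \<Longrightarrow> ck_on k S (f i)"
  shows "ck_on k S (\<lambda>x. \<Sum>i\<in>I. f i x)"
  using assms(2)
  by (induction I rule: infinite_finite_induct) (simp_all add: ck_on_add ck_on_const assms(1))

text \<open>The product rule mixes each function with the derivative of the other, so the induction
  also uses the undifferentiated factors at the lower order \<open>k\<close>, which
  \<open>ck_on_SucD\<close> provides.\<close>

lemma ck_on_scaleR:
  assumes "open S" "ck_on k S a" "ck_on k S f"
  shows "ck_on k S (\<lambda>x. a x *\<^sub>R f x)"
  using assms(2,3)
proof (induction k arbitrary: a f)
  case (Suc k)
  show ?case
  proof (rule ck_on_SucI[OF assms(1)])
    fix x assume "x \<in> S"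
    from has_derivative_scaleR[OF ck_on_has_derivative[OF Suc.prems(1) this] ck_on_has_derivative[OF Suc.prems(2) this]]
    show "((\<lambda>x. a x *\<^sub>R f x) has_derivative
      (\<lambda>v. a x *\<^sub>R frechet_derivative f (at x) v + frechet_derivative a (at x) v *\<^sub>R f x)) (at x)" .
  next
    fix v
    show "ck_on k S (\<lambda>x. a x *\<^sub>R frechet_derivative f (at x) v + frechet_derivative a (at x) v *\<^sub>R f x)"
      by (intro ck_on_add assms(1) Suc.IH) (use Suc.prems in \<open>auto intro: ck_on_SucD[of _ _ a] ck_on_SucD[of _ _ f]\<close>)
  qed
qed (auto intro: continuous_on_scaleR)

section \<open>Orthonormal bases of the model space\<close>

definition onb :: "'e::real_inner set \<Rightarrow> bool" where
  "onb B \<longleftrightarrow> finite B \<and> pairwise orthogonal B \<and> (\<forall>b\<in>B. norm b = 1) \<and> span B = UNIV"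

lemma onb_inner: "onb B \<Longrightarrow> b \<in> B \<Longrightarrow> b' \<in> B \<Longrightarrow> b \<bullet> b' = (if b = b' then 1 else 0)"
  by (auto simp: onb_def pairwise_def orthogonal_def norm_eq_1)

lemma onb_expand:
  assumes "onb B"
  shows "(\<Sum>b\<in>B. (x \<bullet> b) *\<^sub>R b) = x"
proof -
  have fin: "finite B" using assms by (simp add: onb_def)
  have "x \<in> span B" using assms by (simp add: onb_def)
  then obtain u where u: "x = (\<Sum>b\<in>B. u b *\<^sub>R b)"
    using span_finite[OF fin] by auto
  have "x \<bullet> b = u b" if "b \<in> B" for b
    unfolding u using that fin
    by (simp add: inner_sum_left onb_inner[OF assms _ that] if_distrib cong: if_cong)
  then show ?thesis using u by simp
qed

text \<open>Gram-Schmidt gives an orthogonal spanning set that may contain 0; removing 0 does not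
  change the span, and the remaining vectors can be normalised. In dimension 0 the result is the
  empty set.\<close>

lemma onb_exists:
  assumes "finite B" "span B = (UNIV :: 'e::real_inner set)"
  shows "\<exists>C :: 'e set. onb C"
proof -
  obtain C where C: "finite C" "span C = span B" "pairwise orthogonal C"
    using basis_orthogonal[OF assms(1)] by blast
  define D where "D = (\<lambda>x. x /\<^sub>R norm x) ` (C - {0})"
  have "span D = span (C - {0})"
    unfolding D_def by (rule span_image_scale) (use C in auto)
  then have "span D = UNIV" using C assms by (simp add: span_delete_0)
  moreover have "pairwise orthogonal D"
    using C(3) by (auto simp: D_def pairwise_def orthogonal_def)
  moreover have "norm b = 1" if "b \<in> D" for b using that by (auto simp: D_def field_simps split: if_splits)
  moreover have "finite D" using C(1) by (simp add: D_def)
  ultimately show ?thesis unfolding onb_def by blast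
qed

lemma onb_independent: "onb B \<Longrightarrow> independent B"
  by (rule pairwise_orthogonal_independent) (auto simp: onb_def)

lemma onb_card: "onb (B :: 'e::real_inner set) \<Longrightarrow> card B = dim (UNIV :: 'e set)"
  by (metis onb_def onb_independent dim_span_eq_card_independent)

lemma onb_real: "onb {1::real}"
  by (auto simp: onb_def pairwise_def span_singleton)

lemma onb_frechet:
  assumes B: "onb B" and "g differentiable (at y)"
  shows "frechet_derivative g (at y) w = (\<Sum>b\<in>B. (w \<bullet> b) *\<^sub>R frechet_derivative g (at y) b)"
proof -
  interpret bounded_linear "frechet_derivative g (at y)"
    using assms(2) frechet_derivative_works has_derivative_bounded_linear by blast
  have "frechet_derivative g (at y) w = frechet_derivative g (at y) (\<Sum>b\<in>B. (w \<bullet> b) *\<^sub>R b)"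
    by (simp add: onb_expand[OF B])
  then show ?thesis by (simp add: sum scaleR)
qed

text \<open>\<open>ck_on\<close> speaks of derivatives in fixed directions, whereas the chain rule
  differentiates \<open>g\<close> in the direction \<open>?f' v x\<close>, which moves with
  \<open>x\<close>. Expanding that direction in the orthonormal basis turns the derivative into a
  finite sum of products to which the induction hypothesis applies.\<close>

lemma ck_on_compose:
  fixes f :: "'d::real_normed_vector \<Rightarrow> 'e::real_inner"
  assumes B: "onb (B :: 'e set)" and op: "open S" "open T"
    and "ck_on k S f" "ck_on k T g" "f ` S \<subseteq> T"
  shows "ck_on k S (\<lambda>x. g (f x))"
  using assms(4-6)
proof (induction k arbitrary: g)
  case 0
  then show ?case using continuous_on_compose2[of T g S f] by auto
next
  case (Suc k)
  let ?f' = "\<lambda>v x. frechet_derivative f (at x) v"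
  let ?g' = "\<lambda>v y. frechet_derivative g (at y) v"
  have gd: "g differentiable (at (f x))" if "x \<in> S" for x using Suc.prems that by auto
  show ?case
  proof (rule ck_on_SucI[OF op(1), where f'="\<lambda>v x. \<Sum>b\<in>B. (?f' v x \<bullet> b) *\<^sub>R ?g' b (f x)"])
    fix x assume x: "x \<in> S"
    have "((\<lambda>x. g (f x)) has_derivative (\<lambda>v. ?g' (?f' v x) (f x))) (at x)"
      using diff_chain_at[OF ck_on_has_derivative[OF Suc.prems(1) x], of g "\<lambda>v. ?g' v (f x)"]
        gd[OF x] frechet_derivative_works[of g] by (auto simp: o_def)
    moreover have "(\<lambda>v. ?g' (?f' v x) (f x)) = (\<lambda>v. \<Sum>b\<in>B. (?f' v x \<bullet> b) *\<^sub>R ?g' b (f x))"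
      by (rule ext, rule onb_frechet[OF B gd[OF x]])
    ultimately show "((\<lambda>x. g (f x)) has_derivative (\<lambda>v. \<Sum>b\<in>B. (?f' v x \<bullet> b) *\<^sub>R ?g' b (f x))) (at x)"
      by metis
  next
    fix v
    have "ck_on k S (\<lambda>x. ?g' b (f x))" for b
      by (rule Suc.IH) (use Suc.prems in \<open>auto intro: ck_on_SucD[of _ _ f]\<close>)
    moreover have "ck_on k S (\<lambda>x. ?f' v x \<bullet> b)" for b
      by (rule ck_on_bounded_linear[OF op(1) bounded_linear_inner_left]) (use Suc.prems in auto)
    ultimately show "ck_on k S (\<lambda>x. \<Sum>b\<in>B. (?f' v x \<bullet> b) *\<^sub>R ?g' b (f x))"
      by (intro ck_on_sum ck_on_scaleR op)
  qed
qed

section \<open>Reciprocals and a function that is flat at 0\<close>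

lemma ck_on_inverse: "ck_on k (- {0}) (inverse :: real \<Rightarrow> real)"
proof (induction k)
  case 0
  then show ?case by (auto intro!: continuous_intros)
next
  case (Suc k)
  show ?case
  \<comment> \<open>The derivative is expressed by \<open>inverse\<close> itself, so the induction
    hypothesis covers it.\<close>
  proof (rule ck_on_SucI[where f'="\<lambda>v x. (- v) *\<^sub>R (inverse x *\<^sub>R inverse x)"])
    fix x :: real assume "x \<in> - {0}"
    then show "(inverse has_derivative (\<lambda>v. (- v) *\<^sub>R (inverse x *\<^sub>R inverse x))) (at x)"
      by (auto intro!: derivative_eq_intros)
  next
    show "ck_on k (- {0}) (\<lambda>x. (- v) *\<^sub>R (inverse x *\<^sub>R inverse x))" for v :: real
      by (intro ck_on_scaleR ck_on_const Suc) auto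
  qed auto
qed

text \<open>The factor \<open>inverse t ^ m\<close> makes the family closed under differentiation up to linear
  combinations.\<close>
definition flat :: "nat \<Rightarrow> real \<Rightarrow> real" where
  "flat m t = (if t > 0 then inverse t ^ m * exp (- inverse t) else 0)"

text \<open>The difference quotient at 0. From the right, the substitution
  \<open>s = inverse t\<close> turns it into \<open>s ^ Suc m / exp s\<close>, and the exponential
  wins; from the left the function is 0.\<close>

lemma flat_div_tendsto: "((\<lambda>t. flat m t / t) \<longlongrightarrow> 0) (at 0)"
proof -
  have "((\<lambda>s::real. s ^ Suc m / exp s) \<longlongrightarrow> 0) at_top"
    by (rule tendsto_power_div_exp_0)
  then have "((\<lambda>t::real. inverse t ^ Suc m / exp (inverse t)) \<longlongrightarrow> 0) (at_right 0)"
    by (rule filterlim_compose[OF _ filterlim_inverse_at_top_right])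
  moreover have "\<forall>\<^sub>F t in at_right 0. inverse t ^ Suc m / exp (inverse t) = flat m t / t"
    using eventually_at_right_less by (rule eventually_mono) (simp add: flat_def exp_minus field_simps)
  ultimately have "((\<lambda>t. flat m t / t) \<longlongrightarrow> 0) (at_right 0)"
    by (rule Lim_transform_eventually)
  moreover have "((\<lambda>t. flat m t / t) \<longlongrightarrow> 0) (at_left 0)"
  proof (rule Lim_transform_eventually[OF tendsto_const])
    show "\<forall>\<^sub>F t in at_left 0. 0 = flat m t / t"
      using eventually_at_left_real[of "-1" 0] by (auto elim!: eventually_mono simp: flat_def)
  qed
  ultimately show ?thesis by (simp add: filterlim_split_at)
qed

text \<open>The terms of orders \<open>m + 2\<close> and \<open>m + 1\<close> come from
  differentiating the exponential and the power. At 0 both are 0, and the claim reduces to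
  \<open>flat_div_tendsto\<close>.\<close>

lemma flat_has_derivative:
  "(flat m has_derivative (\<lambda>v. v * (flat (m + 2) t - real m * flat (m + 1) t))) (at t)"
proof (cases "t = 0")
  case True
  have "(flat m has_real_derivative 0) (at 0)"
    unfolding has_field_derivative_iff using flat_div_tendsto[of m] by (simp add: flat_def)
  then have "(flat m has_derivative (\<lambda>v. 0)) (at 0)"
    by (simp add: has_field_derivative_def lambda_zero[symmetric])
  then show ?thesis by (simp add: True flat_def)
next
  case False
  show ?thesis
  proof (cases "t > 0")
    case True
    have "((\<lambda>t. inverse t ^ m * exp (- inverse t)) has_real_derivative
        (flat (m + 2) t - real m * flat (m + 1) t)) (at t)"
    proof (cases m)
      case 0
      then show ?thesis using True
        by (auto intro!: derivative_eq_intros simp: flat_def field_simps power2_eq_square)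
    next
      case (Suc n)
      have inv: "(inverse has_real_derivative - (inverse t * inverse t)) (at t)"
        using True by (auto intro!: derivative_eq_intros)
      have "((\<lambda>t. exp (- inverse t)) has_real_derivative exp (- inverse t) * (inverse t * inverse t)) (at t)"
        using DERIV_fun_exp[OF DERIV_minus[OF inv]] by simp
      from DERIV_mult[OF DERIV_power_Suc[OF inv, of n] this] show ?thesis
        using True by (simp add: Suc flat_def algebra_simps)
    qed
    then have "((\<lambda>t. inverse t ^ m * exp (- inverse t)) has_derivative
        (\<lambda>v. v * (flat (m + 2) t - real m * flat (m + 1) t))) (at t)"
      by (simp add: has_field_derivative_def mult.commute[of _ "_ - _"])
    then show ?thesis
      by (rule has_derivative_transform_within_open[where s="{0<..}"]) (auto simp: True flat_def)
  next
    case neg: False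
    have "((\<lambda>t. 0) has_derivative (\<lambda>v. v * (flat (m + 2) t - real m * flat (m + 1) t))) (at t)"
      using neg by (simp add: flat_def)
    then show ?thesis
      by (rule has_derivative_transform_within_open[where s="{..<0}"]) (use neg False in \<open>auto simp: flat_def\<close>)
  qed
qed

lemma ck_on_flat: "ck_on k UNIV (flat m)"
proof (induction k arbitrary: m)
  case 0
  have "isCont (flat m) t" for t
    using flat_has_derivative has_derivative_continuous by blast
  then show ?case by (simp add: continuous_at_imp_continuous_on)
next
  case (Suc k)
  show ?case
  proof (rule ck_on_SucI[OF open_UNIV flat_has_derivative])
    fix v
    have "ck_on k UNIV (\<lambda>t. v *\<^sub>R (flat (m + 2) t + (- real m) *\<^sub>R flat (m + 1) t))"
      by (intro ck_on_scaleR ck_on_add ck_on_const Suc open_UNIV)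
    then show "ck_on k UNIV (\<lambda>t. v * (flat (m + 2) t - real m * flat (m + 1) t))" by simp
  qed
qed

section \<open>Closure properties of smooth maps\<close>

lemma smooth_map_on_cong:
  "open S \<Longrightarrow> (\<And>x. x \<in> S \<Longrightarrow> f x = g x) \<Longrightarrow> smooth_map_on S f \<longleftrightarrow> smooth_map_on S g"
  unfolding smooth_map_on_def using ck_on_cong by metis

lemma smooth_map_on_mono: "smooth_map_on S f \<Longrightarrow> T \<subseteq> S \<Longrightarrow> smooth_map_on T f"
  unfolding smooth_map_on_def using ck_on_mono by metis

lemma smooth_map_on_local:
  "(\<And>x. x \<in> S \<Longrightarrow> \<exists>T. open T \<and> x \<in> T \<and> smooth_map_on (S \<inter> T) f) \<Longrightarrow> smooth_map_on S f"
  unfolding smooth_map_on_def by (metis ck_on_local)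

lemma smooth_map_on_has_derivative:
  "smooth_map_on S f \<Longrightarrow> x \<in> S \<Longrightarrow> (f has_derivative (\<lambda>v. frechet_derivative f (at x) v)) (at x)"
  unfolding smooth_map_on_def using ck_on_has_derivative by metis

lemma smooth_map_on_differentiable:
  "smooth_map_on S f \<Longrightarrow> x \<in> S \<Longrightarrow> f differentiable (at x)"
  using smooth_map_on_has_derivative differentiableI by blast

lemma smooth_map_on_frechet:
  "smooth_map_on S f \<Longrightarrow> smooth_map_on S (\<lambda>x. frechet_derivative f (at x) v)"
  unfolding smooth_map_on_def by (metis ck_on.simps(2))

lemma smooth_map_on_continuous: "smooth_map_on S f \<Longrightarrow> continuous_on S f"
  unfolding smooth_map_on_def by (metis ck_on.simps(1))

lemma smooth_map_on_const: "open S \<Longrightarrow> smooth_map_on S (\<lambda>x. c)"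
  by (simp add: smooth_map_on_def ck_on_const)

lemma smooth_map_on_ident: "open S \<Longrightarrow> smooth_map_on S (\<lambda>x. x)"
  by (simp add: smooth_map_on_def ck_on_ident)

lemma smooth_map_on_add:
  "open S \<Longrightarrow> smooth_map_on S f \<Longrightarrow> smooth_map_on S g \<Longrightarrow> smooth_map_on S (\<lambda>x. f x + g x)"
  by (simp add: smooth_map_on_def ck_on_add)

lemma smooth_map_on_mult:
  fixes f g :: "_ \<Rightarrow> real"
  shows "open S \<Longrightarrow> smooth_map_on S f \<Longrightarrow> smooth_map_on S g \<Longrightarrow> smooth_map_on S (\<lambda>x. f x * g x)"
  using ck_on_scaleR[of S _ f g] by (simp add: smooth_map_on_def)

lemma smooth_map_on_sum:
  "open S \<Longrightarrow> (\<And>i. i \<in> I \<Longrightarrow> smooth_map_on S (f i)) \<Longrightarrow> smooth_map_on S (\<lambda>x. \<Sum>i\<in>I. f i x)"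
  by (simp add: smooth_map_on_def ck_on_sum)

lemma smooth_map_on_bounded_linear:
  "open S \<Longrightarrow> bounded_linear L \<Longrightarrow> smooth_map_on S f \<Longrightarrow> smooth_map_on S (\<lambda>x. L (f x))"
  by (simp add: smooth_map_on_def ck_on_bounded_linear)

lemma smooth_map_on_compose:
  fixes f :: "'d::real_normed_vector \<Rightarrow> 'e::real_inner"
  assumes "onb (B :: 'e set)" "open S" "open T" "smooth_map_on S f" "smooth_map_on T g" "f ` S \<subseteq> T"
  shows "smooth_map_on S (\<lambda>x. g (f x))"
  using assms(4-6) unfolding smooth_map_on_def by (blast intro: ck_on_compose[OF assms(1-3)])

section \<open>Hadamard's lemma\<close>

text \<open>Heine-Borel for the model space. The vectors with coefficients bounded by
  \<open>r\<close> form a finite Minkowski sum of compact segments, hence a compact set, and by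
  Cauchy-Schwarz the ball around 0 is a closed subset of it; translation gives the other
  centres.\<close>

lemma onb_compact_cball:
  assumes B: "onb (B :: 'e::real_inner set)"
  shows "compact (cball (a::'e) r)"
proof -
  have comp: "compact {\<Sum>b\<in>C. t b *\<^sub>R b | t. \<forall>b\<in>C. \<bar>t b\<bar> \<le> r}" if "finite C" for C :: "'e set" and r :: real
    using that
  proof induction
    case empty
    then show ?case by simp
  next
    case (insert c C)
    let ?S = "{\<Sum>b\<in>C. t b *\<^sub>R b | t. \<forall>b\<in>C. \<bar>t b\<bar> \<le> r}"
    have "compact ((\<lambda>s. s *\<^sub>R c) ` {-r..r})"
      by (intro compact_continuous_image continuous_intros) auto
    from compact_sums[OF this insert.IH]
    have "compact {x + y | x y. x \<in> (\<lambda>s. s *\<^sub>R c) ` {-r..r} \<and> y \<in> ?S}" .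
    moreover have "{x + y | x y. x \<in> (\<lambda>s. s *\<^sub>R c) ` {-r..r} \<and> y \<in> ?S} =
        {\<Sum>b\<in>insert c C. t b *\<^sub>R b | t. \<forall>b\<in>insert c C. \<bar>t b\<bar> \<le> r}" (is "?L = ?R")
    proof
      show "?L \<subseteq> ?R"
      proof
        fix z assume "z \<in> ?L"
        then obtain s t where st: "s \<in> {-r..r}" "\<forall>b\<in>C. \<bar>t b\<bar> \<le> r" "z = s *\<^sub>R c + (\<Sum>b\<in>C. t b *\<^sub>R b)"
          by auto
        have "(\<Sum>b\<in>C. (t(c := s)) b *\<^sub>R b) = (\<Sum>b\<in>C. t b *\<^sub>R b)"
          by (rule sum.cong) (use insert.hyps in auto)
        then have "z = (\<Sum>b\<in>insert c C. (t(c := s)) b *\<^sub>R b)"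
          using st(3) insert.hyps by simp
        moreover have "\<forall>b\<in>insert c C. \<bar>(t(c := s)) b\<bar> \<le> r" using st by auto
        ultimately show "z \<in> ?R" by blast
      qed
      show "?R \<subseteq> ?L"
      proof
        fix z assume "z \<in> ?R"
        then obtain t where t: "\<forall>b\<in>insert c C. \<bar>t b\<bar> \<le> r" "z = (\<Sum>b\<in>insert c C. t b *\<^sub>R b)" by auto
        have "z = t c *\<^sub>R c + (\<Sum>b\<in>C. t b *\<^sub>R b)" using t(2) insert.hyps by simp
        moreover have "t c *\<^sub>R c \<in> (\<lambda>s. s *\<^sub>R c) ` {-r..r}"
          by (rule imageI) (use t(1) in auto)
        ultimately show "z \<in> ?L" using t(1) by blast
      qed
    qed
    ultimately show ?case by simp
  qed
  have fin: "finite B" using B by (simp add: onb_def)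
  have "cball 0 r \<subseteq> {\<Sum>b\<in>B. t b *\<^sub>R b | t. \<forall>b\<in>B. \<bar>t b\<bar> \<le> r}"
  proof
    fix x :: 'e assume "x \<in> cball 0 r"
    then have "\<bar>x \<bullet> b\<bar> \<le> r" if "b \<in> B" for b
      using Cauchy_Schwarz_ineq2[of x b] B that by (auto simp: onb_def)
    moreover have "x = (\<Sum>b\<in>B. (x \<bullet> b) *\<^sub>R b)" by (simp add: onb_expand[OF B])
    ultimately show "x \<in> {\<Sum>b\<in>B. t b *\<^sub>R b | t. \<forall>b\<in>B. \<bar>t b\<bar> \<le> r}"
      by (auto intro!: exI[of _ "\<lambda>b. x \<bullet> b"])
  qed
  then have "compact ({\<Sum>b\<in>B. t b *\<^sub>R b | t. \<forall>b\<in>B. \<bar>t b\<bar> \<le> r} \<inter> cball 0 r)"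
    by (intro compact_Int_closed comp fin closed_cball)
  then have "compact (cball (0::'e) r)"
    using \<open>cball 0 r \<subseteq> _\<close> by (simp add: Int_absorb1)
  then have "compact ((+) a ` cball 0 r)" by (rule compact_translation)
  then show ?thesis by (simp add: image_add_cball)
qed

text \<open>A first-order estimate uniform in \<open>z\<close>, as is needed to differentiate under
  an integral sign. The finitely many derivatives along basis vectors are uniformly continuous on
  the compact ball, and the mean value theorem on the segment from \<open>z\<close> to
  \<open>z + w\<close> brings in the derivative at an intermediate point.\<close>

lemma onb_first_order:
  fixes F :: "'e::real_inner \<Rightarrow> real"
  assumes B: "onb (B :: 'e set)" and F: "smooth_map_on (ball a r) F" and s: "0 < s" "s < r" and e: "e > 0"
  shows "\<exists>d>0. \<forall>z w. z \<in> cball a s \<and> z + w \<in> cball a s \<and> norm w < d \<longrightarrow>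
     \<bar>F (z + w) - F z - frechet_derivative F (at z) w\<bar> \<le> e * norm w"
proof -
  have fin: "finite B" using B by (simp add: onb_def)
  \<comment> \<open>Each basis direction may use this share of the error; the \<open>+ 1\<close>
    keeps the quotient meaningful when the basis is empty.\<close>
  define e' where "e' = e / (card B + 1)"
  have e': "e' > 0" using e by (simp add: e'_def)
  have sub: "cball a s \<subseteq> ball a r" using s by auto
  let ?D = "\<lambda>b z. frechet_derivative F (at z) b"
  have "\<exists>d>0. \<forall>z\<in>cball a s. \<forall>z'\<in>cball a s. dist z' z < d \<longrightarrow> dist (?D b z') (?D b z) < e'" for b
  proof -
    have "continuous_on (cball a s) (?D b)"
      using smooth_map_on_continuous[OF smooth_map_on_frechet[OF F]] sub continuous_on_subset by blast
    then have "uniformly_continuous_on (cball a s) (?D b)"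
      using compact_uniformly_continuous onb_compact_cball[OF B] by blast
    then show ?thesis using e' unfolding uniformly_continuous_on_def by blast
  qed
  then obtain d where d: "\<And>b. d b > 0"
    "\<And>b z z'. z \<in> cball a s \<Longrightarrow> z' \<in> cball a s \<Longrightarrow> dist z' z < d b \<Longrightarrow> dist (?D b z') (?D b z) < e'"
    by metis
  \<comment> \<open>The inserted 1 keeps the minimum over a nonempty set in dimension 0.\<close>
  define d0 where "d0 = Min (insert 1 (d ` B))"
  have d0: "d0 > 0" "\<And>b. b \<in> B \<Longrightarrow> d0 \<le> d b"
    using fin d(1) by (auto simp: d0_def)
  show ?thesis
  proof (intro exI[of _ d0] conjI d0 allI impI, elim conjE)
    fix z w assume z: "z \<in> cball a s" and zw: "z + w \<in> cball a s" and w: "norm w < d0"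
    have diff: "F differentiable (at y)" if "y \<in> ball a r" for y
      using smooth_map_on_differentiable[OF F that] .
    have seg: "z + t *\<^sub>R w \<in> cball a s" if "t \<in> {0..1}" for t
    proof -
      have "(1 - t) *\<^sub>R z + t *\<^sub>R (z + w) \<in> cball a s"
        by (rule convexD[OF convex_cball z zw]) (use that in auto)
      then show ?thesis by (simp add: algebra_simps)
    qed
    have der: "((\<lambda>t. F (z + t *\<^sub>R w)) has_real_derivative frechet_derivative F (at (z + t *\<^sub>R w)) w) (at t)"
      if t: "t \<in> {0..1}" for t
    proof -
      have g: "((\<lambda>t. z + t *\<^sub>R w) has_derivative (\<lambda>v. v *\<^sub>R w)) (at t)"
        by (auto intro!: derivative_eq_intros)
      have "z + t *\<^sub>R w \<in> ball a r" using seg[OF t] sub by blast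
      from diff_chain_at[OF g smooth_map_on_has_derivative[OF F this]]
      have h: "((\<lambda>t. F (z + t *\<^sub>R w)) has_derivative (\<lambda>v. frechet_derivative F (at (z + t *\<^sub>R w)) (v *\<^sub>R w))) (at t)"
        by (simp add: o_def)
      moreover have "frechet_derivative F (at (z + t *\<^sub>R w)) (v *\<^sub>R w) = frechet_derivative F (at (z + t *\<^sub>R w)) w * v" for v
        using linear_frechet_derivative[OF diff[OF \<open>z + t *\<^sub>R w \<in> ball a r\<close>]]
        by (simp add: linear_cmul)
      ultimately show ?thesis by (simp add: has_field_derivative_def)
    qed
    obtain t where t: "t > 0" "t < 1"
      "F (z + 1 *\<^sub>R w) - F (z + 0 *\<^sub>R w) = (1 - 0) * frechet_derivative F (at (z + t *\<^sub>R w)) w"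
      using MVT2[of 0 1 "\<lambda>t. F (z + t *\<^sub>R w)" "\<lambda>t. frechet_derivative F (at (z + t *\<^sub>R w)) w"] der
      by auto
    let ?y = "z + t *\<^sub>R w"
    have y: "?y \<in> cball a s" using seg t by auto
    have "dist ?y z = t * norm w" using t by (simp add: dist_norm)
    also have "\<dots> \<le> norm w" using t by (simp add: mult_left_le_one_le)
    finally have dyz: "dist ?y z < d0" using w by simp
    have bd: "\<bar>(w \<bullet> b) * (?D b ?y - ?D b z)\<bar> \<le> norm w * e'" if b: "b \<in> B" for b
    proof -
      have "\<bar>w \<bullet> b\<bar> \<le> norm w" using Cauchy_Schwarz_ineq2[of w b] B b by (auto simp: onb_def)
      moreover have "\<bar>?D b ?y - ?D b z\<bar> \<le> e'"
        using d(2)[OF z y, of b] dyz d0(2)[OF b] by (simp add: dist_real_def)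
      ultimately show ?thesis unfolding abs_mult by (rule mult_mono) auto
    qed
    have "F (z + w) - F z - ?D w z = ?D w ?y - ?D w z" using t(3) by simp
    also have "\<dots> = (\<Sum>b\<in>B. (w \<bullet> b) * (?D b ?y - ?D b z))"
      using onb_frechet[OF B diff, of ?y w] onb_frechet[OF B diff, of z w] subsetD[OF sub y] subsetD[OF sub z]
      by (simp add: right_diff_distrib sum_subtractf)
    finally have "\<bar>F (z + w) - F z - ?D w z\<bar> \<le> (\<Sum>b\<in>B. norm w * e')"
      using sum_mono[of B "\<lambda>b. \<bar>(w \<bullet> b) * (?D b ?y - ?D b z)\<bar>" "\<lambda>b. norm w * e'", OF bd]
        sum_abs[of "\<lambda>b. (w \<bullet> b) * (?D b ?y - ?D b z)" B] by linarith
    also have "\<dots> = (card B * e') * norm w" by simp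
    also have "\<dots> \<le> e * norm w"
      by (rule mult_right_mono) (use e in \<open>auto simp: e'_def field_simps\<close>)
    finally show "\<bar>F (z + w) - F z - ?D w z\<bar> \<le> e * norm w" .
  qed
qed

text \<open>Hadamard's quotients are of this form with \<open>p = 0\<close>. Differentiating raises \<open>p\<close> by one, so the
  family is closed under derivatives, which gives smoothness by induction.\<close>
definition seg_avg :: "'e::real_inner \<Rightarrow> nat \<Rightarrow> ('e \<Rightarrow> real) \<Rightarrow> 'e \<Rightarrow> real" where
  "seg_avg a p F y = integral {0..1} (\<lambda>t. t ^ p * F (a + t *\<^sub>R (y - a)))"

lemma seg_in_ball: "(y::'e::real_inner) \<in> ball a r \<Longrightarrow> t \<in> {0..1} \<Longrightarrow> a + t *\<^sub>R (y - a) \<in> ball a (r::real)"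
proof -
  assume y: "y \<in> ball a r" and t: "t \<in> {0..1::real}"
  have "norm (t *\<^sub>R (y - a)) \<le> norm (y - a)" using t by (simp add: mult_left_le_one_le)
  then show ?thesis using y by (simp add: dist_norm norm_minus_commute)
qed

lemma seg_avg_integrable:
  fixes F :: "'e::real_inner \<Rightarrow> real"
  assumes F: "continuous_on (ball a r) F" and y: "y \<in> ball a r"
  shows "(\<lambda>t. t ^ p * F (a + t *\<^sub>R (y - a))) integrable_on {0..1}"
proof (rule integrable_continuous_real)
  have "continuous_on {0..1} (\<lambda>t. F (a + t *\<^sub>R (y - a)))"
    by (rule continuous_on_compose2[OF F]) (use seg_in_ball[OF y] in \<open>auto intro!: continuous_intros\<close>)
  then show "continuous_on {0..1} (\<lambda>t. t ^ p * F (a + t *\<^sub>R (y - a)))"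
    by (intro continuous_intros)
qed

text \<open>Differentiation under the integral sign. Moving \<open>y\<close> by \<open>v\<close>
  moves the point at parameter \<open>t\<close> by \<open>t *\<^sub>R v\<close>, which is where the
  additional factor \<open>t\<close> comes from; the uniform first-order estimate bounds the
  integrand of the error.\<close>

lemma seg_avg_has_derivative:
  fixes F :: "'e::real_inner \<Rightarrow> real"
  assumes B: "onb (B :: 'e set)" and F: "smooth_map_on (ball a r) F" and y: "y \<in> ball a r"
  shows "(seg_avg a p F has_derivative
    (\<lambda>v. seg_avg a (Suc p) (\<lambda>z. frechet_derivative F (at z) v) y)) (at y)"
proof -
  let ?D = "\<lambda>v z. frechet_derivative F (at z) v"
  have fin: "finite B" using B by (simp add: onb_def)
  have cF: "continuous_on (ball a r) F" by (rule smooth_map_on_continuous[OF F])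
  have cD: "continuous_on (ball a r) (?D v)" for v
    by (rule smooth_map_on_continuous[OF smooth_map_on_frechet[OF F]])
  note int = seg_avg_integrable[OF cF] and intD = seg_avg_integrable[OF cD]
  have lin: "seg_avg a (Suc p) (?D v) y = (\<Sum>b\<in>B. (v \<bullet> b) * seg_avg a (Suc p) (?D b) y)" for v
  proof -
    have "seg_avg a (Suc p) (?D v) y =
      integral {0..1} (\<lambda>t. \<Sum>b\<in>B. (v \<bullet> b) * (t ^ Suc p * ?D b (a + t *\<^sub>R (y - a))))"
      unfolding seg_avg_def
    proof (rule integral_cong)
      fix t :: real assume "t \<in> {0..1}"
      from seg_in_ball[OF y this] have "F differentiable (at (a + t *\<^sub>R (y - a)))"
        by (rule smooth_map_on_differentiable[OF F])
      then show "t ^ Suc p * ?D v (a + t *\<^sub>R (y - a)) =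
          (\<Sum>b\<in>B. (v \<bullet> b) * (t ^ Suc p * ?D b (a + t *\<^sub>R (y - a))))"
        by (subst onb_frechet[OF B, of F _ v]) (simp_all add: sum_distrib_left ac_simps)
    qed
    also have "\<dots> = (\<Sum>b\<in>B. (v \<bullet> b) * seg_avg a (Suc p) (?D b) y)"
      unfolding seg_avg_def
      by (subst integral_sum) (auto intro!: integrable_on_mult_right intD[OF y] fin simp del: power_Suc)
    finally show ?thesis .
  qed
  have bl: "bounded_linear (\<lambda>v. seg_avg a (Suc p) (?D v) y)"
  proof -
    have "(\<lambda>v. seg_avg a (Suc p) (?D v) y) = (\<lambda>v. \<Sum>b\<in>B. (v \<bullet> b) * seg_avg a (Suc p) (?D b) y)"
      by (rule ext, rule lin)
    moreover have "bounded_linear (\<lambda>v. \<Sum>b\<in>B. (v \<bullet> b) * seg_avg a (Suc p) (?D b) y)"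
      by (intro bounded_linear_sum bounded_linear_compose[OF bounded_linear_mult_left] bounded_linear_inner_left)
    ultimately show ?thesis by metis
  qed
  \<comment> \<open>An intermediate radius: the closed ball of radius \<open>s\<close> is compact,
    contains \<open>y\<close> in its interior and lies in the domain of \<open>F\<close>.\<close>
  obtain s where s: "dist a y < s" "s < r" using y dense by auto
  have s0: "0 < s" using s(1) zero_le_dist le_less_trans by blast
  show ?thesis
  proof (rule has_derivativeI[OF bl], rule tendstoI)
    fix e :: real assume e: "e > 0"
    \<comment> \<open>Halving turns the weak bound of the estimate into the strict one that the
      limit asks for.\<close>
    define e' where "e' = e / 2"
    have e': "e' > 0" "e' < e" using e by (auto simp: e'_def)
    obtain d where d: "d > 0" "\<And>z w. z \<in> cball a s \<Longrightarrow> z + w \<in> cball a s \<Longrightarrow> norm w < d \<Longrightarrow>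
       \<bar>F (z + w) - F z - ?D w z\<bar> \<le> e' * norm w"
      using onb_first_order[OF B F s0 s(2) e'(1)] by blast
    define d' where "d' = min d (s - dist a y)"
    have d': "d' > 0" using d s by (simp add: d'_def)
    have main: "\<bar>seg_avg a p F x - seg_avg a p F y - seg_avg a (Suc p) (?D (x - y)) y\<bar> \<le> e' * norm (x - y)"
      if x: "dist x y < d'" for x
    proof -
      have xs: "x \<in> ball a s" using x dist_triangle[of a x y] by (simp add: d'_def dist_commute)
      have ys: "y \<in> ball a s" using s by simp
      have xr: "x \<in> ball a r" using xs s by auto
      let ?f = "\<lambda>t. t ^ p * F (a + t *\<^sub>R (x - a)) - t ^ p * F (a + t *\<^sub>R (y - a))
          - t ^ Suc p * ?D (x - y) (a + t *\<^sub>R (y - a))"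
      have fi: "?f integrable_on {0..1}"
        by (intro integrable_diff int intD xr y)
      have eq: "seg_avg a p F x - seg_avg a p F y - seg_avg a (Suc p) (?D (x - y)) y = integral {0..1} ?f"
        unfolding seg_avg_def
        using integral_diff[OF integrable_diff[OF int[OF xr, of p] int[OF y, of p]] intD[OF y, of "Suc p" "x - y"]]
          integral_diff[OF int[OF xr, of p] int[OF y, of p]] by linarith
      have bnd: "norm (?f t) \<le> e' * norm (x - y)" if t: "t \<in> {0..1}" for t
      proof -
        let ?z = "a + t *\<^sub>R (y - a)" and ?w = "t *\<^sub>R (x - y)"
        have z: "?z \<in> ball a s" by (rule seg_in_ball[OF ys t])
        have zw: "?z + ?w = a + t *\<^sub>R (x - a)" by (simp add: algebra_simps)
        have w: "norm ?w \<le> norm (x - y)" using t by (simp add: mult_left_le_one_le)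
        have wd: "norm ?w < d" using w x by (simp add: d'_def dist_norm)
        have zw': "?z + ?w \<in> ball a s" unfolding zw by (rule seg_in_ball[OF xs t])
        have lin: "?D ?w ?z = t * ?D (x - y) ?z"
          using linear_frechet_derivative[OF smooth_map_on_differentiable[OF F seg_in_ball[OF y t]]]
          by (simp add: linear_cmul)
        have "?f t = t ^ p * (F (?z + ?w) - F ?z - ?D ?w ?z)"
          unfolding zw lin by (simp add: algebra_simps)
        then have "norm (?f t) = t ^ p * \<bar>F (?z + ?w) - F ?z - ?D ?w ?z\<bar>"
          using t by (simp add: abs_mult)
        also have "\<dots> \<le> 1 * \<bar>F (?z + ?w) - F ?z - ?D ?w ?z\<bar>"
          by (rule mult_right_mono) (use t in \<open>auto intro: power_le_one\<close>)
        also have "\<dots> \<le> e' * norm ?w" using d(2)[of ?z ?w] z zw' wd by simp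
        also have "\<dots> \<le> e' * norm (x - y)" using w e' by simp
        finally show ?thesis .
      qed
      have "norm (integral {0..1} ?f) \<le> integral {0..1} (\<lambda>t::real. e' * norm (x - y))"
        by (rule integral_norm_bound_integral[OF fi]) (use bnd in auto)
      then show ?thesis unfolding eq by simp
    qed
    have "\<forall>\<^sub>F x in at y. x \<noteq> y \<and> dist x y < d'"
      using d' unfolding eventually_at by auto
    then show "\<forall>\<^sub>F x in at y. dist ((seg_avg a p F x - seg_avg a p F y
        - seg_avg a (Suc p) (?D (x - y)) y) /\<^sub>R norm (x - y)) 0 < e"
    proof (rule eventually_mono, elim conjE)
      fix x assume x: "x \<noteq> y" "dist x y < d'"
      let ?q = "seg_avg a p F x - seg_avg a p F y - seg_avg a (Suc p) (?D (x - y)) y"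
      have "\<bar>?q\<bar> / norm (x - y) \<le> e'"
        using main[OF x(2)] x(1) by (simp add: field_simps)
      then show "dist (?q /\<^sub>R norm (x - y)) 0 < e"
        using e' by (simp add: divide_inverse mult.commute abs_mult)
    qed
  qed
qed

lemma seg_avg_smooth:
  fixes F :: "'e::real_inner \<Rightarrow> real"
  assumes B: "onb (B :: 'e set)" and F: "smooth_map_on (ball a r) F"
  shows "smooth_map_on (ball a r) (seg_avg a p F)"
proof -
  have "ck_on k (ball a r) (seg_avg a p F)" for k
    using F
  proof (induction k arbitrary: p F)
    case 0
    have "isCont (seg_avg a p F) y" if "y \<in> ball a r" for y
      using seg_avg_has_derivative[OF B 0 that] has_derivative_continuous by blast
    then show ?case by (simp add: continuous_at_imp_continuous_on)
  next
    case (Suc k)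
    show ?case
      by (rule ck_on_SucI[OF open_ball seg_avg_has_derivative[OF B Suc.prems] Suc.IH])
        (auto intro: smooth_map_on_frechet Suc.prems)
  qed
  then show ?thesis by (simp add: smooth_map_on_def)
qed

text \<open>The fundamental theorem of calculus along the segment from \<open>a\<close> to
  \<open>y\<close>, with \<open>y - a\<close> expanded in the basis under the integral. It is what
  makes a derivation at a point computable from its values on the coordinates.\<close>

lemma hadamard:
  fixes F :: "'e::real_inner \<Rightarrow> real"
  assumes B: "onb (B :: 'e set)" and F: "smooth_map_on (ball a r) F"
  shows "\<exists>g. (\<forall>b\<in>B. smooth_map_on (ball a r) (g b) \<and> g b a = frechet_derivative F (at a) b) \<and>
     (\<forall>y\<in>ball a r. F y = F a + (\<Sum>b\<in>B. ((y - a) \<bullet> b) * g b y))"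
proof (intro exI[of _ "\<lambda>b. seg_avg a 0 (\<lambda>z. frechet_derivative F (at z) b)"] conjI ballI)
  fix b
  show "smooth_map_on (ball a r) (seg_avg a 0 (\<lambda>z. frechet_derivative F (at z) b))"
    by (rule seg_avg_smooth[OF B smooth_map_on_frechet[OF F]])
  show "seg_avg a 0 (\<lambda>z. frechet_derivative F (at z) b) a = frechet_derivative F (at a) b"
    by (simp add: seg_avg_def)
next
  fix y assume y: "y \<in> ball a r"
  let ?D = "\<lambda>v z. frechet_derivative F (at z) v"
  have fin: "finite B" using B by (simp add: onb_def)
  have cD: "continuous_on (ball a r) (?D v)" for v
    by (rule smooth_map_on_continuous[OF smooth_map_on_frechet[OF F]])
  have der: "((\<lambda>t. F (a + t *\<^sub>R (y - a))) has_vector_derivative ?D (y - a) (a + t *\<^sub>R (y - a))) (at t within {0..1})"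
    if t: "t \<in> {0..1}" for t
  proof -
    have g: "((\<lambda>t. a + t *\<^sub>R (y - a)) has_derivative (\<lambda>v. v *\<^sub>R (y - a))) (at t)"
      by (auto intro!: derivative_eq_intros)
    note z = seg_in_ball[OF y t]
    from diff_chain_at[OF g smooth_map_on_has_derivative[OF F z]]
    have h: "((\<lambda>t. F (a + t *\<^sub>R (y - a))) has_derivative (\<lambda>v. ?D (v *\<^sub>R (y - a)) (a + t *\<^sub>R (y - a)))) (at t)"
      by (simp add: o_def)
    moreover have "?D (v *\<^sub>R (y - a)) (a + t *\<^sub>R (y - a)) = v *\<^sub>R ?D (y - a) (a + t *\<^sub>R (y - a))" for v
      using linear_frechet_derivative[OF smooth_map_on_differentiable[OF F z]] by (simp add: linear_cmul)
    ultimately show ?thesis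
      unfolding has_vector_derivative_def by (auto intro: has_derivative_at_withinI)
  qed
  have "((\<lambda>t. ?D (y - a) (a + t *\<^sub>R (y - a))) has_integral F (a + 1 *\<^sub>R (y - a)) - F (a + 0 *\<^sub>R (y - a))) {0..1}"
    by (rule fundamental_theorem_of_calculus[OF _ der]) auto
  then have "F y - F a = integral {0..1} (\<lambda>t. ?D (y - a) (a + t *\<^sub>R (y - a)))"
    by (simp add: integral_unique)
  also have "\<dots> = integral {0..1} (\<lambda>t. \<Sum>b\<in>B. ((y - a) \<bullet> b) * (t ^ 0 * ?D b (a + t *\<^sub>R (y - a))))"
  proof (rule integral_cong)
    fix t :: real assume t: "t \<in> {0..1}"
    show "?D (y - a) (a + t *\<^sub>R (y - a)) = (\<Sum>b\<in>B. ((y - a) \<bullet> b) * (t ^ 0 * ?D b (a + t *\<^sub>R (y - a))))"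
      by (subst onb_frechet[OF B smooth_map_on_differentiable[OF F seg_in_ball[OF y t]]]) simp
  qed
  also have "\<dots> = (\<Sum>b\<in>B. ((y - a) \<bullet> b) * seg_avg a 0 (?D b) y)"
    unfolding seg_avg_def
    by (subst integral_sum)
      (auto intro!: integrable_on_mult_right seg_avg_integrable[OF cD y, of 0, simplified] fin)
  finally show "F y = F a + (\<Sum>b\<in>B. ((y - a) \<bullet> b) * seg_avg a 0 (?D b) y)" by simp
qed

section \<open>Smooth functions and tangent vectors on a manifold\<close>

text \<open>Frames are indexed by natural numbers, so an orthonormal basis is chosen together with
  an enumeration, once for all charts. That such a choice exists follows from the finite spanning
  set in \<open>smooth_manifold\<close>.\<close>

definition obasis :: "nat \<Rightarrow> 'e::real_inner" where
  "obasis = (SOME e. onb (e ` {..<dim (UNIV :: 'e set)}) \<and> inj_on e {..<dim (UNIV :: 'e set)})"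

text \<open>The argument only fixes the type \<open>'e\<close> of the model space.\<close>
abbreviation (input) adim :: "('m, 'e::real_inner) atlas \<Rightarrow> nat" where
  "adim A \<equiv> dim (UNIV :: 'e set)"

locale smooth_mfd =
  fixes A :: "('m::{t2_space,second_countable_topology}, 'e::real_inner) atlas"
  assumes mfd: "smooth_manifold A"
begin

lemma obasis: "onb (obasis ` {..<adim A} :: 'e set)" "inj_on (obasis :: nat \<Rightarrow> 'e) {..<adim A}"
proof -
  obtain B :: "'e set" where "finite B" "span B = UNIV"
    using mfd by (simp only: smooth_manifold_def) (elim conjE exE, blast)
  then obtain C :: "'e set" where C: "onb C" using onb_exists by blast
  then have "finite C" by (simp add: onb_def)
  then obtain e where "bij_betw e {..<card C} C" using ex_bij_betw_nat_finite lessThan_atLeast0 by metis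
  then have "onb (e ` {..<adim A}) \<and> inj_on e {..<adim A}"
    using C onb_card[OF C] by (simp add: bij_betw_def)
  then have "onb (obasis ` {..<adim A} :: 'e set) \<and> inj_on (obasis :: nat \<Rightarrow> 'e) {..<adim A}"
    unfolding obasis_def by (rule someI[where P="\<lambda>e. onb (e ` {..<adim A}) \<and> inj_on e {..<adim A}"])
  then show "onb (obasis ` {..<adim A} :: 'e set)" "inj_on (obasis :: nat \<Rightarrow> 'e) {..<adim A}" by auto
qed

lemma obasis_inner: "j < adim A \<Longrightarrow> k < adim A \<Longrightarrow> obasis j \<bullet> (obasis k :: 'e) = (if j = k then 1 else 0)"
  using onb_inner[OF obasis(1), of "obasis j" "obasis k"] obasis(2) by (auto simp: inj_on_def)

lemma chart_open: "(V, c) \<in> A \<Longrightarrow> open V"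
  and chart_image_open: "(V, c) \<in> A \<Longrightarrow> open (c ` V)"
  and chart_homeomorphism: "(V, c) \<in> A \<Longrightarrow> homeomorphism V (c ` V) c (inv_into V c)"
  and chart_transition: "(V, c) \<in> A \<Longrightarrow> (V', c') \<in> A \<Longrightarrow> smooth_map_on (c ` (V \<inter> V')) (c' \<circ> inv_into V c)"
  using mfd by (auto simp: smooth_manifold_def)

lemma chart_exists: "\<exists>V c. (V, c) \<in> A \<and> x \<in> V"
proof -
  have "x \<in> (\<Union>(V, c)\<in>A. V)" using mfd by (simp add: smooth_manifold_def)
  then show ?thesis by auto
qed

lemma chart_inv: "(V, c) \<in> A \<Longrightarrow> x \<in> V \<Longrightarrow> inv_into V c (c x) = x"
  using chart_homeomorphism homeomorphism_apply1 by metis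

lemma chart_continuous: "(V, c) \<in> A \<Longrightarrow> continuous_on V c"
  using chart_homeomorphism homeomorphism_cont1 by metis

lemma chart_image_open_Int: "(V, c) \<in> A \<Longrightarrow> open W \<Longrightarrow> open (c ` (V \<inter> W))"
  using homeomorphism_imp_open_map[OF chart_homeomorphism, of V c "V \<inter> W"] chart_image_open[of V c]
    open_openin_trans[of "c ` V"] by (metis Int_lower1 open_openin openin_open_Int openin_open_trans)

lemma chart_vimage_open: "(V, c) \<in> A \<Longrightarrow> open T \<Longrightarrow> open (V \<inter> c -` T)"
  using continuous_open_preimage[OF chart_continuous chart_open] by blast

lemma smooth_fun_cong:
  assumes "open W" "\<And>x. x \<in> W \<Longrightarrow> f x = g x"
  shows "smooth_fun A W f \<longleftrightarrow> smooth_fun A W g"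
proof -
  have "smooth_map_on (c ` (V \<inter> W)) (f \<circ> inv_into V c) \<longleftrightarrow> smooth_map_on (c ` (V \<inter> W)) (g \<circ> inv_into V c)"
    if "(V, c) \<in> A" for V c
    by (rule smooth_map_on_cong[OF chart_image_open_Int[OF that assms(1)]])
      (use assms(2) chart_inv[OF that] in auto)
  then show ?thesis unfolding smooth_fun_def by auto
qed

lemma smooth_fun_mono: "smooth_fun A W f \<Longrightarrow> W' \<subseteq> W \<Longrightarrow> smooth_fun A W' f"
  unfolding smooth_fun_def by (fast intro: smooth_map_on_mono)

lemma smooth_fun_local:
  assumes "\<And>x. x \<in> W \<Longrightarrow> \<exists>N. open N \<and> x \<in> N \<and> smooth_fun A (W \<inter> N) f"
  shows "smooth_fun A W f"
  unfolding smooth_fun_def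
proof clarify
  fix V c assume Vc: "(V, c) \<in> A"
  show "smooth_map_on (c ` (V \<inter> W)) (f \<circ> inv_into V c)"
  proof (rule smooth_map_on_local)
    fix y assume "y \<in> c ` (V \<inter> W)"
    then obtain x where x: "x \<in> V" "x \<in> W" "y = c x" by auto
    obtain N where N: "open N" "x \<in> N" "smooth_fun A (W \<inter> N) f" using assms x by blast
    have "c ` (V \<inter> W) \<inter> c ` (V \<inter> N) \<subseteq> c ` (V \<inter> (W \<inter> N))"
      using chart_inv[OF Vc] by auto (metis IntI imageI)
    then have "smooth_map_on (c ` (V \<inter> W) \<inter> c ` (V \<inter> N)) (f \<circ> inv_into V c)"
      using N(3) Vc smooth_map_on_mono unfolding smooth_fun_def by blast
    then show "\<exists>T. open T \<and> y \<in> T \<and> smooth_map_on (c ` (V \<inter> W) \<inter> T) (f \<circ> inv_into V c)"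
      using chart_image_open_Int[OF Vc N(1)] x N(2) by blast
  qed
qed

text \<open>The form used for functions given by different formulas on different pieces, such as
  bump functions extended by 0 and locally finite sums.\<close>

lemma smooth_fun_local_agree:
  assumes "\<And>x. x \<in> W \<Longrightarrow> \<exists>N g. open N \<and> x \<in> N \<and> N \<subseteq> W \<and> smooth_fun A N g \<and> (\<forall>y\<in>N. f y = g y)"
  shows "smooth_fun A W f"
proof (rule smooth_fun_local)
  fix x assume "x \<in> W"
  then obtain N g where N: "open N" "x \<in> N" "N \<subseteq> W" "smooth_fun A N g" "\<forall>y\<in>N. f y = g y"
    using assms by blast
  then have "smooth_fun A N f" using smooth_fun_cong[of N f g] by blast
  then show "\<exists>N. open N \<and> x \<in> N \<and> smooth_fun A (W \<inter> N) f"
    using N by (metis Int_absorb1)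
qed

lemma smooth_fun_const: "open W \<Longrightarrow> smooth_fun A W (\<lambda>x. r)"
  unfolding smooth_fun_def by (auto simp: o_def intro!: smooth_map_on_const chart_image_open_Int)

lemma smooth_fun_add:
  "open W \<Longrightarrow> smooth_fun A W f \<Longrightarrow> smooth_fun A W g \<Longrightarrow> smooth_fun A W (\<lambda>x. f x + g x)"
  unfolding smooth_fun_def
  by (fastforce simp: o_def intro!: smooth_map_on_add chart_image_open_Int)

lemma smooth_fun_mult:
  "open W \<Longrightarrow> smooth_fun A W f \<Longrightarrow> smooth_fun A W g \<Longrightarrow> smooth_fun A W (\<lambda>x. f x * g x)"
  unfolding smooth_fun_def
  by (fastforce simp: o_def intro!: smooth_map_on_mult chart_image_open_Int)

lemma smooth_fun_cmult: "open W \<Longrightarrow> smooth_fun A W f \<Longrightarrow> smooth_fun A W (\<lambda>x. r * f x)"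
  by (intro smooth_fun_mult smooth_fun_const)

lemma smooth_fun_minus: "open W \<Longrightarrow> smooth_fun A W f \<Longrightarrow> smooth_fun A W (\<lambda>x. - f x)"
  using smooth_fun_cmult[of W f "-1"] by simp

lemma smooth_fun_diff:
  "open W \<Longrightarrow> smooth_fun A W f \<Longrightarrow> smooth_fun A W g \<Longrightarrow> smooth_fun A W (\<lambda>x. f x - g x)"
  using smooth_fun_add[OF _ _ smooth_fun_minus, of W f g] by simp

lemma smooth_fun_sum:
  "open W \<Longrightarrow> (\<And>i. i \<in> I \<Longrightarrow> smooth_fun A W (f i)) \<Longrightarrow> smooth_fun A W (\<lambda>x. \<Sum>i\<in>I. f i x)"
  by (induction I rule: infinite_finite_induct) (auto intro!: smooth_fun_add smooth_fun_const)

lemma smooth_fun_prod: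
  "open W \<Longrightarrow> (\<And>i. i \<in> I \<Longrightarrow> smooth_fun A W (f i)) \<Longrightarrow> smooth_fun A W (\<lambda>x. \<Prod>i\<in>I. f i x)"
  by (induction I rule: infinite_finite_induct) (auto intro!: smooth_fun_mult smooth_fun_const)

lemma smooth_fun_compose:
  assumes "open W" "open T" "smooth_fun A W f" "smooth_map_on T g" "f ` W \<subseteq> T"
  shows "smooth_fun A W (\<lambda>x. g (f x))"
  unfolding smooth_fun_def
proof clarify
  fix V c assume Vc: "(V, c) \<in> A"
  have "(f \<circ> inv_into V c) ` c ` (V \<inter> W) \<subseteq> T"
    using assms(5) chart_inv[OF Vc] by auto
  from smooth_map_on_compose[OF onb_real chart_image_open_Int[OF Vc assms(1)] assms(2) _ assms(4) this]
  show "smooth_map_on (c ` (V \<inter> W)) ((\<lambda>x. g (f x)) \<circ> inv_into V c)"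
    using assms(3) Vc by (auto simp: smooth_fun_def o_def)
qed

lemma smooth_fun_inverse:
  "open W \<Longrightarrow> smooth_fun A W f \<Longrightarrow> (\<And>x. x \<in> W \<Longrightarrow> f x \<noteq> 0) \<Longrightarrow> smooth_fun A W (\<lambda>x. inverse (f x))"
  by (rule smooth_fun_compose[where T="- {0}"]) (auto simp: smooth_map_on_def ck_on_inverse)

lemma smooth_fun_divide:
  "open W \<Longrightarrow> smooth_fun A W f \<Longrightarrow> smooth_fun A W g \<Longrightarrow> (\<And>x. x \<in> W \<Longrightarrow> g x \<noteq> 0) \<Longrightarrow>
    smooth_fun A W (\<lambda>x. f x / g x)"
  using smooth_fun_mult[OF _ _ smooth_fun_inverse, of W f g] by (simp add: divide_inverse)

lemma smooth_fun_continuous: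
  assumes "open W" "smooth_fun A W f"
  shows "continuous_on W f"
proof (rule continuous_at_imp_continuous_on, rule ballI)
  fix x assume x: "x \<in> W"
  obtain V c where Vc: "(V, c) \<in> A" "x \<in> V" using chart_exists by blast
  have "continuous_on (c ` (V \<inter> W)) (f \<circ> inv_into V c)"
    using assms(2) Vc(1) unfolding smooth_fun_def by (fast intro: smooth_map_on_continuous)
  moreover have "continuous_on (V \<inter> W) c"
    using chart_continuous[OF Vc(1)] continuous_on_subset by blast
  ultimately have "continuous_on (V \<inter> W) ((f \<circ> inv_into V c) \<circ> c)"
    by (rule continuous_on_compose[rotated])
  then have "continuous_on (V \<inter> W) f"
    by (rule continuous_on_eq) (simp add: chart_inv[OF Vc(1)])
  then show "isCont f x"
    using continuous_on_eq_continuous_at[of "V \<inter> W" f] chart_open[OF Vc(1)] assms(1) x Vc(2) by blast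
qed

lemma smooth_fun_nonzero_nbhd:
  assumes "open W" "smooth_fun A W f" "x \<in> W" "f x \<noteq> 0"
  obtains N where "open N" "x \<in> N" "N \<subseteq> W" "\<And>y. y \<in> N \<Longrightarrow> f y \<noteq> 0"
proof
  show "open (W \<inter> f -` (- {0}))"
    by (rule continuous_open_preimage[OF smooth_fun_continuous]) (use assms in auto)
qed (use assms in auto)

text \<open>Smoothness in one chart passes to all others through the transition maps. Constructions
  made in coordinates become smooth functions on the manifold this way.\<close>

lemma smooth_fun_chart:
  assumes Vc: "(V, c) \<in> A" and T: "open T" "T \<subseteq> c ` V" and g: "smooth_map_on T g"
  shows "smooth_fun A (V \<inter> c -` T) (\<lambda>x. g (c x))"
  unfolding smooth_fun_def
proof clarify
  fix V' c' assume Vc': "(V', c') \<in> A"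
  let ?S = "c' ` (V' \<inter> (V \<inter> c -` T))"
  have "smooth_map_on ?S (c \<circ> inv_into V' c')"
    by (rule smooth_map_on_mono[OF chart_transition[OF Vc' Vc]]) auto
  moreover have "(c \<circ> inv_into V' c') ` ?S \<subseteq> T"
    using chart_inv[OF Vc'] by auto
  ultimately show "smooth_map_on ?S ((\<lambda>x. g (c x)) \<circ> inv_into V' c')"
    using smooth_map_on_compose[OF obasis(1) chart_image_open_Int[OF Vc' chart_vimage_open[OF Vc T(1)]] T(1) _ g]
    by (simp add: o_def)
qed

abbreviation chart_coord :: "('m \<Rightarrow> 'e) \<Rightarrow> nat \<Rightarrow> 'm \<Rightarrow> real" where
  "chart_coord c k \<equiv> \<lambda>y. c y \<bullet> obasis k"

lemma smooth_fun_chart_coord: "(V, c) \<in> A \<Longrightarrow> smooth_fun A V (chart_coord c k)"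
  using smooth_fun_chart[of V c "c ` V" "\<lambda>y. y \<bullet> obasis k"] chart_image_open[of V c]
    smooth_map_on_bounded_linear[OF _ bounded_linear_inner_left smooth_map_on_ident, of "c ` V" "obasis k"]
  by (simp add: Int_absorb2 image_subset_iff_subset_vimage[symmetric])

lemma smooth_nearI: "open W \<Longrightarrow> x \<in> W \<Longrightarrow> smooth_fun A W f \<Longrightarrow> smooth_near A x f"
  unfolding smooth_near_def by blast

lemma smooth_near_obtain2:
  assumes "smooth_near A x f" "smooth_near A x g"
  obtains W where "open W" "x \<in> W" "smooth_fun A W f" "smooth_fun A W g"
proof -
  obtain V V' where "open V" "x \<in> V" "smooth_fun A V f" "open V'" "x \<in> V'" "smooth_fun A V' g"
    using assms unfolding smooth_near_def by blast
  then show ?thesis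
    using that[of "V \<inter> V'"] smooth_fun_mono[of V f "V \<inter> V'"] smooth_fun_mono[of V' g "V \<inter> V'"] by auto
qed

lemma smooth_near_add: "smooth_near A x f \<Longrightarrow> smooth_near A x g \<Longrightarrow> smooth_near A x (\<lambda>y. f y + g y)"
  by (erule (1) smooth_near_obtain2) (blast intro: smooth_nearI smooth_fun_add)

lemma smooth_near_mult: "smooth_near A x f \<Longrightarrow> smooth_near A x g \<Longrightarrow> smooth_near A x (\<lambda>y. f y * g y)"
  by (erule (1) smooth_near_obtain2) (blast intro: smooth_nearI smooth_fun_mult)

lemma smooth_near_const: "smooth_near A x (\<lambda>y. r)"
  by (rule smooth_nearI[OF open_UNIV UNIV_I smooth_fun_const[OF open_UNIV]])

lemma smooth_near_cmult: "smooth_near A x f \<Longrightarrow> smooth_near A x (\<lambda>y. r * f y)"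
  by (intro smooth_near_mult smooth_near_const)

lemma smooth_near_sum: "(\<And>i. i \<in> I \<Longrightarrow> smooth_near A x (f i)) \<Longrightarrow> smooth_near A x (\<lambda>y. \<Sum>i\<in>I. f i y)"
  by (induction I rule: infinite_finite_induct) (auto intro!: smooth_near_add smooth_near_const)

section \<open>Calculus of derivations at a point\<close>

context
  fixes v x assumes v: "v \<in> tangent_space A x"
begin

lemma tan_not_smooth: "\<not> smooth_near A x f \<Longrightarrow> v f = 0"
  and tan_add: "smooth_near A x f \<Longrightarrow> smooth_near A x g \<Longrightarrow> v (\<lambda>y. f y + g y) = v f + v g"
  and tan_mult: "smooth_near A x f \<Longrightarrow> smooth_near A x g \<Longrightarrow> v (\<lambda>y. f y * g y) = f x * v g + g x * v f"
  and tan_cmult: "smooth_near A x f \<Longrightarrow> v (\<lambda>y. r * f y) = r * v f"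
  and tan_germ: "smooth_near A x f \<Longrightarrow> smooth_near A x g \<Longrightarrow> eventually (\<lambda>y. f y = g y) (nhds x) \<Longrightarrow> v f = v g"
  using v unfolding tangent_space_def mem_Collect_eq by blast+

lemma tan_cong:
  assumes "open W" "x \<in> W" "smooth_fun A W f" "\<And>y. y \<in> W \<Longrightarrow> f y = g y"
  shows "v f = v g"
proof (rule tan_germ)
  show "smooth_near A x f" using assms smooth_nearI by blast
  show "smooth_near A x g" using assms smooth_nearI smooth_fun_cong[of W f g] by blast
  show "\<forall>\<^sub>F y in nhds x. f y = g y" using assms eventually_nhds by blast
qed

text \<open>The product rule applied to \<open>1 * 1\<close> shows that the derivative of 1 equals
  twice itself.\<close>

lemma tan_const: "v (\<lambda>y. r) = 0"
proof -
  have "v (\<lambda>y. 1 * 1) = 1 * v (\<lambda>y. 1) + 1 * v (\<lambda>y. 1)"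
    by (rule tan_mult) (rule smooth_near_const)+
  then have "v (\<lambda>y. 1) = 0" by simp
  then show ?thesis using tan_cmult[OF smooth_near_const, of r 1] by simp
qed

lemma tan_minus: "smooth_near A x f \<Longrightarrow> v (\<lambda>y. - f y) = - v f"
  using tan_cmult[of f "-1"] by simp

lemma tan_diff: "smooth_near A x f \<Longrightarrow> smooth_near A x g \<Longrightarrow> v (\<lambda>y. f y - g y) = v f - v g"
  using tan_add[OF _ smooth_near_cmult[of x g "-1"], of f] tan_minus[of g] by simp

lemma tan_sum: "(\<And>i. i \<in> I \<Longrightarrow> smooth_near A x (f i)) \<Longrightarrow> v (\<lambda>y. \<Sum>i\<in>I. f i y) = (\<Sum>i\<in>I. v (f i))"
  by (induction I rule: infinite_finite_induct) (simp_all add: tan_const tan_add smooth_near_sum)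

end

lemma tangent_zero: "(\<lambda>f. 0) \<in> tangent_space A x"
  by (simp add: tangent_space_def)

lemma tangent_add:
  assumes "u \<in> tangent_space A x" "v \<in> tangent_space A x"
  shows "(\<lambda>f. u f + v f) \<in> tangent_space A x"
  unfolding tangent_space_def mem_Collect_eq
proof (intro conjI allI impI; (elim conjE)?)
  fix f g assume fg: "smooth_near A x f" "smooth_near A x g"
  show "\<forall>\<^sub>F y in nhds x. f y = g y \<Longrightarrow> u f + v f = u g + v g"
    using tan_germ[OF assms(1) fg] tan_germ[OF assms(2) fg] by simp
  show "u (\<lambda>y. f y + g y) + v (\<lambda>y. f y + g y) = u f + v f + (u g + v g)"
    using tan_add[OF assms(1) fg] tan_add[OF assms(2) fg] by simp
  show "u (\<lambda>y. f y * g y) + v (\<lambda>y. f y * g y) = f x * (u g + v g) + g x * (u f + v f)"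
    using tan_mult[OF assms(1) fg] tan_mult[OF assms(2) fg] by (simp add: algebra_simps)
next
  fix a f assume f: "smooth_near A x f"
  show "u (\<lambda>y. a * f y) + v (\<lambda>y. a * f y) = a * (u f + v f)"
    using tan_cmult[OF assms(1) f] tan_cmult[OF assms(2) f] by (simp add: algebra_simps)
next
  fix f assume f: "\<not> smooth_near A x f"
  show "u f + v f = 0"
    using tan_not_smooth[OF assms(1) f] tan_not_smooth[OF assms(2) f] by simp
qed

lemma tangent_scale:
  assumes "u \<in> tangent_space A x"
  shows "(\<lambda>f. r * u f) \<in> tangent_space A x"
  unfolding tangent_space_def mem_Collect_eq
proof (intro conjI allI impI; (elim conjE)?)
  fix f g assume fg: "smooth_near A x f" "smooth_near A x g"
  show "\<forall>\<^sub>F y in nhds x. f y = g y \<Longrightarrow> r * u f = r * u g"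
    using tan_germ[OF assms fg] by simp
  show "r * u (\<lambda>y. f y + g y) = r * u f + r * u g"
    using tan_add[OF assms fg] by (simp add: algebra_simps)
  show "r * u (\<lambda>y. f y * g y) = f x * (r * u g) + g x * (r * u f)"
    using tan_mult[OF assms fg] by (simp add: algebra_simps)
next
  fix a f assume f: "smooth_near A x f"
  show "r * u (\<lambda>y. a * f y) = a * (r * u f)"
    using tan_cmult[OF assms f] by simp
next
  fix f assume f: "\<not> smooth_near A x f"
  show "r * u f = 0" using tan_not_smooth[OF assms f] by simp
qed

lemma tangent_sum: "(\<And>i. i \<in> I \<Longrightarrow> u i \<in> tangent_space A x) \<Longrightarrow> (\<lambda>f. \<Sum>i\<in>I. u i f) \<in> tangent_space A x"
  by (induction I rule: infinite_finite_induct) (auto intro: tangent_zero tangent_add)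

section \<open>Coordinate derivations\<close>

definition partial :: "'m set \<Rightarrow> ('m \<Rightarrow> 'e) \<Rightarrow> nat \<Rightarrow> 'm \<Rightarrow> 'm tvec" where
  "partial V c k y = (\<lambda>f. if smooth_near A y f
     then frechet_derivative (f \<circ> inv_into V c) (at (c y)) (obasis k) else 0)"

context
  fixes V c assumes Vc: "(V, c) \<in> A"
begin

lemma chart_has_derivative:
  assumes "smooth_near A y f" "y \<in> V"
  shows "((\<lambda>z. f (inv_into V c z)) has_derivative frechet_derivative (f \<circ> inv_into V c) (at (c y))) (at (c y))"
proof -
  obtain W where "open W" "y \<in> W" "smooth_fun A W f" using assms(1) unfolding smooth_near_def by blast
  then have "smooth_map_on (c ` (V \<inter> W)) (f \<circ> inv_into V c)" "c y \<in> c ` (V \<inter> W)"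
    using Vc assms(2) by (auto simp: smooth_fun_def)
  from smooth_map_on_has_derivative[OF this] show ?thesis by (simp add: o_def)
qed

lemma partial_tangent:
  assumes y: "y \<in> V"
  shows "partial V c k y \<in> tangent_space A y"
proof -
  let ?d = "\<lambda>f. frechet_derivative (f \<circ> inv_into V c) (at (c y))"
  have inv: "inv_into V c (c y) = y" by (rule chart_inv[OF Vc y])
  note der = chart_has_derivative[OF _ y]
  have germ: "?d f = ?d g" if sn: "smooth_near A y f" and ev: "eventually (\<lambda>y. f y = g y) (nhds y)" for f g
  proof -
    obtain N where N: "open N" "y \<in> N" "\<forall>y\<in>N. f y = g y" using ev unfolding eventually_nhds by blast
    have "((\<lambda>z. g (inv_into V c z)) has_derivative ?d f) (at (c y))"
      by (rule has_derivative_transform_within_open[OF der[OF sn] chart_image_open_Int[OF Vc N(1)]])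
        (use N y chart_inv[OF Vc] in auto)
    from frechet_derivative_at[OF this] show ?thesis by (simp add: o_def)
  qed
  have add: "?d (\<lambda>y. f y + g y) = (\<lambda>v. ?d f v + ?d g v)" if "smooth_near A y f" "smooth_near A y g" for f g
    using frechet_derivative_at[OF has_derivative_add[OF der[OF that(1)] der[OF that(2)]]] by (simp add: o_def)
  have mult: "?d (\<lambda>y. f y * g y) = (\<lambda>v. f y * ?d g v + ?d f v * g y)" if "smooth_near A y f" "smooth_near A y g" for f g
    using frechet_derivative_at[OF has_derivative_mult[OF der[OF that(1)] der[OF that(2)]]] inv by (simp add: o_def)
  have scale: "?d (\<lambda>y. r * f y) = (\<lambda>v. r * ?d f v)" if "smooth_near A y f" for f r
    using frechet_derivative_at[OF has_derivative_mult_right[OF der[OF that]]] by (simp add: o_def)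
  show ?thesis
    unfolding tangent_space_def mem_Collect_eq
  proof (intro conjI allI impI; (elim conjE)?)
    fix f g assume fg: "smooth_near A y f" "smooth_near A y g"
    show "\<forall>\<^sub>F y in nhds y. f y = g y \<Longrightarrow> partial V c k y f = partial V c k y g"
      using germ fg by (simp add: partial_def)
    show "partial V c k y (\<lambda>z. f z + g z) = partial V c k y f + partial V c k y g"
      using fg by (simp add: partial_def add smooth_near_add)
    show "partial V c k y (\<lambda>z. f z * g z) = f y * partial V c k y g + g y * partial V c k y f"
      using fg by (simp add: partial_def mult smooth_near_mult)
  next
    fix a f assume "smooth_near A y f"
    then show "partial V c k y (\<lambda>z. a * f z) = a * partial V c k y f"
      by (simp add: partial_def scale smooth_near_cmult)
  qed (simp add: partial_def)
qed

lemma partial_vector_field: "vector_field A V (partial V c k)"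
  unfolding vector_field_def
proof (intro conjI ballI allI impI; (elim conjE)?)
  fix V' f assume V': "open V'" "V' \<subseteq> V" and f: "smooth_fun A V' f"
  let ?g = "\<lambda>z. frechet_derivative (f \<circ> inv_into V c) (at z) (obasis k)"
  have "smooth_map_on (c ` (V \<inter> V')) ?g"
    using f Vc by (intro smooth_map_on_frechet) (auto simp: smooth_fun_def)
  from smooth_fun_chart[OF Vc chart_image_open_Int[OF Vc V'(1)] _ this]
  have "smooth_fun A (V \<inter> c -` c ` (V \<inter> V')) (\<lambda>x. ?g (c x))" by auto
  then have "smooth_fun A V' (\<lambda>x. ?g (c x))"
    by (rule smooth_fun_mono) (use V' in auto)
  moreover have "partial V c k x f = ?g (c x)" if "x \<in> V'" for x
    using smooth_nearI[OF V'(1) that f] by (simp add: partial_def)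
  ultimately show "smooth_fun A V' (\<lambda>x. partial V c k x f)"
    using smooth_fun_cong[OF V'(1), of "\<lambda>x. partial V c k x f" "\<lambda>x. ?g (c x)"] by simp
qed (rule partial_tangent)

lemma partial_coord:
  assumes "y \<in> V" "j < adim A" "k < adim A"
  shows "partial V c k y (chart_coord c j) = (if j = k then 1 else 0)"
proof -
  have near: "smooth_near A y (chart_coord c j)"
    using smooth_nearI[OF chart_open[OF Vc] assms(1) smooth_fun_chart_coord[OF Vc]] .
  have "((\<lambda>z. z \<bullet> obasis j) has_derivative (\<lambda>v. v \<bullet> obasis j)) (at (c y))"
    by (auto intro!: derivative_eq_intros)
  then have "((\<lambda>z. chart_coord c j (inv_into V c z)) has_derivative (\<lambda>v. v \<bullet> obasis j)) (at (c y))"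
    by (rule has_derivative_transform_within_open[OF _ chart_image_open[OF Vc]])
      (use assms(1) chart_inv[OF Vc] in auto)
  from frechet_derivative_at[OF this] show ?thesis
    using near obasis_inner[OF assms(3,2)] by (simp add: partial_def o_def) metis
qed

text \<open>By Hadamard's lemma \<open>f\<close> is, near \<open>x\<close>, a constant plus a sum of
  products of a coordinate difference with a smooth function whose value at \<open>x\<close> is a
  partial derivative. A derivation kills the constant, and since the coordinate differences vanish
  at \<open>x\<close>, the product rule leaves only the terms in which the derivation hits a
  coordinate.\<close>

lemma tangent_expand:
  assumes v: "v \<in> tangent_space A x" and x: "x \<in> V"
  shows "v f = (\<Sum>k<adim A. v (chart_coord c k) * partial V c k x f)"
proof (cases "smooth_near A x f")
  case False
  then show ?thesis using tan_not_smooth[OF v] by (simp add: partial_def)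
next
  case True
  then obtain W where W: "open W" "x \<in> W" "smooth_fun A W f" unfolding smooth_near_def by blast
  have "open (c ` (V \<inter> W))" "c x \<in> c ` (V \<inter> W)"
    using chart_image_open_Int[OF Vc W(1)] x W by auto
  then obtain r where r: "r > 0" "ball (c x) r \<subseteq> c ` (V \<inter> W)" by (meson openE)
  let ?F = "f \<circ> inv_into V c" and ?B = "ball (c x) r"
  have F: "smooth_map_on ?B ?F"
    using W(3) Vc smooth_map_on_mono[OF _ r(2)] by (auto simp: smooth_fun_def)
  obtain g where g: "\<forall>b\<in>obasis ` {..<adim A}. smooth_map_on ?B (g b) \<and> g b (c x) = frechet_derivative ?F (at (c x)) b"
    "\<And>y. y\<in>?B \<Longrightarrow> ?F y = ?F (c x) + (\<Sum>b\<in>obasis ` {..<adim A}. ((y - c x) \<bullet> b) * g b y)"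
    using hadamard[OF obasis(1) F] by blast
  let ?N = "V \<inter> c -` ?B"
  let ?h = "\<lambda>k z. (chart_coord c k z - chart_coord c k x) * g (obasis k) (c z)"
  have N: "open ?N" "x \<in> ?N" using chart_vimage_open[OF Vc] x r by auto
  have NW: "?N \<subseteq> W"
  proof
    fix z assume z: "z \<in> ?N"
    then obtain z' where "z' \<in> V \<inter> W" "c z = c z'" using r(2) by blast
    then show "z \<in> W" using z chart_inv[OF Vc] by (metis IntD1 IntD2)
  qed
  have gs: "smooth_fun A ?N (\<lambda>z. g (obasis k) (c z))" if "k < adim A" for k
    by (rule smooth_fun_chart[OF Vc]) (use that g(1) r(2) in auto)
  have cs: "smooth_fun A ?N (chart_coord c k)" for k
    using smooth_fun_mono[OF smooth_fun_chart_coord[OF Vc]] by blast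
  have near: "smooth_near A x (chart_coord c k)" "smooth_near A x (\<lambda>z. chart_coord c k z - chart_coord c k x)" for k
    using smooth_nearI[OF N smooth_fun_diff[OF N(1) cs smooth_fun_const[OF N(1)]]] smooth_nearI[OF N cs] by blast+
  have nearg: "smooth_near A x (\<lambda>z. g (obasis k) (c z))" if "k < adim A" for k
    using smooth_nearI[OF N gs[OF that]] .
  have "f z = f x + (\<Sum>k<adim A. ?h k z)" if z: "z \<in> ?N" for z
  proof -
    have "f z = f x + (\<Sum>b\<in>obasis ` {..<adim A}. ((c z - c x) \<bullet> b) * g b (c z))"
      using g(2)[of "c z"] z x chart_inv[OF Vc] by auto
    then show ?thesis
      by (simp add: sum.reindex[OF obasis(2)] inner_diff_left)
  qed
  then have "v f = v (\<lambda>z. f x + (\<Sum>k<adim A. ?h k z))"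
    by (intro tan_cong[OF v N] smooth_fun_mono[OF W(3)] NW)
  also have "\<dots> = v (\<lambda>z. f x) + v (\<lambda>z. \<Sum>k<adim A. ?h k z)"
    by (intro tan_add[OF v] smooth_near_const smooth_near_sum smooth_near_mult near nearg) auto
  also have "\<dots> = (\<Sum>k<adim A. v (?h k))"
    by (subst tan_sum[OF v]) (auto intro!: smooth_near_mult near nearg simp: tan_const[OF v])
  also have "\<dots> = (\<Sum>k<adim A. v (chart_coord c k) * partial V c k x f)"
  proof (rule sum.cong[OF refl])
    fix k assume k: "k \<in> {..<adim A}"
    have "v (?h k) = g (obasis k) (c x) * v (\<lambda>z. chart_coord c k z - chart_coord c k x)"
      using tan_mult[OF v near(2) nearg, of k k] k by simp
    also have "v (\<lambda>z. chart_coord c k z - chart_coord c k x) = v (chart_coord c k)"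
      using tan_diff[OF v near(1) smooth_near_const, of k] tan_const[OF v] by simp
    finally show "v (?h k) = v (chart_coord c k) * partial V c k x f"
      using k g(1) True by (simp add: partial_def)
  qed
  finally show ?thesis .
qed

end

end

section \<open>Partitions of unity\<close>

lemma flat_pos_iff: "flat m t > 0 \<longleftrightarrow> t > 0" "flat m t = 0 \<longleftrightarrow> t \<le> 0" "flat m t \<ge> 0"
  by (auto simp: flat_def)

context smooth_mfd
begin

text \<open>In a chart the function is \<open>flat 0\<close> of \<open>r\<^sup>2\<close> minus the
  squared distance to \<open>c x\<close>, extended by 0. It vanishes off the preimage of a closed
  ball, which is compact and, the manifold being Hausdorff, closed; this makes the extension smooth
  and gives a whole neighbourhood of zeros around each point outside \<open>W\<close>.\<close>

lemma bump_exists: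
  assumes W: "open W" and x: "x \<in> W"
  shows "\<exists>f. smooth_fun A UNIV f \<and> (\<forall>y. 0 \<le> f y) \<and> f x > 0 \<and>
     (\<forall>y. y \<notin> W \<longrightarrow> (\<exists>N. open N \<and> y \<in> N \<and> (\<forall>z\<in>N. f z = 0)))"
proof -
  obtain V c where Vc: "(V, c) \<in> A" and xV: "x \<in> V" using chart_exists by blast
  have "open (c ` (V \<inter> W))" "c x \<in> c ` (V \<inter> W)"
    using chart_image_open_Int[OF Vc W] x xV by auto
  then obtain r where r: "r > 0" "cball (c x) r \<subseteq> c ` (V \<inter> W)" by (meson open_contains_cball)
  define K where "K = inv_into V c ` cball (c x) r"
  have "continuous_on (cball (c x) r) (inv_into V c)"
    using homeomorphism_cont2[OF chart_homeomorphism[OF Vc]] by (rule continuous_on_subset) (use r in auto)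
  then have "compact K"
    unfolding K_def using onb_compact_cball[OF obasis(1)] by (rule compact_continuous_image)
  then have K: "closed K" by (rule compact_imp_closed)
  have KW: "K \<subseteq> V \<inter> W"
  proof
    fix z assume "z \<in> K"
    then obtain y where "y \<in> cball (c x) r" "z = inv_into V c y" unfolding K_def by blast
    moreover from this(1) obtain z' where "z' \<in> V \<inter> W" "y = c z'" using r(2) by blast
    ultimately show "z \<in> V \<inter> W" using chart_inv[OF Vc] by auto
  qed
  define q where "q y = r\<^sup>2 - (y - c x) \<bullet> (y - c x)" for y
  define f where "f y = (if y \<in> V then flat 0 (q (c y)) else 0)" for y
  have smq: "smooth_map_on T q" if T: "open T" for T
  proof -
    have sub: "smooth_map_on T (\<lambda>y. (y - c x) \<bullet> b)" for b
      using smooth_map_on_add[OF T smooth_map_on_bounded_linear[OF T bounded_linear_inner_left smooth_map_on_ident[OF T]]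
          smooth_map_on_const[OF T], of b "- (c x \<bullet> b)"] by (simp add: inner_diff_left)
    \<comment> \<open>Smoothness of products is available for real functions, so the squared norm is
      written as a sum of squares of coordinates.\<close>
    have "(y - c x) \<bullet> (y - c x) = (\<Sum>b\<in>obasis ` {..<adim A}. ((y - c x) \<bullet> b) * ((y - c x) \<bullet> b))" for y
    proof -
      have "(y - c x) \<bullet> (y - c x) = (\<Sum>b\<in>obasis ` {..<adim A}. ((y - c x) \<bullet> b) *\<^sub>R b) \<bullet> (y - c x)"
        by (simp only: onb_expand[OF obasis(1)])
      also have "\<dots> = (\<Sum>b\<in>obasis ` {..<adim A}. ((y - c x) \<bullet> b) * (b \<bullet> (y - c x)))"
        by (simp only: inner_sum_left inner_scaleR_left)
      also have "\<dots> = (\<Sum>b\<in>obasis ` {..<adim A}. ((y - c x) \<bullet> b) * ((y - c x) \<bullet> b))"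
        by (intro sum.cong refl arg_cong2[of _ _ _ _ "(*)"] inner_commute)
      finally show ?thesis .
    qed
    then have "q = (\<lambda>y. r\<^sup>2 + (- 1) * (\<Sum>b\<in>obasis ` {..<adim A}. ((y - c x) \<bullet> b) * ((y - c x) \<bullet> b)))"
      by (simp add: q_def fun_eq_iff)
    moreover have "smooth_map_on T \<dots>"
      by (intro smooth_map_on_add smooth_map_on_mult smooth_map_on_sum smooth_map_on_const sub T)
    ultimately show ?thesis by simp
  qed
  have f0: "f y = 0" if "y \<notin> K" for y
  proof (cases "y \<in> V")
    case True
    then have "c y \<notin> cball (c x) r"
      using that chart_inv[OF Vc True] unfolding K_def by (metis imageI)
    then have "r < norm (c y - c x)" by (simp add: dist_norm norm_minus_commute)
    then have "r\<^sup>2 \<le> (norm (c y - c x))\<^sup>2" using r(1) by (intro power_mono) auto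
    then have "q (c y) \<le> 0" by (simp add: q_def power2_norm_eq_inner)
    then show ?thesis by (simp add: f_def flat_def)
  qed (simp add: f_def)
  have "smooth_fun A UNIV f"
  proof (rule smooth_fun_local_agree)
    fix y :: 'm
    show "\<exists>N g. open N \<and> y \<in> N \<and> N \<subseteq> UNIV \<and> smooth_fun A N g \<and> (\<forall>z\<in>N. f z = g z)"
    proof (cases "y \<in> V")
      case True
      have "smooth_map_on (c ` V) (\<lambda>y. flat 0 (q y))"
        by (rule smooth_map_on_compose[OF onb_real chart_image_open[OF Vc] open_UNIV smq[OF chart_image_open[OF Vc]]])
          (auto simp: smooth_map_on_def ck_on_flat)
      from smooth_fun_chart[OF Vc chart_image_open[OF Vc] subset_refl this]
      have "smooth_fun A V (\<lambda>y. flat 0 (q (c y)))"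
        by (rule smooth_fun_mono) auto
      then show ?thesis using True chart_open[OF Vc] by (auto simp: f_def intro!: exI[of _ V] exI[of _ "\<lambda>y. flat 0 (q (c y))"])
    next
      case False
      then have "y \<in> - K" using KW by auto
      then show ?thesis using K f0 smooth_fun_const[of "- K" 0]
        by (intro exI[of _ "- K"] exI[of _ "\<lambda>y. 0"]) auto
    qed
  qed
  moreover have "\<forall>y. 0 \<le> f y" by (simp add: f_def flat_pos_iff)
  moreover have "f x > 0" using xV r by (simp add: f_def flat_pos_iff q_def)
  moreover have "\<exists>N. open N \<and> y \<in> N \<and> (\<forall>z\<in>N. f z = 0)" if "y \<notin> W" for y
    using K KW f0 that by (intro exI[of _ "- K"]) auto
  ultimately show ?thesis by blast
qed

text \<open>The positivity sets of bump functions around all points form an open cover, and by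
  Lindelof countably many of them suffice. \<open>idx\<close> records the member of the given cover
  that carries each function, since one member may serve infinitely many of them.\<close>

lemma bump_sequence:
  assumes U: "\<forall>i\<in>I. open (U i)" and cov: "(\<Union>i\<in>I. U i) = UNIV"
  shows "\<exists>f idx. (\<forall>n::nat. idx n \<in> I \<and> smooth_fun A UNIV (f n) \<and> (\<forall>y. 0 \<le> f n y) \<and>
       (\<forall>y. y \<notin> U (idx n) \<longrightarrow> (\<exists>N. open N \<and> y \<in> N \<and> (\<forall>z\<in>N. f n z = 0)))) \<and>
     (\<forall>y. \<exists>n. f n y > 0)"
proof -
  have "\<exists>i f. i \<in> I \<and> smooth_fun A UNIV f \<and> (\<forall>y. 0 \<le> f y) \<and> f x > 0 \<and>
     (\<forall>y. y \<notin> U i \<longrightarrow> (\<exists>N. open N \<and> y \<in> N \<and> (\<forall>z\<in>N. f z = 0)))" for x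
  proof -
    have "x \<in> (\<Union>i\<in>I. U i)" using cov by simp
    then obtain i where i: "i \<in> I" "x \<in> U i" by blast
    then have "open (U i)" using U by simp
    from bump_exists[OF this i(2)] obtain f where "smooth_fun A UNIV f \<and> (\<forall>y. 0 \<le> f y) \<and> f x > 0 \<and>
      (\<forall>y. y \<notin> U i \<longrightarrow> (\<exists>N. open N \<and> y \<in> N \<and> (\<forall>z\<in>N. f z = 0)))" by (elim exE)
    then show ?thesis using i(1) by (intro exI[of _ i] exI[of _ f] conjI) simp_all
  qed
  then obtain i f where fi: "\<And>x. i x \<in> I" "\<And>x. smooth_fun A UNIV (f x)" "\<And>x y. 0 \<le> f x y" "\<And>x. f x x > 0"
     "\<And>x y. y \<notin> U (i x) \<Longrightarrow> \<exists>N. open N \<and> y \<in> N \<and> (\<forall>z\<in>N. f x z = 0)"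
    by metis
  define S where "S x = {y. f x y > 0}" for x
  have openS: "open (S x)" for x
  proof -
    have "continuous_on UNIV (f x)" by (rule smooth_fun_continuous[OF open_UNIV fi(2)])
    then have "open (f x -` {0<..})" by (rule open_vimage[OF open_greaterThan])
    then show ?thesis by (simp add: S_def vimage_def)
  qed
  have "\<And>T. T \<in> range S \<Longrightarrow> open T" using openS by (elim rangeE) simp
  from Lindelof[OF this]
  obtain F where F: "F \<subseteq> range S" "countable F" "\<Union>F = \<Union>(range S)" .
  have un: "\<Union>F = UNIV" using F(3) fi(4) by (auto simp: S_def)
  \<comment> \<open>The manifold type is inhabited, so the countable family is nonempty and can be
    enumerated by all of \<open>nat\<close>.\<close>
  then have "F \<noteq> {}" by auto
  then have ran: "range (from_nat_into F) = F" using F(2) by (simp add: range_from_nat_into)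
  then have "\<exists>x. from_nat_into F n = S x" for n using F(1) by blast
  then obtain xs where xs: "\<And>n. from_nat_into F n = S (xs n)" by metis
  have pos: "\<exists>n. f (xs n) y > 0" for y
  proof -
    have "y \<in> \<Union>(range (from_nat_into F))" using un ran by simp
    then obtain n where "y \<in> from_nat_into F n" by blast
    then show ?thesis unfolding xs by (auto simp: S_def)
  qed
  show ?thesis
    by (intro exI[of _ "\<lambda>n. f (xs n)"] exI[of _ "\<lambda>n. i (xs n)"] conjI allI impI) (rule fi pos, assumption?)+
qed

text \<open>Local finiteness is forced by damping: the factor for \<open>k < n\<close> in
  \<open>g n\<close> vanishes where \<open>f k\<close> is at least \<open>1 / (real n + 1)\<close>,
  so near a point where some \<open>f m\<close> is positive only finitely many \<open>g n\<close>
  are nonzero. The \<open>g n\<close> are then summed according to \<open>idx\<close> and normalised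
  by the total, giving one function per member of the cover.\<close>

lemma partition_of_unity:
  assumes fin: "finite I" and U: "\<And>i. i \<in> I \<Longrightarrow> open (U i)" and cov: "(\<Union>i\<in>I. U i) = UNIV"
  shows "\<exists>\<rho>. (\<forall>i\<in>I. smooth_fun A UNIV (\<rho> i) \<and>
       (\<forall>y. y \<notin> U i \<longrightarrow> (\<exists>N. open N \<and> y \<in> N \<and> (\<forall>z\<in>N. \<rho> i z = 0)))) \<and>
     (\<forall>x. (\<Sum>i\<in>I. \<rho> i x) = (1::real))"
proof -
  have "\<forall>i\<in>I. open (U i)" using U by blast
  from bump_sequence[OF this cov] obtain f idx where
      f0: "\<forall>n::nat. idx n \<in> I \<and> smooth_fun A UNIV (f n) \<and> (\<forall>y. 0 \<le> f n y) \<and>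
       (\<forall>y. y \<notin> U (idx n) \<longrightarrow> (\<exists>N. open N \<and> y \<in> N \<and> (\<forall>z\<in>N. f n z = 0)))"
    and f1: "\<forall>y. \<exists>n. f n y > 0"
    by (elim exE conjE)
  have f: "idx n \<in> I" "smooth_fun A UNIV (f n)" "0 \<le> f n y" "\<exists>n. f n y > 0"
    "y \<notin> U (idx n) \<Longrightarrow> \<exists>N. open N \<and> y \<in> N \<and> (\<forall>z\<in>N. f n z = 0)" for n y
    using spec[OF f0, of n] spec[OF f1, of y] by simp_all
  define g where "g n y = flat 0 (f n y) * (\<Prod>k<n. flat 0 (1 / (real n + 1) - f k y))" for n y
  have g_smooth: "smooth_fun A UNIV (g n)" for n
    unfolding g_def
    by (intro smooth_fun_mult smooth_fun_prod open_UNIV smooth_fun_compose[of UNIV UNIV _ "flat 0"]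
        f(2) smooth_fun_diff smooth_fun_const) (auto simp: smooth_map_on_def ck_on_flat)
  have g_nonneg: "g n y \<ge> 0" for n y
    unfolding g_def by (intro mult_nonneg_nonneg prod_nonneg) (auto simp: flat_pos_iff)
  have g_zero: "f n y = 0 \<Longrightarrow> g n y = 0" for n y by (simp add: g_def flat_def)
  have g_pos: "\<exists>n. g n y > 0" for y
  proof -
    \<comment> \<open>At the first index with positive value all earlier functions vanish at
      \<open>y\<close>, so no factor of the product is 0.\<close>
    define n where "n = (LEAST n. f n y > 0)"
    have n: "f n y > 0" unfolding n_def using f(4) by (rule LeastI_ex)
    have "f k y = 0" if "k < n" for k
      using not_less_Least[of k "\<lambda>n. f n y > 0"] that f(3)[of k y] by (simp add: n_def)
    then have "(\<Prod>k<n. flat 0 (1 / (real n + 1) - f k y)) > 0"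
      by (intro prod_pos) (auto simp: flat_pos_iff)
    then have "g n y > 0" using n by (simp add: g_def flat_pos_iff)
    then show ?thesis ..
  qed
  have locfin: "\<exists>N M. open N \<and> y \<in> N \<and> (\<forall>n\<ge>M. \<forall>z\<in>N. g n z = 0)" for y
  proof -
    obtain m where m: "f m y > 0" using f(4) by blast
    \<comment> \<open>Here \<open>f m\<close> stays above half of its value at \<open>y\<close>; as
      soon as \<open>1 / (real n + 1)\<close> is below that half and \<open>n > m\<close>, the
      factor with index \<open>m\<close> kills \<open>g n\<close>.\<close>
    define N where "N = f m -` {f m y / 2<..}"
    have "open N" unfolding N_def
      by (rule open_vimage[OF open_greaterThan smooth_fun_continuous[OF open_UNIV f(2)]])
    moreover have "y \<in> N" using m by (simp add: N_def)
    moreover obtain M where M: "inverse (real (Suc M)) < f m y / 2"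
      using reals_Archimedean[of "f m y / 2"] m by auto
    have "g n z = 0" if n: "n \<ge> max (Suc m) M" and z: "z \<in> N" for n z
    proof -
      have "1 / (real n + 1) \<le> inverse (real (Suc M))" using n by (simp add: field_simps)
      then have "1 / (real n + 1) - f m z \<le> 0" using M z by (simp add: N_def)
      then have "flat 0 (1 / (real n + 1) - f m z) = 0" by (simp only: flat_pos_iff)
      then have "(\<Prod>k<n. flat 0 (1 / (real n + 1) - f k z)) = 0"
        by (intro prod_zero) (use n in auto)
      then show ?thesis by (simp add: g_def)
    qed
    ultimately show ?thesis by blast
  qed
  define \<sigma> where "\<sigma> i z = (\<Sum>n. if idx n = i then g n z else 0)" for i z
  have \<sigma>_local: "\<exists>N M. open N \<and> y \<in> N \<and> (\<forall>n\<ge>M. \<forall>z\<in>N. g n z = 0) \<and>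
      (\<forall>i. \<forall>z\<in>N. \<sigma> i z = (\<Sum>n<M. if idx n = i then g n z else 0))" for y
  proof -
    obtain N M where NM: "open N" "y \<in> N" "\<forall>n\<ge>M. \<forall>z\<in>N. g n z = 0" using locfin by blast
    have "\<sigma> i z = (\<Sum>n<M. if idx n = i then g n z else 0)" if "z \<in> N" for i z
      unfolding \<sigma>_def by (rule suminf_finite) (use NM(3) that in auto)
    then show ?thesis using NM by blast
  qed
  have \<sigma>_smooth: "smooth_fun A UNIV (\<sigma> i)" for i
  proof (rule smooth_fun_local_agree)
    fix y
    obtain N M where "open N" "y \<in> N" "\<forall>z\<in>N. \<sigma> i z = (\<Sum>n<M. if idx n = i then g n z else 0)"
      using \<sigma>_local[of y] by blast
    moreover have "smooth_fun A N (if idx n = i then g n else (\<lambda>z. 0))" for n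
      using smooth_fun_mono[OF g_smooth] smooth_fun_const[OF \<open>open N\<close>] by auto
    then have "smooth_fun A N (\<lambda>z. \<Sum>n<M. (if idx n = i then g n else (\<lambda>z. 0)) z)"
      by (intro smooth_fun_sum \<open>open N\<close>)
    then have "smooth_fun A N (\<lambda>z. \<Sum>n<M. if idx n = i then g n z else 0)"
      by (simp add: if_distrib[of "\<lambda>h. h _"] cong: if_cong)
    ultimately show "\<exists>N h. open N \<and> y \<in> N \<and> N \<subseteq> UNIV \<and> smooth_fun A N h \<and> (\<forall>z\<in>N. \<sigma> i z = h z)"
      by blast
  qed
  have \<sigma>_supp: "\<exists>N. open N \<and> y \<in> N \<and> (\<forall>z\<in>N. \<sigma> i z = 0)" if y: "y \<notin> U i" for i y
  proof -
    obtain N M where NM: "open N" "y \<in> N" "\<forall>z\<in>N. \<sigma> i z = (\<Sum>n<M. if idx n = i then g n z else 0)"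
      using \<sigma>_local[of y] by blast
    have "\<exists>N. open N \<and> y \<in> N \<and> (\<forall>z\<in>N. idx n = i \<longrightarrow> g n z = 0)" for n
      using f(5)[of y n] y g_zero by (cases "idx n = i") (blast, auto)
    then obtain N' where N': "\<And>n. open (N' n)" "\<And>n. y \<in> N' n" "\<And>n z. z \<in> N' n \<Longrightarrow> idx n = i \<Longrightarrow> g n z = 0"
      by metis
    \<comment> \<open>Near \<open>y\<close> only indices below \<open>M\<close> contribute, so
      intersecting finitely many of these neighbourhoods suffices.\<close>
    show ?thesis
    proof (intro exI[of _ "N \<inter> (\<Inter>n<M. N' n)"] conjI ballI)
      show "open (N \<inter> (\<Inter>n<M. N' n))" using NM N' by (intro open_Int open_INT) auto
      show "y \<in> N \<inter> (\<Inter>n<M. N' n)" using NM N' by auto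
      fix z assume "z \<in> N \<inter> (\<Inter>n<M. N' n)"
      then show "\<sigma> i z = 0" using NM(3) N'(3) by (auto intro!: sum.neutral)
    qed
  qed
  have \<sigma>_sum_pos: "(\<Sum>i\<in>I. \<sigma> i y) > 0" for y
  proof -
    obtain N M where NM: "y \<in> N" "\<forall>n\<ge>M. \<forall>z\<in>N. g n z = 0"
       "\<forall>i. \<forall>z\<in>N. \<sigma> i z = (\<Sum>n<M. if idx n = i then g n z else 0)"
      using \<sigma>_local[of y] by blast
    obtain n where n: "g n y > 0" using g_pos by blast
    then have "n < M" using NM by (metis less_irrefl not_less)
    have "(\<Sum>i\<in>I. \<sigma> i y) = (\<Sum>i\<in>I. \<Sum>n<M. if idx n = i then g n y else 0)"
      using NM by simp
    also have "\<dots> = (\<Sum>n<M. \<Sum>i\<in>I. if idx n = i then g n y else 0)" by (rule sum.swap)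
    also have "\<dots> = (\<Sum>n<M. g n y)" using fin f(1) by (simp add: sum.delta' cong: if_cong)
    also have "\<dots> > 0"
      by (rule sum_pos2[of _ n]) (use n \<open>n < M\<close> g_nonneg in auto)
    finally show ?thesis .
  qed
  define \<rho> where "\<rho> i y = \<sigma> i y / (\<Sum>j\<in>I. \<sigma> j y)" for i y
  show ?thesis
  proof (intro exI[of _ \<rho>] conjI ballI allI impI)
    fix i
    show "smooth_fun A UNIV (\<rho> i)"
      unfolding \<rho>_def by (intro smooth_fun_divide smooth_fun_sum \<sigma>_smooth open_UNIV)
        (use \<sigma>_sum_pos in \<open>simp add: less_imp_neq[symmetric]\<close>)
    show "\<exists>N. open N \<and> y \<in> N \<and> (\<forall>z\<in>N. \<rho> i z = 0)" if "y \<notin> U i" for y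
      using \<sigma>_supp[OF that] by (auto simp: \<rho>_def)
  next
    fix x
    show "(\<Sum>i\<in>I. \<rho> i x) = 1"
      using \<sigma>_sum_pos[of x] unfolding \<rho>_def sum_divide_distrib[symmetric] by simp
  qed
qed

end

section \<open>Vector fields and differential forms\<close>

context smooth_mfd
begin

section \<open>Vector fields\<close>

lemma vf_tangent: "vector_field A W X \<Longrightarrow> x \<in> W \<Longrightarrow> X x \<in> tangent_space A x"
  by (simp add: vector_field_def)

lemma vf_smooth: "open W \<Longrightarrow> vector_field A W X \<Longrightarrow> smooth_fun A W f \<Longrightarrow> smooth_fun A W (\<lambda>x. X x f)"
  by (simp add: vector_field_def)

lemma vf_mono: "vector_field A W X \<Longrightarrow> V \<subseteq> W \<Longrightarrow> vector_field A V X"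
  by (auto simp: vector_field_def)

lemma vf_local:
  assumes "\<And>x. x \<in> W \<Longrightarrow> \<exists>N. open N \<and> x \<in> N \<and> vector_field A (W \<inter> N) X" and "open W"
  shows "vector_field A W X"
  unfolding vector_field_def
proof (intro conjI ballI allI impI; (elim conjE)?)
  fix x assume "x \<in> W"
  then show "X x \<in> tangent_space A x" using assms(1) vf_tangent by blast
next
  fix V f assume V: "open V" "V \<subseteq> W" and f: "smooth_fun A V f"
  show "smooth_fun A V (\<lambda>x. X x f)"
  proof (rule smooth_fun_local)
    fix x assume x: "x \<in> V"
    then obtain N where N: "open N" "x \<in> N" "vector_field A (W \<inter> N) X" using assms(1) V by blast
    have "smooth_fun A (V \<inter> N) (\<lambda>x. X x f)"
      by (rule vf_smooth[OF _ vf_mono[OF N(3)] smooth_fun_mono[OF f]]) (use N V in auto)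
    then show "\<exists>N. open N \<and> x \<in> N \<and> smooth_fun A (V \<inter> N) (\<lambda>x. X x f)" using N by blast
  qed
qed

lemma vf_cong:
  assumes "open W" "\<And>x. x \<in> W \<Longrightarrow> X x = Y x"
  shows "vector_field A W X \<longleftrightarrow> vector_field A W Y"
proof -
  have "vector_field A W Q" if "vector_field A W P" and eq: "\<And>x. x \<in> W \<Longrightarrow> P x = Q x" for P Q
    unfolding vector_field_def
  proof (intro conjI ballI allI impI; (elim conjE)?)
    fix x assume "x \<in> W" then show "Q x \<in> tangent_space A x" using vf_tangent[OF that(1)] eq by metis
  next
    fix V f assume V: "open V" "V \<subseteq> W" and f: "smooth_fun A V f"
    have "smooth_fun A V (\<lambda>x. P x f)" by (rule vf_smooth[OF V(1) vf_mono[OF that(1) V(2)] f])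
    moreover have "P x f = Q x f" if "x \<in> V" for x using eq[of x] that V by auto
    ultimately show "smooth_fun A V (\<lambda>x. Q x f)"
      using smooth_fun_cong[OF V(1), of "\<lambda>x. P x f" "\<lambda>x. Q x f"] by simp
  qed
  from this[of X Y] this[of Y X] assms(2) show ?thesis by metis
qed

lemma vf_zero: "open W \<Longrightarrow> vector_field A W (\<lambda>x f. 0)"
  by (auto simp: vector_field_def tangent_zero smooth_fun_const)

lemma vf_add: "vector_field A W X \<Longrightarrow> vector_field A W Y \<Longrightarrow> vector_field A W (\<lambda>x f. X x f + Y x f)"
  by (auto simp: vector_field_def tangent_add smooth_fun_add)

lemma vf_scale:
  "smooth_fun A W g \<Longrightarrow> vector_field A W X \<Longrightarrow> vector_field A W (\<lambda>x f. g x * X x f)"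
  unfolding vector_field_def
  by (auto intro!: tangent_scale smooth_fun_mult intro: smooth_fun_mono)

lemma vf_cscale: "open W \<Longrightarrow> vector_field A W X \<Longrightarrow> vector_field A W (\<lambda>x f. r * X x f)"
  by (intro vf_scale smooth_fun_const)

lemma vf_sum:
  "open W \<Longrightarrow> (\<And>i. i \<in> I \<Longrightarrow> vector_field A W (X i)) \<Longrightarrow> vector_field A W (\<lambda>x f. \<Sum>i\<in>I. X i x f)"
  by (induction I rule: infinite_finite_induct) (auto intro!: vf_add vf_zero)

lemma vf_fadd: "open V \<Longrightarrow> x \<in> V \<Longrightarrow> vector_field A V X \<Longrightarrow> smooth_fun A V f \<Longrightarrow> smooth_fun A V g \<Longrightarrow>
    X x (\<lambda>y. f y + g y) = X x f + X x g"
  by (rule tan_add[OF vf_tangent[of V X x]]; (assumption | rule smooth_nearI[of V])+)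

lemma vf_fdiff: "open V \<Longrightarrow> x \<in> V \<Longrightarrow> vector_field A V X \<Longrightarrow> smooth_fun A V f \<Longrightarrow> smooth_fun A V g \<Longrightarrow>
    X x (\<lambda>y. f y - g y) = X x f - X x g"
  by (rule tan_diff[OF vf_tangent[of V X x]]; (assumption | rule smooth_nearI[of V])+)

lemma vf_fmult: "open V \<Longrightarrow> x \<in> V \<Longrightarrow> vector_field A V X \<Longrightarrow> smooth_fun A V f \<Longrightarrow> smooth_fun A V g \<Longrightarrow>
    X x (\<lambda>y. f y * g y) = f x * X x g + g x * X x f"
  by (rule tan_mult[OF vf_tangent[of V X x]]; (assumption | rule smooth_nearI[of V])+)

lemma vf_fcmult: "open V \<Longrightarrow> x \<in> V \<Longrightarrow> vector_field A V X \<Longrightarrow> smooth_fun A V f \<Longrightarrow>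
    X x (\<lambda>y. r * f y) = r * X x f"
  by (rule tan_cmult[OF vf_tangent[of V X x]]; (assumption | rule smooth_nearI[of V])+)

lemma vf_fminus: "open V \<Longrightarrow> x \<in> V \<Longrightarrow> vector_field A V X \<Longrightarrow> smooth_fun A V f \<Longrightarrow>
    X x (\<lambda>y. - f y) = - X x f"
  by (rule tan_minus[OF vf_tangent[of V X x]]; (assumption | rule smooth_nearI[of V])+)

lemma vf_fconst: "x \<in> V \<Longrightarrow> vector_field A V X \<Longrightarrow> X x (\<lambda>y. r) = 0"
  by (rule tan_const[OF vf_tangent[of V X x]])

lemma vf_fcong: "open V \<Longrightarrow> x \<in> V \<Longrightarrow> vector_field A V X \<Longrightarrow> smooth_fun A V f \<Longrightarrow>
    (\<And>y. y \<in> V \<Longrightarrow> f y = g y) \<Longrightarrow> X x f = X x g"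
  by (rule tan_cong[OF vf_tangent[of V X x]])

lemma vf_near:
  assumes "open V" "x \<in> V" "vector_field A V X" "smooth_near A x f"
  obtains N where "open N" "x \<in> N" "N \<subseteq> V" "smooth_fun A N f" "smooth_fun A N (\<lambda>y. X y f)"
proof -
  obtain W where W: "open W" "x \<in> W" "smooth_fun A W f" using assms(4) unfolding smooth_near_def by blast
  have "smooth_fun A (V \<inter> W) f" by (rule smooth_fun_mono[OF W(3)]) auto
  moreover have "smooth_fun A (V \<inter> W) (\<lambda>y. X y f)"
    by (rule vf_smooth[OF _ vf_mono[OF assms(3)] calculation]) (use assms W in auto)
  ultimately show ?thesis using that[of "V \<inter> W"] assms W by blast
qed

lemma vf_smooth_near:
  "open V \<Longrightarrow> x \<in> V \<Longrightarrow> vector_field A V X \<Longrightarrow> smooth_near A x f \<Longrightarrow> smooth_near A x (\<lambda>y. X y f)"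
  by (erule (3) vf_near) (blast intro: smooth_nearI)

section \<open>The Lie bracket\<close>

lemma lie_apply_near: "smooth_near A x f \<Longrightarrow> lie_bracket A X Y x f = X x (\<lambda>y. Y y f) - Y x (\<lambda>y. X y f)"
  by (simp add: lie_bracket_def)

lemma lie_apply: "open V \<Longrightarrow> x \<in> V \<Longrightarrow> smooth_fun A V f \<Longrightarrow>
    lie_bracket A X Y x f = X x (\<lambda>y. Y y f) - Y x (\<lambda>y. X y f)"
  by (rule lie_apply_near[OF smooth_nearI])

text \<open>Two nested derivatives are not a derivation, but the failure of the product rule,
  \<open>Y x g * X x f + Y x f * X x g\<close>, is symmetric in \<open>X\<close> and
  \<open>Y\<close> and cancels in the commutator.\<close>

lemma lie_tangent:
  assumes V: "open V" and x: "x \<in> V" and XY: "vector_field A V X" "vector_field A V Y"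
  shows "lie_bracket A X Y x \<in> tangent_space A x"
  unfolding tangent_space_def mem_Collect_eq
proof (intro conjI allI impI; (elim conjE)?)
  fix f assume "\<not> smooth_near A x f"
  then show "lie_bracket A X Y x f = 0" by (simp add: lie_bracket_def)
next
  fix f g assume fg: "smooth_near A x f" "smooth_near A x g"
  from fg obtain W where W: "open W" "x \<in> W" "smooth_fun A W f" "smooth_fun A W g"
    by (rule smooth_near_obtain2)
  let ?N = "V \<inter> W"
  have N: "open ?N" "x \<in> ?N" using V x W by auto
  have X: "vector_field A ?N X" and Y: "vector_field A ?N Y" using XY vf_mono by blast+
  have f: "smooth_fun A ?N f" and g: "smooth_fun A ?N g" using W smooth_fun_mono by blast+
  note sm = vf_smooth[OF N(1) X] vf_smooth[OF N(1) Y]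
  note rules = vf_fadd[OF N X] vf_fadd[OF N Y] vf_fmult[OF N X] vf_fmult[OF N Y]
  show "lie_bracket A X Y x f = lie_bracket A X Y x g" if "\<forall>\<^sub>F y in nhds x. f y = g y"
  proof -
    from that[unfolded eventually_nhds]
    obtain M where M: "open M" "x \<in> M" "\<forall>y\<in>M. f y = g y" by blast
    have "X x (\<lambda>y. Y y f) = X x (\<lambda>y. Y y g)" if Z: "vector_field A ?N X" "vector_field A ?N Y" for X Y
    proof -
      have NM: "open (?N \<inter> M)" "x \<in> ?N \<inter> M" using N M by auto
      have Z': "vector_field A (?N \<inter> M) X" "vector_field A (?N \<inter> M) Y"
        by (rule vf_mono[OF Z(1)], blast, rule vf_mono[OF Z(2)], blast)
      have f': "smooth_fun A (?N \<inter> M) f" by (rule smooth_fun_mono[OF f]) blast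
      have "Y y f = Y y g" if "y \<in> ?N \<inter> M" for y
        by (rule vf_fcong[OF NM(1) that Z'(2) f']) (use M in auto)
      then show ?thesis by (rule vf_fcong[OF NM Z'(1) vf_smooth[OF NM(1) Z'(2) f']])
    qed
    from this[OF X Y] this[OF Y X] show ?thesis using fg by (simp add: lie_bracket_def)
  qed
  have "X x (\<lambda>y. Y y (\<lambda>z. f z + g z)) = X x (\<lambda>y. Y y f) + X x (\<lambda>y. Y y g)"
    if Z: "vector_field A ?N X" "vector_field A ?N Y" for X Y
  proof -
    have "X x (\<lambda>y. Y y (\<lambda>z. f z + g z)) = X x (\<lambda>y. Y y f + Y y g)"
      by (rule vf_fcong[OF N Z(1) vf_smooth[OF N(1) Z(2) smooth_fun_add[OF N(1) f g]]])
        (rule vf_fadd[OF N(1) _ Z(2) f g])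
    then show ?thesis using vf_fadd[OF N Z(1) vf_smooth[OF N(1) Z(2) f] vf_smooth[OF N(1) Z(2) g]] by simp
  qed
  from this[OF X Y] this[OF Y X]
  show "lie_bracket A X Y x (\<lambda>y. f y + g y) = lie_bracket A X Y x f + lie_bracket A X Y x g"
    using fg by (simp add: lie_bracket_def smooth_near_add)
  have "X x (\<lambda>y. Y y (\<lambda>z. f z * g z)) =
      f x * X x (\<lambda>y. Y y g) + Y x g * X x f + (g x * X x (\<lambda>y. Y y f) + Y x f * X x g)"
    if Z: "vector_field A ?N X" "vector_field A ?N Y" for X Y
  proof -
    note s = vf_smooth[OF N(1) Z(2) f] vf_smooth[OF N(1) Z(2) g]
    have "X x (\<lambda>y. Y y (\<lambda>z. f z * g z)) = X x (\<lambda>y. f y * Y y g + g y * Y y f)"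
      by (rule vf_fcong[OF N Z(1) vf_smooth[OF N(1) Z(2) smooth_fun_mult[OF N(1) f g]]])
        (rule vf_fmult[OF N(1) _ Z(2) f g])
    also have "\<dots> = X x (\<lambda>y. f y * Y y g) + X x (\<lambda>y. g y * Y y f)"
      by (intro vf_fadd[OF N Z(1)] smooth_fun_mult N(1) f g s)
    finally show ?thesis using vf_fmult[OF N Z(1) f s(2)] vf_fmult[OF N Z(1) g s(1)] by simp
  qed
  from this[OF X Y] this[OF Y X]
  show "lie_bracket A X Y x (\<lambda>y. f y * g y) = f x * lie_bracket A X Y x g + g x * lie_bracket A X Y x f"
    using fg by (simp add: lie_bracket_def smooth_near_mult algebra_simps)
next
  fix a f assume fn: "smooth_near A x f"
  then obtain W where W: "open W" "x \<in> W" "smooth_fun A W f" unfolding smooth_near_def by blast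
  let ?N = "V \<inter> W"
  have N: "open ?N" "x \<in> ?N" using V x W by auto
  have X: "vector_field A ?N X" and Y: "vector_field A ?N Y" using XY vf_mono by blast+
  have f: "smooth_fun A ?N f" using W smooth_fun_mono by blast
  have "X x (\<lambda>y. Y y (\<lambda>z. a * f z)) = a * X x (\<lambda>y. Y y f)"
    if Z: "vector_field A ?N X" "vector_field A ?N Y" for X Y
  proof -
    have "X x (\<lambda>y. Y y (\<lambda>z. a * f z)) = X x (\<lambda>y. a * Y y f)"
      by (rule vf_fcong[OF N Z(1) vf_smooth[OF N(1) Z(2) smooth_fun_cmult[OF N(1) f]]])
        (rule vf_fcmult[OF N(1) _ Z(2) f])
    then show ?thesis using vf_fcmult[OF N Z(1) vf_smooth[OF N(1) Z(2) f]] by simp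
  qed
  from this[OF X Y] this[OF Y X]
  show "lie_bracket A X Y x (\<lambda>y. a * f y) = a * lie_bracket A X Y x f"
    using fn by (simp add: lie_bracket_def smooth_near_cmult algebra_simps)
qed

lemma vf_lie:
  assumes V: "open V" and XY: "vector_field A V X" "vector_field A V Y"
  shows "vector_field A V (lie_bracket A X Y)"
  unfolding vector_field_def
proof (intro conjI ballI allI impI; (elim conjE)?)
  fix W f assume W: "open W" "W \<subseteq> V" and f: "smooth_fun A W f"
  have XY': "vector_field A W X" "vector_field A W Y" using vf_mono XY W by blast+
  have "smooth_fun A W (\<lambda>x. X x (\<lambda>y. Y y f) - Y x (\<lambda>y. X y f))"
    by (rule smooth_fun_diff[OF W(1) vf_smooth[OF W(1) XY'(1) vf_smooth[OF W(1) XY'(2) f]]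
          vf_smooth[OF W(1) XY'(2) vf_smooth[OF W(1) XY'(1) f]]])
  then show "smooth_fun A W (\<lambda>x. lie_bracket A X Y x f)"
    using smooth_fun_cong[OF W(1), of "\<lambda>x. lie_bracket A X Y x f" "\<lambda>x. X x (\<lambda>y. Y y f) - Y x (\<lambda>y. X y f)"]
      lie_apply[OF W(1) _ f] by simp
qed (rule lie_tangent[OF V _ XY])

text \<open>The sign is written as a factor \<open>- 1\<close> because homogeneity of forms is
  stated for vectors of the shape \<open>\<lambda>f. a * u f\<close>.\<close>

lemma lie_antisym: "lie_bracket A X Y x = (\<lambda>f. - 1 * lie_bracket A Y X x f)"
  by (rule ext) (simp add: lie_bracket_def)

lemma lie_cong:
  assumes V: "open V" "x \<in> V" and X: "vector_field A V X" "vector_field A V Y"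
    and eq: "\<And>y. y \<in> V \<Longrightarrow> X y = X' y" "\<And>y. y \<in> V \<Longrightarrow> Y y = Y' y"
  shows "lie_bracket A X Y x = lie_bracket A X' Y' x"
proof
  fix f
  show "lie_bracket A X Y x f = lie_bracket A X' Y' x f"
  proof (cases "smooth_near A x f")
    case True
    then obtain W where W: "open W" "x \<in> W" "smooth_fun A W f" unfolding smooth_near_def by blast
    have N: "open (V \<inter> W)" "x \<in> V \<inter> W" using V W by auto
    have f: "smooth_fun A (V \<inter> W) f" using W smooth_fun_mono by blast
    have X': "vector_field A (V \<inter> W) X" "vector_field A (V \<inter> W) Y" using X vf_mono by blast+
    have "X x (\<lambda>y. Y y f) = X x (\<lambda>y. Y' y f)"
      by (rule vf_fcong[OF N X'(1) vf_smooth[OF N(1) X'(2) f]]) (simp add: eq)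
    moreover have "Y x (\<lambda>y. X y f) = Y x (\<lambda>y. X' y f)"
      by (rule vf_fcong[OF N X'(2) vf_smooth[OF N(1) X'(1) f]]) (simp add: eq)
    ultimately show ?thesis using eq V True by (simp add: lie_bracket_def)
  qed (simp add: lie_bracket_def)
qed

lemma lie_add_left:
  assumes V: "open V" "x \<in> V" and X: "vector_field A V X" "vector_field A V X'" "vector_field A V Y"
  shows "lie_bracket A (\<lambda>y f. X y f + X' y f) Y x = (\<lambda>f. lie_bracket A X Y x f + lie_bracket A X' Y x f)"
proof
  fix f
  show "lie_bracket A (\<lambda>y f. X y f + X' y f) Y x f = lie_bracket A X Y x f + lie_bracket A X' Y x f"
  proof (cases "smooth_near A x f")
    case True
    have "Y x (\<lambda>y. X y f + X' y f) = Y x (\<lambda>y. X y f) + Y x (\<lambda>y. X' y f)"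
      by (rule tan_add[OF vf_tangent[OF X(3) V(2)] vf_smooth_near[OF V X(1) True] vf_smooth_near[OF V X(2) True]])
    then show ?thesis using True by (simp add: lie_bracket_def)
  qed (simp add: lie_bracket_def)
qed

lemma lie_scale_left:
  assumes V: "open V" "x \<in> V" and X: "vector_field A V X" "vector_field A V Y" and g: "smooth_fun A V g"
  shows "lie_bracket A (\<lambda>y f. g y * X y f) Y x = (\<lambda>f. g x * lie_bracket A X Y x f + (- Y x g) * X x f)"
proof
  fix f
  show "lie_bracket A (\<lambda>y f. g y * X y f) Y x f = g x * lie_bracket A X Y x f + (- Y x g) * X x f"
  proof (cases "smooth_near A x f")
    case True
    have "Y x (\<lambda>y. g y * X y f) = g x * Y x (\<lambda>y. X y f) + X x f * Y x g"
      by (rule tan_mult[OF vf_tangent[OF X(2) V(2)] smooth_nearI[OF V g] vf_smooth_near[OF V X(1) True]])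
    then show ?thesis using True by (simp add: lie_bracket_def algebra_simps)
  next
    case False
    then show ?thesis using tan_not_smooth[OF vf_tangent[OF X(1) V(2)]] by (simp add: lie_bracket_def)
  qed
qed

text \<open>The Jacobi identity in Leibniz form, the shape in which the Dorfman bracket uses it.
  Both sides expand into the same triple derivatives of \<open>f\<close>; smoothness serves to split
  the derivative of a bracket into its two terms.\<close>

lemma lie_jacobi:
  assumes V: "open V" "x \<in> V" and X: "vector_field A V X" and Y: "vector_field A V Y" and Z: "vector_field A V Z"
  shows "lie_bracket A X (lie_bracket A Y Z) x =
    (\<lambda>f. lie_bracket A (lie_bracket A X Y) Z x f + lie_bracket A Y (lie_bracket A X Z) x f)"
proof
  fix f
  show "lie_bracket A X (lie_bracket A Y Z) x f =
    lie_bracket A (lie_bracket A X Y) Z x f + lie_bracket A Y (lie_bracket A X Z) x f"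
  proof (cases "smooth_near A x f")
    case True
    then obtain W where W: "open W" "x \<in> W" "smooth_fun A W f" unfolding smooth_near_def by blast
    let ?N = "V \<inter> W"
    have N: "open ?N" "x \<in> ?N" using V W by auto
    have f: "smooth_fun A ?N f" using W smooth_fun_mono by blast
    have nest: "P x (\<lambda>y. lie_bracket A Q R y f) = P x (\<lambda>y. Q y (\<lambda>z. R z f)) - P x (\<lambda>y. R y (\<lambda>z. Q z f))"
      if "vector_field A V P" "vector_field A V Q" "vector_field A V R" for P Q R
    proof -
      have PQR: "vector_field A ?N P" "vector_field A ?N Q" "vector_field A ?N R" using that vf_mono by blast+
      have "P x (\<lambda>y. lie_bracket A Q R y f) = P x (\<lambda>y. Q y (\<lambda>z. R z f) - R y (\<lambda>z. Q z f))"
        by (rule vf_fcong[OF N PQR(1) vf_smooth[OF N(1) vf_lie[OF N(1) PQR(2,3)] f]])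
          (rule lie_apply[OF N(1) _ f])
      also have "\<dots> = P x (\<lambda>y. Q y (\<lambda>z. R z f)) - P x (\<lambda>y. R y (\<lambda>z. Q z f))"
        by (rule vf_fdiff[OF N PQR(1) vf_smooth[OF N(1) PQR(2) vf_smooth[OF N(1) PQR(3) f]]
              vf_smooth[OF N(1) PQR(3) vf_smooth[OF N(1) PQR(2) f]]])
      finally show ?thesis .
    qed
    have out: "lie_bracket A P Q x (\<lambda>y. R y f) = P x (\<lambda>y. Q y (\<lambda>z. R z f)) - Q x (\<lambda>y. P y (\<lambda>z. R z f))"
      if "vector_field A V R" for P Q R
      by (rule lie_apply_near[OF vf_smooth_near[OF V that True]])
    show ?thesis
      using nest[OF X Y Z] nest[OF Z X Y] nest[OF Y X Z] out[OF X, of Y Z] out[OF Z, of X Y] out[OF Y, of X Z] True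
      by (simp add: lie_bracket_def[of A _ _ x])
  qed (simp add: lie_bracket_def)
qed

section \<open>Alternating forms at a point\<close>

lemma alt_forms_zero: "\<omega> \<in> alt_forms A k x \<Longrightarrow> \<not> (set vs \<subseteq> tangent_space A x \<and> length vs = k) \<Longrightarrow> \<omega> vs = 0"
  unfolding alt_forms_def by blast

lemma alt_forms_update:
  assumes "\<omega> \<in> alt_forms A k x" "set vs \<subseteq> tangent_space A x" "length vs = k" "i < k"
    "u \<in> tangent_space A x" "v \<in> tangent_space A x"
  shows "\<omega> (vs[i := (\<lambda>f. u f + v f)]) = \<omega> (vs[i := u]) + \<omega> (vs[i := v])"
    "\<omega> (vs[i := (\<lambda>f. a * u f)]) = a * \<omega> (vs[i := u])"
  using assms unfolding alt_forms_def by blast+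

lemma alt_forms_repeat:
  "\<omega> \<in> alt_forms A k x \<Longrightarrow> set vs \<subseteq> tangent_space A x \<Longrightarrow> length vs = k \<Longrightarrow> i < j \<Longrightarrow> j < k \<Longrightarrow>
    vs ! i = vs ! j \<Longrightarrow> \<omega> vs = 0"
  unfolding alt_forms_def by blast

lemma alt1:
  assumes "\<omega> \<in> alt_forms A 1 x" "u \<in> tangent_space A x" "v \<in> tangent_space A x"
  shows "\<omega> [\<lambda>f. u f + v f] = \<omega> [u] + \<omega> [v]" "\<omega> [\<lambda>f. a * u f] = a * \<omega> [u]"
  using alt_forms_update[OF assms(1), of "[u]" 0 u v] assms by auto

lemma alt2:
  assumes "\<omega> \<in> alt_forms A 2 x" "u \<in> tangent_space A x" "v \<in> tangent_space A x" "w \<in> tangent_space A x"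
  shows "\<omega> [\<lambda>f. u f + v f, w] = \<omega> [u, w] + \<omega> [v, w]" "\<omega> [\<lambda>f. a * u f, w] = a * \<omega> [u, w]"
    "\<omega> [w, \<lambda>f. u f + v f] = \<omega> [w, u] + \<omega> [w, v]" "\<omega> [w, \<lambda>f. a * u f] = a * \<omega> [w, u]"
    "\<omega> [u, u] = 0"
  using alt_forms_update[OF assms(1), of "[u, w]" 0 u v] alt_forms_update[OF assms(1), of "[w, u]" 1 u v]
    alt_forms_repeat[OF assms(1), of "[u, u]" 0 1] assms by auto

text \<open>Polarisation: the value on \<open>u + v\<close> repeated is 0, and bilinear expansion
  leaves the two mixed terms.\<close>

lemma alt2_swap:
  assumes "\<omega> \<in> alt_forms A 2 x" "u \<in> tangent_space A x" "v \<in> tangent_space A x"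
  shows "\<omega> [u, v] = - \<omega> [v, u]"
proof -
  have "\<omega> [\<lambda>f. u f + v f, \<lambda>f. u f + v f] = 0"
    by (rule alt2(5)[OF assms(1) tangent_add[OF assms(2,3)] assms(2) assms(2)])
  then show ?thesis
    using alt2(1)[OF assms(1,2,3) tangent_add[OF assms(2,3)]] alt2(3)[OF assms(1,2,3) assms(2)]
      alt2(3)[OF assms(1,2,3) assms(3)] alt2(5)[OF assms(1,2,2,2)] alt2(5)[OF assms(1,3,3,3)] by simp
qed

lemma alt3:
  assumes "\<omega> \<in> alt_forms A 3 x" "u \<in> tangent_space A x" "v \<in> tangent_space A x" "w \<in> tangent_space A x" "z \<in> tangent_space A x"
  shows "\<omega> [\<lambda>f. u f + v f, w, z] = \<omega> [u, w, z] + \<omega> [v, w, z]" "\<omega> [\<lambda>f. a * u f, w, z] = a * \<omega> [u, w, z]"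
    "\<omega> [w, \<lambda>f. u f + v f, z] = \<omega> [w, u, z] + \<omega> [w, v, z]" "\<omega> [w, \<lambda>f. a * u f, z] = a * \<omega> [w, u, z]"
    "\<omega> [w, z, \<lambda>f. u f + v f] = \<omega> [w, z, u] + \<omega> [w, z, v]" "\<omega> [w, z, \<lambda>f. a * u f] = a * \<omega> [w, z, u]"
    "\<omega> [u, u, w] = 0" "\<omega> [w, u, u] = 0"
  using alt_forms_update[OF assms(1), of "[u, w, z]" 0 u v] alt_forms_update[OF assms(1), of "[w, u, z]" 1 u v]
    alt_forms_update[OF assms(1), of "[w, z, u]" 2 u v]
    alt_forms_repeat[OF assms(1), of "[u, u, w]" 0 1] alt_forms_repeat[OF assms(1), of "[w, u, u]" 1 2] assms by auto

lemma alt3_swap: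
  assumes "\<omega> \<in> alt_forms A 3 x" "u \<in> tangent_space A x" "v \<in> tangent_space A x" "w \<in> tangent_space A x"
  shows "\<omega> [u, v, w] = - \<omega> [v, u, w]" "\<omega> [w, u, v] = - \<omega> [w, v, u]"
proof -
  note uv = tangent_add[OF assms(2,3)]
  have "\<omega> [\<lambda>f. u f + v f, \<lambda>f. u f + v f, w] = 0" "\<omega> [w, \<lambda>f. u f + v f, \<lambda>f. u f + v f] = 0"
    using alt3(7)[OF assms(1) uv assms(2,4,4)] alt3(8)[OF assms(1) uv assms(2,4,4)] by simp_all
  then show "\<omega> [u, v, w] = - \<omega> [v, u, w]" "\<omega> [w, u, v] = - \<omega> [w, v, u]"
    using alt3(1)[OF assms(1,2,3) uv assms(4)] alt3(3)[OF assms(1,2,3) assms(2) assms(4)]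
      alt3(3)[OF assms(1,2,3) assms(3) assms(4)] alt3(3)[OF assms(1,2,3) assms(4) uv]
      alt3(5)[OF assms(1,2,3) assms(4) assms(2)] alt3(5)[OF assms(1,2,3) assms(4) assms(3)]
      alt3(7,8)[OF assms(1,2,2) assms(4,4)] alt3(7,8)[OF assms(1,3,3) assms(4,4)] by simp_all
qed

section \<open>Differential forms\<close>

lemma df_alt: "diff_form A W k \<omega> \<Longrightarrow> x \<in> W \<Longrightarrow> \<omega> x \<in> alt_forms A k x"
  by (simp add: diff_form_def)

lemma df_mono: "diff_form A W k \<omega> \<Longrightarrow> V \<subseteq> W \<Longrightarrow> diff_form A V k \<omega>"
  unfolding diff_form_def by (auto 4 3)

lemma df_eval:
  "open W \<Longrightarrow> diff_form A W k \<omega> \<Longrightarrow> length Xs = k \<Longrightarrow> (\<forall>X\<in>set Xs. vector_field A W X) \<Longrightarrow>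
    smooth_fun A W (\<lambda>x. \<omega> x (map (\<lambda>X. X x) Xs))"
  by (simp add: diff_form_def)

lemma df_eval1: "open W \<Longrightarrow> diff_form A W 1 \<omega> \<Longrightarrow> vector_field A W X \<Longrightarrow> smooth_fun A W (\<lambda>x. \<omega> x [X x])"
  using df_eval[of W 1 \<omega> "[X]"] by simp

lemma df_eval2: "open W \<Longrightarrow> diff_form A W 2 \<omega> \<Longrightarrow> vector_field A W X \<Longrightarrow> vector_field A W Y \<Longrightarrow>
    smooth_fun A W (\<lambda>x. \<omega> x [X x, Y x])"
  using df_eval[of W 2 \<omega> "[X, Y]"] by simp

lemma df_eval3: "open W \<Longrightarrow> diff_form A W 3 \<omega> \<Longrightarrow> vector_field A W X \<Longrightarrow> vector_field A W Y \<Longrightarrow>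
    vector_field A W Z \<Longrightarrow> smooth_fun A W (\<lambda>x. \<omega> x [X x, Y x, Z x])"
  using df_eval[of W 3 \<omega> "[X, Y, Z]"] by simp

lemma diff_formI:
  assumes "\<And>x. x \<in> W \<Longrightarrow> \<omega> x \<in> alt_forms A k x"
    and "\<And>V Xs. open V \<Longrightarrow> V \<subseteq> W \<Longrightarrow> length Xs = k \<Longrightarrow> \<forall>X\<in>set Xs. vector_field A V X \<Longrightarrow>
       smooth_fun A V (\<lambda>x. \<omega> x (map (\<lambda>X. X x) Xs))"
  shows "diff_form A W k \<omega>"
  using assms unfolding diff_form_def by blast

lemma df_local:
  assumes "\<And>x. x \<in> W \<Longrightarrow> \<exists>N. open N \<and> x \<in> N \<and> diff_form A (W \<inter> N) k \<omega>"
  shows "diff_form A W k \<omega>"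
proof (rule diff_formI)
  fix x assume "x \<in> W"
  then show "\<omega> x \<in> alt_forms A k x" using assms df_alt by blast
next
  fix V Xs assume V: "open V" "V \<subseteq> W" and Xs: "length Xs = k" "\<forall>X\<in>set Xs. vector_field A V X"
  show "smooth_fun A V (\<lambda>x. \<omega> x (map (\<lambda>X. X x) Xs))"
  proof (rule smooth_fun_local)
    fix x assume x: "x \<in> V"
    then obtain N where N: "open N" "x \<in> N" "diff_form A (W \<inter> N) k \<omega>" using assms V by blast
    have "smooth_fun A (V \<inter> N) (\<lambda>x. \<omega> x (map (\<lambda>X. X x) Xs))"
      by (rule df_eval[OF _ df_mono[OF N(3)] Xs(1)]) (use N V Xs vf_mono in auto)
    then show "\<exists>N. open N \<and> x \<in> N \<and> smooth_fun A (V \<inter> N) (\<lambda>x. \<omega> x (map (\<lambda>X. X x) Xs))" using N by blast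
  qed
qed

lemma df_cong:
  assumes "open W" "\<And>x. x \<in> W \<Longrightarrow> \<omega> x = \<theta> x" "diff_form A W k \<omega>"
  shows "diff_form A W k \<theta>"
proof (rule diff_formI)
  fix x assume "x \<in> W" then show "\<theta> x \<in> alt_forms A k x" using df_alt[OF assms(3)] assms(2) by metis
next
  fix V Xs assume V: "open V" "V \<subseteq> W" and Xs: "length Xs = k" "\<forall>X\<in>set Xs. vector_field A V X"
  have "smooth_fun A V (\<lambda>x. \<omega> x (map (\<lambda>X. X x) Xs))"
    by (rule df_eval[OF V(1) df_mono[OF assms(3) V(2)] Xs])
  moreover have "\<omega> x (map (\<lambda>X. X x) Xs) = \<theta> x (map (\<lambda>X. X x) Xs)" if "x \<in> V" for x
    using that V assms(2)[of x] by auto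
  ultimately show "smooth_fun A V (\<lambda>x. \<theta> x (map (\<lambda>X. X x) Xs))"
    using smooth_fun_cong[OF V(1), of "\<lambda>x. \<omega> x (map (\<lambda>X. X x) Xs)" "\<lambda>x. \<theta> x (map (\<lambda>X. X x) Xs)"] by simp
qed

lemma alt_forms_lincomb:
  assumes "\<omega> \<in> alt_forms A k x" "\<theta> \<in> alt_forms A k x"
  shows "(\<lambda>vs. a * \<omega> vs + b * \<theta> vs) \<in> alt_forms A k x"
  using assms unfolding alt_forms_def mem_Collect_eq by (auto simp: algebra_simps)

lemma alt_forms_0: "(\<lambda>vs. 0) \<in> alt_forms A k x"
  by (simp add: alt_forms_def)

lemma df_zero: "diff_form A W k (\<lambda>x vs. 0)"
  by (rule diff_formI) (auto simp: alt_forms_0 smooth_fun_const)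

lemma df_lincomb:
  assumes "smooth_fun A W g" "smooth_fun A W h" "diff_form A W k \<omega>" "diff_form A W k \<theta>"
  shows "diff_form A W k (\<lambda>x vs. g x * \<omega> x vs + h x * \<theta> x vs)"
proof (rule diff_formI)
  fix V Xs assume V: "open V" "V \<subseteq> W" and Xs: "length Xs = k" "\<forall>X\<in>set Xs. vector_field A V X"
  show "smooth_fun A V (\<lambda>x. g x * \<omega> x (map (\<lambda>X. X x) Xs) + h x * \<theta> x (map (\<lambda>X. X x) Xs))"
    by (intro smooth_fun_add smooth_fun_mult V(1) smooth_fun_mono[OF assms(1) V(2)] smooth_fun_mono[OF assms(2) V(2)]
       df_eval[OF V(1) df_mono[OF assms(3) V(2)] Xs] df_eval[OF V(1) df_mono[OF assms(4) V(2)] Xs])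
qed (intro alt_forms_lincomb df_alt[OF assms(3)] df_alt[OF assms(4)])

lemma df_add: "open W \<Longrightarrow> diff_form A W k \<omega> \<Longrightarrow> diff_form A W k \<theta> \<Longrightarrow> diff_form A W k (\<lambda>x vs. \<omega> x vs + \<theta> x vs)"
  using df_lincomb[of W "\<lambda>_. 1" "\<lambda>_. 1" k \<omega> \<theta>] by (simp add: smooth_fun_const)

lemma df_diff: "open W \<Longrightarrow> diff_form A W k \<omega> \<Longrightarrow> diff_form A W k \<theta> \<Longrightarrow> diff_form A W k (\<lambda>x vs. \<omega> x vs - \<theta> x vs)"
  using df_lincomb[of W "\<lambda>_. 1" "\<lambda>_. - 1" k \<omega> \<theta>] by (simp add: smooth_fun_const)

lemma df_scale: "open W \<Longrightarrow> smooth_fun A W g \<Longrightarrow> diff_form A W k \<omega> \<Longrightarrow> diff_form A W k (\<lambda>x vs. g x * \<omega> x vs)"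
  using df_lincomb[of W g "\<lambda>_. 0" k \<omega> "\<lambda>x vs. 0"] by (simp add: smooth_fun_const df_zero)

lemma df_sum: "open W \<Longrightarrow> (\<And>i. i \<in> I \<Longrightarrow> diff_form A W k (\<omega> i)) \<Longrightarrow> diff_form A W k (\<lambda>x vs. \<Sum>i\<in>I. \<omega> i x vs)"
  by (induction I rule: infinite_finite_induct) (simp_all add: df_zero df_add)

end

section \<open>Tensoriality of the exterior and Lie derivatives\<close>

context smooth_mfd
begin

lemma lie_add_right:
  assumes V: "open V" "x \<in> V" and X: "vector_field A V X" "vector_field A V X'" "vector_field A V Y"
  shows "lie_bracket A Y (\<lambda>y f. X y f + X' y f) x = (\<lambda>f. lie_bracket A Y X x f + lie_bracket A Y X' x f)"
  unfolding lie_antisym[of Y] lie_add_left[OF V X] by (simp add: fun_eq_iff)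

lemma lie_scale_right:
  assumes V: "open V" "x \<in> V" and X: "vector_field A V X" "vector_field A V Y" and g: "smooth_fun A V g"
  shows "lie_bracket A Y (\<lambda>y f. g y * X y f) x = (\<lambda>f. g x * lie_bracket A Y X x f + Y x g * X x f)"
  unfolding lie_antisym[of Y] lie_scale_left[OF V X g] by (simp add: fun_eq_iff)

text \<open>The extension has constant coefficients in a chart. It lives only near \<open>x\<close>,
  so no cutoff is involved; that suffices because \<open>ext_deriv\<close> and
  \<open>lie_deriv\<close> range over fields on arbitrary neighbourhoods of the point.\<close>

lemma extend_fields:
  assumes W: "open W" "x \<in> W" and vs: "set vs \<subseteq> tangent_space A x"
  obtains V Xs where "open V" "x \<in> V" "V \<subseteq> W" "\<forall>X\<in>set Xs. vector_field A V X" "map (\<lambda>X. X x) Xs = vs"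
proof -
  obtain V c where Vc: "(V, c) \<in> A" "x \<in> V" using chart_exists by blast
  define ext where "ext v = (\<lambda>y f. \<Sum>k<adim A. v (chart_coord c k) * partial V c k y f)" for v :: "'m tvec"
  have "vector_field A (V \<inter> W) (ext v)" for v
  proof -
    have "vector_field A V (ext v)" unfolding ext_def
      by (rule vf_sum[OF chart_open[OF Vc(1)] vf_cscale[OF chart_open[OF Vc(1)] partial_vector_field[OF Vc(1)]]])
    then show ?thesis by (rule vf_mono) auto
  qed
  moreover have "ext v x = v" if "v \<in> tangent_space A x" for v
    by (rule ext) (simp add: ext_def tangent_expand[OF Vc(1) that Vc(2), symmetric])
  then have "map (\<lambda>X. X x) (map ext vs) = vs" using vs by (auto intro!: map_idI)
  ultimately show ?thesis
    using that[of "V \<inter> W" "map ext vs"] W Vc chart_open[OF Vc(1)] by auto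
qed

text \<open>An operator on vector fields that is local, additive and homogeneous over smooth functions
  depends only on the value of the field at the point.\<close>
lemma tensorial:
  fixes T :: "('m \<Rightarrow> 'm tvec) \<Rightarrow> real"
  assumes W: "open W" "x \<in> W"
    and loc: "\<And>V X Y. open V \<Longrightarrow> x \<in> V \<Longrightarrow> V \<subseteq> W \<Longrightarrow> vector_field A V X \<Longrightarrow> vector_field A V Y \<Longrightarrow>
       (\<And>y. y \<in> V \<Longrightarrow> X y = Y y) \<Longrightarrow> T X = T Y"
    and add: "\<And>V X Y. open V \<Longrightarrow> x \<in> V \<Longrightarrow> V \<subseteq> W \<Longrightarrow> vector_field A V X \<Longrightarrow> vector_field A V Y \<Longrightarrow>
       T (\<lambda>y f. X y f + Y y f) = T X + T Y"
    and hom: "\<And>V X g. open V \<Longrightarrow> x \<in> V \<Longrightarrow> V \<subseteq> W \<Longrightarrow> vector_field A V X \<Longrightarrow> smooth_fun A V g \<Longrightarrow>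
       T (\<lambda>y f. g y * X y f) = g x * T X"
    and X: "open V" "x \<in> V" "vector_field A V X" and Y: "open V'" "x \<in> V'" "vector_field A V' Y"
    and eq: "X x = Y x"
  shows "T X = T Y"
proof -
  obtain U c where Uc: "(U, c) \<in> A" "x \<in> U" using chart_exists by blast
  \<comment> \<open>Near \<open>x\<close> the field is a combination of coordinate fields with
    smooth coefficients; locality allows the replacement, and additivity and homogeneity pull the
    values of the coefficients at \<open>x\<close> out of \<open>T\<close>.\<close>
  have key: "T Z = (\<Sum>k<adim A. Z x (chart_coord c k) * T (partial U c k))"
    if Z: "open V" "x \<in> V" "vector_field A V Z" for V Z
  proof -
    let ?N = "U \<inter> V \<inter> W"
    have N: "open ?N" "x \<in> ?N" "?N \<subseteq> W" using Z W Uc chart_open by auto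
    have pv: "vector_field A ?N (partial U c k)" for k
      by (rule vf_mono[OF partial_vector_field[OF Uc(1)]]) auto
    have Zv: "vector_field A ?N Z" by (rule vf_mono[OF Z(3)]) auto
    have cv: "smooth_fun A ?N (\<lambda>y. Z y (chart_coord c k))" for k
      by (rule vf_smooth[OF N(1) Zv smooth_fun_mono[OF smooth_fun_chart_coord[OF Uc(1)]]]) auto
    have sv: "vector_field A ?N (\<lambda>y f. Z y (chart_coord c k) * partial U c k y f)" for k
      by (rule vf_scale[OF cv pv])
    have part: "T (\<lambda>y f. \<Sum>k<n. Z y (chart_coord c k) * partial U c k y f) =
        (\<Sum>k<n. Z x (chart_coord c k) * T (partial U c k))" for n
    proof (induction n)
      case 0
      \<comment> \<open>The value on the zero field comes from homogeneity with the zero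
        function.\<close>
      have "T (\<lambda>y f. 0 * Z y f) = 0 * T Z"
        by (rule hom[OF N Zv smooth_fun_const[OF N(1)]])
      then show ?case by simp
    next
      case (Suc n)
      have "T (\<lambda>y f. (\<Sum>k<n. Z y (chart_coord c k) * partial U c k y f) + Z y (chart_coord c n) * partial U c n y f) =
          T (\<lambda>y f. \<Sum>k<n. Z y (chart_coord c k) * partial U c k y f) + T (\<lambda>y f. Z y (chart_coord c n) * partial U c n y f)"
        by (rule add[OF N vf_sum[OF N(1) sv] sv])
      then show ?case using Suc hom[OF N pv cv, of n n] by simp
    qed
    have "T Z = T (\<lambda>y f. \<Sum>k<adim A. Z y (chart_coord c k) * partial U c k y f)"
    proof (rule loc[OF N Zv vf_sum[OF N(1) sv]])
      fix y assume "y \<in> ?N"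
      then show "Z y = (\<lambda>f. \<Sum>k<adim A. Z y (chart_coord c k) * partial U c k y f)"
        using tangent_expand[OF Uc(1) vf_tangent[OF Zv]] by auto
    qed
    then show ?thesis using part by simp
  qed
  show ?thesis using key[OF X] key[OF Y] eq by simp
qed

text \<open>The invariant formula for the exterior derivative of a 1-form, as \<open>lie1\<close> is
  the one for its Lie derivative. Computations use these expressions in fields; the definite
  descriptions in \<open>ext_deriv\<close> and \<open>lie_deriv\<close> are evaluated to them once
  tensoriality is known.\<close>

definition d1 :: "('m \<Rightarrow> 'm mform) \<Rightarrow> ('m \<Rightarrow> 'm tvec) \<Rightarrow> ('m \<Rightarrow> 'm tvec) \<Rightarrow> 'm \<Rightarrow> real" where
  "d1 \<omega> X Y x = X x (\<lambda>y. \<omega> y [Y y]) - Y x (\<lambda>y. \<omega> y [X y]) - \<omega> x [lie_bracket A X Y x]"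

definition lie1 :: "('m \<Rightarrow> 'm mform) \<Rightarrow> ('m \<Rightarrow> 'm tvec) \<Rightarrow> ('m \<Rightarrow> 'm tvec) \<Rightarrow> 'm \<Rightarrow> real" where
  "lie1 \<omega> X Z x = X x (\<lambda>y. \<omega> y [Z y]) - \<omega> x [lie_bracket A X Z x]"

lemma lie1_add:
  assumes V: "open V" "x \<in> V" and om: "diff_form A V 1 \<omega>" and X: "vector_field A V X"
    and P: "vector_field A V P" and Q: "vector_field A V Q"
  shows "lie1 \<omega> X (\<lambda>y f. P y f + Q y f) x = lie1 \<omega> X P x + lie1 \<omega> X Q x"
proof -
  have "X x (\<lambda>y. \<omega> y [\<lambda>f. P y f + Q y f]) = X x (\<lambda>y. \<omega> y [P y] + \<omega> y [Q y])"
    by (rule vf_fcong[OF V X df_eval1[OF V(1) om vf_add[OF P Q]]])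
      (rule alt1[OF df_alt[OF om] vf_tangent[OF P] vf_tangent[OF Q]])
  then show ?thesis
    unfolding lie1_def lie_add_right[OF V P Q X]
    using vf_fadd[OF V X df_eval1[OF V(1) om P] df_eval1[OF V(1) om Q]]
      alt1(1)[OF df_alt[OF om V(2)] lie_tangent[OF V X P] lie_tangent[OF V X Q]] by simp
qed

lemma lie1_scale:
  assumes V: "open V" "x \<in> V" and om: "diff_form A V 1 \<omega>" and X: "vector_field A V X"
    and P: "vector_field A V P" and g: "smooth_fun A V g"
  shows "lie1 \<omega> X (\<lambda>y f. g y * P y f) x = g x * lie1 \<omega> X P x"
proof -
  have "X x (\<lambda>y. \<omega> y [\<lambda>f. g y * P y f]) = X x (\<lambda>y. g y * \<omega> y [P y])"
    by (rule vf_fcong[OF V X df_eval1[OF V(1) om vf_scale[OF g P]]])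
      (rule alt1(2)[OF df_alt[OF om] vf_tangent[OF P] vf_tangent[OF P]])
  also have "\<dots> = g x * X x (\<lambda>y. \<omega> y [P y]) + \<omega> x [P x] * X x g"
    by (rule vf_fmult[OF V X g df_eval1[OF V(1) om P]])
  moreover have "\<omega> x [\<lambda>f. g x * lie_bracket A X P x f + X x g * P x f] = g x * \<omega> x [lie_bracket A X P x] + X x g * \<omega> x [P x]"
    using alt1(1)[OF df_alt[OF om V(2)] tangent_scale[OF lie_tangent[OF V X P]] tangent_scale[OF vf_tangent[OF P V(2)]]]
      alt1(2)[OF df_alt[OF om V(2)] lie_tangent[OF V X P] lie_tangent[OF V X P]]
      alt1(2)[OF df_alt[OF om V(2)] vf_tangent[OF P V(2)] vf_tangent[OF P V(2)]] by simp
  ultimately show ?thesis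
    unfolding lie1_def lie_scale_right[OF V P X g] by (simp add: algebra_simps)
qed

text \<open>Only the slot of \<open>Z\<close> is tensorial: when \<open>Z\<close> is multiplied by a
  function, the derivative of that function along \<open>X\<close> appears once from the product
  rule and once from the bracket, with opposite signs. The Lie derivative does depend on derivatives
  of \<open>X\<close>.\<close>

lemma lie1_tensorial:
  assumes W: "open W" "x \<in> W" and om: "diff_form A W 1 \<omega>" and X: "vector_field A W X"
    and Z: "open V" "x \<in> V" "vector_field A V Z" and Z': "open V'" "x \<in> V'" "vector_field A V' Z'"
    and eq: "Z x = Z' x"
  shows "lie1 \<omega> X Z x = lie1 \<omega> X Z' x"
proof (rule tensorial[OF W, where T="\<lambda>Z. lie1 \<omega> X Z x", OF _ _ _ Z Z' eq])
  fix V P Q assume V: "open V" "x \<in> V" "V \<subseteq> W" and P: "vector_field A V P" and Q: "vector_field A V Q"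
  note X' = vf_mono[OF X V(3)] and om' = df_mono[OF om V(3)]
  show "lie1 \<omega> X P x = lie1 \<omega> X Q x" if e: "\<And>y. y \<in> V \<Longrightarrow> P y = Q y"
    unfolding lie1_def
    using vf_fcong[OF V(1,2) X' df_eval1[OF V(1) om' P], of "\<lambda>y. \<omega> y [Q y]"] e
      lie_cong[OF V(1,2) X' P refl e] by simp
  show "lie1 \<omega> X (\<lambda>y f. P y f + Q y f) x = lie1 \<omega> X P x + lie1 \<omega> X Q x"
    by (rule lie1_add[OF V(1,2) om' X' P Q])
next
  fix V P g assume V: "open V" "x \<in> V" "V \<subseteq> W" and P: "vector_field A V P" and g: "smooth_fun A V g"
  show "lie1 \<omega> X (\<lambda>y f. g y * P y f) x = g x * lie1 \<omega> X P x"
    by (rule lie1_scale[OF V(1,2) df_mono[OF om V(3)] vf_mono[OF X V(3)] P g])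
qed

lemma d1_swap:
  assumes W: "open W" "x \<in> W" and om: "diff_form A W 1 \<omega>" and X: "vector_field A W X" and Y: "vector_field A W Y"
  shows "d1 \<omega> X Y x = - d1 \<omega> Y X x"
  unfolding d1_def lie_antisym[of X Y]
  using alt1(2)[OF df_alt[OF om W(2)] lie_tangent[OF W Y X] lie_tangent[OF W Y X], of "-1"] by simp

text \<open>By Cartan's formula the value is
  \<open>P x (\<lambda>y. \<omega> y [Y y]) - lie1 \<omega> Y P x\<close>; the first term depends on
  \<open>P\<close> only at \<open>x\<close>, and so does the second by tensoriality of the Lie
  derivative.\<close>

lemma d1_tensorial_left:
  assumes W: "open W" "x \<in> W" and om: "diff_form A W 1 \<omega>" and Y: "vector_field A W Y"
    and Z: "open V" "x \<in> V" "vector_field A V Z" and Z': "open V'" "x \<in> V'" "vector_field A V' Z'"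
    and eq: "Z x = Z' x"
  shows "d1 \<omega> Z Y x = d1 \<omega> Z' Y x"
proof -
  have "d1 \<omega> P Y x = P x (\<lambda>y. \<omega> y [Y y]) - lie1 \<omega> Y P x" if P: "open V" "x \<in> V" "vector_field A V P" for P V
  proof -
    let ?N = "V \<inter> W"
    have N: "open ?N" "x \<in> ?N" using W P by auto
    have PY: "vector_field A ?N Y" "vector_field A ?N P"
      by (rule vf_mono[OF Y], blast, rule vf_mono[OF P(3)], blast)
    show ?thesis
      unfolding d1_def lie1_def lie_antisym[of P Y]
      using alt1(2)[OF df_alt[OF om W(2)] lie_tangent[OF N PY] lie_tangent[OF N PY], of "-1"] by simp
  qed
  from this[OF Z] this[OF Z'] show ?thesis
    using lie1_tensorial[OF W om Y Z Z' eq] eq by simp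
qed

lemma d1_tensorial:
  assumes W: "open W" "x \<in> W" and om: "diff_form A W 1 \<omega>"
    and X: "vector_field A W X" "vector_field A W X'" "X x = X' x"
    and Y: "vector_field A W Y" "vector_field A W Y'" "Y x = Y' x"
  shows "d1 \<omega> X Y x = d1 \<omega> X' Y' x"
proof -
  have "d1 \<omega> X Y x = d1 \<omega> X' Y x"
    by (rule d1_tensorial_left[OF W om Y(1) W X(1) W X(2,3)])
  also have "\<dots> = - d1 \<omega> Y X' x" by (rule d1_swap[OF W om X(2) Y(1)])
  also have "\<dots> = - d1 \<omega> Y' X' x"
    using d1_tensorial_left[OF W om X(2) W Y(1) W Y(2,3)] by simp
  also have "\<dots> = d1 \<omega> X' Y' x" using d1_swap[OF W om X(2) Y(2)] by simp
  finally show ?thesis .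
qed

text \<open>A definite description over all extensions needs both that they give the same number and
  that there is at least one, which is \<open>extend_fields\<close>.\<close>

lemma ext_deriv_eqI:
  assumes vs: "set vs \<subseteq> tangent_space A x"
    and r: "\<And>V Xs. open V \<Longrightarrow> x \<in> V \<Longrightarrow> \<forall>X\<in>set Xs. vector_field A V X \<Longrightarrow> map (\<lambda>X. X x) Xs = vs \<Longrightarrow>
      ext_deriv_fields A \<omega> Xs x = r"
  shows "ext_deriv A \<omega> x vs = r"
proof -
  obtain V Xs where V: "open V" "x \<in> V" "V \<subseteq> UNIV" "\<forall>X\<in>set Xs. vector_field A V X" "map (\<lambda>X. X x) Xs = vs"
    by (rule extend_fields[OF open_UNIV UNIV_I vs])
  have "(THE r. \<forall>V Xs. open V \<and> x \<in> V \<and> (\<forall>X\<in>set Xs. vector_field A V X) \<and> map (\<lambda>X. X x) Xs = vs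
            \<longrightarrow> r = ext_deriv_fields A \<omega> Xs x) = r"
  proof (rule the_equality)
    show "\<forall>V Xs. open V \<and> x \<in> V \<and> (\<forall>X\<in>set Xs. vector_field A V X) \<and> map (\<lambda>X. X x) Xs = vs
            \<longrightarrow> r = ext_deriv_fields A \<omega> Xs x"
      using r by (auto simp del: map_eq_conv)
    fix r' assume "\<forall>V Xs. open V \<and> x \<in> V \<and> (\<forall>X\<in>set Xs. vector_field A V X) \<and> map (\<lambda>X. X x) Xs = vs
            \<longrightarrow> r' = ext_deriv_fields A \<omega> Xs x"
    then have "r' = ext_deriv_fields A \<omega> Xs x" using V(1,2,4,5) by blast
    then show "r' = r" using r[OF V(1,2,4,5)] by simp
  qed
  then show ?thesis using vs by (simp add: ext_deriv_def)
qed

lemma lie_deriv_eqI: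
  assumes vs: "set vs \<subseteq> tangent_space A x"
    and r: "\<And>V Zs. open V \<Longrightarrow> x \<in> V \<Longrightarrow> \<forall>Z\<in>set Zs. vector_field A V Z \<Longrightarrow> map (\<lambda>Z. Z x) Zs = vs \<Longrightarrow>
      X x (\<lambda>y. \<omega> y (map (\<lambda>Z. Z y) Zs)) - (\<Sum>i<length Zs. \<omega> x (vs[i := lie_bracket A X (Zs ! i) x])) = r"
  shows "lie_deriv A X \<omega> x vs = r"
proof -
  let ?R = "\<lambda>Zs. X x (\<lambda>y. \<omega> y (map (\<lambda>Z. Z y) Zs)) - (\<Sum>i<length Zs. \<omega> x (vs[i := lie_bracket A X (Zs ! i) x]))"
  obtain V Xs where V: "open V" "x \<in> V" "V \<subseteq> UNIV" "\<forall>X\<in>set Xs. vector_field A V X" "map (\<lambda>X. X x) Xs = vs"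
    by (rule extend_fields[OF open_UNIV UNIV_I vs])
  have "(THE r. \<forall>V Zs. open V \<and> x \<in> V \<and> (\<forall>Z\<in>set Zs. vector_field A V Z) \<and> map (\<lambda>Z. Z x) Zs = vs \<longrightarrow> r = ?R Zs) = r"
  proof (rule the_equality)
    show "\<forall>V Zs. open V \<and> x \<in> V \<and> (\<forall>X\<in>set Zs. vector_field A V X) \<and> map (\<lambda>X. X x) Zs = vs \<longrightarrow> r = ?R Zs"
    proof (intro allI impI; elim conjE)
      fix V Zs assume "open V" "x \<in> V" "\<forall>X\<in>set Zs. vector_field A V X" "map (\<lambda>X. X x) Zs = vs"
      from r[OF this] show "r = ?R Zs" by simp
    qed
    fix r' assume "\<forall>V Zs. open V \<and> x \<in> V \<and> (\<forall>X\<in>set Zs. vector_field A V X) \<and> map (\<lambda>X. X x) Zs = vs \<longrightarrow> r' = ?R Zs"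
    then have "r' = ?R Xs" using V(1,2,4,5) by blast
    then show "r' = r" using r[OF V(1,2,4,5)] by simp
  qed
  then show ?thesis using vs by (simp add: lie_deriv_def)
qed

lemma ext_deriv_fields_2: "ext_deriv_fields A \<omega> [X, Y] x = d1 \<omega> X Y x"
  by (simp add: ext_deriv_fields_def d1_def numeral_2_eq_2 lessThan_Suc nths_Cons)

lemma ext_deriv_1:
  assumes W: "open W" "x \<in> W" and om: "diff_form A W 1 \<omega>" and X: "vector_field A W X" and Y: "vector_field A W Y"
  shows "ext_deriv A \<omega> x [X x, Y x] = d1 \<omega> X Y x"
proof (rule ext_deriv_eqI)
  show "set [X x, Y x] \<subseteq> tangent_space A x" using vf_tangent[OF X W(2)] vf_tangent[OF Y W(2)] by simp
  fix V Xs assume V: "open V" "x \<in> V" "\<forall>X\<in>set Xs. vector_field A V X" and eq: "map (\<lambda>X. X x) Xs = [X x, Y x]"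
  then obtain X' Y' where XY: "Xs = [X', Y']" "X' x = X x" "Y' x = Y x"
    by (auto simp: map_eq_Cons_conv)
  have N: "open (V \<inter> W)" "x \<in> V \<inter> W" using V W by auto
  have mono: "vector_field A V P \<Longrightarrow> vector_field A (V \<inter> W) P" "vector_field A W P \<Longrightarrow> vector_field A (V \<inter> W) P" for P
    by (auto intro: vf_mono)
  have "d1 \<omega> X' Y' x = d1 \<omega> X Y x"
    by (rule d1_tensorial[OF N df_mono[OF om]]) (use V XY X Y mono in auto)
  then show "ext_deriv_fields A \<omega> Xs x = d1 \<omega> X Y x" by (simp add: XY(1) ext_deriv_fields_2)
qed

lemma lie_deriv_1:
  assumes W: "open W" "x \<in> W" and om: "diff_form A W 1 \<omega>" and X: "vector_field A W X" and Z: "vector_field A W Z"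
  shows "lie_deriv A X \<omega> x [Z x] = lie1 \<omega> X Z x"
proof (rule lie_deriv_eqI)
  show "set [Z x] \<subseteq> tangent_space A x" using vf_tangent[OF Z W(2)] by simp
  fix V Zs assume V: "open V" "x \<in> V" "\<forall>X\<in>set Zs. vector_field A V X" and eq: "map (\<lambda>X. X x) Zs = [Z x]"
  then obtain Z' where Z': "Zs = [Z']" "Z' x = Z x" by (auto simp: map_eq_Cons_conv)
  have "lie1 \<omega> X Z' x = lie1 \<omega> X Z x"
    by (rule lie1_tensorial[where Z=Z' and Z'=Z and V=V and V'=W, OF W om X V(1,2) _ W Z Z'(2)]) (use V Z' in auto)
  then show "X x (\<lambda>y. \<omega> y (map (\<lambda>Z. Z y) Zs)) - (\<Sum>i<length Zs. \<omega> x ([Z x][i := lie_bracket A X (Zs ! i) x])) = lie1 \<omega> X Z x"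
    by (simp add: Z'(1) lie1_def)
qed

lemma df_wrong_length_deriv:
  assumes W: "open W" "x \<in> W" and om: "diff_form A W k \<omega>" and X: "v \<in> tangent_space A x" and len: "length Xs \<noteq> k"
  shows "v (\<lambda>y. \<omega> y (map (\<lambda>X. X y) Xs)) = 0"
proof -
  have "v (\<lambda>y. 0) = v (\<lambda>y. \<omega> y (map (\<lambda>X. X y) Xs))"
    by (rule tan_cong[OF X W smooth_fun_const[OF W(1)]]) (use alt_forms_zero[OF df_alt[OF om]] len in auto)
  then show ?thesis using tan_const[OF X] by simp
qed

lemma lie_deriv_wrong_length:
  assumes W: "open W" "x \<in> W" and om: "diff_form A W k \<omega>" and X: "vector_field A W X" and len: "length vs \<noteq> k"
  shows "lie_deriv A X \<omega> x vs = 0"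
proof (cases "set vs \<subseteq> tangent_space A x")
  case True
  show ?thesis
  proof (rule lie_deriv_eqI[OF True])
    fix V Zs assume V: "open V" "x \<in> V" "\<forall>X\<in>set Zs. vector_field A V X" and eq: "map (\<lambda>X. X x) Zs = vs"
    have l: "length Zs \<noteq> k" using len eq by auto
    show "X x (\<lambda>y. \<omega> y (map (\<lambda>Z. Z y) Zs)) - (\<Sum>i<length Zs. \<omega> x (vs[i := lie_bracket A X (Zs ! i) x])) = 0"
      using df_wrong_length_deriv[OF W om vf_tangent[OF X W(2)] l] alt_forms_zero[OF df_alt[OF om W(2)]] len by simp
  qed
qed (simp add: lie_deriv_def)

text \<open>Each term of the invariant formula evaluates the form on a list of the wrong length.
  Together with the default value off the tangent space this places \<open>ext_deriv\<close> in the
  convention of \<open>alt_forms\<close>, where forms are 0 on inadmissible lists.\<close>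

lemma ext_deriv_wrong_length:
  assumes W: "open W" "x \<in> W" and om: "diff_form A W k \<omega>" and len: "length vs \<noteq> Suc k"
  shows "ext_deriv A \<omega> x vs = 0"
proof (cases "set vs \<subseteq> tangent_space A x")
  case True
  show ?thesis
  proof (rule ext_deriv_eqI[OF True])
    fix V Xs assume V: "open V" "x \<in> V" "\<forall>X\<in>set Xs. vector_field A V X" and eq: "map (\<lambda>X. X x) Xs = vs"
    have l: "length Xs \<noteq> Suc k" using len eq by auto
    have l1: "length (nths Xs (- {i})) = length Xs - 1" if "i < length Xs" for i
    proof -
      have "{j. j < length Xs \<and> j \<in> - {i}} = {..<length Xs} - {i}" by auto
      then show ?thesis using that by (simp add: length_nths)
    qed
    have l2: "length (nths Xs (- {i, j})) = length Xs - 2" if "i < j" "j < length Xs" for i j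
    proof -
      have "{l. l < length Xs \<and> l \<in> - {i, j}} = {..<length Xs} - {i, j}" by auto
      then show ?thesis using that by (simp add: length_nths card_Diff_subset)
    qed
    have a: "(Xs ! i) x (\<lambda>y. \<omega> y (map (\<lambda>X. X y) (nths Xs (- {i})))) = 0" if i: "i < length Xs" for i
      by (rule df_wrong_length_deriv[OF W om vf_tangent[of V]]) (use V i l l1[OF i] in auto)
    have b: "\<omega> x (v # map (\<lambda>X. X x) (nths Xs (- {i, j}))) = 0" if "i < j" "j < length Xs" for i j v
      by (rule alt_forms_zero[OF df_alt[OF om W(2)]]) (use that l l2[OF that] in auto)
    show "ext_deriv_fields A \<omega> Xs x = 0"
      unfolding ext_deriv_fields_def using a b by simp
  qed
qed (simp add: ext_deriv_def)

section \<open>The exterior derivative of a 2-form\<close>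

definition d2 :: "('m \<Rightarrow> 'm mform) \<Rightarrow> ('m \<Rightarrow> 'm tvec) \<Rightarrow> ('m \<Rightarrow> 'm tvec) \<Rightarrow> ('m \<Rightarrow> 'm tvec) \<Rightarrow> 'm \<Rightarrow> real" where
  "d2 \<omega> X Y Z x = X x (\<lambda>y. \<omega> y [Y y, Z y]) - Y x (\<lambda>y. \<omega> y [X y, Z y]) + Z x (\<lambda>y. \<omega> y [X y, Y y])
    - \<omega> x [lie_bracket A X Y x, Z x] + \<omega> x [lie_bracket A X Z x, Y x] - \<omega> x [lie_bracket A Y Z x, X x]"

lemma ext_deriv_fields_3: "ext_deriv_fields A \<omega> [X, Y, Z] x = d2 \<omega> X Y Z x"
  by (simp add: ext_deriv_fields_def d2_def numeral_3_eq_3 lessThan_Suc nths_Cons)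

text \<open>Contraction in the last slot: it turns tensoriality of \<open>d\<close> on 2-forms into the case of 1-forms.\<close>
definition contr :: "('m \<Rightarrow> 'm mform) \<Rightarrow> ('m \<Rightarrow> 'm tvec) \<Rightarrow> 'm \<Rightarrow> 'm mform" where
  "contr \<omega> Z y = (\<lambda>vs. if length vs = 1 then \<omega> y (vs @ [Z y]) else 0)"

lemma alt_forms_1I:
  assumes "\<And>vs. \<not> (set vs \<subseteq> tangent_space A x \<and> length vs = 1) \<Longrightarrow> \<omega> vs = 0"
    and "\<And>u v. u \<in> tangent_space A x \<Longrightarrow> v \<in> tangent_space A x \<Longrightarrow> \<omega> [\<lambda>f. u f + v f] = \<omega> [u] + \<omega> [v]"
    and "\<And>u a. u \<in> tangent_space A x \<Longrightarrow> \<omega> [\<lambda>f. a * u f] = a * \<omega> [u]"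
  shows "\<omega> \<in> alt_forms A 1 x"
  unfolding alt_forms_def mem_Collect_eq using assms by (auto simp: length_Suc_conv)

lemma df1I:
  assumes "\<And>x. x \<in> W \<Longrightarrow> \<omega> x \<in> alt_forms A 1 x"
    and "\<And>V X. open V \<Longrightarrow> V \<subseteq> W \<Longrightarrow> vector_field A V X \<Longrightarrow> smooth_fun A V (\<lambda>x. \<omega> x [X x])"
  shows "diff_form A W 1 \<omega>"
  using assms by (intro diff_formI) (auto simp: length_Suc_conv)

lemma df_contr:
  assumes om: "diff_form A W 2 \<omega>" and Z: "vector_field A W Z"
  shows "diff_form A W 1 (contr \<omega> Z)"
proof (rule df1I)
  fix x assume x: "x \<in> W"
  note al = df_alt[OF om x] and Zx = vf_tangent[OF Z x]
  show "contr \<omega> Z x \<in> alt_forms A 1 x"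
  proof (rule alt_forms_1I)
    fix vs assume "\<not> (set vs \<subseteq> tangent_space A x \<and> length vs = 1)"
    then show "contr \<omega> Z x vs = 0" using alt_forms_zero[OF al, of "vs @ [Z x]"] by (auto simp: contr_def)
  qed (use alt2[OF al _ _ Zx] in \<open>auto simp: contr_def\<close>)
next
  fix V X assume V: "open V" "V \<subseteq> W" "vector_field A V X"
  show "smooth_fun A V (\<lambda>x. contr \<omega> Z x [X x])"
    unfolding contr_def using df_eval2[OF V(1) df_mono[OF om V(2)] V(3) vf_mono[OF Z V(2)]] by simp
qed

context
  fixes W x \<omega> assumes W: "open W" "x \<in> W" and om: "diff_form A W 2 \<omega>"
begin

text \<open>The terms are grouped so that each summand depends on \<open>X\<close> only at the
  point: the exterior derivative of a contracted 1-form, the Lie derivative of another, and an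
  algebraic term.\<close>

lemma d2_split:
  assumes X: "open V" "x \<in> V" "vector_field A V X" and Y: "vector_field A W Y" and Z: "vector_field A W Z"
  shows "d2 \<omega> X Y Z x = d1 (contr \<omega> Z) X Y x + lie1 (contr \<omega> Y) Z X x + \<omega> x [X x, lie_bracket A Y Z x]"
proof -
  have N: "open (V \<inter> W)" "x \<in> V \<inter> W" using X W by auto
  have ZX: "vector_field A (V \<inter> W) Z" "vector_field A (V \<inter> W) X"
    by (rule vf_mono[OF Z], blast, rule vf_mono[OF X(3)], blast)
  note al = df_alt[OF om W(2)]
  have "\<omega> x [lie_bracket A X Z x, Y x] = - \<omega> x [lie_bracket A Z X x, Y x]"
    using alt2(2)[OF al lie_tangent[OF N ZX] lie_tangent[OF N ZX] vf_tangent[OF Y W(2)], of "-1"]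
    by (simp add: lie_antisym[of X Z])
  moreover have "\<omega> x [lie_bracket A Y Z x, X x] = - \<omega> x [X x, lie_bracket A Y Z x]"
    by (rule alt2_swap[OF al lie_tangent[OF W Y Z] vf_tangent[OF ZX(2) N(2)]])
  ultimately show ?thesis by (simp add: d2_def d1_def lie1_def contr_def)
qed

lemma d2_tensorial_left:
  assumes Y: "vector_field A W Y" and Z: "vector_field A W Z"
    and X: "open V" "x \<in> V" "vector_field A V X" and X': "open V'" "x \<in> V'" "vector_field A V' X'"
    and eq: "X x = X' x"
  shows "d2 \<omega> X Y Z x = d2 \<omega> X' Y Z x"
  unfolding d2_split[OF X Y Z] d2_split[OF X' Y Z]
  using d1_tensorial_left[OF W df_contr[OF om Z] Y X X' eq] lie1_tensorial[OF W df_contr[OF om Y] Z X X' eq] eq by simp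

lemma d2_swap:
  assumes X: "vector_field A W X" and Y: "vector_field A W Y" and Z: "vector_field A W Z"
  shows "d2 \<omega> X Y Z x = - d2 \<omega> Y X Z x" "d2 \<omega> X Y Z x = - d2 \<omega> X Z Y x"
proof -
  have al: "y \<in> W \<Longrightarrow> \<omega> y \<in> alt_forms A 2 y" for y by (rule df_alt[OF om])
  have flip: "P x (\<lambda>y. \<omega> y [Q y, R y]) = - P x (\<lambda>y. \<omega> y [R y, Q y])"
    if "vector_field A W P" "vector_field A W Q" "vector_field A W R" for P Q R
  proof -
    have "P x (\<lambda>y. \<omega> y [Q y, R y]) = P x (\<lambda>y. - \<omega> y [R y, Q y])"
      by (rule vf_fcong[OF W that(1) df_eval2[OF W(1) om that(2,3)]])
        (rule alt2_swap[OF al vf_tangent[OF that(2)] vf_tangent[OF that(3)]])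
    then show ?thesis using vf_fminus[OF W that(1) df_eval2[OF W(1) om that(3,2)]] by simp
  qed
  have lf: "\<omega> x [lie_bracket A Q P x, R x] = - \<omega> x [lie_bracket A P Q x, R x]"
    if "vector_field A W P" "vector_field A W Q" "vector_field A W R" for P Q R
    using alt2(2)[OF al[OF W(2)] lie_tangent[OF W that(1,2)] lie_tangent[OF W that(1,2)] vf_tangent[OF that(3) W(2)], of "-1"]
    by (simp add: lie_antisym[of Q P])
  show "d2 \<omega> X Y Z x = - d2 \<omega> Y X Z x"
    unfolding d2_def using flip[OF Z X Y] lf[OF X Y Z] by simp
  show "d2 \<omega> X Y Z x = - d2 \<omega> X Z Y x"
    unfolding d2_def using flip[OF X Y Z] lf[OF Y Z X] by simp
qed

end

text \<open>Tensoriality in the first slot and the transpositions suffice: each field is brought to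
  the front and replaced there, and the order is restored at the end.\<close>

lemma d2_tensorial:
  assumes W: "open W" "x \<in> W" and om: "diff_form A W 2 \<omega>"
    and X: "vector_field A W X" "vector_field A W X'" "X x = X' x"
    and Y: "vector_field A W Y" "vector_field A W Y'" "Y x = Y' x"
    and Z: "vector_field A W Z" "vector_field A W Z'" "Z x = Z' x"
  shows "d2 \<omega> X Y Z x = d2 \<omega> X' Y' Z' x"
proof -
  note sw = d2_swap[OF W om] and t = d2_tensorial_left[OF W om]
  have "d2 \<omega> X Y Z x = d2 \<omega> X' Y Z x" by (rule t[OF Y(1) Z(1) W X(1) W X(2,3)])
  also have "\<dots> = - d2 \<omega> Y X' Z x" by (rule sw(1)[OF X(2) Y(1) Z(1)])
  also have "d2 \<omega> Y X' Z x = d2 \<omega> Y' X' Z x" by (rule t[OF X(2) Z(1) W Y(1) W Y(2,3)])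
  also have "\<dots> = - d2 \<omega> Y' Z X' x" by (rule sw(2)[OF Y(2) X(2) Z(1)])
  also have "d2 \<omega> Y' Z X' x = - d2 \<omega> Z Y' X' x" by (rule sw(1)[OF Y(2) Z(1) X(2)])
  also have "d2 \<omega> Z Y' X' x = d2 \<omega> Z' Y' X' x" by (rule t[OF Y(2) X(2) W Z(1) W Z(2,3)])
  also have "\<dots> = - d2 \<omega> Y' Z' X' x" by (rule sw(1)[OF Z(2) Y(2) X(2)])
  also have "d2 \<omega> Y' Z' X' x = - d2 \<omega> Y' X' Z' x" by (rule sw(2)[OF Y(2) Z(2) X(2)])
  also have "d2 \<omega> Y' X' Z' x = - d2 \<omega> X' Y' Z' x" by (rule sw(1)[OF Y(2) X(2) Z(2)])
  finally show ?thesis by simp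
qed

lemma ext_deriv_2:
  assumes W: "open W" "x \<in> W" and om: "diff_form A W 2 \<omega>"
    and X: "vector_field A W X" and Y: "vector_field A W Y" and Z: "vector_field A W Z"
  shows "ext_deriv A \<omega> x [X x, Y x, Z x] = d2 \<omega> X Y Z x"
proof (rule ext_deriv_eqI)
  show "set [X x, Y x, Z x] \<subseteq> tangent_space A x"
    using vf_tangent[OF X W(2)] vf_tangent[OF Y W(2)] vf_tangent[OF Z W(2)] by simp
  fix V Xs assume V: "open V" "x \<in> V" "\<forall>X\<in>set Xs. vector_field A V X" and eq: "map (\<lambda>X. X x) Xs = [X x, Y x, Z x]"
  then obtain X' Y' Z' where XY: "Xs = [X', Y', Z']" "X' x = X x" "Y' x = Y x" "Z' x = Z x"
    by (auto simp: map_eq_Cons_conv)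
  have N: "open (V \<inter> W)" "x \<in> V \<inter> W" using V W by auto
  have mono: "vector_field A V P \<Longrightarrow> vector_field A (V \<inter> W) P" "vector_field A W P \<Longrightarrow> vector_field A (V \<inter> W) P" for P
    by (auto intro: vf_mono)
  have "d2 \<omega> X' Y' Z' x = d2 \<omega> X Y Z x"
    by (rule d2_tensorial[OF N df_mono[OF om]]) (use V XY X Y Z mono in auto)
  then show "ext_deriv_fields A \<omega> Xs x = d2 \<omega> X Y Z x" by (simp add: XY(1) ext_deriv_fields_3)
qed

lemma extend3:
  assumes W: "open W" "x \<in> W" and "u \<in> tangent_space A x" "v \<in> tangent_space A x" "w \<in> tangent_space A x"
  obtains V X Y Z where "open V" "x \<in> V" "V \<subseteq> W" "vector_field A V X" "vector_field A V Y" "vector_field A V Z"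
    "X x = u" "Y x = v" "Z x = w"
proof -
  have "set [u, v, w] \<subseteq> tangent_space A x" using assms by simp
  then obtain V Xs where V: "open V" "x \<in> V" "V \<subseteq> W" "\<forall>X\<in>set Xs. vector_field A V X" "map (\<lambda>X. X x) Xs = [u, v, w]"
    by (rule extend_fields[OF W])
  then obtain X Y Z where "Xs = [X, Y, Z]" "X x = u" "Y x = v" "Z x = w"
    by (auto simp: map_eq_Cons_conv)
  with V that show ?thesis by auto
qed

text \<open>Once neighbouring transpositions change the sign, linearity in the first slot carries
  over to the others, and a repeated argument gives a value equal to its negative.\<close>

lemma alt_forms_3I:
  assumes zero: "\<And>vs. \<not> (set vs \<subseteq> tangent_space A x \<and> length vs = 3) \<Longrightarrow> \<omega> vs = 0"
    and add: "\<And>u v w z. u \<in> tangent_space A x \<Longrightarrow> v \<in> tangent_space A x \<Longrightarrow> w \<in> tangent_space A x \<Longrightarrow> z \<in> tangent_space A x \<Longrightarrow>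
        \<omega> [\<lambda>f. u f + v f, w, z] = \<omega> [u, w, z] + \<omega> [v, w, z]"
    and scale: "\<And>u a w z. u \<in> tangent_space A x \<Longrightarrow> w \<in> tangent_space A x \<Longrightarrow> z \<in> tangent_space A x \<Longrightarrow>
        \<omega> [\<lambda>f. a * u f, w, z] = a * \<omega> [u, w, z]"
    and s1: "\<And>u v w. u \<in> tangent_space A x \<Longrightarrow> v \<in> tangent_space A x \<Longrightarrow> w \<in> tangent_space A x \<Longrightarrow> \<omega> [u, v, w] = - \<omega> [v, u, w]"
    and s2: "\<And>u v w. u \<in> tangent_space A x \<Longrightarrow> v \<in> tangent_space A x \<Longrightarrow> w \<in> tangent_space A x \<Longrightarrow> \<omega> [u, v, w] = - \<omega> [u, w, v]"
  shows "\<omega> \<in> alt_forms A 3 x"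
  unfolding alt_forms_def mem_Collect_eq
proof (intro conjI allI impI ballI; (elim conjE)?)
  fix vs assume "\<not> (set vs \<subseteq> tangent_space A x \<and> length vs = 3)"
  then show "\<omega> vs = 0" by (rule zero)
next
  have s3: "\<omega> [u, v, w] = - \<omega> [w, v, u]"
    if "u \<in> tangent_space A x" "v \<in> tangent_space A x" "w \<in> tangent_space A x" for u v w
    using s1[OF that] s2[OF that(2,1,3)] s1[OF that(2,3,1)] by simp
  fix vs assume vs: "set vs \<subseteq> tangent_space A x" "length vs = 3"
  then obtain p q r where pqr: "vs = [p, q, r]" "p \<in> tangent_space A x" "q \<in> tangent_space A x" "r \<in> tangent_space A x"
    by (auto simp: numeral_3_eq_3 length_Suc_conv)
  {
    fix i :: nat and u v :: "'m tvec" and a :: real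
    assume i: "i < 3" and uv: "u \<in> tangent_space A x" "v \<in> tangent_space A x"
    note t = pqr uv tangent_add[OF uv] tangent_scale[OF uv(1)]
    consider "i = 0" | "i = 1" | "i = 2" using i by linarith
    then show "\<omega> (vs[i := (\<lambda>f. u f + v f)]) = \<omega> (vs[i := u]) + \<omega> (vs[i := v])"
    proof cases
      case 1 then show ?thesis using add[of u v q r] t by simp
    next
      case 2 then show ?thesis
        using add[of u v p r] s1[of p "\<lambda>f. u f + v f" r] s1[of p u r] s1[of p v r] t by simp
    next
      case 3 then show ?thesis
        using add[of u v q p] s3[of p q "\<lambda>f. u f + v f"] s3[of p q u] s3[of p q v] t by simp
    qed
    from i consider "i = 0" | "i = 1" | "i = 2" by linarith
    then show "\<omega> (vs[i := (\<lambda>f. a * u f)]) = a * \<omega> (vs[i := u])"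
    proof cases
      case 1 then show ?thesis using scale[of u q r a] t by simp
    next
      case 2 then show ?thesis
        using scale[of u p r a] s1[of p "\<lambda>f. a * u f" r] s1[of p u r] t by simp
    next
      case 3 then show ?thesis
        using scale[of u q p a] s3[of p q "\<lambda>f. a * u f"] s3[of p q u] t by simp
    qed
  next
    fix i j :: nat assume ij: "i < j" "j < 3" "vs ! i = vs ! j"
    then consider "i = 0" "j = 1" | "i = 0" "j = 2" | "i = 1" "j = 2" by linarith
    then show "\<omega> vs = 0"
      by cases (use s1[of p q r] s2[of p q r] s3[of p q r] ij pqr in auto)
  }
qed

text \<open>All claims at a point are transferred to \<open>d2\<close> on local extensions by
  \<open>ext_deriv_2\<close>: skewness comes from \<open>d2_swap\<close>, linearity from extending
  all arguments on one common neighbourhood, and smoothness from the shape of the invariant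
  formula.\<close>

lemma df_ext_deriv_2:
  assumes W: "open W" and om: "diff_form A W 2 \<omega>"
  shows "diff_form A W 3 (ext_deriv A \<omega>)"
proof (rule diff_formI)
  fix x assume x: "x \<in> W"
  note ex = extend3[OF W x]
  have swap: "ext_deriv A \<omega> x [u, v, w] = - ext_deriv A \<omega> x [v, u, w]" "ext_deriv A \<omega> x [u, v, w] = - ext_deriv A \<omega> x [u, w, v]"
    if uvw: "u \<in> tangent_space A x" "v \<in> tangent_space A x" "w \<in> tangent_space A x" for u v w
  proof -
    obtain V X Y Z where V: "open V" "x \<in> V" "V \<subseteq> W" and F: "vector_field A V X" "vector_field A V Y" "vector_field A V Z"
      and eq: "X x = u" "Y x = v" "Z x = w" by (rule ex[OF uvw])
    note e = ext_deriv_2[OF V(1,2) df_mono[OF om V(3)]] and s = d2_swap[OF V(1,2) df_mono[OF om V(3)]]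
    show "ext_deriv A \<omega> x [u, v, w] = - ext_deriv A \<omega> x [v, u, w]" "ext_deriv A \<omega> x [u, v, w] = - ext_deriv A \<omega> x [u, w, v]"
      using e[OF F(1,2,3)] e[OF F(2,1,3)] e[OF F(1,3,2)] s[OF F(1,2,3)] by (simp_all add: eq)
  qed
  show "ext_deriv A \<omega> x \<in> alt_forms A 3 x"
  proof (rule alt_forms_3I[where \<omega>="ext_deriv A \<omega> x", OF _ _ _ swap])
    fix vs assume "\<not> (set vs \<subseteq> tangent_space A x \<and> length vs = 3)"
    then show "ext_deriv A \<omega> x vs = 0"
      using ext_deriv_wrong_length[OF W x om, of vs] by (auto simp: ext_deriv_def)
  next
    fix u v w z assume t: "u \<in> tangent_space A x" "v \<in> tangent_space A x" "w \<in> tangent_space A x" "z \<in> tangent_space A x"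
    have "set [u, v, w, z] \<subseteq> tangent_space A x" using t by simp
    then obtain V Xs where V: "open V" "x \<in> V" "V \<subseteq> W" "\<forall>X\<in>set Xs. vector_field A V X" "map (\<lambda>X. X x) Xs = [u, v, w, z]"
      by (rule extend_fields[OF W x])
    then obtain P Q Y Z where F0: "Xs = [P, Q, Y, Z]" and eq: "P x = u" "Q x = v" "Y x = w" "Z x = z"
      by (auto simp: map_eq_Cons_conv)
    then have F: "vector_field A V P" "vector_field A V Q" "vector_field A V Y" "vector_field A V Z" using V(4) by auto
    note PQ = vf_add[OF F(1,2)]
    note om' = df_mono[OF om V(3)]
    note e = ext_deriv_2[OF V(1,2) om']
    have al: "y \<in> V \<Longrightarrow> \<omega> y \<in> alt_forms A 2 y" for y by (rule df_alt[OF om'])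
    have sp: "R x (\<lambda>y. \<omega> y [\<lambda>f. P y f + Q y f, S y]) = R x (\<lambda>y. \<omega> y [P y, S y]) + R x (\<lambda>y. \<omega> y [Q y, S y])"
      if R: "vector_field A V R" and S: "vector_field A V S" for R S
    proof -
      have "R x (\<lambda>y. \<omega> y [\<lambda>f. P y f + Q y f, S y]) = R x (\<lambda>y. \<omega> y [P y, S y] + \<omega> y [Q y, S y])"
        by (rule vf_fcong[OF V(1,2) R df_eval2[OF V(1) om' PQ S]])
          (rule alt2(1)[OF al vf_tangent[OF F(1)] vf_tangent[OF F(2)] vf_tangent[OF S]])
      then show ?thesis
        using vf_fadd[OF V(1,2) R df_eval2[OF V(1) om' F(1) S] df_eval2[OF V(1) om' F(2) S]] by simp
    qed
    have lp: "\<omega> x [lie_bracket A (\<lambda>y f. P y f + Q y f) S x, R x] = \<omega> x [lie_bracket A P S x, R x] + \<omega> x [lie_bracket A Q S x, R x]"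
      if R: "vector_field A V R" and S: "vector_field A V S" for R S
      unfolding lie_add_left[OF V(1,2) F(1,2) S]
      by (rule alt2(1)[OF al[OF V(2)] lie_tangent[OF V(1,2) F(1) S] lie_tangent[OF V(1,2) F(2) S] vf_tangent[OF R V(2)]])
    have "d2 \<omega> (\<lambda>y f. P y f + Q y f) Y Z x = d2 \<omega> P Y Z x + d2 \<omega> Q Y Z x"
      unfolding d2_def sp[OF F(3,4)] sp[OF F(4,3)] lp[OF F(3,4)] lp[OF F(4,3)]
      using alt2(3)[OF al[OF V(2)] vf_tangent[OF F(1) V(2)] vf_tangent[OF F(2) V(2)] lie_tangent[OF V(1,2) F(3,4)]]
      by simp
    then show "ext_deriv A \<omega> x [\<lambda>f. u f + v f, w, z] = ext_deriv A \<omega> x [u, w, z] + ext_deriv A \<omega> x [v, w, z]"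
      using e[OF PQ F(3,4)] e[OF F(1,3,4)] e[OF F(2,3,4)] by (simp add: eq)
  next
    fix u a w z assume t: "u \<in> tangent_space A x" "w \<in> tangent_space A x" "z \<in> tangent_space A x"
    obtain V P Y Z where V: "open V" "x \<in> V" "V \<subseteq> W" and F: "vector_field A V P" "vector_field A V Y" "vector_field A V Z"
      and eq: "P x = u" "Y x = w" "Z x = z" by (rule ex[OF t])
    note aP = vf_cscale[OF V(1) F(1), of a]
    note om' = df_mono[OF om V(3)]
    note e = ext_deriv_2[OF V(1,2) om']
    have al: "y \<in> V \<Longrightarrow> \<omega> y \<in> alt_forms A 2 y" for y by (rule df_alt[OF om'])
    have sp: "R x (\<lambda>y. \<omega> y [\<lambda>f. a * P y f, S y]) = a * R x (\<lambda>y. \<omega> y [P y, S y])"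
      if R: "vector_field A V R" and S: "vector_field A V S" for R S
    proof -
      have "R x (\<lambda>y. \<omega> y [\<lambda>f. a * P y f, S y]) = R x (\<lambda>y. a * \<omega> y [P y, S y])"
        by (rule vf_fcong[OF V(1,2) R df_eval2[OF V(1) om' aP S]])
          (rule alt2(2)[OF al vf_tangent[OF F(1)] vf_tangent[OF F(1)] vf_tangent[OF S]])
      then show ?thesis using vf_fcmult[OF V(1,2) R df_eval2[OF V(1) om' F(1) S]] by simp
    qed
    have lp: "\<omega> x [lie_bracket A (\<lambda>y f. a * P y f) S x, R x] = a * \<omega> x [lie_bracket A P S x, R x]"
      if R: "vector_field A V R" and S: "vector_field A V S" for R S
      using lie_scale_left[OF V(1,2) F(1) S smooth_fun_const[OF V(1)], of a] vf_fconst[OF V(2) S]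
        alt2(2)[OF al[OF V(2)] lie_tangent[OF V(1,2) F(1) S] lie_tangent[OF V(1,2) F(1) S] vf_tangent[OF R V(2)]] by simp
    have "d2 \<omega> (\<lambda>y f. a * P y f) Y Z x = a * d2 \<omega> P Y Z x"
      unfolding d2_def sp[OF F(2,3)] sp[OF F(3,2)] lp[OF F(2,3)] lp[OF F(3,2)]
      using alt2(4)[OF al[OF V(2)] vf_tangent[OF F(1) V(2)] vf_tangent[OF F(1) V(2)] lie_tangent[OF V(1,2) F(2,3)]]
      by (simp add: algebra_simps)
    then show "ext_deriv A \<omega> x [\<lambda>f. a * u f, w, z] = a * ext_deriv A \<omega> x [u, w, z]"
      using e[OF aP F(2,3)] e[OF F] by (simp add: eq)
  qed
next
  fix V Xs assume V: "open V" "V \<subseteq> W" and Xs: "length Xs = 3" "\<forall>X\<in>set Xs. vector_field A V X"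
  then obtain X Y Z where XYZ: "Xs = [X, Y, Z]" by (auto simp: numeral_3_eq_3 length_Suc_conv)
  then have F: "vector_field A V X" "vector_field A V Y" "vector_field A V Z" using Xs by auto
  note om' = df_mono[OF om V(2)]
  note ev = df_eval2[OF V(1) om'] and vs = vf_smooth[OF V(1)] and L = vf_lie[OF V(1)]
  have "smooth_fun A V (\<lambda>x. d2 \<omega> X Y Z x)"
    unfolding d2_def
    by (intro smooth_fun_add smooth_fun_diff V(1) vs[OF F(1) ev[OF F(2,3)]] vs[OF F(2) ev[OF F(1,3)]]
       vs[OF F(3) ev[OF F(1,2)]] ev[OF L[OF F(1,2)] F(3)] ev[OF L[OF F(1,3)] F(2)] ev[OF L[OF F(2,3)] F(1)])
  moreover have "ext_deriv A \<omega> x (map (\<lambda>X. X x) Xs) = d2 \<omega> X Y Z x" if "x \<in> V" for x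
    using ext_deriv_2[OF V(1) that om' F] by (simp add: XYZ)
  ultimately show "smooth_fun A V (\<lambda>x. ext_deriv A \<omega> x (map (\<lambda>X. X x) Xs))"
    using smooth_fun_cong[OF V(1), of "\<lambda>x. ext_deriv A \<omega> x (map (\<lambda>X. X x) Xs)" "\<lambda>x. d2 \<omega> X Y Z x"] by simp
qed

end

section \<open>The identity \<open>d (d b) = 0\<close> and the twisted Dorfman bracket\<close>

context smooth_mfd
begin

lemma ext_deriv_fields_4: "ext_deriv_fields A \<omega> [X, Y, Z, T] x =
    X x (\<lambda>y. \<omega> y [Y y, Z y, T y]) - Y x (\<lambda>y. \<omega> y [X y, Z y, T y])
    + Z x (\<lambda>y. \<omega> y [X y, Y y, T y]) - T x (\<lambda>y. \<omega> y [X y, Y y, Z y])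
    - \<omega> x [lie_bracket A X Y x, Z x, T x] + \<omega> x [lie_bracket A X Z x, Y x, T x]
    - \<omega> x [lie_bracket A Y Z x, X x, T x] - \<omega> x [lie_bracket A X T x, Y x, Z x]
    + \<omega> x [lie_bracket A Y T x, X x, Z x] - \<omega> x [lie_bracket A Z T x, X x, Y x]"
  by (simp add: ext_deriv_fields_def lessThan_Suc nths_Cons eval_nat_numeral)

text \<open>The cotangent part of the twisted Dorfman bracket of \<open>X + \<xi>\<close> and \<open>Y + \<eta>\<close>, evaluated on a vector
  field \<open>Z\<close>; in this form the Courant identities involve no choice of extensions.\<close>
definition dorfman_form :: "('m \<Rightarrow> 'm mform) \<Rightarrow> ('m \<Rightarrow> 'm tvec) \<Rightarrow> ('m \<Rightarrow> 'm mform) \<Rightarrow> ('m \<Rightarrow> 'm tvec) \<Rightarrow> ('m \<Rightarrow> 'm mform) \<Rightarrow>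
    ('m \<Rightarrow> 'm tvec) \<Rightarrow> 'm \<Rightarrow> real" where
  "dorfman_form H X \<xi> Y \<eta> Z x = X x (\<lambda>y. \<eta> y [Z y]) - \<eta> x [lie_bracket A X Z x] - Y x (\<lambda>y. \<xi> y [Z y])
     + Z x (\<lambda>y. \<xi> y [Y y]) + \<xi> x [lie_bracket A Y Z x] + H x [Y x, X x, Z x]"

lemma dorfman_form_alt: "dorfman_form H X \<xi> Y \<eta> Z x = lie1 \<eta> X Z x - d1 \<xi> Y Z x + H x [Y x, X x, Z x]"
  by (simp add: dorfman_form_def lie1_def d1_def)

lemma dorfman_form_alt': "dorfman_form H X \<xi> Y \<eta> Z x = lie1 \<eta> X Z x - lie1 \<xi> Y Z x + Z x (\<lambda>y. \<xi> y [Y y]) + H x [Y x, X x, Z x]"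
  by (simp add: dorfman_form_def lie1_def)

context
  fixes V :: "'m set" and x :: 'm assumes V: "open V" "x \<in> V"
begin

lemma lie_fun:
  assumes "smooth_fun A V f"
  shows "lie_bracket A X Y x f = X x (\<lambda>y. Y y f) - Y x (\<lambda>y. X y f)"
  by (rule lie_apply[OF V assms])

text \<open>A derivation splits over a sum once every summand is known to be smooth. Doing this
  here, and likewise in \<open>vf_dorf1\<close>, leaves the long identities below as linear
  arithmetic in atomic terms.\<close>

lemma vf_d2:
  assumes b: "diff_form A V 2 b" and P: "vector_field A V P"
    and X: "vector_field A V X" and Y: "vector_field A V Y" and Z: "vector_field A V Z"
  shows "P x (\<lambda>y. d2 b X Y Z y) =
    P x (\<lambda>y. X y (\<lambda>y. b y [Y y, Z y])) - P x (\<lambda>y. Y y (\<lambda>y. b y [X y, Z y])) + P x (\<lambda>y. Z y (\<lambda>y. b y [X y, Y y]))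
    - P x (\<lambda>y. b y [lie_bracket A X Y y, Z y]) + P x (\<lambda>y. b y [lie_bracket A X Z y, Y y])
    - P x (\<lambda>y. b y [lie_bracket A Y Z y, X y])"
proof -
  note ev = df_eval2[OF V(1) b] and vs = vf_smooth[OF V(1)] and L = vf_lie[OF V(1)]
  note s1 = vs[OF X ev[OF Y Z]] and s2 = vs[OF Y ev[OF X Z]] and s3 = vs[OF Z ev[OF X Y]]
    and s4 = ev[OF L[OF X Y] Z] and s5 = ev[OF L[OF X Z] Y] and s6 = ev[OF L[OF Y Z] X]
  note t2 = smooth_fun_diff[OF V(1) s1 s2]
  note t3 = smooth_fun_add[OF V(1) t2 s3]
  note t4 = smooth_fun_diff[OF V(1) t3 s4]
  note t5 = smooth_fun_add[OF V(1) t4 s5]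
  show ?thesis
    unfolding d2_def vf_fdiff[OF V P t5 s6] vf_fadd[OF V P t4 s5] vf_fdiff[OF V P t3 s4]
      vf_fadd[OF V P t2 s3] vf_fdiff[OF V P s1 s2] ..
qed

lemma d2_lie:
  assumes b: "diff_form A V 2 b" and X: "vector_field A V X" and Y: "vector_field A V Y"
    and Z: "vector_field A V Z" and T: "vector_field A V T"
  shows "d2 b (lie_bracket A X Y) Z T x =
    X x (\<lambda>y. Y y (\<lambda>y. b y [Z y, T y])) - Y x (\<lambda>y. X y (\<lambda>y. b y [Z y, T y]))
    - Z x (\<lambda>y. b y [lie_bracket A X Y y, T y]) + T x (\<lambda>y. b y [lie_bracket A X Y y, Z y])
    - b x [lie_bracket A (lie_bracket A X Y) Z x, T x] + b x [lie_bracket A (lie_bracket A X Y) T x, Z x]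
    - b x [lie_bracket A Z T x, lie_bracket A X Y x]"
  unfolding d2_def[of b "lie_bracket A X Y"] lie_fun[OF df_eval2[OF V(1) b Z T], of X Y] ..

lemma jacobi_form2:
  assumes b: "diff_form A V 2 b" and X: "vector_field A V X" and Y: "vector_field A V Y"
    and Z: "vector_field A V Z" and T: "vector_field A V T"
  shows "b x [lie_bracket A (lie_bracket A X Y) Z x, T x] - b x [lie_bracket A (lie_bracket A X Z) Y x, T x]
    + b x [lie_bracket A (lie_bracket A Y Z) X x, T x] = 0"
proof -
  note L = vf_lie[OF V(1)] and l = lie_tangent[OF V]
  note al = df_alt[OF b V(2)]
  have j: "lie_bracket A X (lie_bracket A Y Z) x =
      (\<lambda>f. lie_bracket A (lie_bracket A X Y) Z x f + lie_bracket A Y (lie_bracket A X Z) x f)"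
    by (rule lie_jacobi[OF V X Y Z])
  have "b x [lie_bracket A X (lie_bracket A Y Z) x, T x] =
      b x [lie_bracket A (lie_bracket A X Y) Z x, T x] + b x [lie_bracket A Y (lie_bracket A X Z) x, T x]"
    unfolding j by (rule alt2(1)[OF al l[OF L[OF X Y] Z] l[OF Y L[OF X Z]] vf_tangent[OF T V(2)]])
  moreover have sw: "b x [lie_bracket A P Q x, T x] = - b x [lie_bracket A Q P x, T x]"
    if "vector_field A V P" "vector_field A V Q" for P Q
    using alt2(2)[OF al l[OF that(2,1)] l[OF that(2,1)] vf_tangent[OF T V(2)], of "-1"]
    by (simp add: lie_antisym[of P Q])
  ultimately show ?thesis using sw[OF X L[OF Y Z]] sw[OF Y L[OF X Z]] by simp
qed

text \<open>The hypothesis says that \<open>H\<close> is the exterior derivative of \<open>b\<close>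
  on \<open>V\<close>. Second derivatives of values of \<open>b\<close> cancel against derivatives
  along brackets, derivatives of \<open>b\<close> evaluated on a bracket occur in pairs, double
  brackets cancel by Jacobi and values on two brackets by skewness.\<close>

lemma d_d2_zero:
  assumes b: "diff_form A V 2 b"
    and H: "\<And>y X Y Z. y \<in> V \<Longrightarrow> vector_field A V X \<Longrightarrow> vector_field A V Y \<Longrightarrow> vector_field A V Z \<Longrightarrow>
       H y [X y, Y y, Z y] = d2 b X Y Z y"
    and X: "vector_field A V X" and Y: "vector_field A V Y" and Z: "vector_field A V Z" and T: "vector_field A V T"
  shows "ext_deriv_fields A H [X, Y, Z, T] x = 0"
proof -
  note L = vf_lie[OF V(1)] and l = lie_tangent[OF V]
  note al = df_alt[OF b V(2)]
  have e: "P x (\<lambda>y. H y [Q y, R y, S y]) = P x (\<lambda>y. d2 b Q R S y)"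
    if "vector_field A V P" and QRS: "vector_field A V Q" "vector_field A V R" "vector_field A V S" for P Q R S
  proof (rule vf_fcong[OF V that(1), symmetric])
    note QR = QRS
    note ev = df_eval2[OF V(1) b] and vs = vf_smooth[OF V(1)]
    show "smooth_fun A V (\<lambda>y. d2 b Q R S y)"
      unfolding d2_def
      by (intro smooth_fun_add smooth_fun_diff V(1) vs[OF QR(1) ev[OF QR(2,3)]] vs[OF QR(2) ev[OF QR(1,3)]]
       vs[OF QR(3) ev[OF QR(1,2)]] ev[OF L[OF QR(1,2)] QR(3)] ev[OF L[OF QR(1,3)] QR(2)] ev[OF L[OF QR(2,3)] QR(1)])
    show "d2 b Q R S y = H y [Q y, R y, S y]" if "y \<in> V" for y using H[OF that QRS] by simp
  qed
  have sw: "b x [lie_bracket A P Q x, lie_bracket A R S x] = - b x [lie_bracket A R S x, lie_bracket A P Q x]"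
    if "vector_field A V P" "vector_field A V Q" "vector_field A V R" "vector_field A V S" for P Q R S
    by (rule alt2_swap[OF al l[OF that(1,2)] l[OF that(3,4)]])
  \<comment> \<open>One Jacobi identity is supplied for each field left outside the double brackets,
    and one exchange for each splitting of the four fields into two pairs.\<close>
  show ?thesis
    unfolding ext_deriv_fields_4 e[OF X Y Z T] e[OF Y X Z T] e[OF Z X Y T] e[OF T X Y Z]
      H[OF V(2) L[OF X Y] Z T] H[OF V(2) L[OF X Z] Y T] H[OF V(2) L[OF Y Z] X T]
      H[OF V(2) L[OF X T] Y Z] H[OF V(2) L[OF Y T] X Z] H[OF V(2) L[OF Z T] X Y]
      vf_d2[OF b X Y Z T] vf_d2[OF b Y X Z T] vf_d2[OF b Z X Y T] vf_d2[OF b T X Y Z]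
      d2_lie[OF b X Y Z T] d2_lie[OF b X Z Y T] d2_lie[OF b Y Z X T]
      d2_lie[OF b X T Y Z] d2_lie[OF b Y T X Z] d2_lie[OF b Z T X Y]
    using jacobi_form2[OF b X Y Z T] jacobi_form2[OF b X Y T Z] jacobi_form2[OF b X Z T Y] jacobi_form2[OF b Y Z T X]
      sw[OF X Y Z T] sw[OF X Z Y T] sw[OF Y Z X T]
    by linarith
qed

lemma vf_dorf1:
  assumes H: "diff_form A V 3 H" and xi: "diff_form A V 1 \<xi>" and eta: "diff_form A V 1 \<eta>" and P: "vector_field A V P"
    and X: "vector_field A V X" and Y: "vector_field A V Y" and Z: "vector_field A V Z"
  shows "P x (\<lambda>y. dorfman_form H X \<xi> Y \<eta> Z y) =
    P x (\<lambda>y. X y (\<lambda>y. \<eta> y [Z y])) - P x (\<lambda>y. \<eta> y [lie_bracket A X Z y]) - P x (\<lambda>y. Y y (\<lambda>y. \<xi> y [Z y]))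
     + P x (\<lambda>y. Z y (\<lambda>y. \<xi> y [Y y])) + P x (\<lambda>y. \<xi> y [lie_bracket A Y Z y]) + P x (\<lambda>y. H y [Y y, X y, Z y])"
    (is ?eq)
    and "smooth_fun A V (\<lambda>y. dorfman_form H X \<xi> Y \<eta> Z y)" (is ?sm)
proof -
  note ev = df_eval1[OF V(1)] and vs = vf_smooth[OF V(1)] and L = vf_lie[OF V(1)]
  note s1 = vs[OF X ev[OF eta Z]] and s2 = ev[OF eta L[OF X Z]] and s3 = vs[OF Y ev[OF xi Z]]
    and s4 = vs[OF Z ev[OF xi Y]] and s5 = ev[OF xi L[OF Y Z]] and s6 = df_eval3[OF V(1) H Y X Z]
  note t2 = smooth_fun_diff[OF V(1) s1 s2]
  note t3 = smooth_fun_diff[OF V(1) t2 s3]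
  note t4 = smooth_fun_add[OF V(1) t3 s4]
  note t5 = smooth_fun_add[OF V(1) t4 s5]
  show ?eq
    unfolding dorfman_form_def vf_fadd[OF V P t5 s6] vf_fadd[OF V P t4 s5] vf_fadd[OF V P t3 s4]
      vf_fdiff[OF V P t2 s3] vf_fdiff[OF V P s1 s2] ..
  show ?sm unfolding dorfman_form_def by (rule smooth_fun_add[OF V(1) t5 s6])
qed

lemma jacobi_form1:
  assumes om: "diff_form A V 1 \<omega>" and X: "vector_field A V X" and Y: "vector_field A V Y" and Z: "vector_field A V Z"
  shows "\<omega> x [lie_bracket A X (lie_bracket A Y Z) x] =
     \<omega> x [lie_bracket A (lie_bracket A X Y) Z x] + \<omega> x [lie_bracket A Y (lie_bracket A X Z) x]"
proof -
  note L = vf_lie[OF V(1)] and l = lie_tangent[OF V]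
  show ?thesis unfolding lie_jacobi[OF V X Y Z]
    by (rule alt1(1)[OF df_alt[OF om V(2)] l[OF L[OF X Y] Z] l[OF Y L[OF X Z]]])
qed

text \<open>The forms \<open>\<theta>vw\<close>, \<open>\<theta>uv\<close> and
  \<open>\<theta>uw\<close> are the cotangent parts of the inner brackets and enter only through
  their values on fields. The terms in \<xi>, \<eta> and \<zeta> cancel by the definition of the Lie
  bracket and Jacobi; the terms in \<open>H\<close> add up to the invariant formula for its exterior
  derivative on \<open>X\<close>, \<open>Y\<close>, \<open>W\<close>, \<open>Z\<close>.\<close>

lemma dorfman_form_leibniz:
  assumes H: "diff_form A V 3 H"
    and dH: "\<And>P Q R S. vector_field A V P \<Longrightarrow> vector_field A V Q \<Longrightarrow> vector_field A V R \<Longrightarrow> vector_field A V S \<Longrightarrow>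
       ext_deriv_fields A H [P, Q, R, S] x = 0"
    and X: "vector_field A V X" and xi: "diff_form A V 1 \<xi>"
    and Y: "vector_field A V Y" and eta: "diff_form A V 1 \<eta>"
    and W: "vector_field A V W" and zeta: "diff_form A V 1 \<zeta>"
    and vw: "\<And>y P. y \<in> V \<Longrightarrow> vector_field A V P \<Longrightarrow> \<theta>vw y [P y] = dorfman_form H Y \<eta> W \<zeta> P y"
    and uv: "\<And>y P. y \<in> V \<Longrightarrow> vector_field A V P \<Longrightarrow> \<theta>uv y [P y] = dorfman_form H X \<xi> Y \<eta> P y"
    and uw: "\<And>y P. y \<in> V \<Longrightarrow> vector_field A V P \<Longrightarrow> \<theta>uw y [P y] = dorfman_form H X \<xi> W \<zeta> P y"
    and Z: "vector_field A V Z"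
  shows "dorfman_form H X \<xi> (lie_bracket A Y W) \<theta>vw Z x =
    dorfman_form H (lie_bracket A X Y) \<theta>uv W \<zeta> Z x + dorfman_form H Y \<eta> (lie_bracket A X W) \<theta>uw Z x"
proof -
  note L = vf_lie[OF V(1)] and l = lie_tangent[OF V] and ev = df_eval1[OF V(1)]
  have e: "P x (\<lambda>y. \<theta> y [Q y]) = P x (\<lambda>y. dorfman_form H R \<alpha> S \<beta> Q y)"
    if "vector_field A V P" "vector_field A V Q" "vector_field A V R" "vector_field A V S" "diff_form A V 1 \<alpha>" "diff_form A V 1 \<beta>"
      and eq: "\<forall>y\<in>V. \<forall>P. vector_field A V P \<longrightarrow> \<theta> y [P y] = dorfman_form H R \<alpha> S \<beta> P y" for \<theta> P Q R S \<alpha> \<beta>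
    by (rule vf_fcong[OF V that(1) vf_dorf1(2)[OF H that(5,6,1,3,4,2)], symmetric]) (simp add: eq that(2))
  have vw': "\<forall>y\<in>V. \<forall>P. vector_field A V P \<longrightarrow> \<theta>vw y [P y] = dorfman_form H Y \<eta> W \<zeta> P y"
    and uv': "\<forall>y\<in>V. \<forall>P. vector_field A V P \<longrightarrow> \<theta>uv y [P y] = dorfman_form H X \<xi> Y \<eta> P y"
    and uw': "\<forall>y\<in>V. \<forall>P. vector_field A V P \<longrightarrow> \<theta>uw y [P y] = dorfman_form H X \<xi> W \<zeta> P y"
    using vw uv uw by simp_all
  have al: "y \<in> V \<Longrightarrow> H y \<in> alt_forms A 3 y" for y by (rule df_alt[OF H])
  note tan = vf_tangent[OF _ V(2)]
  have sw1: "P x (\<lambda>y. H y [Q y, R y, S y]) = - P x (\<lambda>y. H y [R y, Q y, S y])"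
    if "vector_field A V P" "vector_field A V Q" "vector_field A V R" "vector_field A V S" for P Q R S
  proof -
    have "P x (\<lambda>y. H y [Q y, R y, S y]) = P x (\<lambda>y. - H y [R y, Q y, S y])"
      by (rule vf_fcong[OF V that(1) df_eval3[OF V(1) H that(2,3,4)]])
        (rule alt3_swap(1)[OF al vf_tangent[OF that(2)] vf_tangent[OF that(3)] vf_tangent[OF that(4)]])
    then show ?thesis using vf_fminus[OF V that(1) df_eval3[OF V(1) H that(3,2,4)]] by simp
  qed
  have sw2: "P x (\<lambda>y. H y [Q y, R y, S y]) = - P x (\<lambda>y. H y [Q y, S y, R y])"
    if "vector_field A V P" "vector_field A V Q" "vector_field A V R" "vector_field A V S" for P Q R S
  proof -
    have "P x (\<lambda>y. H y [Q y, R y, S y]) = P x (\<lambda>y. - H y [Q y, S y, R y])"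
      by (rule vf_fcong[OF V that(1) df_eval3[OF V(1) H that(2,3,4)]])
        (rule alt3_swap(2)[OF al vf_tangent[OF that(3)] vf_tangent[OF that(4)] vf_tangent[OF that(2)]])
    then show ?thesis using vf_fminus[OF V that(1) df_eval3[OF V(1) H that(2,4,3)]] by simp
  qed
  have hs1: "H x [P x, Q x, R x] = - H x [Q x, P x, R x]"
    and hs2: "H x [P x, Q x, R x] = - H x [P x, R x, Q x]"
    if "vector_field A V P" "vector_field A V Q" "vector_field A V R" for P Q R
    using alt3_swap(1)[OF al[OF V(2)] tan[OF that(1)] tan[OF that(2)] tan[OF that(3)]]
      alt3_swap(2)[OF al[OF V(2)] tan[OF that(2)] tan[OF that(3)] tan[OF that(1)]] by simp_all
  \<comment> \<open>The instances of \<open>sw1\<close>, \<open>hs1\<close> and \<open>hs2\<close>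
    bring the arguments of \<open>H\<close> into a common order, so that its terms can be compared
    with the expansion of the exterior derivative.\<close>
  show ?thesis
    unfolding dorfman_form_def[of H _ _ "lie_bracket A Y W"] dorfman_form_def[of H "lie_bracket A X Y"] dorfman_form_def[of H _ _ "lie_bracket A X W"]
      e[OF X Z Y W eta zeta vw'] vw[OF V(2) L[OF X Z]]
      e[OF W Z X Y xi eta uv'] e[OF Z W X Y xi eta uv'] uv[OF V(2) L[OF W Z]]
      e[OF Y Z X W xi zeta uw'] uw[OF V(2) L[OF Y Z]]
      vf_dorf1(1)[OF H eta zeta X Y W Z] vf_dorf1(1)[OF H xi eta W X Y Z] vf_dorf1(1)[OF H xi eta Z X Y W]
      vf_dorf1(1)[OF H xi zeta Y X W Z]
      dorfman_form_def[of H Y \<eta> W \<zeta>] dorfman_form_def[of H X \<xi> Y \<eta>] dorfman_form_def[of H X \<xi> W \<zeta>]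
      lie_fun[OF ev[OF xi Z], of Y W] lie_fun[OF ev[OF zeta Z], of X Y] lie_fun[OF ev[OF eta Z], of X W]
      lie_fun[OF ev[OF eta W], of X Z] lie_fun[OF ev[OF xi Y], of W Z] lie_fun[OF ev[OF xi W], of Y Z]
    using jacobi_form1[OF zeta X Y Z] jacobi_form1[OF eta X W Z] jacobi_form1[OF xi Y W Z]
      dH[OF X Y W Z, unfolded ext_deriv_fields_4]
      sw1[OF X W Y Z] sw1[OF Y W X Z] sw1[OF W Y X Z] sw1[OF Z Y X W]
      hs1[OF W Y L[OF X Z]] hs2[OF Y W L[OF X Z]] hs1[OF Y L[OF X Z] W]
      hs2[OF Y X L[OF W Z]] hs1[OF Y L[OF W Z] X] hs2[OF L[OF W Z] Y X]
      hs1[OF W L[OF X Y] Z]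
      hs2[OF W X L[OF Y Z]] hs1[OF W L[OF Y Z] X] hs2[OF L[OF Y Z] W X]
    by linarith
qed

text \<open>Shifting both 1-forms by contractions with \<open>b\<close> adds the contraction of
  \<open>b\<close> with the Lie bracket, which belongs to the transformed result, and the exterior
  derivative of \<open>b\<close>. The twist enters as \<open>H(Y, X, Z)\<close>, so it cancels the
  latter when \<open>H\<close> is that derivative.\<close>

lemma dorfman_form_b_shift:
  assumes b: "diff_form A V 2 b" and X: "vector_field A V X" and xi: "diff_form A V 1 \<xi>"
    and Y: "vector_field A V Y" and eta: "diff_form A V 1 \<eta>"
    and xi': "\<And>y P. y \<in> V \<Longrightarrow> vector_field A V P \<Longrightarrow> \<xi>' y [P y] = \<xi> y [P y] + b y [X y, P y]"
    and eta': "\<And>y P. y \<in> V \<Longrightarrow> vector_field A V P \<Longrightarrow> \<eta>' y [P y] = \<eta> y [P y] + b y [Y y, P y]"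
    and Z: "vector_field A V Z"
  shows "dorfman_form H X \<xi>' Y \<eta>' Z x = dorfman_form (\<lambda>x vs. 0) X \<xi> Y \<eta> Z x + b x [lie_bracket A X Y x, Z x]
     + d2 b X Y Z x + H x [Y x, X x, Z x]"
proof -
  note L = vf_lie[OF V(1)] and l = lie_tangent[OF V] and ev = df_eval1[OF V(1)] and ev2 = df_eval2[OF V(1) b]
  have al: "y \<in> V \<Longrightarrow> b y \<in> alt_forms A 2 y" for y by (rule df_alt[OF b])
  note tan = vf_tangent[OF _ V(2)]
  have e: "P x (\<lambda>y. \<theta>' y [Q y]) = P x (\<lambda>y. \<theta> y [Q y]) + P x (\<lambda>y. b y [R y, Q y])"
    if "vector_field A V P" "vector_field A V Q" "vector_field A V R" "diff_form A V 1 \<theta>"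
      and eq: "\<forall>y\<in>V. \<forall>P. vector_field A V P \<longrightarrow> \<theta>' y [P y] = \<theta> y [P y] + b y [R y, P y]" for P Q R \<theta> \<theta>'
  proof -
    have "P x (\<lambda>y. \<theta>' y [Q y]) = P x (\<lambda>y. \<theta> y [Q y] + b y [R y, Q y])"
      by (rule vf_fcong[OF V that(1) smooth_fun_add[OF V(1) ev[OF that(4,2)] ev2[OF that(3,2)]], symmetric])
        (simp add: eq that(2))
    then show ?thesis using vf_fadd[OF V that(1) ev[OF that(4,2)] ev2[OF that(3,2)]] by simp
  qed
  have e1: "\<forall>y\<in>V. \<forall>P. vector_field A V P \<longrightarrow> \<xi>' y [P y] = \<xi> y [P y] + b y [X y, P y]"
    and e2: "\<forall>y\<in>V. \<forall>P. vector_field A V P \<longrightarrow> \<eta>' y [P y] = \<eta> y [P y] + b y [Y y, P y]"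
    using xi' eta' by simp_all
  have sw: "b x [P x, Q x] = - b x [Q x, P x]" if "vector_field A V P" "vector_field A V Q" for P Q
    by (rule alt2_swap[OF al[OF V(2)] tan[OF that(1)] tan[OF that(2)]])
  show ?thesis
    unfolding dorfman_form_def d2_def e[OF X Z Y eta e2] e[OF Y Z X xi e1] e[OF Z Y X xi e1]
      xi'[OF V(2) L[OF Y Z]] eta'[OF V(2) L[OF X Z]]
    using sw[OF X L[OF Y Z]] sw[OF Y L[OF X Z]] by simp
qed

end

end

section \<open>Sections of the generalized tangent bundle\<close>

context smooth_mfd
begin

text \<open>Smoothness of the two components, free of frames and of the convention that sections are
  \<open>undefined\<close> outside their domain. \<open>sections_gtb\<close> relates it to
  \<open>sections\<close>.\<close>

definition gsec :: "'m set \<Rightarrow> ('m \<Rightarrow> 'm gvec) \<Rightarrow> bool" where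
  "gsec W u \<longleftrightarrow> vector_field A W (\<lambda>x. fst (u x)) \<and> diff_form A W 1 (\<lambda>x. snd (u x))"

lemma gsec_mono: "gsec W u \<Longrightarrow> V \<subseteq> W \<Longrightarrow> gsec V u"
  by (auto simp: gsec_def intro: vf_mono df_mono)

lemma gsec_cong: "open W \<Longrightarrow> gsec W u \<Longrightarrow> (\<And>x. x \<in> W \<Longrightarrow> u x = v x) \<Longrightarrow> gsec W v"
  using vf_cong[of W "\<lambda>x. fst (u x)" "\<lambda>x. fst (v x)"] df_cong[of W "\<lambda>x. snd (u x)" "\<lambda>x. snd (v x)" 1]
  by (simp add: gsec_def)

lemma gsec_local:
  assumes "open W" "\<And>x. x \<in> W \<Longrightarrow> \<exists>N. open N \<and> x \<in> N \<and> gsec (W \<inter> N) u"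
  shows "gsec W u"
  unfolding gsec_def
proof
  show "vector_field A W (\<lambda>x. fst (u x))" by (rule vf_local[OF _ assms(1)]) (use assms(2) gsec_def in blast)
  show "diff_form A W 1 (\<lambda>x. snd (u x))" by (rule df_local) (use assms(2) gsec_def in blast)
qed

lemma gtan_iff: "u \<in> gtan A x \<longleftrightarrow> fst u \<in> tangent_space A x \<and> snd u \<in> alt_forms A 1 x"
  by (cases u) (simp add: gtan_vsp_def)

lemma gtan_ops:
  "vadd (gtan_vsp A x) u v = (\<lambda>f. fst u f + fst v f, \<lambda>vs. snd u vs + snd v vs)"
  "vzero (gtan_vsp A x) = (\<lambda>f. 0, \<lambda>vs. 0)"
  "vscale (gtan_vsp A x) a u = (\<lambda>f. a * fst u f, \<lambda>vs. a * snd u vs)"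
  by (simp_all add: gtan_vsp_def)

lemma gsec_gtan: "gsec W u \<Longrightarrow> x \<in> W \<Longrightarrow> u x \<in> gtan A x"
  using vf_tangent[of W "\<lambda>x. fst (u x)" x] df_alt[of W 1 "\<lambda>x. snd (u x)" x] by (simp add: gsec_def gtan_iff)

lemma gsec_vf: "gsec W u \<Longrightarrow> vector_field A W (\<lambda>x. fst (u x))"
  and gsec_df: "gsec W u \<Longrightarrow> diff_form A W 1 (\<lambda>x. snd (u x))"
  by (simp_all add: gsec_def)

lemma gsec_add: "open W \<Longrightarrow> gsec W u \<Longrightarrow> gsec W v \<Longrightarrow> gsec W (\<lambda>x. vadd (gtan_vsp A x) (u x) (v x))"
  by (simp add: gsec_def gtan_ops vf_add df_add)

lemma gsec_scale: "open W \<Longrightarrow> smooth_fun A W g \<Longrightarrow> gsec W u \<Longrightarrow> gsec W (\<lambda>x. vscale (gtan_vsp A x) (g x) (u x))"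
  by (simp add: gsec_def gtan_ops vf_scale df_scale)

lemma gsec_cscale: "open W \<Longrightarrow> gsec W u \<Longrightarrow> gsec W (\<lambda>x. vscale (gtan_vsp A x) a (u x))"
  by (rule gsec_scale[OF _ smooth_fun_const])

lemma gsec_pairing: "open W \<Longrightarrow> gsec W u \<Longrightarrow> gsec W v \<Longrightarrow> smooth_fun A W (\<lambda>x. gpairing (u x) (v x))"
  unfolding gpairing_def gsec_def by (intro smooth_fun_add) (auto intro: df_eval1)

lemma alt1_eqI:
  assumes "\<omega> \<in> alt_forms A 1 x" "\<theta> \<in> alt_forms A 1 x" "\<And>v. v \<in> tangent_space A x \<Longrightarrow> \<omega> [v] = \<theta> [v]"
  shows "\<omega> = \<theta>"
proof
  fix vs
  show "\<omega> vs = \<theta> vs"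
  proof (cases "set vs \<subseteq> tangent_space A x \<and> length vs = 1")
    case True
    then obtain v where "vs = [v]" "v \<in> tangent_space A x" by (auto simp: length_Suc_conv)
    then show ?thesis using assms(3) by simp
  next
    case False
    then show ?thesis using alt_forms_zero[OF assms(1)] alt_forms_zero[OF assms(2)] by simp
  qed
qed

lemma alt1_eq_fieldsI:
  assumes W: "open W" "x \<in> W" and al: "\<omega> \<in> alt_forms A 1 x" "\<theta> \<in> alt_forms A 1 x"
    and eq: "\<And>V Z. open V \<Longrightarrow> x \<in> V \<Longrightarrow> V \<subseteq> W \<Longrightarrow> vector_field A V Z \<Longrightarrow> \<omega> [Z x] = \<theta> [Z x]"
  shows "\<omega> = \<theta>"
proof (rule alt1_eqI[OF al])
  fix v assume v: "v \<in> tangent_space A x"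
  obtain V X Y Z where "open V" "x \<in> V" "V \<subseteq> W" "vector_field A V X" "vector_field A V Y" "vector_field A V Z"
    "X x = v" "Y x = v" "Z x = v" by (rule extend3[OF W v v v])
  then show "\<omega> [v] = \<theta> [v]" using eq by metis
qed

text \<open>The cotangent part of a bracket is known through \<open>dorfman_snd\<close> on values of
  vector fields, and by extension every tangent vector is such a value.\<close>

lemma gvec_eqI:
  assumes W: "open W" "x \<in> W" and g: "p \<in> gtan A x" "q \<in> gtan A x" and f: "fst p = fst q"
    and eq: "\<And>V Z. open V \<Longrightarrow> x \<in> V \<Longrightarrow> V \<subseteq> W \<Longrightarrow> vector_field A V Z \<Longrightarrow> snd p [Z x] = snd q [Z x]"
  shows "p = q"
proof -
  have "snd p = snd q"
  proof (rule alt1_eq_fieldsI[OF W])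
    show "snd p \<in> alt_forms A 1 x" "snd q \<in> alt_forms A 1 x" using g gtan_iff by blast+
  qed (rule eq)
  then show ?thesis using f by (simp add: prod_eq_iff)
qed

lemma dorfman_fst: "fst (dorfman A H u v x) = lie_bracket A (\<lambda>y. fst (u y)) (\<lambda>y. fst (v y)) x"
  by (simp add: dorfman_def)

abbreviation gsec_dorfman_form :: "('m \<Rightarrow> 'm mform) \<Rightarrow> ('m \<Rightarrow> 'm gvec) \<Rightarrow> ('m \<Rightarrow> 'm gvec) \<Rightarrow> ('m \<Rightarrow> 'm tvec) \<Rightarrow> 'm \<Rightarrow> real" where
  "gsec_dorfman_form H u v \<equiv> dorfman_form H (\<lambda>y. fst (u y)) (\<lambda>y. snd (u y)) (\<lambda>y. fst (v y)) (\<lambda>y. snd (v y))"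

text \<open>Here the definite descriptions in \<open>lie_deriv\<close> and \<open>ext_deriv\<close>
  are evaluated; from now on brackets are handled through \<open>dorfman_form\<close>.\<close>

lemma dorfman_snd:
  assumes W: "open W" "x \<in> W" and u: "gsec W u" and v: "gsec W v" and Z: "vector_field A W Z"
  shows "snd (dorfman A H u v x) [Z x] = gsec_dorfman_form H u v Z x"
  unfolding dorfman_form_alt dorfman_def
  using lie_deriv_1[OF W gsec_df[OF v] gsec_vf[OF u] Z] ext_deriv_1[OF W gsec_df[OF u] gsec_vf[OF v] Z] by simp

lemma dorfman_snd_zero:
  assumes W: "open W" "x \<in> W" and u: "gsec W u" and v: "gsec W v" and H: "H x \<in> alt_forms A 3 x"
    and vs: "\<not> (set vs \<subseteq> tangent_space A x \<and> length vs = 1)"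
  shows "snd (dorfman A H u v x) vs = 0"
proof -
  have "H x (fst (v x) # fst (u x) # vs) = 0"
    by (rule alt_forms_zero[OF H]) (use vs in auto)
  moreover have "lie_deriv A (\<lambda>y. fst (u y)) (\<lambda>y. snd (v y)) x vs = 0"
    using vs lie_deriv_wrong_length[OF W gsec_df[OF v] gsec_vf[OF u], of vs]
    by (cases "set vs \<subseteq> tangent_space A x") (auto simp: lie_deriv_def)
  moreover have "ext_deriv A (\<lambda>y. snd (u y)) x (fst (v x) # vs) = 0"
    using vs ext_deriv_wrong_length[OF W gsec_df[OF u], of "fst (v x) # vs"]
    by (cases "set vs \<subseteq> tangent_space A x") (auto simp: ext_deriv_def)
  ultimately show ?thesis by (simp add: dorfman_def)
qed

text \<open>That the second component is a covector at each point is read off from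
  \<open>dorfman_form_alt'\<close>, where every summand is linear in the test field; smoothness
  follows from the formula for fields.\<close>

lemma gsec_dorfman:
  assumes W: "open W" and u: "gsec W u" and v: "gsec W v" and H: "diff_form A W 3 H"
  shows "gsec W (dorfman A H u v)"
  unfolding gsec_def
proof
  show "vector_field A W (\<lambda>x. fst (dorfman A H u v x))"
    unfolding dorfman_fst by (rule vf_lie[OF W gsec_vf[OF u] gsec_vf[OF v]])
  show "diff_form A W 1 (\<lambda>x. snd (dorfman A H u v x))"
  proof (rule df1I)
    fix x assume x: "x \<in> W"
    show "snd (dorfman A H u v x) \<in> alt_forms A 1 x"
    proof (rule alt_forms_1I)
      fix vs assume "\<not> (set vs \<subseteq> tangent_space A x \<and> length vs = 1)"
      then show "snd (dorfman A H u v x) vs = 0"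
        by (rule dorfman_snd_zero[where H=H, OF W x u v df_alt[OF H x]])
    next
      fix p q assume pq: "p \<in> tangent_space A x" "q \<in> tangent_space A x"
      obtain V P Q R where V: "open V" "x \<in> V" "V \<subseteq> W" and F: "vector_field A V P" "vector_field A V Q"
        and eq: "P x = p" "Q x = q" by (rule extend3[OF W x pq pq(2)])
      note u' = gsec_mono[OF u V(3)] and v' = gsec_mono[OF v V(3)]
      note s = dorfman_snd[OF V(1,2) u' v']
      have "gsec_dorfman_form H u v (\<lambda>y f. P y f + Q y f) x = gsec_dorfman_form H u v P x + gsec_dorfman_form H u v Q x"
        unfolding dorfman_form_alt' lie1_add[OF V(1,2) gsec_df[OF v'] gsec_vf[OF u'] F] lie1_add[OF V(1,2) gsec_df[OF u'] gsec_vf[OF v'] F]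
        using alt3(5)[OF df_alt[OF H x] pq vf_tangent[OF gsec_vf[OF v] x] vf_tangent[OF gsec_vf[OF u] x]]
        by (simp add: eq)
      then show "snd (dorfman A H u v x) [\<lambda>f. p f + q f] = snd (dorfman A H u v x) [p] + snd (dorfman A H u v x) [q]"
        using s[OF F(1), of H] s[OF F(2), of H] s[OF vf_add[OF F], of H] by (simp add: eq)
    next
      fix p a assume p: "p \<in> tangent_space A x"
      obtain V P Q R where V: "open V" "x \<in> V" "V \<subseteq> W" and F: "vector_field A V P" and eq: "P x = p"
        by (rule extend3[OF W x p p p])
      note u' = gsec_mono[OF u V(3)] and v' = gsec_mono[OF v V(3)] and c = smooth_fun_const[OF V(1), of a]
      note s = dorfman_snd[OF V(1,2) u' v']
      have "gsec_dorfman_form H u v (\<lambda>y f. a * P y f) x = a * gsec_dorfman_form H u v P x"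
        unfolding dorfman_form_alt' lie1_scale[OF V(1,2) gsec_df[OF v'] gsec_vf[OF u'] F c] lie1_scale[OF V(1,2) gsec_df[OF u'] gsec_vf[OF v'] F c]
        using alt3(6)[OF df_alt[OF H x] p p vf_tangent[OF gsec_vf[OF v] x] vf_tangent[OF gsec_vf[OF u] x]]
        by (simp add: eq algebra_simps)
      then show "snd (dorfman A H u v x) [\<lambda>f. a * p f] = a * snd (dorfman A H u v x) [p]"
        using s[OF F, of H] s[OF vf_cscale[OF V(1) F], of H a] by (simp add: eq)
    qed
  next
    fix V Z assume V: "open V" "V \<subseteq> W" "vector_field A V Z"
    note u' = gsec_mono[OF u V(2)] and v' = gsec_mono[OF v V(2)]
    have "smooth_fun A V (gsec_dorfman_form H u v Z)"
    proof (rule smooth_fun_local)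
      fix x assume x: "x \<in> V"
      have "smooth_fun A V (gsec_dorfman_form H u v Z)"
        using vf_dorf1(2)[OF V(1) x df_mono[OF H V(2)] gsec_df[OF u'] gsec_df[OF v'] V(3) gsec_vf[OF u'] gsec_vf[OF v'] V(3)] .
      then show "\<exists>N. open N \<and> x \<in> N \<and> smooth_fun A (V \<inter> N) (gsec_dorfman_form H u v Z)" using V(1) x by (metis Int_absorb)
    qed
    then show "smooth_fun A V (\<lambda>x. snd (dorfman A H u v x) [Z x])"
      using smooth_fun_cong[OF V(1), of "\<lambda>x. snd (dorfman A H u v x) [Z x]" "gsec_dorfman_form H u v Z"]
        dorfman_snd[OF V(1) _ u' v' V(3)] by simp
  qed
qed

lemma lie_lincomb_left:
  assumes V: "open V" "x \<in> V" and X: "vector_field A V X" "vector_field A V X'" "vector_field A V Y"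
  shows "lie_bracket A (\<lambda>y f. a * X y f + b * X' y f) Y x = (\<lambda>f. a * lie_bracket A X Y x f + b * lie_bracket A X' Y x f)"
  using lie_add_left[OF V vf_cscale[OF V(1) X(1)] vf_cscale[OF V(1) X(2)] X(3), of a b]
    lie_scale_left[OF V X(1,3) smooth_fun_const[OF V(1)], of a]
    lie_scale_left[OF V X(2,3) smooth_fun_const[OF V(1)], of b] vf_fconst[OF V(2) X(3)] by simp

lemma lie_lincomb_right:
  assumes V: "open V" "x \<in> V" and X: "vector_field A V X" "vector_field A V X'" "vector_field A V Y"
  shows "lie_bracket A Y (\<lambda>y f. a * X y f + b * X' y f) x = (\<lambda>f. a * lie_bracket A Y X x f + b * lie_bracket A Y X' x f)"
  unfolding lie_antisym[of Y] lie_lincomb_left[OF V X] by (simp add: fun_eq_iff algebra_simps)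

lemma alt1_lincomb:
  assumes "\<omega> \<in> alt_forms A 1 x" "u \<in> tangent_space A x" "v \<in> tangent_space A x"
  shows "\<omega> [\<lambda>f. a * u f + b * v f] = a * \<omega> [u] + b * \<omega> [v]"
  using alt1(1)[OF assms(1) tangent_scale[OF assms(2)] tangent_scale[OF assms(3)], of a b]
    alt1(2)[OF assms(1,2,2), of a] alt1(2)[OF assms(1,3,3), of b] by simp

lemma alt3_lincomb:
  assumes "\<omega> \<in> alt_forms A 3 x" "u \<in> tangent_space A x" "v \<in> tangent_space A x" "w \<in> tangent_space A x" "z \<in> tangent_space A x"
  shows "\<omega> [\<lambda>f. a * u f + b * v f, w, z] = a * \<omega> [u, w, z] + b * \<omega> [v, w, z]"
    "\<omega> [w, \<lambda>f. a * u f + b * v f, z] = a * \<omega> [w, u, z] + b * \<omega> [w, v, z]"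
  using alt3(1,3)[OF assms(1) tangent_scale[OF assms(2)] tangent_scale[OF assms(3)] assms(4,5), of a b]
    alt3(2,4)[OF assms(1,2,2,4,5), of a] alt3(2,4)[OF assms(1,3,3,4,5), of b] by simp_all

lemma vf_flincomb:
  assumes V: "open V" "x \<in> V" and X: "vector_field A V X" and f: "smooth_fun A V f" and g: "smooth_fun A V g"
  shows "X x (\<lambda>y. a * f y + b * g y) = a * X x f + b * X x g"
  using vf_fadd[OF V X smooth_fun_cmult[OF V(1) f] smooth_fun_cmult[OF V(1) g], of a b]
    vf_fcmult[OF V X f, of a] vf_fcmult[OF V X g, of b] by simp

text \<open>One operation for the sum (coefficients 1 and 1), the scalar multiple (second
  coefficient 0) and the skew-symmetrisation (coefficients 1/2 and -1/2), so that bilinearity is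
  proved once.\<close>

definition glincomb :: "real \<Rightarrow> ('m \<Rightarrow> 'm gvec) \<Rightarrow> real \<Rightarrow> ('m \<Rightarrow> 'm gvec) \<Rightarrow> 'm \<Rightarrow> 'm gvec" where
  "glincomb a u b v x = (\<lambda>f. a * fst (u x) f + b * fst (v x) f, \<lambda>vs. a * snd (u x) vs + b * snd (v x) vs)"

lemma gsec_glincomb: "open W \<Longrightarrow> gsec W u \<Longrightarrow> gsec W v \<Longrightarrow> gsec W (glincomb a u b v)"
  using gsec_add[OF _ gsec_cscale gsec_cscale, of W u v a b] by (simp add: gtan_ops glincomb_def[abs_def])

lemma dorfman_glincomb:
  assumes W: "open W" "x \<in> W" and u: "gsec W u" and u': "gsec W u'" and w: "gsec W w" and H: "diff_form A W 3 H"
  shows "dorfman A H (glincomb a u b u') w x = glincomb a (dorfman A H u w) b (dorfman A H u' w) x" (is ?left)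
    and "dorfman A H w (glincomb a u b u') x = glincomb a (dorfman A H w u) b (dorfman A H w u') x" (is ?right)
proof -
  note gc = gsec_glincomb[OF W(1) u u', of a b]
  note D = gsec_dorfman[OF W(1) _ _ H]
  have fs: "fst (glincomb a p b q y) = (\<lambda>f. a * fst (p y) f + b * fst (q y) f)"
    "snd (glincomb a p b q y) = (\<lambda>vs. a * snd (p y) vs + b * snd (q y) vs)" for p q y
    by (simp_all add: glincomb_def)
  note Hx = df_alt[OF H W(2)]
  show ?left
  proof (rule gvec_eqI[OF W gsec_gtan[OF D[OF gc w] W(2)] gsec_gtan[OF gsec_glincomb[OF W(1) D[OF u w] D[OF u' w]] W(2)]])
    show "fst (dorfman A H (glincomb a u b u') w x) = fst (glincomb a (dorfman A H u w) b (dorfman A H u' w) x)"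
      unfolding fs dorfman_fst by (rule lie_lincomb_left[OF W gsec_vf[OF u] gsec_vf[OF u'] gsec_vf[OF w]])
    fix V Z assume V: "open V" "x \<in> V" "V \<subseteq> W" and Z: "vector_field A V Z"
    note m = gsec_mono[OF _ V(3)]
    note uu = gsec_vf[OF m[OF u]] gsec_df[OF m[OF u]] and uu' = gsec_vf[OF m[OF u']] gsec_df[OF m[OF u']]
      and ww = gsec_vf[OF m[OF w]] gsec_df[OF m[OF w]]
    note ev = df_eval1[OF V(1)]
    have "gsec_dorfman_form H (glincomb a u b u') w Z x = a * gsec_dorfman_form H u w Z x + b * gsec_dorfman_form H u' w Z x"
      unfolding dorfman_form_def fs lie_lincomb_left[OF V(1,2) uu(1) uu'(1) Z]
        vf_flincomb[OF V(1,2) ww(1) ev[OF uu(2) Z] ev[OF uu'(2) Z]]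
        vf_flincomb[OF V(1,2) Z ev[OF uu(2) ww(1)] ev[OF uu'(2) ww(1)]]
        alt1_lincomb[OF df_alt[OF ww(2) V(2)] lie_tangent[OF V(1,2) uu(1) Z] lie_tangent[OF V(1,2) uu'(1) Z]]
        alt3_lincomb(2)[OF Hx vf_tangent[OF uu(1) V(2)] vf_tangent[OF uu'(1) V(2)] vf_tangent[OF ww(1) V(2)] vf_tangent[OF Z V(2)]]
      by (simp add: algebra_simps)
    then show "snd (dorfman A H (glincomb a u b u') w x) [Z x] = snd (glincomb a (dorfman A H u w) b (dorfman A H u' w) x) [Z x]"
      by (subst fs(2)) (simp only: dorfman_snd[OF V(1,2) m[OF gc] m[OF w] Z] dorfman_snd[OF V(1,2) m[OF u] m[OF w] Z]
        dorfman_snd[OF V(1,2) m[OF u'] m[OF w] Z])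
  qed
  show ?right
  proof (rule gvec_eqI[OF W gsec_gtan[OF D[OF w gc] W(2)] gsec_gtan[OF gsec_glincomb[OF W(1) D[OF w u] D[OF w u']] W(2)]])
    show "fst (dorfman A H w (glincomb a u b u') x) = fst (glincomb a (dorfman A H w u) b (dorfman A H w u') x)"
      unfolding fs dorfman_fst by (rule lie_lincomb_right[OF W gsec_vf[OF u] gsec_vf[OF u'] gsec_vf[OF w]])
    fix V Z assume V: "open V" "x \<in> V" "V \<subseteq> W" and Z: "vector_field A V Z"
    note m = gsec_mono[OF _ V(3)]
    note uu = gsec_vf[OF m[OF u]] gsec_df[OF m[OF u]] and uu' = gsec_vf[OF m[OF u']] gsec_df[OF m[OF u']]
      and ww = gsec_vf[OF m[OF w]] gsec_df[OF m[OF w]]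
    note ev = df_eval1[OF V(1)]
    have wa: "Z x (\<lambda>y. snd (w y) [\<lambda>f. a * fst (u y) f + b * fst (u' y) f]) =
        Z x (\<lambda>y. a * snd (w y) [fst (u y)] + b * snd (w y) [fst (u' y)])"
    proof (rule vf_fcong[OF V(1,2) Z, symmetric])
      show "smooth_fun A V (\<lambda>y. a * snd (w y) [fst (u y)] + b * snd (w y) [fst (u' y)])"
        by (intro smooth_fun_add smooth_fun_cmult V(1) ev[OF ww(2) uu(1)] ev[OF ww(2) uu'(1)])
      fix y assume y: "y \<in> V"
      show "a * snd (w y) [fst (u y)] + b * snd (w y) [fst (u' y)] = snd (w y) [\<lambda>f. a * fst (u y) f + b * fst (u' y) f]"
        using alt1_lincomb[OF df_alt[OF ww(2) y] vf_tangent[OF uu(1) y] vf_tangent[OF uu'(1) y]] by simp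
    qed
    have "gsec_dorfman_form H w (glincomb a u b u') Z x = a * gsec_dorfman_form H w u Z x + b * gsec_dorfman_form H w u' Z x"
      unfolding dorfman_form_def fs lie_lincomb_left[OF V(1,2) uu(1) uu'(1) Z]
        vf_flincomb[OF V(1,2) ww(1) ev[OF uu(2) Z] ev[OF uu'(2) Z]] wa
        vf_flincomb[OF V(1,2) Z ev[OF ww(2) uu(1)] ev[OF ww(2) uu'(1)]]
        alt1_lincomb[OF df_alt[OF ww(2) V(2)] lie_tangent[OF V(1,2) uu(1) Z] lie_tangent[OF V(1,2) uu'(1) Z]]
        alt3_lincomb(1)[OF Hx vf_tangent[OF uu(1) V(2)] vf_tangent[OF uu'(1) V(2)] vf_tangent[OF ww(1) V(2)] vf_tangent[OF Z V(2)]]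
      by (simp add: algebra_simps)
    then show "snd (dorfman A H w (glincomb a u b u') x) [Z x] = snd (glincomb a (dorfman A H w u) b (dorfman A H w u') x) [Z x]"
      by (subst fs(2)) (simp only: dorfman_snd[OF V(1,2) m[OF w] m[OF gc] Z] dorfman_snd[OF V(1,2) m[OF w] m[OF u] Z]
        dorfman_snd[OF V(1,2) m[OF w] m[OF u'] Z])
  qed
qed

lemma dorfman_cong:
  assumes V: "open V" "x \<in> V" and u: "gsec V u" and v: "gsec V v" and H: "diff_form A V 3 H"
    and eq: "\<And>y. y \<in> V \<Longrightarrow> u y = u' y" "\<And>y. y \<in> V \<Longrightarrow> v y = v' y"
  shows "dorfman A H u v x = dorfman A H u' v' x"
proof -
  have u': "gsec V u'" and v': "gsec V v'" using gsec_cong[OF V(1) u eq(1)] gsec_cong[OF V(1) v eq(2)] by auto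
  note D = gsec_dorfman[OF V(1) _ _ H]
  show ?thesis
  proof (rule gvec_eqI[OF V gsec_gtan[OF D[OF u v] V(2)] gsec_gtan[OF D[OF u' v'] V(2)]])
    show "fst (dorfman A H u v x) = fst (dorfman A H u' v' x)"
      unfolding dorfman_fst by (rule lie_cong[OF V gsec_vf[OF u] gsec_vf[OF v]]) (simp_all add: eq)
    fix W Z assume W: "open W" "x \<in> W" "W \<subseteq> V" and Z: "vector_field A W Z"
    note m = gsec_mono[OF _ W(3)]
    note uu = gsec_vf[OF m[OF u]] gsec_df[OF m[OF u]] and vv = gsec_vf[OF m[OF v]] gsec_df[OF m[OF v]]
    note ev = df_eval1[OF W(1)]
    have eq': "\<And>y. y \<in> W \<Longrightarrow> u y = u' y" "\<And>y. y \<in> W \<Longrightarrow> v y = v' y" using eq W by auto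
    have "gsec_dorfman_form H u v Z x = gsec_dorfman_form H u' v' Z x"
      unfolding dorfman_form_def
      using vf_fcong[OF W(1,2) uu(1) ev[OF vv(2) Z], of "\<lambda>y. snd (v' y) [Z y]"]
        vf_fcong[OF W(1,2) vv(1) ev[OF uu(2) Z], of "\<lambda>y. snd (u' y) [Z y]"]
        vf_fcong[OF W(1,2) Z ev[OF uu(2) vv(1)], of "\<lambda>y. snd (u' y) [fst (v' y)]"]
        lie_cong[OF W(1,2) uu(1) Z, of "\<lambda>y. fst (u' y)" Z] lie_cong[OF W(1,2) vv(1) Z, of "\<lambda>y. fst (v' y)" Z]
      by (simp add: eq' W(2))
    then show "snd (dorfman A H u v x) [Z x] = snd (dorfman A H u' v' x) [Z x]"
      using dorfman_snd[OF W(1,2) m[OF u] m[OF v] Z] dorfman_snd[OF W(1,2) m[OF u'] m[OF v'] Z] by simp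
  qed
qed

lemma dorfman_leibniz:
  assumes W: "open W" "x \<in> W" and u: "gsec W u" and v: "gsec W v" and w: "gsec W w" and H: "diff_form A W 3 H"
    and dH: "\<And>V P Q R S. open V \<Longrightarrow> x \<in> V \<Longrightarrow> V \<subseteq> W \<Longrightarrow> vector_field A V P \<Longrightarrow> vector_field A V Q \<Longrightarrow>
       vector_field A V R \<Longrightarrow> vector_field A V S \<Longrightarrow> ext_deriv_fields A H [P, Q, R, S] x = 0"
  shows "dorfman A H u (dorfman A H v w) x =
    vadd (gtan_vsp A x) (dorfman A H (dorfman A H u v) w x) (dorfman A H v (dorfman A H u w) x)"
proof -
  note D = gsec_dorfman[OF W(1) _ _ H]
  show ?thesis
  proof (rule gvec_eqI[OF W gsec_gtan[OF D[OF u D[OF v w]] W(2)]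
        gsec_gtan[OF gsec_add[OF W(1) D[OF D[OF u v] w] D[OF v D[OF u w]]] W(2)]])
    show "fst (dorfman A H u (dorfman A H v w) x) =
      fst (vadd (gtan_vsp A x) (dorfman A H (dorfman A H u v) w x) (dorfman A H v (dorfman A H u w) x))"
      using lie_jacobi[OF W gsec_vf[OF u] gsec_vf[OF v] gsec_vf[OF w]]
      by (simp add: gtan_ops dorfman_fst)
    fix V Z assume V: "open V" "x \<in> V" "V \<subseteq> W" and Z: "vector_field A V Z"
    note m = gsec_mono[OF _ V(3)]
    note u' = m[OF u] and v' = m[OF v] and w' = m[OF w]
    note vw' = m[OF D[OF v w]] and uv' = m[OF D[OF u v]] and uw' = m[OF D[OF u w]]
    note H' = df_mono[OF H V(3)]
    have "gsec_dorfman_form H u (dorfman A H v w) Z x = gsec_dorfman_form H (dorfman A H u v) w Z x + gsec_dorfman_form H v (dorfman A H u w) Z x"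
      unfolding dorfman_fst
      by (rule dorfman_form_leibniz[OF V(1,2) H' dH[OF V] gsec_vf[OF u'] gsec_df[OF u'] gsec_vf[OF v'] gsec_df[OF v']
            gsec_vf[OF w'] gsec_df[OF w'] _ _ _ Z])
        (simp_all add: dorfman_snd[OF V(1) _ v' w'] dorfman_snd[OF V(1) _ u' v'] dorfman_snd[OF V(1) _ u' w'])
    then show "snd (dorfman A H u (dorfman A H v w) x) [Z x] =
      snd (vadd (gtan_vsp A x) (dorfman A H (dorfman A H u v) w x) (dorfman A H v (dorfman A H u w) x)) [Z x]"
      using dorfman_snd[OF V(1,2) u' vw' Z] dorfman_snd[OF V(1,2) uv' w' Z] dorfman_snd[OF V(1,2) v' uw' Z]
      by (simp add: gtan_ops)
  qed
qed

text \<open>Apart from the derivatives of the pairing, all terms in the three 1-forms occur twice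
  with opposite signs, and the twist drops out because \<open>H\<close> changes sign when
  \<open>v\<close> and \<open>w\<close> are exchanged.\<close>

lemma dorfman_invariant:
  assumes W: "open W" "x \<in> W" and u: "gsec W u" and v: "gsec W v" and w: "gsec W w" and H: "diff_form A W 3 H"
  shows "fst (u x) (\<lambda>y. gpairing (v y) (w y)) =
    gpairing (dorfman A H u v x) (w x) + gpairing (v x) (dorfman A H u w x)"
proof -
  note uu = gsec_vf[OF u] gsec_df[OF u] and vv = gsec_vf[OF v] gsec_df[OF v] and ww = gsec_vf[OF w] gsec_df[OF w]
  note ev = df_eval1[OF W(1)]
  have "fst (u x) (\<lambda>y. gpairing (v y) (w y)) = fst (u x) (\<lambda>y. snd (w y) [fst (v y)]) + fst (u x) (\<lambda>y. snd (v y) [fst (w y)])"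
    unfolding gpairing_def by (rule vf_fadd[OF W uu(1) ev[OF ww(2) vv(1)] ev[OF vv(2) ww(1)]])
  moreover have "H x [fst (v x), fst (u x), fst (w x)] = - H x [fst (w x), fst (u x), fst (v x)]"
    using alt3_swap[OF df_alt[OF H W(2)]] vf_tangent[OF uu(1) W(2)] vf_tangent[OF vv(1) W(2)] vf_tangent[OF ww(1) W(2)]
    by (metis add.inverse_inverse)
  moreover have "snd (u x) [lie_bracket A (\<lambda>y. fst (v y)) (\<lambda>y. fst (w y)) x] =
      - snd (u x) [lie_bracket A (\<lambda>y. fst (w y)) (\<lambda>y. fst (v y)) x]"
    using alt1(2)[OF df_alt[OF uu(2) W(2)] lie_tangent[OF W ww(1) vv(1)] lie_tangent[OF W ww(1) vv(1)], of "-1"]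
    by (simp add: lie_antisym[of "\<lambda>y. fst (v y)"])
  ultimately show ?thesis
    unfolding gpairing_def dorfman_fst
    using dorfman_snd[OF W u v ww(1), of H] dorfman_snd[OF W u w vv(1), of H]
    by (simp add: dorfman_form_def)
qed

section \<open>Differentials of functions and the symmetric part of the bracket\<close>

definition dform :: "('m \<Rightarrow> real) \<Rightarrow> 'm \<Rightarrow> 'm mform" where
  "dform f x = (\<lambda>vs. if set vs \<subseteq> tangent_space A x \<and> length vs = 1 then hd vs f else 0)"

lemma dform_alt: "dform f x \<in> alt_forms A 1 x"
  by (rule alt_forms_1I) (auto simp: dform_def tangent_add tangent_scale)

lemma dform_apply: "v \<in> tangent_space A x \<Longrightarrow> dform f x [v] = v f"
  by (simp add: dform_def)

lemma df_dform: "smooth_fun A W f \<Longrightarrow> diff_form A W 1 (dform f)"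
proof (rule df1I)
  fix V X assume f: "smooth_fun A W f" and V: "open V" "V \<subseteq> W" "vector_field A V X"
  have "smooth_fun A V (\<lambda>x. X x f)" by (rule vf_smooth[OF V(1,3) smooth_fun_mono[OF f V(2)]])
  then show "smooth_fun A V (\<lambda>x. dform f x [X x])"
    using smooth_fun_cong[OF V(1), of "\<lambda>x. dform f x [X x]" "\<lambda>x. X x f"] dform_apply vf_tangent[OF V(3)] by simp
qed (rule dform_alt)

text \<open>The Lie bracket and the twist are skew, so what remains of the symmetrisation is the
  differential of the pairing. Half of it is what the Courant bracket removes and
  \<open>courant_circ\<close> adds back.\<close>

lemma dorfman_sym:
  assumes W: "open W" "x \<in> W" and u: "gsec W u" and v: "gsec W v" and H: "diff_form A W 3 H"
  shows "vadd (gtan_vsp A x) (dorfman A H u v x) (dorfman A H v u x) = (\<lambda>f. 0, dform (\<lambda>y. gpairing (u y) (v y)) x)"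
proof -
  note D = gsec_dorfman[OF W(1) _ _ H]
  show ?thesis
  proof (rule gvec_eqI[OF W gsec_gtan[OF gsec_add[OF W(1) D[OF u v] D[OF v u]] W(2)]])
    show "(\<lambda>f. 0, dform (\<lambda>y. gpairing (u y) (v y)) x) \<in> gtan A x"
      using dform_alt tangent_zero by (simp add: gtan_iff)
    show "fst (vadd (gtan_vsp A x) (dorfman A H u v x) (dorfman A H v u x)) = fst (\<lambda>f. 0, dform (\<lambda>y. gpairing (u y) (v y)) x)"
      by (simp add: gtan_ops dorfman_fst lie_bracket_def fun_eq_iff)
    fix V Z assume V: "open V" "x \<in> V" "V \<subseteq> W" and Z: "vector_field A V Z"
    note u' = gsec_mono[OF u V(3)] and v' = gsec_mono[OF v V(3)]
    note uu = gsec_vf[OF u'] gsec_df[OF u'] and vv = gsec_vf[OF v'] gsec_df[OF v']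
    have "Z x (\<lambda>y. gpairing (u y) (v y)) = Z x (\<lambda>y. snd (v y) [fst (u y)]) + Z x (\<lambda>y. snd (u y) [fst (v y)])"
      unfolding gpairing_def by (rule vf_fadd[OF V(1,2) Z df_eval1[OF V(1) vv(2) uu(1)] df_eval1[OF V(1) uu(2) vv(1)]])
    moreover have "H x [fst (v x), fst (u x), Z x] = - H x [fst (u x), fst (v x), Z x]"
      by (rule alt3_swap(1)[OF df_alt[OF H W(2)] vf_tangent[OF vv(1) V(2)] vf_tangent[OF uu(1) V(2)] vf_tangent[OF Z V(2)]])
    ultimately show "snd (vadd (gtan_vsp A x) (dorfman A H u v x) (dorfman A H v u x)) [Z x] =
        snd (\<lambda>f. 0, dform (\<lambda>y. gpairing (u y) (v y)) x) [Z x]"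
      using dorfman_snd[OF V(1,2) u' v' Z, of H] dorfman_snd[OF V(1,2) v' u' Z, of H] dform_apply[OF vf_tangent[OF Z V(2)]]
      by (simp add: gtan_ops dorfman_form_def)
  qed
qed

lemma courant_bracket_glincomb:
  "courant_bracket A H u v x = glincomb (1/2) (dorfman A H u v) (-1/2) (dorfman A H v u) x"
  by (simp add: courant_bracket_def gtan_ops glincomb_def fun_eq_iff algebra_simps)

lemma gsec_courant_bracket:
  "open W \<Longrightarrow> gsec W u \<Longrightarrow> gsec W v \<Longrightarrow> diff_form A W 3 H \<Longrightarrow> gsec W (courant_bracket A H u v)"
  using gsec_glincomb[OF _ gsec_dorfman[of W u v H] gsec_dorfman[of W v u H]]
  by (simp add: courant_bracket_glincomb[abs_def])

lemma courant_bracket_cong: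
  assumes "open V" "x \<in> V" "gsec V u" "gsec V v" "diff_form A V 3 H"
    "\<And>y. y \<in> V \<Longrightarrow> u y = u' y" "\<And>y. y \<in> V \<Longrightarrow> v y = v' y"
  shows "courant_bracket A H u v x = courant_bracket A H u' v' x"
  unfolding courant_bracket_def
  using dorfman_cong[of V x u v H u' v'] dorfman_cong[of V x v u H v' u'] assms by simp

lemma courant_dorfman:
  assumes W: "open W" "x \<in> W" and u: "gsec W u" and v: "gsec W v" and H: "diff_form A W 3 H"
  shows "vadd (gtan_vsp A x) (courant_bracket A H u v x)
      (vscale (gtan_vsp A x) (1/2) (\<lambda>f. 0, dform (\<lambda>y. gpairing (u y) (v y)) x)) = dorfman A H u v x"
  unfolding dorfman_sym[OF assms, symmetric] courant_bracket_def
  by (simp add: gtan_ops prod_eq_iff fun_eq_iff algebra_simps)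

section \<open>Transformations by 2-forms\<close>

lemma b_exp_fst: "fst (b_exp b u) = fst u"
  by (simp add: b_exp_def)

lemma contract2_alt:
  assumes b: "b \<in> alt_forms A 2 x" and X: "X \<in> tangent_space A x"
  shows "(\<lambda>vs. b (X # vs)) \<in> alt_forms A 1 x"
proof (rule alt_forms_1I)
  fix vs assume "\<not> (set vs \<subseteq> tangent_space A x \<and> length vs = 1)"
  then show "b (X # vs) = 0" by (intro alt_forms_zero[OF b]) auto
qed (use alt2[OF b _ _ X] in auto)

lemma b_exp_gtan:
  assumes b: "b \<in> alt_forms A 2 x" and u: "u \<in> gtan A x"
  shows "b_exp b u \<in> gtan A x"
  using alt_forms_lincomb[of "snd u" 1 x "\<lambda>vs. b (fst u # vs)" 1 1] contract2_alt[OF b, of "fst u"] u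
  by (simp add: gtan_iff b_exp_def)

lemma b_exp_pairing:
  assumes b: "b \<in> alt_forms A 2 x" and u: "u \<in> gtan A x" and v: "v \<in> gtan A x"
  shows "gpairing (b_exp b u) (b_exp b v) = gpairing u v"
  using alt2_swap[OF b, of "fst u" "fst v"] u v by (simp add: gpairing_def b_exp_def gtan_iff)

lemma b_exp_linear:
  assumes b: "b \<in> alt_forms A 2 x" and u: "u \<in> gtan A x" and v: "v \<in> gtan A x"
  shows "b_exp b (vadd (gtan_vsp A x) u v) = vadd (gtan_vsp A x) (b_exp b u) (b_exp b v)"
    "b_exp b (vscale (gtan_vsp A x) a u) = vscale (gtan_vsp A x) a (b_exp b u)"
proof -
  have T: "fst u \<in> tangent_space A x" "fst v \<in> tangent_space A x" using u v by (auto simp: gtan_iff)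
  have "b ((\<lambda>f. fst u f + fst v f) # vs) = b (fst u # vs) + b (fst v # vs)"
    "b ((\<lambda>f. a * fst u f) # vs) = a * b (fst u # vs)" for vs
  proof -
    show "b ((\<lambda>f. fst u f + fst v f) # vs) = b (fst u # vs) + b (fst v # vs)"
    proof (cases "set vs \<subseteq> tangent_space A x \<and> length vs = 1")
      case True
      then show ?thesis using alt2(1)[OF b T] by (auto simp: length_Suc_conv)
    next
      case False
      then have "b (X # vs) = 0" for X by (intro alt_forms_zero[OF b]) auto
      then show ?thesis by simp
    qed
    show "b ((\<lambda>f. a * fst u f) # vs) = a * b (fst u # vs)"
    proof (cases "set vs \<subseteq> tangent_space A x \<and> length vs = 1")
      case True
      then show ?thesis using alt2(2)[OF b T] by (auto simp: length_Suc_conv)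
    next
      case False
      then have "b (X # vs) = 0" for X by (intro alt_forms_zero[OF b]) auto
      then show ?thesis by simp
    qed
  qed
  then show "b_exp b (vadd (gtan_vsp A x) u v) = vadd (gtan_vsp A x) (b_exp b u) (b_exp b v)"
    "b_exp b (vscale (gtan_vsp A x) a u) = vscale (gtan_vsp A x) a (b_exp b u)"
    by (simp_all add: b_exp_def gtan_ops fun_eq_iff algebra_simps)
qed

lemma gsec_b_exp:
  assumes W: "open W" and b: "diff_form A W 2 b" and u: "gsec W u"
  shows "gsec W (\<lambda>x. b_exp (b x) (u x))"
  unfolding gsec_def b_exp_fst
proof
  show "vector_field A W (\<lambda>x. fst (u x))" by (rule gsec_vf[OF u])
  show "diff_form A W 1 (\<lambda>x. snd (b_exp (b x) (u x)))"
  proof (rule df1I)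
    fix x assume "x \<in> W"
    then show "snd (b_exp (b x) (u x)) \<in> alt_forms A 1 x"
      using b_exp_gtan[OF df_alt[OF b] gsec_gtan[OF u]] gtan_iff by blast
  next
    fix V Z assume V: "open V" "V \<subseteq> W" "vector_field A V Z"
    note u' = gsec_mono[OF u V(2)]
    show "smooth_fun A V (\<lambda>x. snd (b_exp (b x) (u x)) [Z x])"
      using smooth_fun_add[OF V(1) df_eval1[OF V(1) gsec_df[OF u'] V(3)] df_eval2[OF V(1) df_mono[OF b V(2)] gsec_vf[OF u'] V(3)]]
      by (simp add: b_exp_def)
  qed
qed

text \<open>In \<open>dorfman_form_b_shift\<close> the last two terms cancel, because the argument
  order of the twist makes it minus the exterior derivative of \<open>b\<close>; the remaining
  correction is the contraction of \<open>b\<close> with the vector part of the bracket, as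
  \<open>b_exp\<close> prescribes.\<close>

lemma dorfman_b_exp:
  assumes W: "open W" "x \<in> W" and b: "diff_form A W 2 b" and u: "gsec W u" and v: "gsec W v"
    and H: "diff_form A W 3 H" "\<forall>y\<in>W. H y = ext_deriv A b y"
  shows "dorfman A H (\<lambda>y. b_exp (b y) (u y)) (\<lambda>y. b_exp (b y) (v y)) x =
    b_exp (b x) (dorfman A (\<lambda>x vs. 0) u v x)"
proof -
  note E = gsec_b_exp[OF W(1) b]
  note D0 = gsec_dorfman[OF W(1) u v df_zero]
  show ?thesis
  proof (rule gvec_eqI[OF W gsec_gtan[OF gsec_dorfman[OF W(1) E[OF u] E[OF v] H(1)] W(2)]
        b_exp_gtan[OF df_alt[OF b W(2)] gsec_gtan[OF D0 W(2)]]])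
    show "fst (dorfman A H (\<lambda>y. b_exp (b y) (u y)) (\<lambda>y. b_exp (b y) (v y)) x) =
        fst (b_exp (b x) (dorfman A (\<lambda>x vs. 0) u v x))"
      by (simp add: dorfman_fst b_exp_fst)
    fix V Z assume V: "open V" "x \<in> V" "V \<subseteq> W" and Z: "vector_field A V Z"
    note m = gsec_mono[OF _ V(3)] and b' = df_mono[OF b V(3)]
    note u' = m[OF u] and v' = m[OF v]
    have "gsec_dorfman_form H (\<lambda>y. b_exp (b y) (u y)) (\<lambda>y. b_exp (b y) (v y)) Z x =
        gsec_dorfman_form (\<lambda>x vs. 0) u v Z x + b x [lie_bracket A (\<lambda>y. fst (u y)) (\<lambda>y. fst (v y)) x, Z x]
        + d2 b (\<lambda>y. fst (u y)) (\<lambda>y. fst (v y)) Z x + H x [fst (v x), fst (u x), Z x]"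
      unfolding b_exp_fst
      by (rule dorfman_form_b_shift[OF V(1,2) b' gsec_vf[OF u'] gsec_df[OF u'] gsec_vf[OF v'] gsec_df[OF v'] _ _ Z])
        (simp_all add: b_exp_def)
    moreover have "H x [fst (v x), fst (u x), Z x] = - d2 b (\<lambda>y. fst (u y)) (\<lambda>y. fst (v y)) Z x"
      using ext_deriv_2[OF V(1,2) b' gsec_vf[OF v'] gsec_vf[OF u'] Z]
        d2_swap(1)[OF V(1,2) b' gsec_vf[OF v'] gsec_vf[OF u'] Z] H(2) W(2) by simp
    ultimately show "snd (dorfman A H (\<lambda>y. b_exp (b y) (u y)) (\<lambda>y. b_exp (b y) (v y)) x) [Z x] =
        snd (b_exp (b x) (dorfman A (\<lambda>x vs. 0) u v x)) [Z x]"
      using dorfman_snd[OF V(1,2) m[OF E[OF u]] m[OF E[OF v]] Z] dorfman_snd[OF V(1,2) u' v' Z]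
      by (simp add: b_exp_def dorfman_fst)
  qed
qed

lemma courant_bracket_b_exp:
  assumes W: "open W" "x \<in> W" and b: "diff_form A W 2 b" and u: "gsec W u" and v: "gsec W v"
    and H: "diff_form A W 3 H" "\<forall>y\<in>W. H y = ext_deriv A b y"
  shows "courant_bracket A H (\<lambda>y. b_exp (b y) (u y)) (\<lambda>y. b_exp (b y) (v y)) x =
    b_exp (b x) (courant_bracket A (\<lambda>x vs. 0) u v x)"
proof -
  note g = gsec_gtan[OF gsec_dorfman[OF W(1) _ _ df_zero] W(2)]
  note bx = df_alt[OF b W(2)]
  have sc: "vscale (gtan_vsp A x) a w \<in> gtan A x" if "w \<in> gtan A x" for a w
    using that alt_forms_lincomb[of "snd w" 1 x "snd w" a 0] by (simp add: gtan_iff gtan_ops tangent_scale)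
  have ad: "vadd (gtan_vsp A x) w z \<in> gtan A x" if "w \<in> gtan A x" "z \<in> gtan A x" for w z
    using that alt_forms_lincomb[of "snd w" 1 x "snd z" 1 1] by (simp add: gtan_iff gtan_ops tangent_add)
  show ?thesis
    by (simp only: courant_bracket_def dorfman_b_exp[OF W b u v H] dorfman_b_exp[OF W b v u H]
      b_exp_linear(2)[OF bx g[OF v u] g[OF v u]]
      b_exp_linear(1)[OF bx g[OF u v] sc[OF g[OF v u]]]
      b_exp_linear(2)[OF bx ad[OF g[OF u v] sc[OF g[OF v u]]] g[OF u v]])
qed

end

section \<open>The generalized tangent bundle as a vector bundle\<close>

lemma basis_vsp_coords:
  assumes "basis_vsp V n e" "v \<in> vcarrier V"
  shows "\<forall>k\<ge>n. coords V n e v k = 0" "v = lincomb V (coords V n e v) e n"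
proof -
  have "\<exists>!c. (\<forall>k\<ge>n. c k = 0) \<and> v = lincomb V c e n" using assms by (simp add: basis_vsp_def)
  from theI'[OF this] show "\<forall>k\<ge>n. coords V n e v k = 0" "v = lincomb V (coords V n e v) e n"
    by (simp_all add: coords_def)
qed

lemma coords_eqI:
  assumes "basis_vsp V n e" "v \<in> vcarrier V" "\<forall>k\<ge>n. c k = 0" "v = lincomb V c e n"
  shows "coords V n e v = c"
proof -
  have "\<exists>!c. (\<forall>k\<ge>n. c k = 0) \<and> v = lincomb V c e n" using assms by (simp add: basis_vsp_def)
  then show ?thesis using assms(3,4) basis_vsp_coords[OF assms(1,2)] by blast
qed

lemma lincomb_cong: "(\<And>k. k < n \<Longrightarrow> c k = d k) \<Longrightarrow> lincomb V c e n = lincomb V d e n"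
  by (induction n) auto

lemma basis_vsp_independent:
  assumes e: "basis_vsp V n e" and zero: "vzero V \<in> vcarrier V" "lincomb V (\<lambda>k. 0) e n = vzero V"
    and d: "lincomb V d e n = vzero V" and k: "k < n"
  shows "d k = 0"
proof -
  \<comment> \<open>Coordinates are normalised to vanish from index \<open>n\<close> on, so
    \<open>d\<close> is truncated before uniqueness is applied.\<close>
  have "lincomb V (\<lambda>k. if k < n then d k else 0) e n = lincomb V d e n"
    by (rule lincomb_cong) simp
  then have "coords V n e (vzero V) = (\<lambda>k. if k < n then d k else 0)"
    by (intro coords_eqI[OF e zero(1)]) (use d in auto)
  moreover have "coords V n e (vzero V) = (\<lambda>k. 0)"
    by (rule coords_eqI[OF e zero(1)]) (use zero in auto)
  ultimately show ?thesis using k by (metis (full_types))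
qed

lemma sum_double: "(\<Sum>k<2 * n. f k) = (\<Sum>k<n. f k) + (\<Sum>k<n. f (n + k :: nat) :: real)"
proof -
  have "(\<Sum>k<n + m. f k) = (\<Sum>k<n. f k) + (\<Sum>k<m. f (n + k))" for m
    by (induction m) (simp_all add: add.assoc)
  from this[of n] show ?thesis by (simp add: mult_2)
qed

context smooth_mfd
begin

text \<open>Solutions of a linear system with smooth coefficients and trivial kernel are smooth: eliminate
  the last unknown with a row whose last coefficient does not vanish at the given point.\<close>
lemma smooth_linear_system:
  fixes G :: "nat \<Rightarrow> nat \<Rightarrow> 'm \<Rightarrow> real" and s c :: "nat \<Rightarrow> 'm \<Rightarrow> real"
  assumes "open N"
    and "\<And>l k. l < m \<Longrightarrow> k < n \<Longrightarrow> smooth_fun A N (G l k)"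
    and "\<And>l. l < m \<Longrightarrow> smooth_fun A N (s l)"
    and "\<And>x l. x \<in> N \<Longrightarrow> l < m \<Longrightarrow> (\<Sum>k<n. G l k x * c k x) = s l x"
    and "\<And>x d k. x \<in> N \<Longrightarrow> (\<And>l. l < m \<Longrightarrow> (\<Sum>k<n. G l k x * d k) = 0) \<Longrightarrow> k < n \<Longrightarrow> d k = 0"
    and "k < n"
  shows "smooth_fun A N (c k)"
  using assms
proof (induction n arbitrary: N G s k)
  case 0
  then show ?case by simp
next
  case (Suc n)
  note N = Suc.prems(1) and G = Suc.prems(2) and s = Suc.prems(3) and eqn = Suc.prems(4) and ker = Suc.prems(5)
  show ?case
  proof (rule smooth_fun_local)
    fix x0 assume x0: "x0 \<in> N"
    \<comment> \<open>Otherwise the last unit vector would lie in the kernel.\<close>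
    have "\<exists>l<m. G l n x0 \<noteq> 0"
    proof (rule ccontr)
      assume "\<not> (\<exists>l<m. G l n x0 \<noteq> 0)"
      then have "(if n = n then 1 else 0 :: real) = 0"
        by (intro ker[OF x0, of "\<lambda>k. if k = n then 1 else 0" n]) (auto simp: if_distrib cong: if_cong)
      then show False by simp
    qed
    then obtain l where l: "l < m" "G l n x0 \<noteq> 0" by blast
    obtain N' where N': "open N'" "x0 \<in> N'" "N' \<subseteq> N" "\<And>y. y \<in> N' \<Longrightarrow> G l n y \<noteq> 0"
      using smooth_fun_nonzero_nbhd[OF N G[OF l(1) lessI] x0 l(2)] by metis
    have G': "smooth_fun A N' (G l' k)" if "l' < m" "k < Suc n" for l' k
      by (rule smooth_fun_mono[OF G[OF that] N'(3)])
    have s': "smooth_fun A N' (s l')" if "l' < m" for l'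
      by (rule smooth_fun_mono[OF s[OF that] N'(3)])
    \<comment> \<open>The system after subtracting from each row the multiple of the pivot row
      \<open>l\<close> that clears the last column; the pivot row itself becomes trivial.\<close>
    define F where "F l' k y = G l' k y - G l' n y * G l k y / G l n y" for l' k y
    define t where "t l' y = s l' y - G l' n y * s l y / G l n y" for l' y
    have row: "c n y = (s l y - (\<Sum>k<n. G l k y * c k y)) / G l n y" if "y \<in> N'" for y
      using eqn[of y l] N'(3,4) that l(1) by (auto simp: field_simps)
    have sumF: "(\<Sum>k<n. F l' k y * d k) = (\<Sum>k<n. G l' k y * d k) - G l' n y * (\<Sum>k<n. G l k y * d k) / G l n y" for l' y d
      by (simp add: F_def left_diff_distrib sum_subtractf sum_distrib_left sum_divide_distrib mult.assoc)
    have ck: "smooth_fun A N' (c k)" if k: "k < n" for k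
    proof (rule Suc.IH[of N' F t, OF N'(1) _ _ _ _ k])
      fix l' k assume "l' < m" "k < n"
      then show "smooth_fun A N' (F l' k)"
        unfolding F_def using l(1) N'(4)
        by (intro smooth_fun_diff smooth_fun_divide smooth_fun_mult N'(1) G') auto
    next
      fix l' assume "l' < m"
      then show "smooth_fun A N' (t l')"
        unfolding t_def using l(1) N'(4)
        by (intro smooth_fun_diff smooth_fun_divide smooth_fun_mult N'(1) G' s') auto
    next
      fix y l' assume y: "y \<in> N'" and l': "l' < m"
      have "s l' y = (\<Sum>k<n. G l' k y * c k y) + G l' n y * c n y" "s l y = (\<Sum>k<n. G l k y * c k y) + G l n y * c n y"
        using eqn[of y] y N'(3) l' l(1) by auto
      then show "(\<Sum>k<n. F l' k y * c k y) = t l' y"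
        unfolding sumF t_def using N'(4)[OF y] by (simp add: field_simps)
    next
      fix y d k assume y: "y \<in> N'" and k: "k < n" and d: "\<And>l'. l' < m \<Longrightarrow> (\<Sum>k<n. F l' k y * d k) = 0"
      \<comment> \<open>A kernel vector of the reduced system is completed by the last entry that
        the pivot row forces, giving a kernel vector of the original one.\<close>
      define d' where "d' = d(n := - (\<Sum>k<n. G l k y * d k) / G l n y)"
      have "(\<Sum>k<Suc n. G l' k y * d' k) = 0" if "l' < m" for l'
      proof -
        have "(\<Sum>k<n. G l' k y * d' k) = (\<Sum>k<n. G l' k y * d k)"
          by (rule sum.cong) (auto simp: d'_def)
        then show ?thesis using d[OF that] unfolding sumF by (simp add: d'_def)
      qed
      then have "d' k = 0" using ker[of y d' k] y N'(3) k by auto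
      then show "d k = 0" using k by (simp add: d'_def)
    qed
    have "smooth_fun A N' (\<lambda>y. (s l y - (\<Sum>k<n. G l k y * c k y)) / G l n y)"
      using l(1) N'(4) by (intro smooth_fun_divide smooth_fun_diff smooth_fun_sum smooth_fun_mult N'(1) G' s' ck) auto
    then have cn: "smooth_fun A N' (c n)"
      using smooth_fun_cong[OF N'(1), of "c n" "\<lambda>y. (s l y - (\<Sum>k<n. G l k y * c k y)) / G l n y"] row by simp
    have "smooth_fun A N' (c k)" using ck cn \<open>k < Suc n\<close> by (cases "k = n") auto
    then show "\<exists>M. open M \<and> x0 \<in> M \<and> smooth_fun A (N \<inter> M) (c k)"
      using N' by (metis Int_absorb1)
  qed
qed

lemma lincomb_tangent: "lincomb (tangent_vsp A x) c e n = (\<lambda>f. \<Sum>k<n. c k * e k f)"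
  by (induction n) (simp_all add: tangent_vsp_def)

lemma lincomb_gtan:
  "lincomb (gtan_vsp A x) c e n = (\<lambda>f. \<Sum>k<n. c k * fst (e k) f, \<lambda>vs. \<Sum>k<n. c k * snd (e k) vs)"
  by (induction n) (simp_all add: gtan_vsp_def)

lemma gtan_closed:
  "(\<lambda>f. 0, \<lambda>vs. 0) \<in> gtan A x"
  "u \<in> gtan A x \<Longrightarrow> v \<in> gtan A x \<Longrightarrow> vadd (gtan_vsp A x) u v \<in> gtan A x"
  "u \<in> gtan A x \<Longrightarrow> vscale (gtan_vsp A x) a u \<in> gtan A x"
  using tangent_zero[of x] alt_forms_0[of 1 x] tangent_add[of "fst u" x "fst v"] tangent_scale[of "fst u" x a]
    alt_forms_lincomb[of "snd u" 1 x "snd v" 1 1] alt_forms_lincomb[of "snd u" 1 x "snd u" a 0]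
  by (simp_all add: gtan_iff gtan_ops)

lemma gtan_real_vsp: "real_vsp (gtan_vsp A x)"
  unfolding real_vsp_def
  using gtan_closed by (auto simp: gtan_ops algebra_simps)

lemma gtan_zero: "vzero (gtan_vsp A x) \<in> gtan A x" "lincomb (gtan_vsp A x) (\<lambda>k. 0) e n = vzero (gtan_vsp A x)"
  using gtan_closed(1) by (simp_all add: gtan_ops lincomb_gtan)

text \<open>Pairing with the differential of any function \<open>f\<close> yields
  \<open>fst u f\<close>, which determines a derivation; pairing with vectors determines the
  covector.\<close>

lemma gpairing_nondegenerate:
  assumes u: "u \<in> gtan A x" and z: "\<And>v. v \<in> gtan A x \<Longrightarrow> gpairing u v = 0"
  shows "u = vzero (gtan_vsp A x)"
proof -
  have T: "fst u \<in> tangent_space A x" and al: "snd u \<in> alt_forms A 1 x" using u by (auto simp: gtan_iff)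
  have "fst u f = 0" for f
  proof -
    have "(\<lambda>f. 0, dform f x) \<in> gtan A x"
      using dform_alt tangent_zero by (simp add: gtan_iff)
    from z[OF this] show ?thesis using alt1(2)[OF al T T, of 0] dform_apply[OF T] by (simp add: gpairing_def)
  qed
  moreover have "snd u = (\<lambda>vs. 0)"
  proof (rule alt1_eqI[OF al alt_forms_0])
    fix v assume v: "v \<in> tangent_space A x"
    then have "(v, \<lambda>vs. 0) \<in> gtan A x" using alt_forms_0 by (simp add: gtan_iff)
    from z[OF this] show "snd u [v] = 0" by (simp add: gpairing_def)
  qed
  ultimately show ?thesis by (simp add: gtan_ops prod_eq_iff fun_eq_iff)
qed

lemma gpairing_sym: "gpairing u v = gpairing v u"
  by (simp add: gpairing_def)

lemma gpairing_linear:
  assumes "u \<in> gtan A x" "v \<in> gtan A x" "w \<in> gtan A x"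
  shows "gpairing (vadd (gtan_vsp A x) u v) w = gpairing u w + gpairing v w"
    "gpairing (vscale (gtan_vsp A x) a u) w = a * gpairing u w"
  using alt1(1)[of "snd w" x "fst u" "fst v"] alt1(2)[of "snd w" x "fst u" "fst u" a] assms
  by (simp_all add: gpairing_def gtan_ops gtan_iff algebra_simps)

lemma lincomb_gtan_closed: "(\<And>k. k < n \<Longrightarrow> e k \<in> gtan A x) \<Longrightarrow> lincomb (gtan_vsp A x) c e n \<in> gtan A x"
proof (induction n)
  case 0
  then show ?case using gtan_zero by simp
next
  case (Suc n)
  then show ?case using gtan_closed(2,3) by simp
qed

lemma gpairing_lincomb:
  assumes "\<And>k. k < n \<Longrightarrow> e k \<in> gtan A x" "w \<in> gtan A x"
  shows "gpairing (lincomb (gtan_vsp A x) c e n) w = (\<Sum>k<n. c k * gpairing (e k) w)"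
  using assms(1)
proof (induction n)
  case 0
  have "gpairing (vscale (gtan_vsp A x) 0 w) w = 0 * gpairing w w" by (rule gpairing_linear(2)[OF assms(2,2,2)])
  then show ?case by (simp add: gtan_ops)
next
  case (Suc n)
  have "gpairing (vadd (gtan_vsp A x) (lincomb (gtan_vsp A x) c e n) (vscale (gtan_vsp A x) (c n) (e n))) w =
    gpairing (lincomb (gtan_vsp A x) c e n) w + gpairing (vscale (gtan_vsp A x) (c n) (e n)) w"
    by (rule gpairing_linear(1)) (use Suc.prems assms(2) in \<open>auto intro: lincomb_gtan_closed gtan_closed\<close>)
  then show ?case using Suc gpairing_linear(2)[of "e n" x w w] assms(2) by simp
qed

lemma gtb_simps: "fibre (gen_tangent_bundle A W) = gtan_vsp A" "vrank (gen_tangent_bundle A W) = 2 * adim A"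
  by (simp_all add: gen_tangent_bundle_def)

lemma gtb_frames_iff:
  "(V, e) \<in> frames (gen_tangent_bundle A W) \<longleftrightarrow> open V \<and> V \<subseteq> W \<and> (\<forall>k<2 * adim A. gsec V (e k)) \<and>
     (\<forall>x\<in>V. basis_vsp (gtan_vsp A x) (2 * adim A) (\<lambda>k. e k x))"
  by (simp add: gen_tangent_bundle_def gsec_def)

section \<open>Coordinate frames of the generalized tangent bundle\<close>

definition chart_frame :: "'m set \<Rightarrow> ('m \<Rightarrow> 'e) \<Rightarrow> nat \<Rightarrow> 'm \<Rightarrow> 'm gvec" where
  "chart_frame V c k x = (if k < adim A then (partial V c k x, \<lambda>vs. 0)
     else (\<lambda>f. 0, dform (chart_coord c (k - adim A)) x))"

context
  fixes V :: "'m set" and c assumes Vc: "(V, c) \<in> A"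
begin

lemma gsec_chart_frame: "gsec V (chart_frame V c k)"
  unfolding gsec_def chart_frame_def
  using partial_vector_field[OF Vc, of k] df_zero[of V 1] vf_zero[OF chart_open[OF Vc]]
    df_dform[OF smooth_fun_chart_coord[OF Vc], of "k - adim A"]
  by (cases "k < adim A") simp_all

lemma chart_frame_basis:
  assumes x: "x \<in> V"
  shows "basis_vsp (gtan_vsp A x) (2 * adim A) (\<lambda>k. chart_frame V c k x)"
proof -
  let ?n = "adim A"
  note pt = partial_tangent[OF Vc x]
  have lc: "lincomb (gtan_vsp A x) d (\<lambda>k. chart_frame V c k x) (2 * ?n) =
     (\<lambda>f. \<Sum>k<?n. d k * partial V c k x f, \<lambda>vs. \<Sum>k<?n. d (?n + k) * dform (chart_coord c k) x vs)" for d
    by (simp add: lincomb_gtan sum_double chart_frame_def)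
  have coef1: "(\<Sum>k<?n. d k * partial V c k x (chart_coord c j)) = d j" if "j < ?n" for d j
  proof -
    have "(\<Sum>k<?n. d k * partial V c k x (chart_coord c j)) = (\<Sum>k<?n. if k = j then d k else 0)"
      by (rule sum.cong) (auto simp: partial_coord[OF Vc x that])
    then show ?thesis using that by simp
  qed
  have coef2: "(\<Sum>k<?n. d k * dform (chart_coord c k) x [partial V c j x]) = d j" if "j < ?n" for d j
  proof -
    have "(\<Sum>k<?n. d k * dform (chart_coord c k) x [partial V c j x]) = (\<Sum>k<?n. if k = j then d k else 0)"
      by (rule sum.cong) (auto simp: dform_apply[OF pt] partial_coord[OF Vc x _ that])
    then show ?thesis using that by simp
  qed
  show ?thesis
    unfolding basis_vsp_def
  proof (intro conjI allI impI ballI)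
    fix k assume "k < 2 * ?n"
    show "chart_frame V c k x \<in> gtan A x" by (rule gsec_gtan[OF gsec_chart_frame x])
  next
    fix v assume v: "v \<in> gtan A x"
    then have T: "fst v \<in> tangent_space A x" and al: "snd v \<in> alt_forms A 1 x" by (auto simp: gtan_iff)
    \<comment> \<open>Coordinate fields and coordinate differentials are dual to each other, so
      coefficients are read off by applying the derivation to the coordinates and the covector to
      the coordinate fields.\<close>
    define d where "d k = (if k < ?n then fst v (chart_coord c k) else if k < 2 * ?n then snd v [partial V c (k - ?n) x] else 0)" for k
    show "\<exists>!d. (\<forall>k\<ge>2 * ?n. d k = 0) \<and> v = lincomb (gtan_vsp A x) d (\<lambda>k. chart_frame V c k x) (2 * ?n)"
    proof (rule ex1I[of _ d])
      have "fst v = (\<lambda>f. \<Sum>k<?n. d k * partial V c k x f)"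
        unfolding d_def by (rule ext, subst tangent_expand[OF Vc T x]) simp
      moreover have "snd v = (\<lambda>vs. \<Sum>k<?n. d (?n + k) * dform (chart_coord c k) x vs)"
      proof (rule alt1_eqI[OF al])
        have "(\<lambda>vs. \<Sum>k<m. d (?n + k) * dform (chart_coord c k) x vs) \<in> alt_forms A 1 x" for m
        proof (induction m)
          case (Suc m)
          then show ?case using alt_forms_lincomb[OF Suc dform_alt, of 1 "d (?n + m)" "chart_coord c m"] by simp
        qed (use alt_forms_0 in simp)
        then show "(\<lambda>vs. \<Sum>k<?n. d (?n + k) * dform (chart_coord c k) x vs) \<in> alt_forms A 1 x" .
        fix u assume u: "u \<in> tangent_space A x"
        have lin: "snd v [\<lambda>f. \<Sum>k<m. a k * partial V c k x f] = (\<Sum>k<m. a k * snd v [partial V c k x])" for m a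
        proof (induction m)
          case 0
          show ?case using alt1(2)[OF al T T, of 0] by simp
        next
          case (Suc m)
          have st: "(\<lambda>f. \<Sum>k<m. a k * partial V c k x f) \<in> tangent_space A x"
            by (intro tangent_sum tangent_scale pt)
          show ?case using alt1(1)[OF al st tangent_scale[OF pt], of "a m" m] alt1(2)[OF al pt pt, of "a m" m] Suc by simp
        qed
        have "u = (\<lambda>f. \<Sum>k<?n. u (chart_coord c k) * partial V c k x f)"
          by (rule ext) (rule tangent_expand[OF Vc u x])
        then have "snd v [u] = (\<Sum>k<?n. u (chart_coord c k) * snd v [partial V c k x])"
          using lin[of "\<lambda>k. u (chart_coord c k)" ?n] by metis
        then show "snd v [u] = (\<Sum>k<?n. d (?n + k) * dform (chart_coord c k) x [u])"
          by (simp add: d_def dform_apply[OF u] mult.commute)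
      qed
      ultimately show "(\<forall>k\<ge>2 * ?n. d k = 0) \<and> v = lincomb (gtan_vsp A x) d (\<lambda>k. chart_frame V c k x) (2 * ?n)"
        unfolding lc by (auto simp: d_def prod_eq_iff)
    next
      fix d' assume d': "(\<forall>k\<ge>2 * ?n. d' k = 0) \<and> v = lincomb (gtan_vsp A x) d' (\<lambda>k. chart_frame V c k x) (2 * ?n)"
      then have v': "fst v = (\<lambda>f. \<Sum>k<?n. d' k * partial V c k x f)"
        "snd v = (\<lambda>vs. \<Sum>k<?n. d' (?n + k) * dform (chart_coord c k) x vs)" unfolding lc by auto
      show "d' = d"
      proof
        fix k
        consider "k < ?n" | "?n \<le> k" "k < 2 * ?n" | "2 * ?n \<le> k" by linarith
        then show "d' k = d k"
        proof cases
          case 1 then show ?thesis using coef1[of k d'] v'(1) by (simp add: d_def)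
        next
          case 2
          then have "k - ?n < ?n" "?n + (k - ?n) = k" by auto
          then show ?thesis using coef2[of "k - ?n" "\<lambda>k. d' (?n + k)"] v'(2) 2 by (simp add: d_def)
        next
          case 3 then show ?thesis using d' by (simp add: d_def)
        qed
      qed
    qed
  qed
qed

lemma chart_frame_gtb: "open W \<Longrightarrow> (V \<inter> W, chart_frame V c) \<in> frames (gen_tangent_bundle A W)"
  unfolding gtb_frames_iff
  using chart_open[OF Vc] gsec_mono[OF gsec_chart_frame] chart_frame_basis by auto

end

text \<open>Pairing a section with the frame gives a linear system for its coordinates whose matrix
  is the Gram matrix of the frame. Its entries are smooth and its kernel is trivial by
  nondegeneracy, whatever the frame.\<close>

lemma gtb_coords_smooth:
  assumes e: "(V', e) \<in> frames (gen_tangent_bundle A W)" and V: "open V" and s: "gsec V s" and k: "k < 2 * adim A"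
  shows "smooth_fun A (V \<inter> V') (\<lambda>x. coords (gtan_vsp A x) (2 * adim A) (\<lambda>k. e k x) (s x) k)"
proof -
  let ?n = "2 * adim A" and ?N = "V \<inter> V'"
  have V': "open V'" and es: "\<And>k. k < ?n \<Longrightarrow> gsec V' (e k)"
    and ba: "\<And>x. x \<in> V' \<Longrightarrow> basis_vsp (gtan_vsp A x) ?n (\<lambda>k. e k x)"
    using e by (auto simp: gtb_frames_iff)
  have N: "open ?N" using V V' by auto
  have eN: "gsec ?N (e k)" if "k < ?n" for k by (rule gsec_mono[OF es[OF that]]) auto
  have sN: "gsec ?N s" by (rule gsec_mono[OF s]) auto
  have eg: "e k x \<in> gtan A x" if "k < ?n" "x \<in> V'" for k x by (rule gsec_gtan[OF es[OF that(1)] that(2)])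
  show ?thesis
  proof (rule smooth_linear_system[where m="?n" and n="?n" and G="\<lambda>l k x. gpairing (e k x) (e l x)"
        and s="\<lambda>l x. gpairing (s x) (e l x)" and c="\<lambda>k x. coords (gtan_vsp A x) ?n (\<lambda>k. e k x) (s x) k", OF N _ _ _ _ k])
    fix l k assume "l < ?n" "k < ?n"
    then show "smooth_fun A ?N (\<lambda>x. gpairing (e k x) (e l x))" by (intro gsec_pairing N eN)
  next
    fix l assume "l < ?n"
    then show "smooth_fun A ?N (\<lambda>x. gpairing (s x) (e l x))" by (intro gsec_pairing N eN sN)
  next
    fix x l assume x: "x \<in> ?N" and l: "l < ?n"
    have "s x = lincomb (gtan_vsp A x) (coords (gtan_vsp A x) ?n (\<lambda>k. e k x) (s x)) (\<lambda>k. e k x) ?n"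
      by (rule basis_vsp_coords(2)[OF ba gsec_gtan[OF sN x]]) (use x in auto)
    then have "gpairing (s x) (e l x) = (\<Sum>k<?n. coords (gtan_vsp A x) ?n (\<lambda>k. e k x) (s x) k * gpairing (e k x) (e l x))"
      using gpairing_lincomb[of ?n "\<lambda>k. e k x" x "e l x" "coords (gtan_vsp A x) ?n (\<lambda>k. e k x) (s x)"] eg x l by auto
    then show "(\<Sum>k<?n. gpairing (e k x) (e l x) * coords (gtan_vsp A x) ?n (\<lambda>k. e k x) (s x) k) = gpairing (s x) (e l x)"
      by (simp add: mult.commute)
  next
    fix x d k assume x: "x \<in> ?N" and k: "k < ?n"
      and d: "\<And>l. l < ?n \<Longrightarrow> (\<Sum>k<?n. gpairing (e k x) (e l x) * d k) = 0"
    let ?u = "lincomb (gtan_vsp A x) d (\<lambda>k. e k x) ?n"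
    have ug: "?u \<in> gtan A x" by (rule lincomb_gtan_closed) (use eg x in auto)
    have ul: "gpairing ?u (e l x) = 0" if "l < ?n" for l
      using gpairing_lincomb[of ?n "\<lambda>k. e k x" x "e l x" d] eg x that d[OF that] by (simp add: mult.commute)
    have "?u = vzero (gtan_vsp A x)"
    proof (rule gpairing_nondegenerate[OF ug])
      fix w assume w: "w \<in> gtan A x"
      let ?c = "coords (gtan_vsp A x) ?n (\<lambda>k. e k x) w"
      have "w = lincomb (gtan_vsp A x) ?c (\<lambda>k. e k x) ?n"
        by (rule basis_vsp_coords(2)[OF ba w]) (use x in auto)
      then have "gpairing w ?u = (\<Sum>k<?n. ?c k * gpairing (e k x) ?u)"
        using gpairing_lincomb[of ?n "\<lambda>k. e k x" x ?u ?c] eg x ug by auto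
      also have "\<dots> = 0" using ul by (intro sum.neutral) (simp add: gpairing_sym[of "e _ x" ?u])
      finally show "gpairing ?u w = 0" by (simp add: gpairing_sym)
    qed
    then show "d k = 0"
      by (intro basis_vsp_independent[OF ba gtan_zero _ k]) (use x in auto)
  qed
qed

lemma vector_bundle_gtb: "open W \<Longrightarrow> vector_bundle A W (gen_tangent_bundle A W)"
  unfolding vector_bundle_def gtb_simps
proof (intro conjI)
  assume W: "open W"
  show "(\<Union>(V, e)\<in>frames (gen_tangent_bundle A W). V) = W"
  proof
    show "(\<Union>(V, e)\<in>frames (gen_tangent_bundle A W). V) \<subseteq> W" using gtb_frames_iff by auto
    show "W \<subseteq> (\<Union>(V, e)\<in>frames (gen_tangent_bundle A W). V)"
    proof
      fix x assume x: "x \<in> W"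
      obtain V c where Vc: "(V, c) \<in> A" "x \<in> V" using chart_exists by blast
      show "x \<in> (\<Union>(V, e)\<in>frames (gen_tangent_bundle A W). V)"
        using chart_frame_gtb[OF Vc(1) W] x Vc(2) by blast
    qed
  qed
next
  show "\<forall>(V, e)\<in>frames (gen_tangent_bundle A W). \<forall>(V', e')\<in>frames (gen_tangent_bundle A W).
      \<forall>j<2 * adim A. \<forall>k<2 * adim A.
        smooth_fun A (V \<inter> V') (\<lambda>x. coords (gtan_vsp A x) (2 * adim A) (\<lambda>k. e k x) (e' j x) k)"
  proof clarify
    fix V e V' e' j k
    assume e: "(V, e) \<in> frames (gen_tangent_bundle A W)" and e': "(V', e') \<in> frames (gen_tangent_bundle A W)"
      and jk: "j < 2 * adim A" "k < 2 * adim A"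
    have "open V'" "gsec V' (e' j)" using e' jk by (auto simp: gtb_frames_iff)
    from gtb_coords_smooth[OF e this jk(2)]
    show "smooth_fun A (V \<inter> V') (\<lambda>x. coords (gtan_vsp A x) (2 * adim A) (\<lambda>k. e k x) (e' j x) k)"
      by (simp add: Int_commute)
  qed
next
  show "\<forall>(V, e)\<in>frames (gen_tangent_bundle A W). open V \<and>
      (\<forall>x\<in>V. basis_vsp (gtan_vsp A x) (2 * adim A) (\<lambda>k. e k x))"
    using gtb_frames_iff by blast
qed (simp add: gtan_real_vsp)

lemma gsec_lincomb:
  assumes V: "open V" and c: "\<And>k. k < n \<Longrightarrow> smooth_fun A V (c k)" and e: "\<And>k. k < n \<Longrightarrow> gsec V (e k)"
  shows "gsec V (\<lambda>x. lincomb (gtan_vsp A x) (\<lambda>k. c k x) (\<lambda>k. e k x) n)"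
  unfolding gsec_def lincomb_gtan fst_conv snd_conv
  by (intro conjI vf_sum df_sum V vf_scale df_scale c gsec_vf gsec_df e) auto

text \<open>From left to right the coordinate frames, whose members have smooth components,
  recombine the section; from right to left arbitrary frames have to be handled, which is
  \<open>gtb_coords_smooth\<close>.\<close>

lemma sections_gtb:
  assumes V: "open V" "V \<subseteq> W" and W: "open W"
  shows "s \<in> sections A V (gen_tangent_bundle A W) \<longleftrightarrow> s \<in> extensional V \<and> gsec V s"
proof
  assume "s \<in> sections A V (gen_tangent_bundle A W)"
  then have ext: "s \<in> (\<Pi>\<^sub>E x\<in>V. gtan A x)"
    and sm: "\<And>V' e k. (V', e) \<in> frames (gen_tangent_bundle A W) \<Longrightarrow> k < 2 * adim A \<Longrightarrow>
       smooth_fun A (V \<inter> V') (\<lambda>x. coords (gtan_vsp A x) (2 * adim A) (\<lambda>k. e k x) (s x) k)"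
    unfolding sections_def gtb_simps by fast+
  have "gsec V s"
  proof (rule gsec_local[OF V(1)])
    fix x assume x: "x \<in> V"
    obtain U c where Uc: "(U, c) \<in> A" "x \<in> U" using chart_exists by blast
    let ?N = "V \<inter> (U \<inter> W)" and ?e = "chart_frame U c"
    have N: "open ?N" using V W chart_open[OF Uc(1)] by auto
    have "gsec ?N (\<lambda>x. lincomb (gtan_vsp A x) (\<lambda>k. coords (gtan_vsp A x) (2 * adim A) (\<lambda>k. ?e k x) (s x) k) (\<lambda>k. ?e k x) (2 * adim A))"
      by (rule gsec_lincomb[OF N sm[OF chart_frame_gtb[OF Uc(1) W]] gsec_mono[OF gsec_chart_frame[OF Uc(1)]]]) auto
    then have "gsec ?N s"
    proof (rule gsec_cong[OF N])
      fix y assume y: "y \<in> ?N"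
      then have "s y \<in> gtan A y" using ext by auto
      then show "lincomb (gtan_vsp A y) (\<lambda>k. coords (gtan_vsp A y) (2 * adim A) (\<lambda>k. ?e k y) (s y) k) (\<lambda>k. ?e k y) (2 * adim A) = s y"
        using basis_vsp_coords(2)[OF chart_frame_basis[OF Uc(1)], of y "s y"] y by auto
    qed
    then show "\<exists>N. open N \<and> x \<in> N \<and> gsec (V \<inter> N) s" using x V Uc chart_open[OF Uc(1)] W by blast
  qed
  then show "s \<in> extensional V \<and> gsec V s" using ext by (auto simp: PiE_def)
next
  assume s: "s \<in> extensional V \<and> gsec V s"
  then have "s \<in> (\<Pi>\<^sub>E x\<in>V. gtan A x)" using gsec_gtan by (auto simp: PiE_def)
  then show "s \<in> sections A V (gen_tangent_bundle A W)"
    unfolding sections_def gtb_simps using gtb_coords_smooth[OF _ V(1)] s by auto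
qed

lemma sections_gtb_UNIV: "s \<in> sections A UNIV (gen_tangent_bundle A UNIV) \<longleftrightarrow> gsec UNIV s"
  by (simp add: sections_gtb)

text \<open>The tangent bundle carries no pairing, so the rows of the linear system are obtained by
  applying the fields to chart coordinates; its kernel is trivial because a derivation that vanishes
  on the coordinates is 0.\<close>

lemma tangent_bundle_section:
  assumes V: "open V" "V \<subseteq> W" and X: "vector_field A V X"
  shows "(\<lambda>x\<in>V. X x) \<in> sections A V (tangent_bundle A W)"
proof -
  let ?n = "adim A"
  have "smooth_fun A (V \<inter> V') (\<lambda>x. coords (tangent_vsp A x) ?n (\<lambda>k. e k x) (restrict X V x) k)"
    if V': "open V'" and e: "\<And>k. k < ?n \<Longrightarrow> vector_field A V' (e k)"
      and ba: "\<And>x. x \<in> V' \<Longrightarrow> basis_vsp (tangent_vsp A x) ?n (\<lambda>k. e k x)" and k: "k < ?n" for V' e k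
  proof (rule smooth_fun_local)
    fix x assume x: "x \<in> V \<inter> V'"
    obtain U c where Uc: "(U, c) \<in> A" "x \<in> U" using chart_exists by blast
    let ?N = "V \<inter> V' \<inter> U"
    have N: "open ?N" using V V' chart_open[OF Uc(1)] by auto
    have cs: "smooth_fun A ?N (chart_coord c l)" for l
      by (rule smooth_fun_mono[OF smooth_fun_chart_coord[OF Uc(1)]]) auto
    have eN: "vector_field A ?N (e k)" if "k < ?n" for k by (rule vf_mono[OF e[OF that]]) auto
    have XN: "vector_field A ?N X" by (rule vf_mono[OF X]) auto
    have car: "vcarrier (tangent_vsp A y) = tangent_space A y" "vzero (tangent_vsp A y) = (\<lambda>f. 0)" for y
      by (simp_all add: tangent_vsp_def)
    have "smooth_fun A ?N (\<lambda>x. coords (tangent_vsp A x) ?n (\<lambda>k. e k x) (restrict X V x) k)"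
    proof (rule smooth_linear_system[where m="?n" and n="?n" and G="\<lambda>l k x. e k x (chart_coord c l)"
        and s="\<lambda>l x. X x (chart_coord c l)" and c="\<lambda>k x. coords (tangent_vsp A x) ?n (\<lambda>k. e k x) (restrict X V x) k", OF N _ _ _ _ k])
      fix l k assume "l < ?n" "k < ?n"
      then show "smooth_fun A ?N (\<lambda>x. e k x (chart_coord c l))" using vf_smooth[OF N eN cs] by simp
    next
      fix l show "smooth_fun A ?N (\<lambda>x. X x (chart_coord c l))" by (rule vf_smooth[OF N XN cs])
    next
      fix y l assume y: "y \<in> ?N" and l: "l < ?n"
      have "X y = lincomb (tangent_vsp A y) (coords (tangent_vsp A y) ?n (\<lambda>k. e k y) (X y)) (\<lambda>k. e k y) ?n"
        by (rule basis_vsp_coords(2)[OF ba]) (use y vf_tangent[OF XN y] car in auto)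
      then have "X y (chart_coord c l) = (\<Sum>k<?n. coords (tangent_vsp A y) ?n (\<lambda>k. e k y) (X y) k * e k y (chart_coord c l))"
        unfolding lincomb_tangent by (rule fun_cong)
      then show "(\<Sum>k<?n. e k y (chart_coord c l) * coords (tangent_vsp A y) ?n (\<lambda>k. e k y) (restrict X V y) k) = X y (chart_coord c l)"
        using y by (simp add: mult.commute)
    next
      fix y d k assume y: "y \<in> ?N" and k: "k < ?n"
        and d: "\<And>l. l < ?n \<Longrightarrow> (\<Sum>k<?n. e k y (chart_coord c l) * d k) = 0"
      have T: "(\<lambda>f. \<Sum>k<?n. d k * e k y f) \<in> tangent_space A y"
        by (intro tangent_sum tangent_scale vf_tangent[OF eN _]) (use y in auto)
      have "(\<Sum>k<?n. d k * e k y f) = 0" for f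
        using tangent_expand[OF Uc(1) T, of f] y d by (simp add: mult.commute)
      then show "d k = 0"
        by (intro basis_vsp_independent[OF ba _ _ _ k]) (use y tangent_zero in \<open>auto simp: car lincomb_tangent\<close>)
    qed
    then show "\<exists>N. open N \<and> x \<in> N \<and> smooth_fun A (V \<inter> V' \<inter> N) (\<lambda>x. coords (tangent_vsp A x) ?n (\<lambda>k. e k x) (restrict X V x) k)"
      using Uc chart_open[OF Uc(1)] by blast
  qed
  moreover have "restrict X V \<in> (\<Pi>\<^sub>E x\<in>V. tangent_space A x)" using vf_tangent[OF X] by auto
  ultimately show ?thesis
    unfolding sections_def tangent_bundle_def by (auto simp: tangent_vsp_def[of A])
qed

end

section \<open>The twisted exact Courant algebroid\<close>

context smooth_mfd
begin

lemma tan_bundle_simps: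
  "fibre (tangent_bundle A W) x = tangent_vsp A x" "vcarrier (tangent_vsp A x) = tangent_space A x"
  "vadd (tangent_vsp A x) u v = (\<lambda>f. u f + v f)" "vscale (tangent_vsp A x) a u = (\<lambda>f. a * u f)"
  by (simp_all add: tangent_bundle_def tangent_vsp_def)

lemma twisted_simps:
  "vb (twisted_courant A W H) = gen_tangent_bundle A W"
  "pairing (twisted_courant A W H) x = gpairing"
  "anchor (twisted_courant A W H) x = fst"
  "brkt (twisted_courant A W H) u v = (\<lambda>x\<in>W. courant_bracket A H u v x)"
  by (simp_all add: twisted_courant_def)

lemma restrict_UNIV_eq: "restrict f UNIV = f"
  by (simp add: restrict_def)

lemma sec_add_glincomb: "sec_add UNIV (gen_tangent_bundle A UNIV) u v = glincomb 1 u 1 v"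
  by (rule ext) (simp add: sec_add_def gtb_simps gtan_ops glincomb_def)

lemma sec_scale_glincomb: "sec_scale UNIV (gen_tangent_bundle A UNIV) a u = glincomb a u 0 u"
  by (rule ext) (simp add: sec_scale_def gtb_simps gtan_ops glincomb_def)

text \<open>Both the operator \<open>courant_D\<close> and the dual of the anchor are definite
  descriptions of this kind. The equivalence gives existence and, by nondegeneracy, uniqueness at
  once.\<close>

lemma anchor_element:
  "w \<in> gtan A x \<and> (\<forall>e\<in>gtan A x. gpairing w e = \<alpha> [fst e]) \<longleftrightarrow> w = (\<lambda>f. 0, \<alpha>)" if al: "\<alpha> \<in> alt_forms A 1 x"
proof
  have z: "(\<lambda>f. 0, \<alpha>) \<in> gtan A x" using al tangent_zero by (simp add: gtan_iff)
  have p: "gpairing (\<lambda>f. 0, \<alpha>) e = \<alpha> [fst e]" if "e \<in> gtan A x" for e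
    using that alt1(2)[of "snd e" x "fst e" "fst e" 0] by (simp add: gpairing_def gtan_iff)
  show "w = (\<lambda>f. 0, \<alpha>) \<Longrightarrow> w \<in> gtan A x \<and> (\<forall>e\<in>gtan A x. gpairing w e = \<alpha> [fst e])"
    using z p by simp
  assume w: "w \<in> gtan A x \<and> (\<forall>e\<in>gtan A x. gpairing w e = \<alpha> [fst e])"
  let ?d = "vadd (gtan_vsp A x) w (vscale (gtan_vsp A x) (-1) (\<lambda>f. 0, \<alpha>))"
  have "?d = vzero (gtan_vsp A x)"
  proof (rule gpairing_nondegenerate)
    show "?d \<in> gtan A x" using w z by (intro gtan_closed) auto
    fix e assume e: "e \<in> gtan A x"
    show "gpairing ?d e = 0"
      using gpairing_linear(1)[OF _ gtan_closed(3)[OF z] e, of w "-1"] gpairing_linear(2)[OF z z e, of "-1"] p[OF e] w e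
      by simp
  qed
  then show "w = (\<lambda>f. 0, \<alpha>)" by (simp add: gtan_ops prod_eq_iff fun_eq_iff)
qed

lemma twisted_courant_D: "courant_D UNIV (twisted_courant A UNIV H) f x = (\<lambda>f. 0, dform f x)"
proof -
  have "(w \<in> gtan A x \<and> (\<forall>e\<in>gtan A x. gpairing w e = fst e f)) \<longleftrightarrow> w = (\<lambda>f. 0, dform f x)" for w
    using anchor_element[OF dform_alt[of f x], of w] dform_apply[of _ x f] gtan_iff by auto
  then show ?thesis by (simp add: courant_D_def twisted_simps gtb_simps)
qed

text \<open>Adding half of the differential of the pairing undoes the skew-symmetrisation, so the
  Leibniz and invariance axioms become statements about the Dorfman bracket.\<close>

lemma twisted_circ:
  assumes "diff_form A UNIV 3 H" "gsec UNIV u" "gsec UNIV v"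
  shows "courant_circ UNIV (twisted_courant A UNIV H) u v = dorfman A H u v"
  using courant_dorfman[OF open_UNIV UNIV_I assms(2,3,1)]
  by (intro ext) (simp add: courant_circ_def twisted_courant_D twisted_simps(1,2,4) gtb_simps)

lemma dorfman_glincomb_UNIV:
  assumes "diff_form A UNIV 3 H" "gsec UNIV u" "gsec UNIV u'" "gsec UNIV w"
  shows "dorfman A H (glincomb a u b u') w = glincomb a (dorfman A H u w) b (dorfman A H u' w)"
    "dorfman A H w (glincomb a u b u') = glincomb a (dorfman A H w u) b (dorfman A H w u')"
  using dorfman_glincomb[OF open_UNIV UNIV_I assms(2,3,4,1)] by auto

text \<open>Closedness of \<open>H\<close> is assumed through the invariant formula on four fields,
  the form in which the Leibniz identity consumes it.\<close>

lemma twisted_courant_algebroid: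
  assumes H: "diff_form A UNIV 3 H"
    and dH: "\<And>V x P Q R S. open V \<Longrightarrow> x \<in> V \<Longrightarrow> vector_field A V P \<Longrightarrow> vector_field A V Q \<Longrightarrow>
       vector_field A V R \<Longrightarrow> vector_field A V S \<Longrightarrow> ext_deriv_fields A H [P, Q, R, S] x = 0"
  shows "courant_algebroid A UNIV (twisted_courant A UNIV H)"
proof -
  let ?E = "gen_tangent_bundle A UNIV" and ?C = "twisted_courant A UNIV H"
  note D = gsec_dorfman[OF open_UNIV _ _ H]
  show ?thesis
    unfolding courant_algebroid_def Let_def twisted_simps gtb_simps restrict_UNIV_eq
  proof (intro conjI allI ballI impI; (elim conjE)?)
    show "vector_bundle A UNIV ?E" by (rule vector_bundle_gtb[OF open_UNIV])
  next
    fix x u v w a assume "u \<in> gtan A x" "v \<in> gtan A x" "w \<in> gtan A x"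
    note l = gpairing_linear[OF this]
    show "gpairing u v = gpairing v u" by (rule gpairing_sym)
    show "gpairing (vadd (gtan_vsp A x) u v) w = gpairing u w + gpairing v w" by (rule l)
    show "gpairing (vscale (gtan_vsp A x) a u) w = a * gpairing u w" by (rule l)
  next
    fix x u assume "u \<in> gtan A x" "\<forall>v\<in>gtan A x. gpairing u v = 0"
    then show "u = vzero (gtan_vsp A x)" by (intro gpairing_nondegenerate) auto
  next
    fix V s t assume "open V" "s \<in> sections A V ?E" "t \<in> sections A V ?E"
    then show "smooth_fun A V (\<lambda>x. gpairing (s x) (t x))"
      by (intro gsec_pairing) (auto simp: sections_gtb)
  next
    show "bundle_map A UNIV ?E (tangent_bundle A UNIV) (\<lambda>x. fst)"
      unfolding bundle_map_def linear_vsp_def gtb_simps tan_bundle_simps twisted_simps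
    proof (intro conjI ballI allI impI; (elim conjE)?)
      fix V s assume V: "open V" and s: "s \<in> sections A V ?E"
      show "(\<lambda>x\<in>V. fst (s x)) \<in> sections A V (tangent_bundle A UNIV)"
        by (rule tangent_bundle_section[OF V]) (use s V in \<open>auto simp: sections_gtb gsec_def\<close>)
    qed (simp_all add: gtan_iff gtan_ops)
  next
    fix u v assume uv: "u \<in> sections A UNIV ?E" "v \<in> sections A UNIV ?E"
    show "courant_bracket A H u v \<in> sections A UNIV ?E"
      using gsec_courant_bracket[OF open_UNIV _ _ H] uv by (simp add: sections_gtb_UNIV)
    show "courant_bracket A H u v = sec_scale UNIV ?E (-1) (courant_bracket A H v u)"
      unfolding sec_scale_glincomb
      by (rule ext) (simp add: courant_bracket_glincomb glincomb_def fun_eq_iff)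
  next
    fix u v w assume "u \<in> sections A UNIV ?E" "v \<in> sections A UNIV ?E" "w \<in> sections A UNIV ?E"
    then have g: "gsec UNIV u" "gsec UNIV v" "gsec UNIV w" by (simp_all add: sections_gtb_UNIV)
    show "courant_bracket A H (sec_add UNIV ?E u v) w = sec_add UNIV ?E (courant_bracket A H u w) (courant_bracket A H v w)"
      unfolding sec_add_glincomb courant_bracket_glincomb[abs_def] dorfman_glincomb_UNIV[OF H g]
      by (rule ext) (simp add: glincomb_def fun_eq_iff algebra_simps)
  next
    fix u v a assume "u \<in> sections A UNIV ?E" "v \<in> sections A UNIV ?E"
    then have g: "gsec UNIV u" "gsec UNIV v" by (simp_all add: sections_gtb_UNIV)
    show "courant_bracket A H (sec_scale UNIV ?E a u) v = sec_scale UNIV ?E a (courant_bracket A H u v)"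
      unfolding sec_scale_glincomb courant_bracket_glincomb[abs_def] dorfman_glincomb_UNIV[OF H g(1,1,2)]
      by (rule ext) (simp add: glincomb_def fun_eq_iff algebra_simps)
  next
    fix u v w assume "u \<in> sections A UNIV ?E" "v \<in> sections A UNIV ?E" "w \<in> sections A UNIV ?E"
    then have g: "gsec UNIV u" "gsec UNIV v" "gsec UNIV w" by (simp_all add: sections_gtb_UNIV)
    note circ = twisted_circ[OF H]
    have lb: "dorfman A H u (dorfman A H v w) x =
        vadd (gtan_vsp A x) (dorfman A H (dorfman A H u v) w x) (dorfman A H v (dorfman A H u w) x)" for x
      by (rule dorfman_leibniz[OF open_UNIV UNIV_I g H dH])
    show "courant_circ UNIV ?C u (courant_circ UNIV ?C v w) =
        sec_add UNIV ?E (courant_circ UNIV ?C (courant_circ UNIV ?C u v) w) (courant_circ UNIV ?C v (courant_circ UNIV ?C u w))"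
      using circ[OF g(2,3)] circ[OF g(1,2)] circ[OF g(1,3)] circ[OF g(1) D[OF g(2,3)]] circ[OF D[OF g(1,2)] g(3)]
        circ[OF g(2) D[OF g(1,3)]] by (intro ext) (simp add: sec_add_def gtb_simps lb)
    show "fst (u x) (\<lambda>y. gpairing (v y) (w y)) =
        gpairing (courant_circ UNIV ?C u v x) (w x) + gpairing (v x) (courant_circ UNIV ?C u w x)" for x
      unfolding circ[OF g(1,2)] circ[OF g(1,3)] by (rule dorfman_invariant[OF open_UNIV UNIV_I g H])
  qed
qed

lemma twisted_exact:
  assumes "courant_algebroid A UNIV (twisted_courant A UNIV H)"
  shows "exact_courant_algebroid A UNIV (twisted_courant A UNIV H)"
proof -
  have co: "coanchor (twisted_courant A UNIV H) x \<alpha> = (\<lambda>f. 0, \<alpha>)" if "\<alpha> \<in> alt_forms A 1 x" for x \<alpha>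
    unfolding coanchor_def twisted_simps gtb_simps by (simp only: anchor_element[OF that] the_eq_trivial)
  show ?thesis
    unfolding exact_courant_algebroid_def twisted_simps gtb_simps
  proof (intro conjI assms ballI)
    fix x :: 'm
    show "inj_on (coanchor (twisted_courant A UNIV H) x) (alt_forms A 1 x)"
      by (rule inj_onI) (simp add: co)
    have "coanchor (twisted_courant A UNIV H) x ` alt_forms A 1 x = (\<lambda>\<alpha>. (\<lambda>f. 0, \<alpha>)) ` alt_forms A 1 x"
      by (rule image_cong) (use co in auto)
    also have "\<dots> = {u \<in> gtan A x. fst u = (\<lambda>f. 0)}"
      using tangent_zero by (auto simp: gtan_iff image_iff)
    finally show "coanchor (twisted_courant A UNIV H) x ` alt_forms A 1 x = {u \<in> gtan A x. fst u = (\<lambda>f. 0)}" .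
    have "v \<in> fst ` gtan A x" if "v \<in> tangent_space A x" for v
      using that alt_forms_0[of 1 x] by (intro image_eqI[of _ _ "(v, \<lambda>vs. 0)"]) (auto simp: gtan_iff)
    then show "fst ` gtan A x = tangent_space A x" by (auto simp: gtan_iff)
  qed
qed

end

section \<open>Trivialising the cocycle\<close>

lemma b_exp_comp: "b_exp \<beta> (b_exp \<gamma> u) = b_exp (\<lambda>vs. \<gamma> vs + \<beta> vs) u"
  by (simp add: b_exp_def add.assoc)

lemma b_exp_0: "b_exp (\<lambda>vs. 0) u = u"
  by (simp add: b_exp_def)

context smooth_mfd
begin

text \<open>\<open>B k i\<close> is under control only over \<open>U k \<inter> U i\<close>, but
  \<open>\<rho> k\<close> vanishes near each point outside \<open>U k\<close>, so the product
  extended by 0 is a form on all of \<open>U i\<close>. The difference of two potentials is then an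
  average of copies of \<open>B i j\<close> with weights of sum 1.\<close>

lemma cocycle_potential:
  assumes fin: "finite I" and U: "\<And>i. i \<in> I \<Longrightarrow> open (U i)" and cov: "(\<Union>i\<in>I. U i) = UNIV"
    and B: "\<And>i j. i \<in> I \<Longrightarrow> j \<in> I \<Longrightarrow> diff_form A (U i \<inter> U j) 2 (B i j)"
    and coc: "\<And>i j k x vs. i \<in> I \<Longrightarrow> j \<in> I \<Longrightarrow> k \<in> I \<Longrightarrow> x \<in> U i \<inter> U j \<inter> U k \<Longrightarrow>
       B i j x vs + B j k x vs = B i k x vs"
  shows "\<exists>b. (\<forall>i\<in>I. diff_form A (U i) 2 (b i)) \<and>
    (\<forall>i\<in>I. \<forall>j\<in>I. \<forall>x\<in>U i \<inter> U j. \<forall>vs. B i j x vs = b j x vs - b i x vs)"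
proof -
  have "\<exists>\<rho>. (\<forall>i\<in>I. smooth_fun A UNIV (\<rho> i) \<and>
       (\<forall>y. y \<notin> U i \<longrightarrow> (\<exists>N. open N \<and> y \<in> N \<and> (\<forall>z\<in>N. \<rho> i z = 0)))) \<and>
     (\<forall>x. (\<Sum>i\<in>I. \<rho> i x) = (1::real))"
    by (rule partition_of_unity[OF fin U cov])
  then obtain \<rho> where rho: "\<forall>i\<in>I. smooth_fun A UNIV (\<rho> i) \<and>
       (\<forall>y. y \<notin> U i \<longrightarrow> (\<exists>N. open N \<and> y \<in> N \<and> (\<forall>z\<in>N. \<rho> i z = 0)))"
    and one: "\<forall>x. (\<Sum>i\<in>I. \<rho> i x) = (1::real)"
    by (elim exE conjE)
  define b where "b i x vs = (\<Sum>k\<in>I. if x \<in> U k then \<rho> k x * B k i x vs else 0)" for i x vs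
  show ?thesis
  proof (intro exI[of _ b] conjI ballI allI)
    fix i assume i: "i \<in> I"
    have "diff_form A (U i) 2 (\<lambda>x vs. if x \<in> U k then \<rho> k x * B k i x vs else 0)" if k: "k \<in> I" for k
    proof (rule df_local)
      fix x assume x: "x \<in> U i"
      show "\<exists>N. open N \<and> x \<in> N \<and> diff_form A (U i \<inter> N) 2 (\<lambda>x vs. if x \<in> U k then \<rho> k x * B k i x vs else 0)"
      proof (cases "x \<in> U k")
        case True
        have op: "open (U i \<inter> U k)" using U i k by auto
        have "diff_form A (U i \<inter> U k) 2 (\<lambda>x vs. \<rho> k x * B k i x vs)"
          by (rule df_scale[OF op smooth_fun_mono[of UNIV]]) (use rho k B[OF k i] in \<open>auto simp: Int_commute\<close>)
        then have "diff_form A (U i \<inter> U k) 2 (\<lambda>x vs. if x \<in> U k then \<rho> k x * B k i x vs else 0)"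
          by (rule df_cong[OF op, rotated]) auto
        then show ?thesis using True U[OF k] by blast
      next
        case False
        then obtain N where N: "open N" "x \<in> N" "\<forall>z\<in>N. \<rho> k z = 0" using rho k by blast
        have "diff_form A (U i \<inter> N) 2 (\<lambda>x vs. if x \<in> U k then \<rho> k x * B k i x vs else 0)"
          by (rule df_cong[OF _ _ df_zero]) (use U[OF i] N in \<open>auto simp: fun_eq_iff\<close>)
        then show ?thesis using N by blast
      qed
    qed
    then show "diff_form A (U i) 2 (b i)"
      unfolding b_def[abs_def] by (intro df_sum U i)
  next
    fix i j x vs assume ij: "i \<in> I" "j \<in> I" and x: "x \<in> U i \<inter> U j"
    have "b j x vs - b i x vs = (\<Sum>k\<in>I. \<rho> k x * B i j x vs)"
      unfolding b_def sum_subtractf[symmetric]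
    proof (rule sum.cong[OF refl])
      fix k assume k: "k \<in> I"
      show "(if x \<in> U k then \<rho> k x * B k j x vs else 0) - (if x \<in> U k then \<rho> k x * B k i x vs else 0) = \<rho> k x * B i j x vs"
      proof (cases "x \<in> U k")
        case True
        \<comment> \<open>The cocycle identity for the indices \<open>k\<close>, \<open>i\<close>,
          \<open>j\<close> makes the difference of \<open>B k j\<close> and \<open>B k i\<close>
          independent of \<open>k\<close>.\<close>
        then show ?thesis using coc[OF k ij, of x vs] x by (simp add: algebra_simps flip: distrib_left)
      next
        case False
        then have "\<rho> k x = 0" using rho k by blast
        then show ?thesis by simp
      qed
    qed
    also have "\<dots> = B i j x vs" using one by (simp flip: sum_distrib_right)
    finally show "B i j x vs = b j x vs - b i x vs" by simp
  qed
qed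

lemma d2_diff:
  assumes V: "open V" "x \<in> V" and \<omega>: "diff_form A V 2 \<omega>" and \<theta>: "diff_form A V 2 \<theta>"
    and X: "vector_field A V X" and Y: "vector_field A V Y" and Z: "vector_field A V Z"
    and eq: "\<And>y vs. y \<in> V \<Longrightarrow> \<beta> y vs = \<omega> y vs - \<theta> y vs"
  shows "d2 \<beta> X Y Z x = d2 \<omega> X Y Z x - d2 \<theta> X Y Z x"
proof -
  note ev = df_eval2[OF V(1)]
  have e: "P x (\<lambda>y. \<beta> y [Q y, R y]) = P x (\<lambda>y. \<omega> y [Q y, R y]) - P x (\<lambda>y. \<theta> y [Q y, R y])"
    if "vector_field A V P" "vector_field A V Q" "vector_field A V R" for P Q R
  proof -
    have "P x (\<lambda>y. \<beta> y [Q y, R y]) = P x (\<lambda>y. \<omega> y [Q y, R y] - \<theta> y [Q y, R y])"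
      by (rule vf_fcong[OF V that(1) smooth_fun_diff[OF V(1) ev[OF \<omega> that(2,3)] ev[OF \<theta> that(2,3)]], symmetric]) (simp add: eq)
    then show ?thesis using vf_fdiff[OF V that(1) ev[OF \<omega> that(2,3)] ev[OF \<theta> that(2,3)]] by simp
  qed
  show ?thesis unfolding d2_def e[OF X Y Z] e[OF Y X Z] e[OF Z X Y] by (simp add: eq V(2))
qed

text \<open>The exterior derivative is linear at the level of the field formula \<open>d2\<close>.
  Applied to the potentials of two members of the cover, this makes the local 3-forms agree on the
  overlap.\<close>

lemma ext_deriv_eq_of_closed_diff:
  assumes W: "open W" "x \<in> W" and \<omega>: "diff_form A W 2 \<omega>" and \<theta>: "diff_form A W 2 \<theta>"
    and \<beta>: "diff_form A W 2 \<beta>" and cl: "closed_form A W \<beta>"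
    and eq: "\<And>y vs. y \<in> W \<Longrightarrow> \<beta> y vs = \<omega> y vs - \<theta> y vs"
  shows "ext_deriv A \<omega> x = ext_deriv A \<theta> x"
proof
  fix vs
  show "ext_deriv A \<omega> x vs = ext_deriv A \<theta> x vs"
  proof (cases "set vs \<subseteq> tangent_space A x \<and> length vs = Suc 2")
    case False
    then show ?thesis
      using ext_deriv_wrong_length[OF W \<omega>, of vs] ext_deriv_wrong_length[OF W \<theta>, of vs]
      by (cases "set vs \<subseteq> tangent_space A x") (auto simp: ext_deriv_def)
  next
    case True
    then obtain p q r where vs: "vs = [p, q, r]" and T: "p \<in> tangent_space A x" "q \<in> tangent_space A x" "r \<in> tangent_space A x"
      by (auto simp: numeral_2_eq_2 length_Suc_conv)
    obtain V X Y Z where V: "open V" "x \<in> V" "V \<subseteq> W" and F: "vector_field A V X" "vector_field A V Y" "vector_field A V Z"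
      and e: "X x = p" "Y x = q" "Z x = r" by (rule extend3[OF W T])
    note m = df_mono[OF _ V(3)]
    have "ext_deriv A \<beta> x vs = 0" using cl W(2) by (simp add: closed_form_def)
    moreover have "ext_deriv A \<beta> x vs = ext_deriv A \<omega> x vs - ext_deriv A \<theta> x vs"
      using ext_deriv_2[OF V(1,2) m[OF \<beta>] F] ext_deriv_2[OF V(1,2) m[OF \<omega>] F] ext_deriv_2[OF V(1,2) m[OF \<theta>] F]
        d2_diff[OF V(1,2) m[OF \<omega>] m[OF \<theta>] F eq] V(3) by (auto simp: vs e)
    ultimately show ?thesis by simp
  qed
qed

end

text \<open>The situation after the cocycle has been trivialised. The gluing conditions on \<phi>
  are consequences of its form as the exponential of a difference, and \<open>H_eq\<close> over the
  cover determines \<open>H\<close>.\<close>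

locale glue_data = smooth_mfd A
  for A :: "('m::{t2_space,second_countable_topology}, 'e::real_inner) atlas" +
  fixes I :: "'i set" and U :: "'i \<Rightarrow> 'm set" and \<phi> :: "'i \<Rightarrow> 'i \<Rightarrow> 'm \<Rightarrow> 'm gvec \<Rightarrow> 'm gvec"
    and b :: "'i \<Rightarrow> 'm \<Rightarrow> 'm mform" and H :: "'m \<Rightarrow> 'm mform"
  assumes U_open: "\<And>i. i \<in> I \<Longrightarrow> open (U i)" and U_cover: "(\<Union>i\<in>I. U i) = UNIV"
    and b_form: "\<And>i. i \<in> I \<Longrightarrow> diff_form A (U i) 2 (b i)"
    and phi: "\<And>i j x u. i \<in> I \<Longrightarrow> j \<in> I \<Longrightarrow> x \<in> U i \<inter> U j \<Longrightarrow> u \<in> gtan A x \<Longrightarrow>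
       \<phi> i j x u = b_exp (\<lambda>vs. b j x vs - b i x vs) u"
    and H_eq: "\<And>i x. i \<in> I \<Longrightarrow> x \<in> U i \<Longrightarrow> H x = ext_deriv A (b i) x"
begin

lemma cover_obtain: obtains i where "i \<in> I" "x \<in> U i"
  using U_cover by blast

lemma H_form: "diff_form A UNIV 3 H"
proof (rule df_local)
  fix x :: 'm
  obtain i where i: "i \<in> I" "x \<in> U i" by (rule cover_obtain)
  have "diff_form A (U i) 3 H"
    by (rule df_cong[OF U_open[OF i(1)] _ df_ext_deriv_2[OF U_open[OF i(1)] b_form[OF i(1)]]]) (rule H_eq[OF i(1), symmetric])
  then show "\<exists>N. open N \<and> x \<in> N \<and> diff_form A (UNIV \<inter> N) 3 H" using U_open i by auto
qed

text \<open>The identity is local, and over each \<open>U i\<close> the form \<open>H\<close> is the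
  exterior derivative of \<open>b i\<close>.\<close>

lemma H_deriv_fields:
  assumes V: "open V" "x \<in> V" and X: "vector_field A V X" "vector_field A V Y" "vector_field A V Z" "vector_field A V T"
  shows "ext_deriv_fields A H [X, Y, Z, T] x = 0"
proof -
  obtain i where i: "i \<in> I" "x \<in> U i" by (rule cover_obtain)
  let ?N = "V \<inter> U i"
  have N: "open ?N" "x \<in> ?N" using V i U_open by auto
  have m: "vector_field A V P \<Longrightarrow> vector_field A ?N P" for P by (rule vf_mono) auto
  have b: "diff_form A ?N 2 (b i)" by (rule df_mono[OF b_form[OF i(1)]]) auto
  show ?thesis
  proof (rule d_d2_zero[OF N b _ m[OF X(1)] m[OF X(2)] m[OF X(3)] m[OF X(4)]])
    fix y P Q R assume y: "y \<in> ?N" and PQR: "vector_field A ?N P" "vector_field A ?N Q" "vector_field A ?N R"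
    show "H y [P y, Q y, R y] = d2 (b i) P Q R y"
      using ext_deriv_2[OF N(1) y b PQR] H_eq[OF i(1), of y] y by simp
  qed
qed

lemma H_closed: "closed_form A UNIV H"
  unfolding closed_form_def
proof (intro ballI allI)
  fix x vs
  show "ext_deriv A H x vs = 0"
  proof (cases "length vs = Suc 3 \<and> set vs \<subseteq> tangent_space A x")
    case False
    then show ?thesis using ext_deriv_wrong_length[OF open_UNIV UNIV_I H_form, of vs x] by (auto simp: ext_deriv_def)
  next
    case True
    show ?thesis
    proof (rule ext_deriv_eqI)
      show "set vs \<subseteq> tangent_space A x" using True by simp
      fix V Xs assume V: "open V" "x \<in> V" "\<forall>X\<in>set Xs. vector_field A V X" "map (\<lambda>X. X x) Xs = vs"
      have "length Xs = Suc 3" using V(4) True by auto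
      then obtain X Y Z T where "Xs = [X, Y, Z, T]" by (auto simp: numeral_3_eq_3 length_Suc_conv)
      then show "ext_deriv_fields A H Xs x = 0" using H_deriv_fields[OF V(1,2)] V(3) by simp
    qed
  qed
qed

lemma twisted_H: "courant_algebroid A UNIV (twisted_courant A UNIV H)"
  by (rule twisted_courant_algebroid[OF H_form H_deriv_fields])

text \<open>\<open>exp (bm i)\<close> inverts \<open>exp (b i)\<close>. Turning the sign into a form
  of its own lets the lemmas about forms apply to both.\<close>

definition bm :: "'i \<Rightarrow> 'm \<Rightarrow> 'm mform" where
  "bm i x = (\<lambda>vs. - b i x vs)"

lemma b_alt: "i \<in> I \<Longrightarrow> x \<in> U i \<Longrightarrow> b i x \<in> alt_forms A 2 x"
  by (rule df_alt[OF b_form])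

lemma bm_form: assumes i: "i \<in> I" shows "diff_form A (U i) 2 (bm i)"
  using df_diff[OF U_open[OF i] df_zero b_form[OF i]] by (simp add: bm_def[abs_def])

lemma bm_alt: "i \<in> I \<Longrightarrow> x \<in> U i \<Longrightarrow> bm i x \<in> alt_forms A 2 x"
  by (rule df_alt[OF bm_form])

lemma b_exp_bm: "b_exp (bm i x) (b_exp (b i x) u) = u" "b_exp (b i x) (b_exp (bm i x) u) = u"
  by (simp_all add: b_exp_comp bm_def b_exp_0)

text \<open>The class of the glued bundle whose representative over each \<open>U i\<close> becomes \<open>w\<close> after applying
  \<open>exp (b i)\<close>; it trivialises the gluing globally.\<close>
definition K :: "'m \<Rightarrow> 'm gvec \<Rightarrow> ('i \<times> 'm \<times> 'm gvec) set" where
  "K x w = {(j, x, b_exp (bm j x) w) | j. j \<in> I \<and> x \<in> U j}"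

lemma K_mem: "(j, y, v) \<in> K x w \<longleftrightarrow> y = x \<and> j \<in> I \<and> x \<in> U j \<and> v = b_exp (bm j x) w"
  by (auto simp: K_def)

lemma K_inj: "K x w = K x w' \<longleftrightarrow> w = w'"
proof
  assume eq: "K x w = K x w'"
  obtain i where "i \<in> I" "x \<in> U i" by (rule cover_obtain)
  then have "(i, x, b_exp (bm i x) w) \<in> K x w'" using eq[symmetric] by (simp add: K_mem)
  then have "b_exp (bm i x) w = b_exp (bm i x) w'" by (simp add: K_mem)
  then show "w = w'" by (metis b_exp_bm(2))
qed simp

text \<open>Moving \<open>b i\<close> to the other side exhibits the relation as equality of images
  under a map, from which the properties of an equivalence relation are immediate.\<close>

lemma glue_rel_iff:
  "((i, x, u), (j, y, v)) \<in> glue_rel A I U \<phi> \<longleftrightarrow>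
     i \<in> I \<and> j \<in> I \<and> x = y \<and> x \<in> U i \<inter> U j \<and> u \<in> gtan A x \<and> v \<in> gtan A x \<and> b_exp (b i x) u = b_exp (b j x) v"
proof -
  have "u = b_exp (\<lambda>vs. b j x vs - b i x vs) v \<longleftrightarrow> b_exp (b i x) u = b_exp (b j x) v"
  proof
    assume "u = b_exp (\<lambda>vs. b j x vs - b i x vs) v"
    then show "b_exp (b i x) u = b_exp (b j x) v" by (simp add: b_exp_comp)
  next
    assume "b_exp (b i x) u = b_exp (b j x) v"
    then have "b_exp (bm i x) (b_exp (b i x) u) = b_exp (bm i x) (b_exp (b j x) v)" by simp
    then show "u = b_exp (\<lambda>vs. b j x vs - b i x vs) v"
      unfolding b_exp_bm by (simp add: b_exp_comp bm_def)
  qed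
  then show ?thesis
    using phi[of i j x v] by (auto simp: glue_rel_def glue_union_def simp del: split_paired_Ex)
qed

lemma glue_equiv: "equiv (glue_union A I U) (glue_rel A I U \<phi>)"
  unfolding equiv_def refl_on_def sym_def trans_def
  by (auto simp: glue_rel_iff glue_union_def)

lemma glue_class_K:
  assumes i: "i \<in> I" "x \<in> U i" and u: "u \<in> gtan A x"
  shows "glue_class A I U \<phi> i x u = K x (b_exp (b i x) u)"
proof -
  have "(j, y, v) \<in> glue_class A I U \<phi> i x u \<longleftrightarrow> (j, y, v) \<in> K x (b_exp (b i x) u)" for j y v
  proof -
    have "b_exp (b i x) u = b_exp (b j x) v \<longleftrightarrow> v = b_exp (bm j x) (b_exp (b i x) u)"
      by (metis b_exp_bm)
    moreover have "b_exp (bm j x) (b_exp (b i x) u) \<in> gtan A x" if "j \<in> I" "x \<in> U j"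
      by (rule b_exp_gtan[OF bm_alt[OF that] b_exp_gtan[OF b_alt[OF i] u]])
    ultimately show ?thesis
      using i u by (auto simp: glue_class_def glue_rel_iff K_mem)
  qed
  then show ?thesis by auto
qed

abbreviation E where "E \<equiv> glued_bundle A I U \<phi>"
abbreviation C where "C \<equiv> glued_courant A I U \<phi>"

lemma E_carrier: "vcarrier (fibre E x) = K x ` gtan A x"
proof -
  have "vcarrier (fibre E x) = {glue_class A I U \<phi> i x u | i u. i \<in> I \<and> x \<in> U i \<and> u \<in> gtan A x}"
    by (auto simp: glued_bundle_def quotient_def glue_union_def glue_class_def)
  also have "\<dots> = K x ` gtan A x"
  proof
    show "{glue_class A I U \<phi> i x u | i u. i \<in> I \<and> x \<in> U i \<and> u \<in> gtan A x} \<subseteq> K x ` gtan A x"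
      using glue_class_K b_exp_gtan[OF b_alt] by auto
    show "K x ` gtan A x \<subseteq> {glue_class A I U \<phi> i x u | i u. i \<in> I \<and> x \<in> U i \<and> u \<in> gtan A x}"
    proof
      fix p assume "p \<in> K x ` gtan A x"
      then obtain w where w: "w \<in> gtan A x" "p = K x w" by blast
      obtain i where i: "i \<in> I" "x \<in> U i" by (rule cover_obtain)
      have g: "b_exp (bm i x) w \<in> gtan A x" by (rule b_exp_gtan[OF bm_alt[OF i] w(1)])
      have "p = glue_class A I U \<phi> i x (b_exp (bm i x) w)"
        unfolding glue_class_K[OF i g] b_exp_bm w(2) ..
      then show "p \<in> {glue_class A I U \<phi> i x u | i u. i \<in> I \<and> x \<in> U i \<and> u \<in> gtan A x}" using i g by blast
    qed
  qed
  finally show ?thesis .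
qed

text \<open>The operations on classes act on all representatives at once; they agree with those of
  \<open>gtan_vsp A x\<close> because every \<open>exp (bm i)\<close> is linear.\<close>

lemma E_ops:
  assumes w: "w \<in> gtan A x" "w' \<in> gtan A x"
  shows "vadd (fibre E x) (K x w) (K x w') = K x (vadd (gtan_vsp A x) w w')"
    "vscale (fibre E x) a (K x w) = K x (vscale (gtan_vsp A x) a w)"
    "vzero (fibre E x) = K x (vzero (gtan_vsp A x))"
proof -
  have g: "b_exp (bm i x) (vadd (gtan_vsp A x) w w') = vadd (gtan_vsp A x) (b_exp (bm i x) w) (b_exp (bm i x) w')"
    "b_exp (bm i x) (vscale (gtan_vsp A x) a w) = vscale (gtan_vsp A x) a (b_exp (bm i x) w)"
    if "i \<in> I" "x \<in> U i" for i
    using b_exp_linear[OF bm_alt[OF that] w] by simp_all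
  show "vadd (fibre E x) (K x w) (K x w') = K x (vadd (gtan_vsp A x) w w')"
    by (auto simp: glued_bundle_def K_mem K_def g simp del: split_paired_Ex)
  show "vscale (fibre E x) a (K x w) = K x (vscale (gtan_vsp A x) a w)"
    by (auto simp: glued_bundle_def K_mem K_def g simp del: split_paired_Ex)
  have "b_exp (bm i x) (vzero (gtan_vsp A x)) = vzero (gtan_vsp A x)" if "i \<in> I" "x \<in> U i" for i
  proof -
    have "b_exp (bm i x) (vscale (gtan_vsp A x) 0 w) = vscale (gtan_vsp A x) 0 (b_exp (bm i x) w)"
      using b_exp_linear(2)[OF bm_alt[OF that] w] .
    then show ?thesis by (simp add: gtan_ops)
  qed
  then show "vzero (fibre E x) = K x (vzero (gtan_vsp A x))"
    by (auto simp: glued_bundle_def K_def)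
qed

text \<open>The definite descriptions are well defined because each \<open>exp (bm j)\<close>
  preserves the pairing and the vector part, so that every representative gives the same
  value.\<close>

lemma C_simps:
  assumes w: "w \<in> gtan A x" "w' \<in> gtan A x"
  shows "pairing C x (K x w) (K x w') = gpairing w w'" "anchor C x (K x w) = fst w"
proof -
  obtain i where i: "i \<in> I" "x \<in> U i" by (rule cover_obtain)
  have p: "gpairing (b_exp (bm j x) w) (b_exp (bm j x) w') = gpairing w w'" if "j \<in> I" "x \<in> U j" for j
    by (rule b_exp_pairing[OF bm_alt[OF that] w])
  have "(\<exists>j u v. (j, x, u) \<in> K x w \<and> (j, x, v) \<in> K x w' \<and> r = gpairing u v) \<longleftrightarrow> r = gpairing w w'" for r
    using i p by (auto simp: K_mem simp del: split_paired_Ex)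
  then show "pairing C x (K x w) (K x w') = gpairing w w'"
    by (simp add: glued_courant_def del: split_paired_Ex)
  have "(\<exists>j u. (j, x, u) \<in> K x w \<and> X = fst u) \<longleftrightarrow> X = fst w" for X
    using i by (auto simp: K_mem b_exp_fst simp del: split_paired_Ex)
  then show "anchor C x (K x w) = fst w"
    by (simp add: glued_courant_def del: split_paired_Ex)
qed

end

section \<open>The glued Courant algebroid\<close>

lemma lincomb_cong_vectors: "(\<And>k. k < n \<Longrightarrow> e k = e' k) \<Longrightarrow> lincomb V c e n = lincomb V c e' n"
  by (induction n) auto

lemma basis_vsp_cong: "(\<And>k. k < n \<Longrightarrow> e k = e' k) \<Longrightarrow> basis_vsp V n e \<longleftrightarrow> basis_vsp V n e'"
  using lincomb_cong_vectors[of n e e' V] by (simp add: basis_vsp_def)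

lemma coords_cong: "(\<And>k. k < n \<Longrightarrow> e k = e' k) \<Longrightarrow> coords V n e = coords V n e'"
  using lincomb_cong_vectors[of n e e' V] by (simp add: coords_def fun_eq_iff)

lemma real_vsp_closed:
  assumes "real_vsp V"
  shows "vzero V \<in> vcarrier V" "u \<in> vcarrier V \<Longrightarrow> v \<in> vcarrier V \<Longrightarrow> vadd V u v \<in> vcarrier V"
    "u \<in> vcarrier V \<Longrightarrow> vscale V a u \<in> vcarrier V"
proof -
  show "vzero V \<in> vcarrier V" using assms by (simp add: real_vsp_def)
  have "\<forall>u\<in>vcarrier V. \<forall>v\<in>vcarrier V. vadd V u v \<in> vcarrier V"
    using assms unfolding real_vsp_def by (elim conjE)
  then show "u \<in> vcarrier V \<Longrightarrow> v \<in> vcarrier V \<Longrightarrow> vadd V u v \<in> vcarrier V" by blast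
  have "\<forall>a. \<forall>u\<in>vcarrier V. vscale V a u \<in> vcarrier V"
    using assms unfolding real_vsp_def by (elim conjE)
  then show "u \<in> vcarrier V \<Longrightarrow> vscale V a u \<in> vcarrier V" by blast
qed

lemma lincomb_closed:
  "real_vsp V \<Longrightarrow> (\<And>k. k < n \<Longrightarrow> e k \<in> vcarrier V) \<Longrightarrow> lincomb V c e n \<in> vcarrier V"
  by (induction n) (simp_all add: real_vsp_closed)

lemma lincomb_image:
  assumes V: "real_vsp V" and f: "linear_vsp V W f" "f (vzero V) = vzero W" and e: "\<And>k. k < n \<Longrightarrow> e k \<in> vcarrier V"
  shows "lincomb W c (\<lambda>k. f (e k)) n = f (lincomb V c e n)"
  using e
proof (induction n)
  case (Suc n)
  have "lincomb V c e n \<in> vcarrier V" by (rule lincomb_closed[OF V]) (use Suc.prems in auto)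
  moreover have "vscale V (c n) (e n) \<in> vcarrier V" using V Suc.prems by (simp add: real_vsp_closed)
  ultimately show ?case using f(1) Suc by (simp add: linear_vsp_def)
qed (simp add: f)

lemma basis_vsp_image:
  assumes V: "real_vsp V" and f: "linear_vsp V W f" "f (vzero V) = vzero W"
    and bij: "bij_betw f (vcarrier V) (vcarrier W)" and e: "basis_vsp V n e"
  shows "basis_vsp W n (\<lambda>k. f (e k))"
    "v \<in> vcarrier V \<Longrightarrow> coords W n (\<lambda>k. f (e k)) (f v) = coords V n e v"
proof -
  have ec: "e k \<in> vcarrier V" if "k < n" for k using e that by (simp add: basis_vsp_def)
  note li = lincomb_image[where e=e and n=n, OF V f ec]
  have lc: "lincomb V c e n \<in> vcarrier V" for c by (rule lincomb_closed[OF V ec])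
  have inj: "u \<in> vcarrier V \<Longrightarrow> v \<in> vcarrier V \<Longrightarrow> f u = f v \<longleftrightarrow> u = v" for u v
    using bij by (auto simp: bij_betw_def inj_on_def)
  show ba: "basis_vsp W n (\<lambda>k. f (e k))"
    unfolding basis_vsp_def
  proof (intro conjI allI impI ballI)
    fix k assume "k < n" then show "f (e k) \<in> vcarrier W" using ec bij by (auto simp: bij_betw_def)
  next
    fix w assume "w \<in> vcarrier W"
    then obtain v where v: "v \<in> vcarrier V" "w = f v" using bij by (auto simp: bij_betw_def)
    have "(w = lincomb W c (\<lambda>k. f (e k)) n) \<longleftrightarrow> v = lincomb V c e n" for c
      using li[of c] inj[OF v(1) lc] v(2) by simp
    then show "\<exists>!c. (\<forall>k\<ge>n. c k = 0) \<and> w = lincomb W c (\<lambda>k. f (e k)) n"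
      using e v(1) by (simp add: basis_vsp_def)
  qed
  show "coords W n (\<lambda>k. f (e k)) (f v) = coords V n e v" if v: "v \<in> vcarrier V"
  proof (rule coords_eqI[OF ba])
    show "f v \<in> vcarrier W" using bij v by (auto simp: bij_betw_def)
    show "\<forall>k\<ge>n. coords V n e v k = 0" by (rule basis_vsp_coords[OF e v])
    show "f v = lincomb W (coords V n e v) (\<lambda>k. f (e k)) n"
      using basis_vsp_coords(2)[OF e v] li[of "coords V n e v"] by simp
  qed
qed

context smooth_mfd
begin

lemma b_exp_iso:
  assumes b: "\<beta> \<in> alt_forms A 2 x"
  shows "linear_vsp (gtan_vsp A x) (gtan_vsp A x) (b_exp \<beta>)" "b_exp \<beta> (vzero (gtan_vsp A x)) = vzero (gtan_vsp A x)"
    "bij_betw (b_exp \<beta>) (gtan A x) (gtan A x)"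
proof -
  show lin: "linear_vsp (gtan_vsp A x) (gtan_vsp A x) (b_exp \<beta>)"
    unfolding linear_vsp_def using b_exp_gtan[OF b] b_exp_linear[OF b] by blast
  have "b_exp \<beta> (vscale (gtan_vsp A x) 0 (vzero (gtan_vsp A x))) = vscale (gtan_vsp A x) 0 (b_exp \<beta> (vzero (gtan_vsp A x)))"
    using lin gtan_zero(1) by (simp add: linear_vsp_def)
  then show "b_exp \<beta> (vzero (gtan_vsp A x)) = vzero (gtan_vsp A x)" by (simp add: gtan_ops)
  have b': "(\<lambda>vs. - \<beta> vs) \<in> alt_forms A 2 x" using alt_forms_lincomb[OF b b, of "-1" 0] by simp
  show "bij_betw (b_exp \<beta>) (gtan A x) (gtan A x)"
    by (rule bij_betwI[where g="b_exp (\<lambda>vs. - \<beta> vs)"])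
      (use b_exp_gtan[OF b] b_exp_gtan[OF b'] in \<open>auto simp: b_exp_comp b_exp_0\<close>)
qed

lemma gtb_frames_b_exp:
  assumes V: "(V, e) \<in> frames (gen_tangent_bundle A W)" and N: "open N" "N \<subseteq> V" "N \<subseteq> W'" and b: "diff_form A N 2 b"
  shows "(N, \<lambda>k x. b_exp (b x) (e k x)) \<in> frames (gen_tangent_bundle A W')"
  unfolding gtb_frames_iff
proof (intro conjI allI impI ballI)
  fix k assume "k < 2 * adim A"
  then have "gsec N (e k)" using V gsec_mono[OF _ N(2)] by (auto simp: gtb_frames_iff)
  then show "gsec N (\<lambda>x. b_exp (b x) (e k x))" by (rule gsec_b_exp[OF N(1) b])
next
  fix x assume x: "x \<in> N"
  have "basis_vsp (gtan_vsp A x) (2 * adim A) (\<lambda>k. e k x)" using V N x by (auto simp: gtb_frames_iff)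
  then show "basis_vsp (gtan_vsp A x) (2 * adim A) (\<lambda>k. b_exp (b x) (e k x))"
    by (rule basis_vsp_image(1)[OF gtan_real_vsp b_exp_iso[OF df_alt[OF b x]]])
qed (use N in auto)

end

context glue_data
begin

section \<open>The glued vector bundle and its sections\<close>

lemma E_zero: "vzero (fibre E x) = K x (vzero (gtan_vsp A x))"
  by (rule E_ops(3)[OF gtan_zero(1) gtan_zero(1)])

lemma K_linear: "linear_vsp (gtan_vsp A x) (fibre E x) (K x)"
  unfolding linear_vsp_def E_carrier by (simp add: E_ops)

lemma K_bij: "bij_betw (K x) (gtan A x) (vcarrier (fibre E x))"
  unfolding E_carrier by (rule bij_betw_imageI) (auto simp: inj_on_def K_inj)

text \<open>The inverse of the global parametrisation \<open>K\<close>; it becomes the isomorphism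
  onto the twisted Courant algebroid.\<close>

definition Psi :: "'m \<Rightarrow> ('i \<times> 'm \<times> 'm gvec) set \<Rightarrow> 'm gvec" where
  "Psi x = inv_into (gtan A x) (K x)"

lemma Psi_K: "w \<in> gtan A x \<Longrightarrow> Psi x (K x w) = w"
  unfolding Psi_def by (rule inv_into_f_f) (auto simp: inj_on_def K_inj)

lemma E_carrierE: assumes "p \<in> vcarrier (fibre E x)" obtains w where "w \<in> gtan A x" "p = K x w" "Psi x p = w"
proof -
  obtain w where "w \<in> gtan A x" "p = K x w" using assms unfolding E_carrier by (elim imageE)
  then show ?thesis using that Psi_K by simp
qed

lemma E_real_vsp: "real_vsp (fibre E x)"
proof -
  show ?thesis
    unfolding real_vsp_def E_carrier ball_simps E_zero
    by (intro conjI ballI allI; simp add: E_ops gtan_closed gtan_zero(1) K_inj imageI; simp add: gtan_ops algebra_simps)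
qed

lemma E_rank: "vrank E = 2 * adim A"
  by (simp add: glued_bundle_def)

lemma E_frames_iff: "(V, f) \<in> frames E \<longleftrightarrow>
    (\<exists>i e. i \<in> I \<and> (V, e) \<in> frames (gen_tangent_bundle A (U i)) \<and> f = (\<lambda>k x. glue_class A I U \<phi> i x (e k x)))"
  by (auto simp: glued_bundle_def)

lemma E_framesD:
  assumes "(V, f) \<in> frames E"
  obtains e where "(V, e) \<in> frames (gen_tangent_bundle A UNIV)" "\<forall>x\<in>V. \<forall>k<2 * adim A. f k x = K x (e k x)"
proof -
  obtain i e where i: "i \<in> I" and e: "(V, e) \<in> frames (gen_tangent_bundle A (U i))"
    and f: "f = (\<lambda>k x. glue_class A I U \<phi> i x (e k x))" using assms unfolding E_frames_iff by blast
  have V: "open V" "V \<subseteq> U i" and es: "\<And>k. k < 2 * adim A \<Longrightarrow> gsec V (e k)" using e by (auto simp: gtb_frames_iff)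
  show ?thesis
  proof (rule that)
    show "(V, \<lambda>k x. b_exp (b i x) (e k x)) \<in> frames (gen_tangent_bundle A UNIV)"
      by (rule gtb_frames_b_exp[OF e V(1) _ _ df_mono[OF b_form[OF i] V(2)]]) auto
    show "\<forall>x\<in>V. \<forall>k<2 * adim A. f k x = K x (b_exp (b i x) (e k x))"
      unfolding f using glue_class_K[OF i _ gsec_gtan[OF es]] V(2) by blast
  qed
qed

text \<open>The bundle atlas of the glued bundle consists of frames over subsets of a single
  \<open>U i\<close>, so a frame over a larger set has to be restricted first.\<close>

lemma E_framesI:
  assumes e: "(V, e) \<in> frames (gen_tangent_bundle A UNIV)" and i: "i \<in> I"
  obtains f where "(V \<inter> U i, f) \<in> frames E" "\<forall>x\<in>V \<inter> U i. \<forall>k<2 * adim A. f k x = K x (e k x)"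
proof
  have V: "open V" and es: "\<And>k. k < 2 * adim A \<Longrightarrow> gsec V (e k)" using e by (auto simp: gtb_frames_iff)
  let ?e = "\<lambda>k x. b_exp (bm i x) (e k x)"
  have "(V \<inter> U i, ?e) \<in> frames (gen_tangent_bundle A (U i))"
    by (rule gtb_frames_b_exp[OF e _ _ _ df_mono[OF bm_form[OF i]]]) (use V U_open[OF i] in auto)
  then show "(V \<inter> U i, \<lambda>k x. glue_class A I U \<phi> i x (?e k x)) \<in> frames E"
    unfolding E_frames_iff using i by blast
  show "\<forall>x\<in>V \<inter> U i. \<forall>k<2 * adim A. glue_class A I U \<phi> i x (?e k x) = K x (e k x)"
  proof (intro ballI allI impI)
  fix x k assume x: "x \<in> V \<inter> U i" and k: "k < 2 * adim A"
  have "?e k x \<in> gtan A x"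
    by (rule b_exp_gtan[OF bm_alt[OF i] gsec_gtan[OF es[OF k]]]) (use x in auto)
  then show "glue_class A I U \<phi> i x (?e k x) = K x (e k x)"
    using glue_class_K[OF i, of x "?e k x"] x by (simp add: b_exp_bm)
  qed
qed

text \<open>\<open>K\<close> is a linear isomorphism on each fibre, so it preserves coordinates.
  Smoothness questions on the glued bundle thereby reduce to the generalized tangent bundle.\<close>

lemma E_frame_coords:
  assumes e: "(V, e) \<in> frames (gen_tangent_bundle A W)" and x: "x \<in> V"
    and f: "\<And>k. k < 2 * adim A \<Longrightarrow> f k x = K x (e k x)"
  shows "basis_vsp (fibre E x) (2 * adim A) (\<lambda>k. f k x)"
    "w \<in> gtan A x \<Longrightarrow> coords (fibre E x) (2 * adim A) (\<lambda>k. f k x) (K x w) = coords (gtan_vsp A x) (2 * adim A) (\<lambda>k. e k x) w"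
proof -
  have ba: "basis_vsp (gtan_vsp A x) (2 * adim A) (\<lambda>k. e k x)" using e x by (auto simp: gtb_frames_iff)
  note im = basis_vsp_image[OF gtan_real_vsp K_linear E_zero[symmetric] K_bij ba]
  have c: "k < 2 * adim A \<Longrightarrow> f k x = K x (e k x)" for k by (rule f)
  show "basis_vsp (fibre E x) (2 * adim A) (\<lambda>k. f k x)"
    using im(1) basis_vsp_cong[where e="\<lambda>k. f k x" and e'="\<lambda>k. K x (e k x)", OF c] by blast
  show "coords (fibre E x) (2 * adim A) (\<lambda>k. f k x) (K x w) = coords (gtan_vsp A x) (2 * adim A) (\<lambda>k. e k x) w"
    if "w \<in> gtan A x"
    using im(2)[OF that] coords_cong[where e="\<lambda>k. f k x" and e'="\<lambda>k. K x (e k x)", OF c] by metis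
qed

lemma E_vector_bundle: "vector_bundle A UNIV E"
  unfolding vector_bundle_def E_rank
proof (intro conjI)
  show "\<forall>x\<in>UNIV. real_vsp (fibre E x)" using E_real_vsp by simp
  show "(\<Union>(V, f)\<in>frames E. V) = UNIV"
  proof (rule UNIV_eq_I[symmetric])
    fix x
    obtain V c where Vc: "(V, c) \<in> A" "x \<in> V" using chart_exists by blast
    obtain i where i: "i \<in> I" "x \<in> U i" by (rule cover_obtain)
    obtain f where "(V \<inter> UNIV \<inter> U i, f) \<in> frames E" by (rule E_framesI[OF chart_frame_gtb[OF Vc(1) open_UNIV] i(1)])
    then show "x \<in> (\<Union>(V, f)\<in>frames E. V)" using Vc i by (auto intro!: bexI[of _ "(V \<inter> U i, f)"])
  qed
  show "\<forall>(V, f)\<in>frames E. open V \<and> (\<forall>x\<in>V. basis_vsp (fibre E x) (2 * adim A) (\<lambda>k. f k x))"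
  proof clarify
    fix V f assume "(V, f) \<in> frames E"
    then obtain e where e: "(V, e) \<in> frames (gen_tangent_bundle A UNIV)"
      "\<forall>x\<in>V. \<forall>k<2 * adim A. f k x = K x (e k x)" by (rule E_framesD)
    have "basis_vsp (fibre E x) (2 * adim A) (\<lambda>k. f k x)" if "x \<in> V" for x
      by (rule E_frame_coords(1)[OF e(1) that]) (use e(2) that in auto)
    then show "open V \<and> (\<forall>x\<in>V. basis_vsp (fibre E x) (2 * adim A) (\<lambda>k. f k x))"
      using e(1) by (simp add: gtb_frames_iff)
  qed
  show "\<forall>(V, f)\<in>frames E. \<forall>(V', f')\<in>frames E. \<forall>j<2 * adim A. \<forall>k<2 * adim A.
      smooth_fun A (V \<inter> V') (\<lambda>x. coords (fibre E x) (2 * adim A) (\<lambda>k. f k x) (f' j x) k)"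
  proof clarify
    fix V f V' f' j k assume f: "(V, f) \<in> frames E" "(V', f') \<in> frames E" and jk: "j < 2 * adim A" "k < 2 * adim A"
    obtain e where e: "(V, e) \<in> frames (gen_tangent_bundle A UNIV)"
      "\<forall>x\<in>V. \<forall>k<2 * adim A. f k x = K x (e k x)" using f(1) by (rule E_framesD)
    obtain e' where e': "(V', e') \<in> frames (gen_tangent_bundle A UNIV)"
      "\<forall>x\<in>V'. \<forall>k<2 * adim A. f' k x = K x (e' k x)" using f(2) by (rule E_framesD)
    have V: "open V" "open V'" and s: "gsec V' (e' j)" using e(1) e'(1) jk by (auto simp: gtb_frames_iff)
    have "coords (fibre E x) (2 * adim A) (\<lambda>k. f k x) (f' j x) k = coords (gtan_vsp A x) (2 * adim A) (\<lambda>k. e k x) (e' j x) k"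
      if x: "x \<in> V \<inter> V'" for x
    proof -
      have "coords (fibre E x) (2 * adim A) (\<lambda>k. f k x) (K x (e' j x)) = coords (gtan_vsp A x) (2 * adim A) (\<lambda>k. e k x) (e' j x)"
        by (rule E_frame_coords(2)[OF e(1)]) (use x e(2) gsec_gtan[OF s] in auto)
      then show ?thesis using e'(2) x jk by simp
    qed
    moreover have "smooth_fun A (V \<inter> V') (\<lambda>x. coords (gtan_vsp A x) (2 * adim A) (\<lambda>k. e k x) (e' j x) k)"
      using gtb_coords_smooth[OF e(1) V(2) s jk(2)] by (simp add: Int_commute)
    ultimately show "smooth_fun A (V \<inter> V') (\<lambda>x. coords (fibre E x) (2 * adim A) (\<lambda>k. f k x) (f' j x) k)"
      using V smooth_fun_cong[of "V \<inter> V'" "\<lambda>x. coords (fibre E x) (2 * adim A) (\<lambda>k. f k x) (f' j x) k"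
         "\<lambda>x. coords (gtan_vsp A x) (2 * adim A) (\<lambda>k. e k x) (e' j x) k"] by auto
  qed
qed

lemma E_sectionI:
  assumes V: "open V" and t: "gsec V t"
  shows "(\<lambda>x\<in>V. K x (t x)) \<in> sections A V E"
  unfolding sections_def E_rank mem_Collect_eq
proof
  show "(\<lambda>x\<in>V. K x (t x)) \<in> (\<Pi>\<^sub>E x\<in>V. vcarrier (fibre E x))"
    using gsec_gtan[OF t] by (auto simp: E_carrier)
  show "\<forall>(V', f)\<in>frames E. \<forall>k<2 * adim A.
      smooth_fun A (V \<inter> V') (\<lambda>x. coords (fibre E x) (2 * adim A) (\<lambda>k. f k x) ((\<lambda>x\<in>V. K x (t x)) x) k)"
  proof clarify
    fix V' f k assume f: "(V', f) \<in> frames E" and k: "k < 2 * adim A"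
    obtain e where e: "(V', e) \<in> frames (gen_tangent_bundle A UNIV)"
      "\<forall>x\<in>V'. \<forall>k<2 * adim A. f k x = K x (e k x)" using f by (rule E_framesD)
    have "open (V \<inter> V')" using V e(1) by (auto simp: gtb_frames_iff)
    moreover have "coords (fibre E x) (2 * adim A) (\<lambda>k. f k x) ((\<lambda>x\<in>V. K x (t x)) x) k =
        coords (gtan_vsp A x) (2 * adim A) (\<lambda>k. e k x) (t x) k" if "x \<in> V \<inter> V'" for x
      using E_frame_coords(2)[OF e(1), of x f "t x"] that e(2) gsec_gtan[OF t, of x] by simp
    ultimately show "smooth_fun A (V \<inter> V') (\<lambda>x. coords (fibre E x) (2 * adim A) (\<lambda>k. f k x) ((\<lambda>x\<in>V. K x (t x)) x) k)"
      using smooth_fun_cong[of "V \<inter> V'" "\<lambda>x. coords (fibre E x) (2 * adim A) (\<lambda>k. f k x) ((\<lambda>x\<in>V. K x (t x)) x) k"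
         "\<lambda>x. coords (gtan_vsp A x) (2 * adim A) (\<lambda>k. e k x) (t x) k"] gtb_coords_smooth[OF e(1) V t k] by simp
  qed
qed

text \<open>Together with \<open>E_sectionI\<close> this identifies sections of the glued bundle
  with sections of the generalized tangent bundle, through \<open>K\<close>.\<close>

lemma E_sectionD:
  assumes V: "open V" and s: "s \<in> sections A V E"
  shows "gsec V (\<lambda>x. Psi x (s x))" "s = (\<lambda>x\<in>V. K x (Psi x (s x)))" "x \<in> V \<Longrightarrow> K x (Psi x (s x)) = s x"
proof -
  have sx: "s x \<in> vcarrier (fibre E x)" if "x \<in> V" for x using s that by (auto simp: sections_def)
  have sm: "smooth_fun A (V \<inter> V') (\<lambda>x. coords (fibre E x) (2 * adim A) (\<lambda>k. f k x) (s x) k)"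
    if "(V', f) \<in> frames E" "k < 2 * adim A" for V' f k
    using s that unfolding sections_def E_rank by fast
  have K: "K x (Psi x (s x)) = s x" "Psi x (s x) \<in> gtan A x" if x: "x \<in> V" for x
  proof -
    obtain w where "w \<in> gtan A x" "s x = K x w" "Psi x (s x) = w" by (rule E_carrierE[OF sx[OF x]])
    then show "K x (Psi x (s x)) = s x" "Psi x (s x) \<in> gtan A x" by simp_all
  qed
  show "K x (Psi x (s x)) = s x" if "x \<in> V" by (rule K(1)[OF that])
  show "s = (\<lambda>x\<in>V. K x (Psi x (s x)))"
    using s K by (auto simp: sections_def fun_eq_iff PiE_def extensional_def)
  let ?t = "\<lambda>x\<in>V. Psi x (s x)"
  have "?t \<in> sections A V (gen_tangent_bundle A UNIV)"
    unfolding sections_def gtb_simps mem_Collect_eq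
  proof
    show "?t \<in> (\<Pi>\<^sub>E x\<in>V. gtan A x)" using K by auto
    show "\<forall>(V', e)\<in>frames (gen_tangent_bundle A UNIV). \<forall>k<2 * adim A.
      smooth_fun A (V \<inter> V') (\<lambda>x. coords (gtan_vsp A x) (2 * adim A) (\<lambda>k. e k x) (?t x) k)"
    proof clarify
      fix V' e k assume e: "(V', e) \<in> frames (gen_tangent_bundle A UNIV)" and k: "k < 2 * adim A"
      show "smooth_fun A (V \<inter> V') (\<lambda>x. coords (gtan_vsp A x) (2 * adim A) (\<lambda>k. e k x) (?t x) k)"
      \<comment> \<open>Smoothness is checked over each \<open>U i\<close>, where the frame of the
        generalized tangent bundle has a counterpart among the frames of \<open>E\<close>.\<close>
      proof (rule smooth_fun_local)
        fix x assume x: "x \<in> V \<inter> V'"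
        obtain i where i: "i \<in> I" "x \<in> U i" by (rule cover_obtain)
        obtain f where f: "(V' \<inter> U i, f) \<in> frames E" "\<forall>x\<in>V' \<inter> U i. \<forall>k<2 * adim A. f k x = K x (e k x)"
          using e i(1) by (rule E_framesI)
        let ?N = "V \<inter> V' \<inter> U i"
        have N: "open ?N" using V e U_open[OF i(1)] by (auto simp: gtb_frames_iff)
        have "coords (gtan_vsp A y) (2 * adim A) (\<lambda>k. e k y) (?t y) k = coords (fibre E y) (2 * adim A) (\<lambda>k. f k y) (s y) k"
          if y: "y \<in> ?N" for y
          using E_frame_coords(2)[OF e, of y f "Psi y (s y)"] f(2) y K[of y] by simp
        then have "smooth_fun A ?N (\<lambda>x. coords (gtan_vsp A x) (2 * adim A) (\<lambda>k. e k x) (?t x) k)"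
          using smooth_fun_cong[OF N, of "\<lambda>x. coords (gtan_vsp A x) (2 * adim A) (\<lambda>k. e k x) (?t x) k"
            "\<lambda>y. coords (fibre E y) (2 * adim A) (\<lambda>k. f k y) (s y) k"] sm[OF f(1) k] by (simp add: Int_assoc)
        then show "\<exists>N. open N \<and> x \<in> N \<and> smooth_fun A (V \<inter> V' \<inter> N) (\<lambda>x. coords (gtan_vsp A x) (2 * adim A) (\<lambda>k. e k x) (?t x) k)"
          using i U_open by blast
      qed
    qed
  qed
  then have "gsec V ?t" by (simp add: sections_gtb[OF V])
  then show "gsec V (\<lambda>x. Psi x (s x))" by (rule gsec_cong[OF V]) simp
qed

abbreviation Ks :: "('m \<Rightarrow> 'm gvec) \<Rightarrow> 'm \<Rightarrow> ('i \<times> 'm \<times> 'm gvec) set" where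
  "Ks t \<equiv> \<lambda>x. K x (t x)"

lemma E_sections_UNIV: "s \<in> sections A UNIV E \<longleftrightarrow> (\<exists>t. gsec UNIV t \<and> s = Ks t)"
proof
  assume "s \<in> sections A UNIV E"
  from E_sectionD(1,2)[OF open_UNIV this] show "\<exists>t. gsec UNIV t \<and> s = Ks t"
    unfolding restrict_UNIV_eq by (intro exI conjI)
next
  assume "\<exists>t. gsec UNIV t \<and> s = Ks t"
  then obtain t where "gsec UNIV t" "s = Ks t" by (elim exE conjE)
  then show "s \<in> sections A UNIV E" using E_sectionI[OF open_UNIV] by (simp add: restrict_UNIV_eq)
qed

section \<open>The glued operations in the global parametrisation\<close>

lemma C_vb: "vb C = E"
  by (simp add: glued_courant_def)

lemma local_rep_Ks: "i \<in> I \<Longrightarrow> local_rep U i (Ks t) = (\<lambda>x\<in>U i. b_exp (bm i x) (t x))"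
  unfolding local_rep_def by (rule restrict_ext) (simp add: K_mem)

lemma gsec_bm: "i \<in> I \<Longrightarrow> gsec (U i) t \<Longrightarrow> gsec (U i) (\<lambda>x. b_exp (bm i x) (t x))"
  by (rule gsec_b_exp[OF U_open bm_form])

text \<open>Over \<open>U i\<close> the twist \<open>H\<close> is the exterior derivative of
  \<open>b i\<close>, so \<open>exp (b i)\<close> carries the standard bracket of local
  representatives to the twisted bracket of global ones.\<close>

lemma courant_bracket_local:
  assumes i: "i \<in> I" "x \<in> U i" and t: "gsec (U i) t" "gsec (U i) t'"
    and a: "\<And>y. y \<in> U i \<Longrightarrow> a y = b_exp (bm i y) (t y)" "\<And>y. y \<in> U i \<Longrightarrow> a' y = b_exp (bm i y) (t' y)"
  shows "courant_bracket A H t t' x = b_exp (b i x) (courant_bracket A (\<lambda>x vs. 0) a a' x)"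
proof -
  note op = U_open[OF i(1)]
  have ga: "gsec (U i) a" by (rule gsec_cong[OF op gsec_bm[OF i(1) t(1)]]) (simp add: a)
  have ga': "gsec (U i) a'" by (rule gsec_cong[OF op gsec_bm[OF i(1) t(2)]]) (simp add: a)
  have HU: "diff_form A (U i) 3 H" by (rule df_mono[OF H_form]) simp
  have "courant_bracket A H t t' x = courant_bracket A H (\<lambda>y. b_exp (b i y) (a y)) (\<lambda>y. b_exp (b i y) (a' y)) x"
    by (rule courant_bracket_cong[OF op i(2) t HU]) (simp_all add: a b_exp_bm)
  also have "\<dots> = b_exp (b i x) (courant_bracket A (\<lambda>x vs. 0) a a' x)"
    by (rule courant_bracket_b_exp[OF op i(2) b_form[OF i(1)] ga ga' HU]) (simp add: H_eq[OF i(1)])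
  finally show ?thesis .
qed

text \<open>The local standard brackets define one class at each point because all of them come from
  the same twisted bracket by applying \<open>exp (bm i)\<close>.\<close>

lemma C_brkt:
  assumes t: "gsec UNIV t" "gsec UNIV t'"
  shows "brkt C (Ks t) (Ks t') = Ks (courant_bracket A H t t')"
proof
  fix x
  have "brkt (standard_courant A (U i)) (local_rep U i (Ks t)) (local_rep U i (Ks t')) x =
      b_exp (bm i x) (courant_bracket A H t t' x)" if i: "i \<in> I" "x \<in> U i" for i
    using courant_bracket_local[OF i gsec_mono[OF t(1)] gsec_mono[OF t(2)],
        of "local_rep U i (Ks t)" "local_rep U i (Ks t')"] i
    by (simp add: local_rep_Ks twisted_simps b_exp_bm)
  then show "brkt C (Ks t) (Ks t') x = K x (courant_bracket A H t t' x)"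
    by (auto simp: glued_courant_def K_def)
qed

lemma C_sec_ops:
  assumes t: "gsec UNIV t" "gsec UNIV t'"
  shows "sec_add UNIV E (Ks t) (Ks t') = Ks (glincomb 1 t 1 t')" "sec_scale UNIV E a (Ks t) = Ks (glincomb a t 0 t)"
  unfolding sec_add_def sec_scale_def restrict_UNIV_eq
  using E_ops(1)[OF gsec_gtan[OF t(1) UNIV_I] gsec_gtan[OF t(2) UNIV_I]] E_ops(2)[OF gsec_gtan[OF t(1) UNIV_I] gsec_gtan[OF t(1) UNIV_I]]
  by (simp_all add: glincomb_def gtan_ops)

lemma C_anchor_element:
  assumes al: "\<alpha> \<in> alt_forms A 1 x"
  shows "(p \<in> vcarrier (fibre E x) \<and> (\<forall>e\<in>vcarrier (fibre E x). pairing C x p e = \<alpha> [anchor C x e])) \<longleftrightarrow>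
    p = K x (\<lambda>f. 0, \<alpha>)"
proof -
  have key: "(\<forall>e\<in>vcarrier (fibre E x). pairing C x (K x w) e = \<alpha> [anchor C x e]) \<longleftrightarrow> w = (\<lambda>f. 0, \<alpha>)"
    if w: "w \<in> gtan A x" for w
  proof -
    have "(\<forall>e\<in>vcarrier (fibre E x). pairing C x (K x w) e = \<alpha> [anchor C x e]) \<longleftrightarrow> (\<forall>e\<in>gtan A x. gpairing w e = \<alpha> [fst e])"
      unfolding E_carrier ball_simps using C_simps w by auto
    then show ?thesis using anchor_element[OF al, of w] w by simp
  qed
  show ?thesis
  proof
    assume p: "p \<in> vcarrier (fibre E x) \<and> (\<forall>e\<in>vcarrier (fibre E x). pairing C x p e = \<alpha> [anchor C x e])"
    then obtain w where w: "w \<in> gtan A x" "p = K x w" unfolding E_carrier by (elim conjE imageE)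
    then show "p = K x (\<lambda>f. 0, \<alpha>)" using key[OF w(1)] p by simp
  next
    assume p: "p = K x (\<lambda>f. 0, \<alpha>)"
    have g: "(\<lambda>f. 0, \<alpha>) \<in> gtan A x" using al tangent_zero by (simp add: gtan_iff)
    then show "p \<in> vcarrier (fibre E x) \<and> (\<forall>e\<in>vcarrier (fibre E x). pairing C x p e = \<alpha> [anchor C x e])"
      using key[OF g] p imageI[OF g, of "K x"] by (simp add: E_carrier)
  qed
qed

lemma C_courant_D: "courant_D UNIV C f = Ks (\<lambda>x. (\<lambda>f. 0, dform f x))"
proof
  fix x
  have an: "anchor C x e \<in> tangent_space A x" if "e \<in> vcarrier (fibre E x)" for e
    using that C_simps(2) by (auto simp: E_carrier gtan_iff)
  then have "(p \<in> vcarrier (fibre E x) \<and> (\<forall>e\<in>vcarrier (fibre E x). pairing C x p e = anchor C x e f)) \<longleftrightarrow>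
    p = K x (\<lambda>f. 0, dform f x)" for p
    using C_anchor_element[OF dform_alt[of f x], of p] dform_apply[of _ x f] by simp
  then show "courant_D UNIV C f x = K x (\<lambda>f. 0, dform f x)" by (simp add: courant_D_def C_vb)
qed

lemma C_circ:
  assumes t: "gsec UNIV t" "gsec UNIV t'"
  shows "courant_circ UNIV C (Ks t) (Ks t') = Ks (dorfman A H t t')"
proof
  fix x
  have g: "courant_bracket A H t t' x \<in> gtan A x"
    by (rule gsec_gtan[OF gsec_courant_bracket[OF open_UNIV t H_form] UNIV_I])
  have g': "(\<lambda>f. 0, dform f x) \<in> gtan A x" for f using dform_alt tangent_zero by (simp add: gtan_iff)
  have "(\<lambda>y. pairing C y (K y (t y)) (K y (t' y))) = (\<lambda>y. gpairing (t y) (t' y))"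
    by (rule ext) (rule C_simps(1)[OF gsec_gtan[OF t(1) UNIV_I] gsec_gtan[OF t(2) UNIV_I]])
  then have "courant_circ UNIV C (Ks t) (Ks t') x = vadd (fibre E x) (K x (courant_bracket A H t t' x))
      (vscale (fibre E x) (1/2) (K x (\<lambda>f. 0, dform (\<lambda>y. gpairing (t y) (t' y)) x)))"
    by (simp add: courant_circ_def C_vb C_brkt[OF t] C_courant_D)
  also have "\<dots> = K x (dorfman A H t t' x)"
    using courant_dorfman[OF open_UNIV UNIV_I t H_form, of x]
    by (simp only: E_ops(2)[OF g' g'] E_ops(1)[OF g gtan_closed(3)[OF g']])
  finally show "courant_circ UNIV C (Ks t) (Ks t') x = K x (dorfman A H t t' x)" .
qed

text \<open>Every section over the manifold has the form \<open>Ks t\<close>, and pairing, anchor,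
  bracket and linear operations have been computed in this form, so each axiom becomes the
  corresponding fact about the \<open>H\<close>-twisted structure.\<close>

lemma C_courant_algebroid: "courant_algebroid A UNIV C"
proof -
  note D = gsec_dorfman[OF open_UNIV _ _ H_form] and G = gsec_glincomb[OF open_UNIV] and B = gsec_courant_bracket[OF open_UNIV _ _ H_form]
  show ?thesis
    unfolding courant_algebroid_def Let_def C_vb
  proof (intro conjI allI ballI impI; (elim conjE)?)
    show "vector_bundle A UNIV E" by (rule E_vector_bundle)
  next
    fix x p q r a assume "p \<in> vcarrier (fibre E x)" "q \<in> vcarrier (fibre E x)" "r \<in> vcarrier (fibre E x)"
    then obtain u v w where g: "u \<in> gtan A x" "v \<in> gtan A x" "w \<in> gtan A x" and eq: "p = K x u" "q = K x v" "r = K x w"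
      unfolding E_carrier by blast
    note l = gpairing_linear[OF g] and c = gtan_closed
    show "pairing C x p q = pairing C x q p"
      unfolding eq C_simps(1)[OF g(1,2)] C_simps(1)[OF g(2,1)] by (rule gpairing_sym)
    show "pairing C x (vadd (fibre E x) p q) r = pairing C x p r + pairing C x q r"
      unfolding eq E_ops(1)[OF g(1,2)] C_simps(1)[OF g(1,3)] C_simps(1)[OF g(2,3)] C_simps(1)[OF gtan_closed(2)[OF g(1,2)] g(3)] by (rule l)
    show "pairing C x (vscale (fibre E x) a p) r = a * pairing C x p r"
      unfolding eq E_ops(2)[OF g(1,1)] C_simps(1)[OF g(1,3)] C_simps(1)[OF gtan_closed(3)[OF g(1)] g(3)] by (rule l)
  next
    fix x p assume "p \<in> vcarrier (fibre E x)" and z: "\<forall>v\<in>vcarrier (fibre E x). pairing C x p v = 0"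
    then obtain u where u: "u \<in> gtan A x" "p = K x u" unfolding E_carrier by blast
    have "u = vzero (gtan_vsp A x)"
      by (rule gpairing_nondegenerate[OF u(1)]) (use z u C_simps(1) in \<open>auto simp: E_carrier\<close>)
    then show "p = vzero (fibre E x)" by (simp add: u(2) E_zero)
  next
    fix V s t assume V: "open V" and st: "s \<in> sections A V E" "t \<in> sections A V E"
    note s = E_sectionD[OF V st(1)] and t = E_sectionD[OF V st(2)]
    have "pairing C x (s x) (t x) = gpairing (Psi x (s x)) (Psi x (t x))" if x: "x \<in> V" for x
      using C_simps(1)[OF gsec_gtan[OF s(1) x] gsec_gtan[OF t(1) x]] s(3)[OF x] t(3)[OF x] by simp
    then show "smooth_fun A V (\<lambda>x. pairing C x (s x) (t x))"
      using smooth_fun_cong[OF V, of "\<lambda>x. pairing C x (s x) (t x)" "\<lambda>x. gpairing (Psi x (s x)) (Psi x (t x))"]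
        gsec_pairing[OF V s(1) t(1)] by simp
  next
    show "bundle_map A UNIV E (tangent_bundle A UNIV) (anchor C)"
      unfolding bundle_map_def linear_vsp_def tan_bundle_simps
    proof (intro conjI ballI allI impI; (elim conjE)?)
      fix V s assume V: "open V" and s0: "s \<in> sections A V E"
      note s = E_sectionD[OF V s0]
      have "anchor C x (s x) = fst (Psi x (s x))" if x: "x \<in> V" for x
        using C_simps(2)[OF gsec_gtan[OF s(1) x] gsec_gtan[OF s(1) x]] s(3)[OF x] by simp
      then have "(\<lambda>x\<in>V. anchor C x (s x)) = (\<lambda>x\<in>V. fst (Psi x (s x)))" by (intro restrict_ext)
      then show "(\<lambda>x\<in>V. anchor C x (s x)) \<in> sections A V (tangent_bundle A UNIV)"
        using tangent_bundle_section[OF V subset_UNIV gsec_vf[OF s(1)]] by simp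
    next
      fix x p assume "p \<in> vcarrier (fibre E x)"
      then obtain u where u: "u \<in> gtan A x" "p = K x u" unfolding E_carrier by blast
      show "anchor C x p \<in> tangent_space A x" using u C_simps(2) by (simp add: gtan_iff)
    next
      fix x p q assume "p \<in> vcarrier (fibre E x)" "q \<in> vcarrier (fibre E x)"
      then obtain u v where g: "u \<in> gtan A x" "v \<in> gtan A x" and eq: "p = K x u" "q = K x v" unfolding E_carrier by blast
      show "anchor C x (vadd (fibre E x) p q) = (\<lambda>f. anchor C x p f + anchor C x q f)"
        using C_simps(2)[OF gtan_closed(2)[OF g] g(1)] C_simps(2)[OF g] C_simps(2)[OF g(2,1)]
        by (simp add: eq E_ops(1)[OF g] gtan_ops)
    next
      fix x a p assume "p \<in> vcarrier (fibre E x)"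
      then obtain u where u: "u \<in> gtan A x" "p = K x u" unfolding E_carrier by blast
      show "anchor C x (vscale (fibre E x) a p) = (\<lambda>f. a * anchor C x p f)"
        using C_simps(2)[OF gtan_closed(3)[OF u(1)] u(1)] C_simps(2)[OF u(1,1)]
        by (simp add: u(2) E_ops(2)[OF u(1,1)] gtan_ops)
    qed
  next
    fix p q assume "p \<in> sections A UNIV E" "q \<in> sections A UNIV E"
    then obtain u v where g: "gsec UNIV u" "gsec UNIV v" and eq: "p = Ks u" "q = Ks v" unfolding E_sections_UNIV by blast
    show "brkt C p q \<in> sections A UNIV E"
      unfolding eq C_brkt[OF g] using B[OF g] E_sections_UNIV by blast
    have "courant_bracket A H u v = glincomb (-1) (courant_bracket A H v u) 0 (courant_bracket A H v u)"
      by (rule ext) (simp add: courant_bracket_glincomb glincomb_def fun_eq_iff)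
    then show "brkt C p q = sec_scale UNIV E (-1) (brkt C q p)"
      unfolding eq C_brkt[OF g] C_brkt[OF g(2,1)] C_sec_ops(2)[OF B[OF g(2,1)] B[OF g(2,1)]] by metis
  next
    fix p q r assume "p \<in> sections A UNIV E" "q \<in> sections A UNIV E" "r \<in> sections A UNIV E"
    then obtain u v w where g: "gsec UNIV u" "gsec UNIV v" "gsec UNIV w" and eq: "p = Ks u" "q = Ks v" "r = Ks w"
      unfolding E_sections_UNIV by blast
    have "courant_bracket A H (glincomb 1 u 1 v) w = glincomb 1 (courant_bracket A H u w) 1 (courant_bracket A H v w)"
      unfolding courant_bracket_glincomb[abs_def] dorfman_glincomb_UNIV[OF H_form g]
      by (rule ext) (simp add: glincomb_def fun_eq_iff algebra_simps)
    then show "brkt C (sec_add UNIV E p q) r = sec_add UNIV E (brkt C p r) (brkt C q r)"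
      by (simp only: eq C_sec_ops(1)[OF g(1,2)] C_brkt[OF G[OF g(1,2)] g(3)] C_brkt[OF g(1,3)] C_brkt[OF g(2,3)]
        C_sec_ops(1)[OF B[OF g(1,3)] B[OF g(2,3)]])
  next
    fix p q a assume "p \<in> sections A UNIV E" "q \<in> sections A UNIV E"
    then obtain u v where g: "gsec UNIV u" "gsec UNIV v" and eq: "p = Ks u" "q = Ks v" unfolding E_sections_UNIV by blast
    have "courant_bracket A H (glincomb a u 0 u) v = glincomb a (courant_bracket A H u v) 0 (courant_bracket A H u v)"
      unfolding courant_bracket_glincomb[abs_def] dorfman_glincomb_UNIV[OF H_form g(1,1,2)]
      by (rule ext) (simp add: glincomb_def fun_eq_iff algebra_simps)
    then show "brkt C (sec_scale UNIV E a p) q = sec_scale UNIV E a (brkt C p q)"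
      by (simp only: eq C_sec_ops(2)[OF g(1,1)] C_brkt[OF G[OF g(1,1)] g(2)] C_brkt[OF g] C_sec_ops(2)[OF B[OF g] B[OF g]])
  next
    fix p q r assume "p \<in> sections A UNIV E" "q \<in> sections A UNIV E" "r \<in> sections A UNIV E"
    then obtain u v w where g: "gsec UNIV u" "gsec UNIV v" "gsec UNIV w" and eq: "p = Ks u" "q = Ks v" "r = Ks w"
      unfolding E_sections_UNIV by blast
    have "dorfman A H u (dorfman A H v w) = glincomb 1 (dorfman A H (dorfman A H u v) w) 1 (dorfman A H v (dorfman A H u w))"
      using dorfman_leibniz[OF open_UNIV UNIV_I g H_form H_deriv_fields]
      by (intro ext) (simp add: glincomb_def gtan_ops)
    then show "courant_circ UNIV C p (courant_circ UNIV C q r) =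
        sec_add UNIV E (courant_circ UNIV C (courant_circ UNIV C p q) r) (courant_circ UNIV C q (courant_circ UNIV C p r))"
      by (simp only: eq C_circ[OF g(2,3)] C_circ[OF g(1,2)] C_circ[OF g(1,3)] C_circ[OF g(1) D[OF g(2,3)]]
        C_circ[OF D[OF g(1,2)] g(3)] C_circ[OF g(2) D[OF g(1,3)]] C_sec_ops(1)[OF D[OF D[OF g(1,2)] g(3)] D[OF g(2) D[OF g(1,3)]]])
    fix x
    note m = gsec_gtan[OF _ UNIV_I]
    have "(\<lambda>y. pairing C y (K y (v y)) (K y (w y))) = (\<lambda>y. gpairing (v y) (w y))"
      by (rule ext) (rule C_simps(1)[OF m[OF g(2)] m[OF g(3)]])
    then show "anchor C x (p x) (\<lambda>y. pairing C y (q y) (r y)) =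
        pairing C x (courant_circ UNIV C p q x) (r x) + pairing C x (q x) (courant_circ UNIV C p r x)"
      using dorfman_invariant[OF open_UNIV UNIV_I g H_form, of x]
      by (simp only: eq C_circ[OF g(1,2)] C_circ[OF g(1,3)] C_simps(2)[OF m[OF g(1)] m[OF g(1)]]
        C_simps(1)[OF m[OF D[OF g(1,2)]] m[OF g(3)]] C_simps(1)[OF m[OF g(2)] m[OF D[OF g(1,3)]]])
  qed
qed

text \<open>The dual of the anchor sends a covector \<alpha> to the class of
  \<open>(\<lambda>f. 0, \<alpha>)\<close>, so exactness is that of the generalized tangent bundle,
  read through \<open>K\<close>.\<close>

lemma C_exact: "exact_courant_algebroid A UNIV C"
proof -
  have co: "coanchor C x \<alpha> = K x (\<lambda>f. 0, \<alpha>)" if "\<alpha> \<in> alt_forms A 1 x" for x \<alpha>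
  proof -
    have "(\<lambda>p. p \<in> vcarrier (fibre E x) \<and> (\<forall>e\<in>vcarrier (fibre E x). pairing C x p e = \<alpha> [anchor C x e])) =
        (\<lambda>p. p = K x (\<lambda>f. 0, \<alpha>))"
      by (rule ext) (rule C_anchor_element[OF that])
    then show ?thesis unfolding coanchor_def C_vb by (metis the_eq_trivial)
  qed
  have an: "anchor C x (K x w) = fst w" if "w \<in> gtan A x" for x w by (rule C_simps(2)[OF that that])
  show ?thesis
    unfolding exact_courant_algebroid_def C_vb
  proof (intro conjI C_courant_algebroid ballI)
    fix x :: 'm
    show "inj_on (coanchor C x) (alt_forms A 1 x)"
      by (rule inj_onI) (simp add: co K_inj)
    have "coanchor C x ` alt_forms A 1 x = (\<lambda>\<alpha>. K x (\<lambda>f. 0, \<alpha>)) ` alt_forms A 1 x"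
      by (rule image_cong) (use co in auto)
    also have "\<dots> = {p \<in> K x ` gtan A x. anchor C x p = (\<lambda>f. 0)}"
    proof
      show "(\<lambda>\<alpha>. K x (\<lambda>f. 0, \<alpha>)) ` alt_forms A 1 x \<subseteq> {p \<in> K x ` gtan A x. anchor C x p = (\<lambda>f. 0)}"
      proof
        fix p assume "p \<in> (\<lambda>\<alpha>. K x (\<lambda>f. 0, \<alpha>)) ` alt_forms A 1 x"
        then obtain \<alpha> where a: "\<alpha> \<in> alt_forms A 1 x" "p = K x (\<lambda>f. 0, \<alpha>)" by blast
        then have "(\<lambda>f. 0, \<alpha>) \<in> gtan A x" using tangent_zero by (simp add: gtan_iff)
        then show "p \<in> {p \<in> K x ` gtan A x. anchor C x p = (\<lambda>f. 0)}" using an a by auto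
      qed
      show "{p \<in> K x ` gtan A x. anchor C x p = (\<lambda>f. 0)} \<subseteq> (\<lambda>\<alpha>. K x (\<lambda>f. 0, \<alpha>)) ` alt_forms A 1 x"
      proof clarify
        fix X \<alpha> assume w: "(X, \<alpha>) \<in> gtan A x" "anchor C x (K x (X, \<alpha>)) = (\<lambda>f. 0)"
        then have "X = (\<lambda>f. 0)" "\<alpha> \<in> alt_forms A 1 x" using an[OF w(1)] by (auto simp: gtan_iff)
        then show "K x (X, \<alpha>) \<in> (\<lambda>\<alpha>. K x (\<lambda>f. 0, \<alpha>)) ` alt_forms A 1 x" by blast
      qed
    qed
    finally show "coanchor C x ` alt_forms A 1 x = {u \<in> vcarrier (fibre E x). anchor C x u = (\<lambda>f. 0)}"
      unfolding E_carrier .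
    have "anchor C x ` vcarrier (fibre E x) = fst ` gtan A x"
      unfolding E_carrier image_image by (rule image_cong) (use an in auto)
    also have "\<dots> = tangent_space A x"
      using twisted_exact[OF twisted_H] unfolding exact_courant_algebroid_def twisted_simps gtb_simps by blast
    finally show "anchor C x ` vcarrier (fibre E x) = tangent_space A x" .
  qed
qed

end

section \<open>Local and global isomorphisms\<close>

lemma linear_vsp_inv:
  assumes V: "real_vsp V" and f: "linear_vsp V W f" and bij: "bij_betw f (vcarrier V) (vcarrier W)"
  shows "linear_vsp W V (inv_into (vcarrier V) f)"
proof -
  let ?g = "inv_into (vcarrier V) f"
  have gf: "?g (f u) = u" if "u \<in> vcarrier V" for u using bij that by (simp add: bij_betw_inv_into_left)
  have ob: "\<exists>u. u \<in> vcarrier V \<and> w = f u" if "w \<in> vcarrier W" for w using bij that by (auto simp: bij_betw_def)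
  show ?thesis
    unfolding linear_vsp_def
  proof (intro conjI ballI allI)
    fix w assume "w \<in> vcarrier W"
    then obtain u where u: "u \<in> vcarrier V" "w = f u" using ob by blast
    show "?g w \<in> vcarrier V" using u gf by simp
    fix w' assume "w' \<in> vcarrier W"
    then obtain u' where u': "u' \<in> vcarrier V" "w' = f u'" using ob by blast
    have "vadd W w w' = f (vadd V u u')" using f u u' by (simp add: linear_vsp_def)
    then show "?g (vadd W w w') = vadd V (?g w) (?g w')"
      using gf real_vsp_closed(2)[OF V u(1) u'(1)] u u' by simp
  next
    fix a w assume "w \<in> vcarrier W"
    then obtain u where u: "u \<in> vcarrier V" "w = f u" using ob by blast
    have "vscale W a w = f (vscale V a u)" using f u by (simp add: linear_vsp_def)
    then show "?g (vscale W a w) = vscale V a (?g w)"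
      using gf real_vsp_closed(3)[OF V u(1)] u by simp
  qed
qed

context glue_data
begin

abbreviation cls :: "'i \<Rightarrow> 'm \<Rightarrow> 'm gvec \<Rightarrow> ('i \<times> 'm \<times> 'm gvec) set" where
  "cls \<equiv> glue_class A I U \<phi>"

lemma cls_K: "i \<in> I \<Longrightarrow> x \<in> U i \<Longrightarrow> u \<in> gtan A x \<Longrightarrow> cls i x u = K x (b_exp (b i x) u)"
  by (rule glue_class_K)

lemma K_cls: "i \<in> I \<Longrightarrow> x \<in> U i \<Longrightarrow> w \<in> gtan A x \<Longrightarrow> K x w = cls i x (b_exp (bm i x) w)"
  using glue_class_K[of i x "b_exp (bm i x) w"] b_exp_gtan[OF bm_alt] by (simp add: b_exp_bm)

lemma cls_inj: "i \<in> I \<Longrightarrow> x \<in> U i \<Longrightarrow> u \<in> gtan A x \<Longrightarrow> v \<in> gtan A x \<Longrightarrow> cls i x u = cls i x v \<longleftrightarrow> u = v"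
  by (simp add: cls_K K_inj) (metis b_exp_bm(1))

lemma cls_bij:
  assumes i: "i \<in> I" "x \<in> U i"
  shows "bij_betw (cls i x) (gtan A x) (vcarrier (fibre E x))"
proof -
  have "bij_betw (K x \<circ> b_exp (b i x)) (gtan A x) (vcarrier (fibre E x))"
    by (rule bij_betw_trans[OF b_exp_iso(3)[OF b_alt[OF i]] K_bij])
  then show ?thesis
    by (rule bij_betw_cong[THEN iffD1, rotated]) (simp add: cls_K[OF i])
qed

lemma cls_linear:
  assumes i: "i \<in> I" "x \<in> U i"
  shows "linear_vsp (gtan_vsp A x) (fibre E x) (cls i x)"
proof -
  note g = b_exp_gtan[OF b_alt[OF i]]
  show ?thesis
    unfolding linear_vsp_def E_carrier
    using b_exp_linear[OF b_alt[OF i]] by (simp add: cls_K[OF i] gtan_closed E_ops g imageI)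
qed

text \<open>Over \<open>U i\<close> the class map is \<open>exp (b i)\<close> followed by
  \<open>K\<close>, with inverse \<open>exp (bm i)\<close> after \<open>Psi\<close>; both directions
  preserve smooth sections by the facts about \<open>K\<close> and \<open>b_exp\<close>.\<close>

lemma cls_iso:
  assumes i: "i \<in> I"
  shows "bundle_iso A (U i) (gen_tangent_bundle A (U i)) E (cls i)"
  unfolding bundle_iso_def gtb_simps
proof (intro conjI)
  note op = U_open[OF i]
  show "bundle_map A (U i) (gen_tangent_bundle A (U i)) E (cls i)"
    unfolding bundle_map_def gtb_simps
  proof (intro conjI ballI allI impI; (elim conjE)?)
    fix x assume "x \<in> U i" then show "linear_vsp (gtan_vsp A x) (fibre E x) (cls i x)" by (rule cls_linear[OF i])
  next
    fix V s assume V: "open V" "V \<subseteq> U i" and "s \<in> sections A V (gen_tangent_bundle A (U i))"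
    then have s: "gsec V s" by (simp add: sections_gtb[OF V op])
    have "(\<lambda>x\<in>V. cls i x (s x)) = (\<lambda>x\<in>V. K x (b_exp (b i x) (s x)))"
      by (rule restrict_ext) (use cls_K[OF i _ gsec_gtan[OF s]] V(2) in blast)
    then show "(\<lambda>x\<in>V. cls i x (s x)) \<in> sections A V E"
      using E_sectionI[OF V(1) gsec_b_exp[OF V(1) df_mono[OF b_form[OF i] V(2)] s]] by simp
  qed
  show "\<forall>x\<in>U i. bij_betw (cls i x) (gtan A x) (vcarrier (fibre E x))" using cls_bij[OF i] by blast
  show "bundle_map A (U i) E (gen_tangent_bundle A (U i)) (\<lambda>x. inv_into (gtan A x) (cls i x))"
    unfolding bundle_map_def gtb_simps
  proof (intro conjI ballI allI impI; (elim conjE)?)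
    fix x assume "x \<in> U i"
    then show "linear_vsp (fibre E x) (gtan_vsp A x) (inv_into (gtan A x) (cls i x))"
      by (intro linear_vsp_inv gtan_real_vsp cls_linear cls_bij i)
  next
    fix V s assume V: "open V" "V \<subseteq> U i" and s: "s \<in> sections A V E"
    note t = E_sectionD[OF V(1) s]
    have eq: "(\<lambda>x\<in>V. inv_into (gtan A x) (cls i x) (s x)) = (\<lambda>x\<in>V. b_exp (bm i x) (Psi x (s x)))"
    proof (rule restrict_ext)
      fix x assume x: "x \<in> V"
      then have xU: "x \<in> U i" using V(2) by blast
      have g: "Psi x (s x) \<in> gtan A x" by (rule gsec_gtan[OF t(1) x])
      have "inv_into (gtan A x) (cls i x) (cls i x (b_exp (bm i x) (Psi x (s x)))) = b_exp (bm i x) (Psi x (s x))"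
        by (rule bij_betw_inv_into_left[OF cls_bij[OF i xU] b_exp_gtan[OF bm_alt[OF i xU] g]])
      then show "inv_into (gtan A x) (cls i x) (s x) = b_exp (bm i x) (Psi x (s x))"
        using K_cls[OF i xU g] t(3)[OF x] by simp
    qed
    have gs: "gsec V (\<lambda>x. b_exp (bm i x) (Psi x (s x)))"
      by (rule gsec_b_exp[OF V(1) df_mono[OF bm_form[OF i] V(2)] t(1)])
    have "gsec V (\<lambda>x\<in>V. b_exp (bm i x) (Psi x (s x)))"
      by (rule gsec_cong[OF V(1) gs]) simp
    then show "(\<lambda>x\<in>V. inv_into (gtan A x) (cls i x) (s x)) \<in> sections A V (gen_tangent_bundle A (U i))"
      unfolding sections_gtb[OF V op] eq by simp
  qed
qed

text \<open>With all operations expressed through \<open>K\<close>, its inverse preserves them; for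
  the bracket this is \<open>C_brkt\<close>, where the twist by \<open>H\<close> appears.\<close>

lemma Psi_iso: "courant_iso A UNIV C (twisted_courant A UNIV H) Psi"
  unfolding courant_iso_def twisted_simps C_vb
proof (intro conjI ballI)
  have lin: "linear_vsp (fibre E x) (gtan_vsp A x) (Psi x)" for x
    unfolding Psi_def by (rule linear_vsp_inv[OF gtan_real_vsp K_linear K_bij])
  have bij: "bij_betw (Psi x) (vcarrier (fibre E x)) (gtan A x)" for x
    unfolding Psi_def by (rule bij_betw_inv_into[OF K_bij])
  show "bundle_iso A UNIV E (gen_tangent_bundle A UNIV) Psi"
    unfolding bundle_iso_def gtb_simps
  proof (intro conjI)
    show "bundle_map A UNIV E (gen_tangent_bundle A UNIV) Psi"
      unfolding bundle_map_def gtb_simps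
    proof (intro conjI ballI allI impI lin; elim conjE)
      fix V s assume V: "open V" and s: "s \<in> sections A V E"
      have "gsec V (\<lambda>x\<in>V. Psi x (s x))"
        by (rule gsec_cong[OF V E_sectionD(1)[OF V s]]) simp
      then show "(\<lambda>x\<in>V. Psi x (s x)) \<in> sections A V (gen_tangent_bundle A UNIV)"
        by (simp add: sections_gtb[OF V])
    qed
    show "\<forall>x\<in>UNIV. bij_betw (Psi x) (vcarrier (fibre E x)) (gtan A x)" using bij by blast
    show "bundle_map A UNIV (gen_tangent_bundle A UNIV) E (\<lambda>x. inv_into (vcarrier (fibre E x)) (Psi x))"
      unfolding bundle_map_def gtb_simps
    proof (intro conjI ballI allI impI linear_vsp_inv[OF E_real_vsp lin bij]; elim conjE)
      fix V s assume V: "open V" and "s \<in> sections A V (gen_tangent_bundle A UNIV)"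
      then have s: "gsec V s" by (simp add: sections_gtb[OF V])
      have "inv_into (vcarrier (fibre E x)) (Psi x) (s x) = K x (s x)" if x: "x \<in> V" for x
      proof (rule inv_into_f_eq)
        show "inj_on (Psi x) (vcarrier (fibre E x))" using bij by (simp add: bij_betw_def)
        show "K x (s x) \<in> vcarrier (fibre E x)" unfolding E_carrier by (rule imageI[OF gsec_gtan[OF s x]])
        show "Psi x (K x (s x)) = s x" by (rule Psi_K[OF gsec_gtan[OF s x]])
      qed
      then have "(\<lambda>x\<in>V. inv_into (vcarrier (fibre E x)) (Psi x) (s x)) = (\<lambda>x\<in>V. K x (s x))" by (intro restrict_ext)
      then show "(\<lambda>x\<in>V. inv_into (vcarrier (fibre E x)) (Psi x) (s x)) \<in> sections A V E"
        using E_sectionI[OF V s] by simp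
    qed
  qed
next
  fix x p q assume "p \<in> vcarrier (fibre E x)" "q \<in> vcarrier (fibre E x)"
  then obtain u v where g: "u \<in> gtan A x" "v \<in> gtan A x" and eq: "p = K x u" "q = K x v" unfolding E_carrier by blast
  show "gpairing (Psi x p) (Psi x q) = pairing C x p q"
    by (simp add: eq Psi_K g C_simps)
next
  fix x p assume "p \<in> vcarrier (fibre E x)"
  then obtain u where g: "u \<in> gtan A x" and eq: "p = K x u" unfolding E_carrier by blast
  show "fst (Psi x p) = anchor C x p" using C_simps(2)[OF g g] by (simp add: eq Psi_K[OF g])
next
  fix p q x assume "p \<in> sections A UNIV E" "q \<in> sections A UNIV E"
  then obtain u v where g: "gsec UNIV u" "gsec UNIV v" and eq: "p = Ks u" "q = Ks v" unfolding E_sections_UNIV by blast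
  have "(\<lambda>y\<in>UNIV. Psi y (K y (t y))) = t" if "gsec UNIV t" for t
    using Psi_K[OF gsec_gtan[OF that UNIV_I]] by (simp add: restrict_UNIV_eq)
  then show "(\<lambda>x\<in>UNIV. courant_bracket A H (\<lambda>y\<in>UNIV. Psi y (p y)) (\<lambda>y\<in>UNIV. Psi y (q y)) x) x = Psi x (brkt C p q x)"
    using g C_brkt[OF g] Psi_K[OF gsec_gtan[OF gsec_courant_bracket[OF open_UNIV g H_form] UNIV_I]]
    by (simp add: eq)
qed

text \<open>Injectivity of \<open>K\<close> forces the given local representatives to be
  \<open>exp (bm i)\<close> of the global ones, so \<open>courant_bracket_local\<close> applies to
  them.\<close>

lemma C_brkt_local:
  assumes st: "s \<in> sections A UNIV E" "t \<in> sections A UNIV E" and i: "i \<in> I"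
    and a: "gsec (U i) a" "gsec (U i) a'" and eq: "\<And>x. x \<in> U i \<Longrightarrow> s x = cls i x (a x) \<and> t x = cls i x (a' x)"
    and x: "x \<in> U i"
  shows "brkt C s t x = cls i x (courant_bracket A (\<lambda>x vs. 0) a a' x)"
proof -
  obtain u v where g: "gsec UNIV u" "gsec UNIV v" and uv: "s = Ks u" "t = Ks v"
    using st unfolding E_sections_UNIV by blast
  have "a y = b_exp (bm i y) (u y)" "a' y = b_exp (bm i y) (v y)" if y: "y \<in> U i" for y
  proof -
    have "K y (u y) = K y (b_exp (b i y) (a y))" "K y (v y) = K y (b_exp (b i y) (a' y))"
      using eq[OF y] cls_K[OF i y gsec_gtan[OF a(1) y]] cls_K[OF i y gsec_gtan[OF a(2) y]] by (simp_all add: uv)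
    then show "a y = b_exp (bm i y) (u y)" "a' y = b_exp (bm i y) (v y)" by (simp_all add: K_inj b_exp_bm)
  qed
  then have "courant_bracket A H u v x = b_exp (b i x) (courant_bracket A (\<lambda>x vs. 0) a a' x)"
    by (intro courant_bracket_local[OF i x gsec_mono[OF g(1)] gsec_mono[OF g(2)]]) auto
  moreover have "courant_bracket A (\<lambda>x vs. 0) a a' x \<in> gtan A x"
    by (rule gsec_gtan[OF gsec_courant_bracket[OF U_open[OF i] a df_zero] x])
  ultimately show ?thesis
    using C_brkt[OF g] cls_K[OF i x] by (simp add: uv)
qed

text \<open>Contraction with the zero vector vanishes, so \<phi> even fixes every covector.\<close>

lemma phi_cotangent:
  assumes ij: "i \<in> I" "j \<in> I" and x: "x \<in> U i \<inter> U j"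
  shows "\<phi> i j x ` ({\<lambda>f. 0} \<times> alt_forms A 1 x) = {\<lambda>f. 0} \<times> alt_forms A 1 x"
proof -
  have bb: "(\<lambda>vs. b j x vs - b i x vs) \<in> alt_forms A 2 x"
    using alt_forms_lincomb[OF b_alt b_alt, of j x i 1 "-1"] ij x by simp
  have "\<phi> i j x u = u" if u: "u \<in> {\<lambda>f. 0} \<times> alt_forms A 1 x" for u
  proof -
    have g: "u \<in> gtan A x" using u tangent_zero by (auto simp: gtan_iff)
    have "(\<lambda>vs. b j x vs - b i x vs) (fst u # vs) = 0" for vs
    proof (cases "set vs \<subseteq> tangent_space A x \<and> length vs = 1")
      case True
      then obtain v where "vs = [v]" "v \<in> tangent_space A x" by (auto simp: length_Suc_conv)
      then show ?thesis using alt2(2)[OF bb tangent_zero tangent_zero, of v 0] u by auto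
    next
      case False
      then show ?thesis by (intro alt_forms_zero[OF bb]) auto
    qed
    then have "b_exp (\<lambda>vs. b j x vs - b i x vs) u = u" by (simp add: b_exp_def)
    then show ?thesis using phi[OF ij x g] by simp
  qed
  then show ?thesis by (simp cong: image_cong)
qed

end

section \<open>Glued generalized complex structures\<close>

context glue_data
begin

context
  fixes J :: "'i \<Rightarrow> 'm \<Rightarrow> 'm gvec \<Rightarrow> 'm gvec"
  assumes gacs: "\<And>i. i \<in> I \<Longrightarrow> strong_gacs A (U i) (standard_courant A (U i)) (J i)"
    and compat: "\<And>i j x u. i \<in> I \<Longrightarrow> j \<in> I \<Longrightarrow> x \<in> U i \<inter> U j \<Longrightarrow> u \<in> gtan A x \<Longrightarrow>
       J i x u = \<phi> i j x (J j x (\<phi> j i x u))"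
begin

lemma J_linear: "i \<in> I \<Longrightarrow> x \<in> U i \<Longrightarrow> linear_vsp (gtan_vsp A x) (gtan_vsp A x) (J i x)"
  and J_sections: "i \<in> I \<Longrightarrow> open V \<Longrightarrow> V \<subseteq> U i \<Longrightarrow> s \<in> sections A V (gen_tangent_bundle A (U i)) \<Longrightarrow>
     (\<lambda>x\<in>V. J i x (s x)) \<in> sections A V (gen_tangent_bundle A (U i))"
  and J_square: "i \<in> I \<Longrightarrow> x \<in> U i \<Longrightarrow> u \<in> gtan A x \<Longrightarrow> J i x (J i x u) = vscale (gtan_vsp A x) (-1) u"
  and J_pairing: "i \<in> I \<Longrightarrow> x \<in> U i \<Longrightarrow> u \<in> gtan A x \<Longrightarrow> v \<in> gtan A x \<Longrightarrow> gpairing (J i x u) (J i x v) = gpairing u v"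
  using gacs[of i] by (auto simp: strong_gacs_def bundle_map_def twisted_simps gtb_simps)

lemma J_gtan: "i \<in> I \<Longrightarrow> x \<in> U i \<Longrightarrow> u \<in> gtan A x \<Longrightarrow> J i x u \<in> gtan A x"
  using J_linear by (simp add: linear_vsp_def)

text \<open>\<open>glued_endo\<close> applies \<open>J j\<close> to every representative of a class.
  The compatibility condition says that this commutes with the change of representative, so the
  result is again a class.\<close>

lemma glued_endo_cls:
  assumes i: "i \<in> I" "x \<in> U i" and u: "u \<in> gtan A x"
  shows "glued_endo J x (cls i x u) = cls i x (J i x u)"
proof -
  have ph: "\<phi> j i x v = b_exp (bm j x) (b_exp (b i x) v)" if "j \<in> I" "x \<in> U j" "v \<in> gtan A x" for j v
    using phi[of j i x v] i that by (simp add: b_exp_comp bm_def)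
  have ph': "\<phi> i j x v = b_exp (bm i x) (b_exp (b j x) v)" if "j \<in> I" "x \<in> U j" "v \<in> gtan A x" for j v
    using phi[of i j x v] i that by (simp add: b_exp_comp bm_def)
  have key: "J j x (b_exp (bm j x) (b_exp (b i x) u)) = b_exp (bm j x) (b_exp (b i x) (J i x u))"
    if j: "j \<in> I" "x \<in> U j" for j
  proof -
    let ?v = "b_exp (bm j x) (b_exp (b i x) u)"
    have v: "?v \<in> gtan A x" by (rule b_exp_gtan[OF bm_alt[OF j] b_exp_gtan[OF b_alt[OF i] u]])
    have "J j x ?v = \<phi> j i x (J i x (\<phi> i j x ?v))" by (rule compat) (use i j v in auto)
    also have "\<phi> i j x ?v = u" unfolding ph'[OF j v] b_exp_bm ..
    also have "\<phi> j i x (J i x u) = b_exp (bm j x) (b_exp (b i x) (J i x u))" by (rule ph[OF j J_gtan[OF i u]])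
    finally show ?thesis .
  qed
  show ?thesis
    unfolding cls_K[OF i u] cls_K[OF i J_gtan[OF i u]] glued_endo_def
    by (auto simp: K_def key simp del: split_paired_Ex)
qed

lemma glued_gacs: "strong_gacs A UNIV C (glued_endo J)"
  unfolding strong_gacs_def C_vb
proof (intro conjI ballI)
  have rep: "\<exists>i u. i \<in> I \<and> x \<in> U i \<and> u \<in> gtan A x \<and> p = cls i x u" if "p \<in> vcarrier (fibre E x)" for p x
  proof -
    obtain i where i: "i \<in> I" "x \<in> U i" by (rule cover_obtain)
    have "p \<in> cls i x ` gtan A x" using cls_bij[OF i] that by (simp add: bij_betw_def)
    then show ?thesis using i by blast
  qed
  have rep2: "\<exists>i u v. i \<in> I \<and> x \<in> U i \<and> u \<in> gtan A x \<and> v \<in> gtan A x \<and> p = cls i x u \<and> q = cls i x v"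
    if "p \<in> vcarrier (fibre E x)" "q \<in> vcarrier (fibre E x)" for p q x
  proof -
    obtain i where i: "i \<in> I" "x \<in> U i" by (rule cover_obtain)
    have "p \<in> cls i x ` gtan A x" "q \<in> cls i x ` gtan A x" using cls_bij[OF i] that by (auto simp: bij_betw_def)
    then show ?thesis using i by blast
  qed
  show "bundle_map A UNIV E E (glued_endo J)"
    unfolding bundle_map_def
  proof (intro conjI ballI allI impI; (elim conjE)?)
    fix x
    show "linear_vsp (fibre E x) (fibre E x) (glued_endo J x)"
      unfolding linear_vsp_def
    proof (intro conjI ballI allI)
      fix p assume "p \<in> vcarrier (fibre E x)"
      then obtain i u where i: "i \<in> I" "x \<in> U i" and u: "u \<in> gtan A x" and p: "p = cls i x u" using rep by blast
      show "glued_endo J x p \<in> vcarrier (fibre E x)"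
        unfolding p glued_endo_cls[OF i u] using cls_linear[OF i] J_gtan[OF i u] by (simp add: linear_vsp_def)
      fix a
      show "glued_endo J x (vscale (fibre E x) a p) = vscale (fibre E x) a (glued_endo J x p)"
      proof -
        have "vscale (fibre E x) a p = cls i x (vscale (gtan_vsp A x) a u)"
          using cls_linear[OF i] u by (simp add: p linear_vsp_def)
        then have "glued_endo J x (vscale (fibre E x) a p) = cls i x (J i x (vscale (gtan_vsp A x) a u))"
          using glued_endo_cls[OF i gtan_closed(3)[OF u]] by simp
        also have "\<dots> = vscale (fibre E x) a (cls i x (J i x u))"
          using cls_linear[OF i] J_linear[OF i] u J_gtan[OF i u] by (simp add: linear_vsp_def)
        finally show ?thesis by (simp add: p glued_endo_cls[OF i u])
      qed
    next
      fix p q assume "p \<in> vcarrier (fibre E x)" "q \<in> vcarrier (fibre E x)"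
      then obtain i u v where i: "i \<in> I" "x \<in> U i" and u: "u \<in> gtan A x" "v \<in> gtan A x" and pq: "p = cls i x u" "q = cls i x v"
        using rep2 by blast
      have "vadd (fibre E x) p q = cls i x (vadd (gtan_vsp A x) u v)"
        using cls_linear[OF i] u by (simp add: pq linear_vsp_def)
      then have "glued_endo J x (vadd (fibre E x) p q) = cls i x (J i x (vadd (gtan_vsp A x) u v))"
        using glued_endo_cls[OF i gtan_closed(2)[OF u]] by simp
      also have "\<dots> = vadd (fibre E x) (cls i x (J i x u)) (cls i x (J i x v))"
        using cls_linear[OF i] J_linear[OF i] u J_gtan[OF i] by (simp add: linear_vsp_def)
      finally show "glued_endo J x (vadd (fibre E x) p q) = vadd (fibre E x) (glued_endo J x p) (glued_endo J x q)"
        by (simp add: pq glued_endo_cls[OF i] u)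
    qed
  next
    fix V s assume V: "open V" and s: "s \<in> sections A V E"
    note t = E_sectionD[OF V s]
    let ?r = "\<lambda>x. Psi x (glued_endo J x (s x))"
    have loc: "glued_endo J x (s x) = K x (b_exp (b i x) (J i x (b_exp (bm i x) (Psi x (s x)))))
        \<and> b_exp (b i x) (J i x (b_exp (bm i x) (Psi x (s x)))) \<in> gtan A x"
      if i: "i \<in> I" "x \<in> U i" and x: "x \<in> V" for i x
    proof -
      have g: "Psi x (s x) \<in> gtan A x" by (rule gsec_gtan[OF t(1) x])
      have g': "b_exp (bm i x) (Psi x (s x)) \<in> gtan A x" by (rule b_exp_gtan[OF bm_alt[OF i] g])
      have "s x = cls i x (b_exp (bm i x) (Psi x (s x)))" using K_cls[OF i g] t(3)[OF x] by simp
      then have "glued_endo J x (s x) = cls i x (J i x (b_exp (bm i x) (Psi x (s x))))"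
        using glued_endo_cls[OF i g'] by metis
      then show ?thesis using cls_K[OF i J_gtan[OF i g']] b_exp_gtan[OF b_alt[OF i] J_gtan[OF i g']] by simp
    qed
    have "gsec V ?r"
    proof (rule gsec_local[OF V])
      fix x assume x: "x \<in> V"
      \<comment> \<open>Over \<open>V \<inter> U i\<close> the new section is
        \<open>exp (b i)\<close> applied to \<open>J i\<close> of the local representative, which is
        smooth because \<open>J i\<close> is a bundle map.\<close>
      obtain i where i: "i \<in> I" "x \<in> U i" by (rule cover_obtain)
      let ?N = "V \<inter> U i"
      have N: "open ?N" "?N \<subseteq> U i" using V U_open[OF i(1)] by auto
      let ?a = "\<lambda>x\<in>?N. b_exp (bm i x) (Psi x (s x))"
      have ga: "gsec ?N (\<lambda>x. b_exp (bm i x) (Psi x (s x)))"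
        by (rule gsec_b_exp[OF N(1) df_mono[OF bm_form[OF i(1)] N(2)] gsec_mono[OF t(1)]]) blast
      have "gsec ?N ?a" by (rule gsec_cong[OF N(1) ga]) simp
      then have "?a \<in> sections A ?N (gen_tangent_bundle A (U i))"
        by (simp add: sections_gtb[OF N U_open[OF i(1)]])
      from J_sections[OF i(1) N this] have "gsec ?N (\<lambda>x\<in>?N. J i x (?a x))"
        by (simp add: sections_gtb[OF N U_open[OF i(1)]])
      from gsec_b_exp[OF N(1) df_mono[OF b_form[OF i(1)] N(2)] this]
      have "gsec ?N ?r"
      proof (rule gsec_cong[OF N(1)])
        fix y assume y: "y \<in> ?N"
        then show "b_exp (b i y) ((\<lambda>x\<in>?N. J i x (?a x)) y) = ?r y"
          using loc[OF i(1), of y] Psi_K by simp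
      qed
      then show "\<exists>N. open N \<and> x \<in> N \<and> gsec (V \<inter> N) ?r" using i U_open by blast
    qed
    from E_sectionI[OF V this] have "(\<lambda>x\<in>V. K x (?r x)) \<in> sections A V E" .
    moreover have "K x (?r x) = glued_endo J x (s x)" if x: "x \<in> V" for x
    proof -
      obtain i where i: "i \<in> I" "x \<in> U i" by (rule cover_obtain)
      show ?thesis using loc[OF i x] Psi_K by simp
    qed
    then have "(\<lambda>x\<in>V. K x (?r x)) = (\<lambda>x\<in>V. glued_endo J x (s x))" by (intro restrict_ext)
    ultimately show "(\<lambda>x\<in>V. glued_endo J x (s x)) \<in> sections A V E" by simp
  qed
next
  fix x p assume "p \<in> vcarrier (fibre E x)"
  then have "p \<in> K x ` gtan A x" by (simp add: E_carrier)
  then obtain w where w: "w \<in> gtan A x" "p = K x w" by blast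
  obtain i where i: "i \<in> I" "x \<in> U i" by (rule cover_obtain)
  let ?u = "b_exp (bm i x) w"
  have u: "?u \<in> gtan A x" by (rule b_exp_gtan[OF bm_alt[OF i] w(1)])
  have p: "p = cls i x ?u" using K_cls[OF i w(1)] w(2) by simp
  have "glued_endo J x (glued_endo J x p) = cls i x (vscale (gtan_vsp A x) (-1) ?u)"
    by (simp only: p glued_endo_cls[OF i u] glued_endo_cls[OF i J_gtan[OF i u]] J_square[OF i u])
  also have "\<dots> = vscale (fibre E x) (-1) p" using cls_linear[OF i] u by (simp add: p linear_vsp_def)
  finally show "glued_endo J x (glued_endo J x p) = vscale (fibre E x) (-1) p" .
  fix q assume "q \<in> vcarrier (fibre E x)"
  then have "q \<in> K x ` gtan A x" by (simp add: E_carrier)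
  then obtain z where z: "z \<in> gtan A x" "q = K x z" by blast
  let ?v = "b_exp (bm i x) z"
  have v: "?v \<in> gtan A x" by (rule b_exp_gtan[OF bm_alt[OF i] z(1)])
  have q: "q = cls i x ?v" using K_cls[OF i z(1)] z(2) by simp
  have pc: "pairing C x (cls i x a) (cls i x a') = gpairing a a'" if "a \<in> gtan A x" "a' \<in> gtan A x" for a a'
    using C_simps(1)[OF b_exp_gtan[OF b_alt[OF i] that(1)] b_exp_gtan[OF b_alt[OF i] that(2)]]
      b_exp_pairing[OF b_alt[OF i] that] cls_K[OF i] that by simp
  show "pairing C x (glued_endo J x p) (glued_endo J x q) = pairing C x p q"
    by (simp only: p q glued_endo_cls[OF i u] glued_endo_cls[OF i v] pc[OF J_gtan[OF i u] J_gtan[OF i v]] pc[OF u v] J_pairing[OF i u v])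
qed

text \<open>The eigenvalue equations are pointwise and \<open>cls i x\<close> is linear and
  injective, so they can be read on local representatives. Integrability of the glued structure
  tests global sections, so restriction to \<open>U i\<close> is the only direction
  involved.\<close>

lemma plus_i_local:
  assumes p: "(s, s') \<in> plus_i_sections A UNIV C (glued_endo J)" and i: "i \<in> I"
  shows "\<exists>a a'. (a, a') \<in> plus_i_sections A (U i) (standard_courant A (U i)) (J i) \<and>
    (\<forall>x\<in>U i. s x = cls i x (a x) \<and> s' x = cls i x (a' x))"
proof -
  have st: "s \<in> sections A UNIV E" "s' \<in> sections A UNIV E"
    and ei: "\<forall>x. glued_endo J x (s x) = vscale (fibre E x) (-1) (s' x) \<and> glued_endo J x (s' x) = s x"
    using p by (auto simp: plus_i_sections_def C_vb)
  have rep: "\<exists>a. a \<in> sections A (U i) (gen_tangent_bundle A (U i)) \<and> (\<forall>x\<in>U i. a x \<in> gtan A x \<and> s x = cls i x (a x))"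
    if s: "s \<in> sections A UNIV E" for s
  proof -
    obtain u where u: "gsec UNIV u" "s = Ks u" using s unfolding E_sections_UNIV by blast
    let ?a = "\<lambda>x\<in>U i. b_exp (bm i x) (u x)"
    have "gsec (U i) ?a"
      by (rule gsec_cong[OF U_open[OF i] gsec_b_exp[OF U_open[OF i] bm_form[OF i] gsec_mono[OF u(1) subset_UNIV]]]) simp
    then have "?a \<in> sections A (U i) (gen_tangent_bundle A (U i))" by (simp add: sections_gtb[OF U_open[OF i] subset_refl U_open[OF i]])
    moreover have "?a x \<in> gtan A x \<and> s x = cls i x (?a x)" if x: "x \<in> U i" for x
      using K_cls[OF i x gsec_gtan[OF u(1) UNIV_I]] b_exp_gtan[OF bm_alt[OF i x] gsec_gtan[OF u(1) UNIV_I]] x by (simp add: u(2))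
    ultimately show ?thesis by blast
  qed
  obtain a where a: "a \<in> sections A (U i) (gen_tangent_bundle A (U i))" "\<forall>x\<in>U i. a x \<in> gtan A x \<and> s x = cls i x (a x)"
    using rep[OF st(1)] by blast
  obtain a' where a': "a' \<in> sections A (U i) (gen_tangent_bundle A (U i))" "\<forall>x\<in>U i. a' x \<in> gtan A x \<and> s' x = cls i x (a' x)"
    using rep[OF st(2)] by blast
  have "J i x (a x) = vscale (gtan_vsp A x) (-1) (a' x) \<and> J i x (a' x) = a x" if x: "x \<in> U i" for x
  proof
    note ix = i x
    have g: "a x \<in> gtan A x" "a' x \<in> gtan A x" and e: "s x = cls i x (a x)" "s' x = cls i x (a' x)" using a a' x by auto
    have Jg: "J i x u \<in> gtan A x" if "u \<in> gtan A x" for u by (rule J_gtan[OF ix that])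
    have "cls i x (J i x (a x)) = glued_endo J x (s x)" unfolding e by (rule glued_endo_cls[OF ix g(1), symmetric])
    also have "\<dots> = vscale (fibre E x) (-1) (s' x)" using ei by blast
    also have "\<dots> = cls i x (vscale (gtan_vsp A x) (-1) (a' x))"
      using cls_linear[OF ix] g(2) by (simp add: e linear_vsp_def)
    finally show "J i x (a x) = vscale (gtan_vsp A x) (-1) (a' x)"
      using cls_inj[OF ix Jg[OF g(1)] gtan_closed(3)[OF g(2)]] by simp
    have "cls i x (J i x (a' x)) = glued_endo J x (s' x)" unfolding e by (rule glued_endo_cls[OF ix g(2), symmetric])
    also have "\<dots> = cls i x (a x)" using ei e(1) by simp
    finally show "J i x (a' x) = a x" using cls_inj[OF ix Jg[OF g(2)] g(1)] by simp
  qed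
  then have "(a, a') \<in> plus_i_sections A (U i) (standard_courant A (U i)) (J i)"
    using a(1) a'(1) by (simp add: plus_i_sections_def twisted_simps gtb_simps)
  then show ?thesis using a(2) a'(2) by blast
qed

lemma E_section_ops:
  assumes s: "s \<in> sections A UNIV E"
  shows "sec_scale UNIV E c s \<in> sections A UNIV E"
    "t \<in> sections A UNIV E \<Longrightarrow> sec_add UNIV E s t \<in> sections A UNIV E"
    "t \<in> sections A UNIV E \<Longrightarrow> brkt C s t \<in> sections A UNIV E"
proof -
  note G = gsec_glincomb[OF open_UNIV]
  obtain u where u: "gsec UNIV u" "s = Ks u" using s unfolding E_sections_UNIV by blast
  show "sec_scale UNIV E c s \<in> sections A UNIV E"
    unfolding u(2) C_sec_ops(2)[OF u(1,1)] using G[OF u(1,1)] E_sections_UNIV by blast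
  assume "t \<in> sections A UNIV E"
  then obtain v where v: "gsec UNIV v" "t = Ks v" unfolding E_sections_UNIV by blast
  show "sec_add UNIV E s t \<in> sections A UNIV E"
    unfolding u(2) v(2) C_sec_ops(1)[OF u(1) v(1)] using G[OF u(1) v(1)] E_sections_UNIV by blast
  show "brkt C s t \<in> sections A UNIV E"
    unfolding u(2) v(2) C_brkt[OF u(1) v(1)]
    using gsec_courant_bracket[OF open_UNIV u(1) v(1) H_form] E_sections_UNIV by blast
qed

text \<open>Membership in the eigenbundle is checked at each point, and around it the glued bracket
  is the local standard bracket of the restricted sections, to which integrability of
  \<open>J i\<close> applies.\<close>

lemma glued_integrable:
  assumes integrable: "\<And>i. i \<in> I \<Longrightarrow> courant_integrable A (U i) (standard_courant A (U i)) (J i)"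
  shows "courant_integrable A UNIV C (glued_endo J)"
  unfolding courant_integrable_def
proof (intro ballI)
  fix p q
  assume "p \<in> plus_i_sections A UNIV C (glued_endo J)" "q \<in> plus_i_sections A UNIV C (glued_endo J)"
  then obtain s s' t t' where pq: "p = (s, s')" "q = (t, t')"
    and P: "(s, s') \<in> plus_i_sections A UNIV C (glued_endo J)" and Q: "(t, t') \<in> plus_i_sections A UNIV C (glued_endo J)"
    by (metis surj_pair)
  have S: "s \<in> sections A UNIV E" "s' \<in> sections A UNIV E" "t \<in> sections A UNIV E" "t' \<in> sections A UNIV E"
    using P Q by (auto simp: plus_i_sections_def C_vb)
  define r where "r = sec_add UNIV E (brkt C s t) (sec_scale UNIV E (-1) (brkt C s' t'))"
  define r' where "r' = sec_add UNIV E (brkt C s t') (brkt C s' t)"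
  have "glued_endo J x (r x) = vscale (fibre E x) (-1) (r' x) \<and> glued_endo J x (r' x) = r x" for x
  proof -
    obtain i where i: "i \<in> I" "x \<in> U i" by (rule cover_obtain)
    let ?S = "standard_courant A (U i)"
    obtain a a' where a: "(a, a') \<in> plus_i_sections A (U i) ?S (J i)" "\<forall>x\<in>U i. s x = cls i x (a x) \<and> s' x = cls i x (a' x)"
      using plus_i_local[OF P i(1)] by blast
    obtain c c' where c: "(c, c') \<in> plus_i_sections A (U i) ?S (J i)" "\<forall>x\<in>U i. t x = cls i x (c x) \<and> t' x = cls i x (c' x)"
      using plus_i_local[OF Q i(1)] by blast
    have g: "gsec (U i) a" "gsec (U i) a'" "gsec (U i) c" "gsec (U i) c'"
      using a(1) c(1) by (auto simp: plus_i_sections_def twisted_simps sections_gtb[OF U_open[OF i(1)] subset_refl U_open[OF i(1)]])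
    let ?B = "\<lambda>u v. courant_bracket A (\<lambda>x vs. 0) u v x"
    have B: "?B u v \<in> gtan A x" if "gsec (U i) u" "gsec (U i) v" for u v
      by (rule gsec_gtan[OF gsec_courant_bracket[OF U_open[OF i(1)] that df_zero] i(2)])
    \<comment> \<open>Local representatives of the real and imaginary parts \<open>r\<close> and
      \<open>r'\<close> of the complex bracket.\<close>
    define w where "w = vadd (gtan_vsp A x) (?B a c) (vscale (gtan_vsp A x) (-1) (?B a' c'))"
    define w' where "w' = vadd (gtan_vsp A x) (?B a c') (?B a' c)"
    have wg: "w \<in> gtan A x" "w' \<in> gtan A x"
      unfolding w_def w'_def by (intro gtan_closed(2,3) B g)+
    have br1: "brkt C s t x = cls i x (?B a c)"
      by (rule C_brkt_local[OF S(1,3) i(1) g(1,3) _ i(2)]) (use a(2) c(2) in blast)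
    have br2: "brkt C s' t' x = cls i x (?B a' c')"
      by (rule C_brkt_local[OF S(2,4) i(1) g(2,4) _ i(2)]) (use a(2) c(2) in blast)
    have br3: "brkt C s t' x = cls i x (?B a c')"
      by (rule C_brkt_local[OF S(1,4) i(1) g(1,4) _ i(2)]) (use a(2) c(2) in blast)
    have br4: "brkt C s' t x = cls i x (?B a' c)"
      by (rule C_brkt_local[OF S(2,3) i(1) g(2,3) _ i(2)]) (use a(2) c(2) in blast)
    note lin = cls_linear[OF i, unfolded linear_vsp_def]
    have rw: "r x = cls i x w" "r' x = cls i x w'"
      using lin B g gtan_closed(3)[OF B[OF g(2,4)], of "-1"]
      by (simp_all add: r_def r'_def w_def w'_def sec_add_def sec_scale_def br1 br2 br3 br4)
    have "complex_brkt (U i) ?S (a, a') (c, c') \<in> plus_i_sections A (U i) ?S (J i)"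
      using integrable[OF i(1)] a(1) c(1) unfolding courant_integrable_def by blast
    then have "J i x w = vscale (gtan_vsp A x) (-1) w' \<and> J i x w' = w"
      using i(2) by (simp add: complex_brkt_def plus_i_sections_def twisted_simps sec_add_def sec_scale_def gtb_simps w_def w'_def)
    moreover have "vscale (fibre E x) (-1) (cls i x w') = cls i x (vscale (gtan_vsp A x) (-1) w')"
      using lin wg by simp
    ultimately show ?thesis unfolding rw glued_endo_cls[OF i wg(1)] glued_endo_cls[OF i wg(2)] by simp
  qed
  moreover have "r \<in> sections A UNIV E" "r' \<in> sections A UNIV E"
    unfolding r_def r'_def by (intro E_section_ops S)+
  ultimately show "complex_brkt UNIV C p q \<in> plus_i_sections A UNIV C (glued_endo J)"
    by (simp add: pq complex_brkt_def plus_i_sections_def C_vb r_def r'_def)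
qed

end

end

theorem proposition4p0p1:
  fixes A :: "('m::{t2_space,second_countable_topology}, 'e::real_inner) atlas"
    and I :: "'i set"
    and U :: "'i \<Rightarrow> 'm set"
    and \<phi> :: "'i \<Rightarrow> 'i \<Rightarrow> 'm \<Rightarrow> 'm gvec \<Rightarrow> 'm gvec"
  assumes "smooth_manifold A"
    and "finite I"
    and "\<And>i. i \<in> I \<Longrightarrow> open (U i)"
    and "(\<Union>i\<in>I. U i) = UNIV"
    and "\<And>i j. i \<in> I \<Longrightarrow> j \<in> I \<Longrightarrow> b_field_transform A (U i \<inter> U j) (\<phi> i j)"
    and "\<And>i x u. i \<in> I \<Longrightarrow> x \<in> U i \<Longrightarrow> u \<in> gtan A x \<Longrightarrow> \<phi> i i x u = u"
    and "\<And>i j x u. i \<in> I \<Longrightarrow> j \<in> I \<Longrightarrow> x \<in> U i \<inter> U j \<Longrightarrow> u \<in> gtan A x \<Longrightarrow>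
           \<phi> i j x (\<phi> j i x u) = u"
    and "\<And>i j k x u. i \<in> I \<Longrightarrow> j \<in> I \<Longrightarrow> k \<in> I \<Longrightarrow> x \<in> U i \<inter> U j \<inter> U k \<Longrightarrow> u \<in> gtan A x \<Longrightarrow>
           \<phi> i j x (\<phi> j k x u) = \<phi> i k x u"
  shows
    "let C = glued_courant A I U \<phi>; cls = glue_class A I U \<phi> in
     (equiv (glue_union A I U) (glue_rel A I U \<phi>) \<and>
      vector_bundle A UNIV (vb C) \<and>
      (\<forall>i\<in>I. bundle_iso A (U i) (gen_tangent_bundle A (U i)) (vb C) (cls i)) \<and>
      courant_algebroid A UNIV C \<and>
      (\<forall>i\<in>I. \<forall>x\<in>U i. \<forall>u\<in>gtan A x. \<forall>v\<in>gtan A x.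
         pairing C x (cls i x u) (cls i x v) = gpairing u v \<and> anchor C x (cls i x u) = fst u) \<and>
      (\<forall>s\<in>sections A UNIV (vb C). \<forall>t\<in>sections A UNIV (vb C). \<forall>i\<in>I.
         \<forall>a\<in>sections A (U i) (gen_tangent_bundle A (U i)). \<forall>b\<in>sections A (U i) (gen_tangent_bundle A (U i)).
         (\<forall>x\<in>U i. s x = cls i x (a x) \<and> t x = cls i x (b x)) \<longrightarrow>
         (\<forall>x\<in>U i. brkt C s t x = cls i x (brkt (standard_courant A (U i)) a b x)))) \<and>

     ((\<forall>i\<in>I. \<forall>j\<in>I. \<forall>x\<in>U i \<inter> U j.
         \<phi> i j x ` ({\<lambda>f. 0} \<times> alt_forms A 1 x) = {\<lambda>f. 0} \<times> alt_forms A 1 x) \<and>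
      exact_courant_algebroid A UNIV C \<and>
      (\<exists>b. (\<forall>i\<in>I. diff_form A (U i) 2 (b i)) \<and>
         (\<forall>i\<in>I. \<forall>j\<in>I. \<forall>x\<in>U i \<inter> U j. \<forall>u\<in>gtan A x.
            \<phi> i j x u = b_exp (\<lambda>vs. b j x vs - b i x vs) u) \<and>
         (\<exists>H. diff_form A UNIV 3 H \<and> closed_form A UNIV H \<and>
            (\<forall>i\<in>I. \<forall>x\<in>U i. H x = ext_deriv A (b i) x) \<and>
            exact_courant_algebroid A UNIV (twisted_courant A UNIV H) \<and>
            (\<exists>\<Psi>. courant_iso A UNIV C (twisted_courant A UNIV H) \<Psi>)))) \<and>

     (\<forall>J. (\<forall>i\<in>I. strong_gacs A (U i) (standard_courant A (U i)) (J i) \<and>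
              courant_integrable A (U i) (standard_courant A (U i)) (J i)) \<and>
          (\<forall>i\<in>I. \<forall>j\<in>I. \<forall>x\<in>U i \<inter> U j. \<forall>u\<in>gtan A x. J i x u = \<phi> i j x (J j x (\<phi> j i x u))) \<longrightarrow>
        (\<forall>i\<in>I. \<forall>x\<in>U i. \<forall>u\<in>gtan A x. glued_endo J x (cls i x u) = cls i x (J i x u)) \<and>
        strong_gacs A UNIV C (glued_endo J) \<and>
        courant_integrable A UNIV C (glued_endo J))"
proof -
  interpret smooth_mfd A by (rule smooth_mfd.intro[OF assms(1)])
  have "\<forall>i j. \<exists>b. i \<in> I \<and> j \<in> I \<longrightarrow> diff_form A (U i \<inter> U j) 2 b \<and> closed_form A (U i \<inter> U j) b \<and>
     (\<forall>x\<in>U i \<inter> U j. \<forall>u\<in>gtan A x. \<phi> i j x u = b_exp (b x) u)"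
    using assms(5) unfolding b_field_transform_def by metis
  then have "\<exists>B. \<forall>i j. i \<in> I \<and> j \<in> I \<longrightarrow> diff_form A (U i \<inter> U j) 2 (B i j) \<and> closed_form A (U i \<inter> U j) (B i j) \<and>
     (\<forall>x\<in>U i \<inter> U j. \<forall>u\<in>gtan A x. \<phi> i j x u = b_exp (B i j x) u)"
    by (subst (asm) choice_iff, subst (asm) choice_iff)
  then obtain B where "\<forall>i j. i \<in> I \<and> j \<in> I \<longrightarrow> diff_form A (U i \<inter> U j) 2 (B i j) \<and> closed_form A (U i \<inter> U j) (B i j) \<and>
     (\<forall>x\<in>U i \<inter> U j. \<forall>u\<in>gtan A x. \<phi> i j x u = b_exp (B i j x) u)" ..
  then have B: "diff_form A (U i \<inter> U j) 2 (B i j)" and cl: "closed_form A (U i \<inter> U j) (B i j)"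
    and phi: "\<And>x u. x \<in> U i \<inter> U j \<Longrightarrow> u \<in> gtan A x \<Longrightarrow> \<phi> i j x u = b_exp (B i j x) u"
    if "i \<in> I" "j \<in> I" for i j using that by blast+
  \<comment> \<open>The cocycle condition for maps has to be turned into one for forms: on a list
    starting with a tangent vector it is obtained by applying the maps to that vector, and on all
    other lists the three forms are 0.\<close>
  have coc: "B i j x vs + B j k x vs = B i k x vs"
    if I: "i \<in> I" "j \<in> I" "k \<in> I" and x: "x \<in> U i \<inter> U j \<inter> U k" for i j k x vs
  proof -
    have xx: "x \<in> U i \<inter> U j" "x \<in> U j \<inter> U k" "x \<in> U i \<inter> U k" using x by auto
    note al = df_alt[OF B[OF I(1,2)] xx(1)] df_alt[OF B[OF I(2,3)] xx(2)] df_alt[OF B[OF I(1,3)] xx(3)]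
    show ?thesis
    proof (cases vs)
      case Nil
      then show ?thesis using alt_forms_zero[OF al(1), of vs] alt_forms_zero[OF al(2), of vs] alt_forms_zero[OF al(3), of vs] by simp
    next
      case (Cons X ws)
      show ?thesis
      proof (cases "X \<in> tangent_space A x")
        case False
        then show ?thesis using Cons alt_forms_zero[OF al(1), of vs] alt_forms_zero[OF al(2), of vs] alt_forms_zero[OF al(3), of vs] by simp
      next
        case True
        \<comment> \<open>With zero covector part, the image under \<open>b_exp\<close> has the
          contraction itself as covector part, so comparing second components gives the
          identity.\<close>
        let ?u = "(X, \<lambda>vs. 0)"
        have u: "?u \<in> gtan A x" using True alt_forms_0 by (simp add: gtan_iff)
        have u': "\<phi> j k x ?u \<in> gtan A x" unfolding phi[OF I(2,3) xx(2) u] by (rule b_exp_gtan[OF al(2) u])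
        have "b_exp (B i j x) (b_exp (B j k x) ?u) = b_exp (B i k x) ?u"
          using assms(8)[OF I x u] phi[OF I(1,2) xx(1) u'] phi[OF I(2,3) xx(2) u] phi[OF I(1,3) xx(3) u] by simp
        then have "(\<lambda>vs. B j k x (X # vs) + B i j x (X # vs)) = (\<lambda>vs. B i k x (X # vs))"
          by (simp add: b_exp_def)
        from fun_cong[OF this, of ws] show ?thesis using Cons by simp
      qed
    qed
  qed
  have "\<exists>b. (\<forall>i\<in>I. diff_form A (U i) 2 (b i)) \<and>
    (\<forall>i\<in>I. \<forall>j\<in>I. \<forall>x\<in>U i \<inter> U j. \<forall>vs. B i j x vs = b j x vs - b i x vs)"
    by (rule cocycle_potential[OF assms(2-4) B coc])
  then obtain b where b: "\<forall>i\<in>I. diff_form A (U i) 2 (b i)"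
    and Bb: "\<forall>i\<in>I. \<forall>j\<in>I. \<forall>x\<in>U i \<inter> U j. \<forall>vs. B i j x vs = b j x vs - b i x vs" by (elim exE conjE)
  \<comment> \<open>At each point an arbitrary member of the cover is chosen; closedness of the
    forms \<open>B i j\<close> makes the value independent of the choice.\<close>
  define H where "H x = ext_deriv A (b (SOME i. i \<in> I \<and> x \<in> U i)) x" for x
  interpret glue_data A I U \<phi> b H
  proof unfold_locales
    fix i j x u assume ij: "i \<in> I" "j \<in> I" and x: "x \<in> U i \<inter> U j" and u: "u \<in> gtan A x"
    have "B i j x = (\<lambda>vs. b j x vs - b i x vs)" using Bb ij x by (intro ext) blast
    then show "\<phi> i j x u = b_exp (\<lambda>vs. b j x vs - b i x vs) u" using phi[OF ij x u] by simp
  next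
    fix i x assume i: "i \<in> I" "x \<in> U i"
    define j where "j = (SOME i. i \<in> I \<and> x \<in> U i)"
    have j: "j \<in> I \<and> x \<in> U j" unfolding j_def by (rule someI[of _ i]) (use i in blast)
    have "ext_deriv A (b j) x = ext_deriv A (b i) x"
    proof (rule ext_deriv_eq_of_closed_diff[OF _ _ _ _ B cl])
      show "open (U i \<inter> U j)" "x \<in> U i \<inter> U j" "i \<in> I" "j \<in> I" using assms(3) i j by auto
      show "diff_form A (U i \<inter> U j) 2 (b j)" by (rule df_mono[of "U j"]) (use b j in auto)
      show "diff_form A (U i \<inter> U j) 2 (b i)" by (rule df_mono[of "U i"]) (use b i in auto)
      show "\<And>y vs. y \<in> U i \<inter> U j \<Longrightarrow> B i j y vs = b j y vs - b i y vs" using Bb i j by blast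
    qed (use i j in auto)
    then show "H x = ext_deriv A (b i) x" by (simp add: H_def flip: j_def)
  qed (use assms(3,4) b in auto)
  have local: "pairing C x (cls i x u) (cls i x v) = gpairing u v \<and> anchor C x (cls i x u) = fst u"
    if "i \<in> I" "x \<in> U i" "u \<in> gtan A x" "v \<in> gtan A x" for i x u v
    using that C_simps[OF b_exp_gtan[OF b_alt[OF that(1,2)] that(3)] b_exp_gtan[OF b_alt[OF that(1,2)] that(4)]]
    by (simp add: cls_K b_exp_pairing[OF b_alt] b_exp_fst)
  have bracket: "brkt C s t x = cls i x (brkt (standard_courant A (U i)) a a' x)"
    if "s \<in> sections A UNIV E" "t \<in> sections A UNIV E" "i \<in> I"
      "a \<in> sections A (U i) (gen_tangent_bundle A (U i))" "a' \<in> sections A (U i) (gen_tangent_bundle A (U i))"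
      "\<forall>x\<in>U i. s x = cls i x (a x) \<and> t x = cls i x (a' x)" "x \<in> U i" for s t i a a' x
  proof -
    have "gsec (U i) a" "gsec (U i) a'"
      using that(4,5) sections_gtb[OF U_open[OF that(3)] subset_refl U_open[OF that(3)]] by auto
    from C_brkt_local[OF that(1-3) this _ that(7)] show ?thesis using that(6,7) by (simp add: twisted_simps)
  qed
  have part3: "(\<forall>i\<in>I. \<forall>x\<in>U i. \<forall>u\<in>gtan A x. glued_endo J x (cls i x u) = cls i x (J i x u)) \<and>
        strong_gacs A UNIV C (glued_endo J) \<and> courant_integrable A UNIV C (glued_endo J)"
    if J: "\<forall>i\<in>I. strong_gacs A (U i) (standard_courant A (U i)) (J i) \<and>
              courant_integrable A (U i) (standard_courant A (U i)) (J i)"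
      and comp: "\<forall>i\<in>I. \<forall>j\<in>I. \<forall>x\<in>U i \<inter> U j. \<forall>u\<in>gtan A x. J i x u = \<phi> i j x (J j x (\<phi> j i x u))" for J
  proof (intro conjI ballI)
    fix i x u assume "i \<in> I" "x \<in> U i" "u \<in> gtan A x"
    then show "glued_endo J x (cls i x u) = cls i x (J i x u)" by (rule glued_endo_cls[rotated 2]) (use J comp in blast)+
  next
    show "strong_gacs A UNIV C (glued_endo J)" by (rule glued_gacs) (use J comp in blast)+
    show "courant_integrable A UNIV C (glued_endo J)" by (rule glued_integrable) (use J comp in blast)+
  qed
  show ?thesis
    unfolding Let_def C_vb
  proof (intro conjI ballI allI impI; (elim conjE)?)
    show "equiv (glue_union A I U) (glue_rel A I U \<phi>)" by (rule glue_equiv)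
    show "vector_bundle A UNIV E" by (rule E_vector_bundle)
    show "courant_algebroid A UNIV C" by (rule C_courant_algebroid)
    show "exact_courant_algebroid A UNIV C" by (rule C_exact)
    show "\<exists>b. (\<forall>i\<in>I. diff_form A (U i) 2 (b i)) \<and>
         (\<forall>i\<in>I. \<forall>j\<in>I. \<forall>x\<in>U i \<inter> U j. \<forall>u\<in>gtan A x.
            \<phi> i j x u = b_exp (\<lambda>vs. b j x vs - b i x vs) u) \<and>
         (\<exists>H. diff_form A UNIV 3 H \<and> closed_form A UNIV H \<and>
            (\<forall>i\<in>I. \<forall>x\<in>U i. H x = ext_deriv A (b i) x) \<and>
            exact_courant_algebroid A UNIV (twisted_courant A UNIV H) \<and>
            (\<exists>\<Psi>. courant_iso A UNIV C (twisted_courant A UNIV H) \<Psi>))"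
      by (intro exI[of _ b] exI[of _ H] exI[of _ Psi] conjI ballI H_form H_closed H_eq twisted_exact[OF twisted_H] Psi_iso)
        (use b glue_data.phi[OF glue_data_axioms] in blast)+
  next
    fix i assume "i \<in> I" then show "bundle_iso A (U i) (gen_tangent_bundle A (U i)) E (cls i)" by (rule cls_iso)
  next
    fix i x u v assume "i \<in> I" "x \<in> U i" "u \<in> gtan A x" "v \<in> gtan A x"
    then show "pairing C x (cls i x u) (cls i x v) = gpairing u v" "anchor C x (cls i x u) = fst u" using local by blast+
  next
    fix s t i a a' x assume "s \<in> sections A UNIV E" "t \<in> sections A UNIV E" "i \<in> I"
      "a \<in> sections A (U i) (gen_tangent_bundle A (U i))" "a' \<in> sections A (U i) (gen_tangent_bundle A (U i))"
      "\<forall>x\<in>U i. s x = cls i x (a x) \<and> t x = cls i x (a' x)" "x \<in> U i"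
    then show "brkt C s t x = cls i x (brkt (standard_courant A (U i)) a a' x)" by (rule bracket)
  next
    fix i j x assume "i \<in> I" "j \<in> I" "x \<in> U i \<inter> U j"
    then show "\<phi> i j x ` ({\<lambda>f. 0} \<times> alt_forms A 1 x) = {\<lambda>f. 0} \<times> alt_forms A 1 x" by (rule phi_cotangent)
  next
    fix J assume J: "\<forall>i\<in>I. strong_gacs A (U i) (standard_courant A (U i)) (J i) \<and>
              courant_integrable A (U i) (standard_courant A (U i)) (J i)"
      "\<forall>i\<in>I. \<forall>j\<in>I. \<forall>x\<in>U i \<inter> U j. \<forall>u\<in>gtan A x. J i x u = \<phi> i j x (J j x (\<phi> j i x u))"
    note p3 = part3[OF J]
    show "strong_gacs A UNIV C (glued_endo J)" "courant_integrable A UNIV C (glued_endo J)" using p3 by blast+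
    fix i x u assume "i \<in> I" "x \<in> U i" "u \<in> gtan A x"
    then show "glued_endo J x (cls i x u) = cls i x (J i x u)" using p3 by blast
  qed
qed

end
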